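(* Let $\Delta$ be a $(d-1)$-dimensional connected simplicial complex which is Buchsbaum* over some field $k$. If $d\ge 3$, then the graph $\mathcal{G}(\Delta)$ is generically $d$-rigid.
   Context: A simplicial complex is a finite collection of subsets of a finite ground set closed under taking subsets; $|\Delta|$ is its geometric realization, $\widetilde{H}_*(\cdot;k)$ reduced homology over $k$. $\Delta$ is Buchsbaum over $k$ if its face ring $k[\Delta]$ is a Buchsbaum ring. A $(d-1)$-dimensional complex $\Delta$ which is Buchsbaum over $k$ is Buchsbaum* over $k$ if $\dim_k \widetilde{H}_{d-2}(|\Delta|-p;k) = \dim_k \widetilde{H}_{d-2}(|\Delta|;k)$ for every $p\in|\Delta|$. The graph $\mathcal{G}(\Delta)$ has the vertices of $\Delta$ as nodes and the 1-dimensional faces as edges. For a graph $\mathcal{G}$ with node set $V$, a map $f:V\to\mathbb{R}^d$ is $\mathcal{G}$-rigid if there is $\varepsilon>0$ such that every $g:V\to\mathbb{R}^d$ with $\|f(v)-g(v)\|<\varepsilon$ for all $v$ and $\|g(u)-g(v)\|=\|f(u)-f(v)\|$ for all edges $\{u,v\}$ satisfies $\|g(u)-g(v)\|=\|f(u)-f(v)\|$ for all $u,v\in V$. $\mathcal{G}$ is generically $d$-rigid if the set of $\mathcal{G}$-rigid maps $V\to\mathbb{R}^d$ is open and dense in the space of all maps $V\to\mathbb{R}^d$.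
   Formalization: "Generically d-rigid" is read as: the set of G-rigid maps contains an open dense subset of all maps V→R^d; literally "is open and dense" fails, e.g. for the octahedron graph with d=3, where flexible maps scale down to the constant map, which is rigid. *)

theory Defs
  imports
    "HOL-Analysis.Analysis"
    "HOL-Algebra.Algebra"
    "HOL-Homology.Homology"
    "HOL-Library.Extended_Nat"
begin

section \<open>Simplicial complexes and their geometric realization\<close>

definition abstract_simplicial_complex :: "'v set set \<Rightarrow> bool" where
  "abstract_simplicial_complex \<Delta> \<longleftrightarrow>
     finite \<Delta> \<and> (\<forall>F\<in>\<Delta>. finite F) \<and> (\<forall>F\<in>\<Delta>. \<forall>G. G \<subseteq> F \<longrightarrow> G \<in> \<Delta>)"

definition vertex_set :: "'v set set \<Rightarrow> 'v set" where
  "vertex_set \<Delta> = {v. {v} \<in> \<Delta>}"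

text \<open>The inserted \<open>-1\<close> only matters for the void complex, where \<open>Max\<close> would be unspecified.\<close>
definition complex_dim :: "'v set set \<Rightarrow> int" where
  "complex_dim \<Delta> = Max (insert (-1) ((\<lambda>F. int (card F) - 1) ` \<Delta>))"

text \<open>Points are given by their barycentric coordinates; the support of a point is the unique face
  containing it in its relative interior.  The topology is inherited from \<open>'v \<Rightarrow> real\<close>
  (product topology), which is the usual one because only finitely many coordinates can be nonzero.\<close>
definition geometric_realization :: "'v set set \<Rightarrow> ('v \<Rightarrow> real) set" where
  "geometric_realization \<Delta> =
     {x. (\<forall>v. 0 \<le> x v) \<and> {v. x v \<noteq> 0} \<in> \<Delta> \<and> (\<Sum>v | x v \<noteq> 0. x v) = 1}"


section \<open>Reduced singular homology with coefficients in a field\<close>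

text \<open>HOL-Homology only provides integral chains.  We use its singular simplices and faces, with
  coefficients in the field \<open>'k\<close>.\<close>

type_synonym ('a, 'k) field_chain = "((nat \<Rightarrow> real) \<Rightarrow> 'a) \<Rightarrow>\<^sub>0 'k"

definition field_chains :: "nat \<Rightarrow> 'a topology \<Rightarrow> ('a, 'k::field) field_chain set" where
  "field_chains p T = {c. Poly_Mapping.keys c \<subseteq> singular_simplex_set p T}"

definition field_boundary :: "nat \<Rightarrow> ('a, 'k::field) field_chain \<Rightarrow> ('a, 'k) field_chain" where
  "field_boundary p c =
     (if p = 0 then 0
      else \<Sum>f\<in>Poly_Mapping.keys c. \<Sum>i\<le>p.
             Poly_Mapping.single (singular_face p i f) ((-1) ^ i * Poly_Mapping.lookup c f))"

definition augmentation :: "('a, 'k::field) field_chain \<Rightarrow> 'k" where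
  "augmentation c = (\<Sum>f\<in>Poly_Mapping.keys c. Poly_Mapping.lookup c f)"

definition reduced_cycles :: "nat \<Rightarrow> 'a topology \<Rightarrow> ('a, 'k::field) field_chain set" where
  "reduced_cycles p T =
     {c \<in> field_chains p T. field_boundary p c = 0 \<and> (p = 0 \<longrightarrow> augmentation c = 0)}"

definition boundaries :: "nat \<Rightarrow> 'a topology \<Rightarrow> ('a, 'k::field) field_chain set" where
  "boundaries p T = field_boundary (Suc p) ` field_chains (Suc p) T"

text \<open>The dimension of the quotient space \<open>Z/B\<close>: the largest number of elements of \<open>Z\<close> whose classes
  modulo \<open>B\<close> are linearly independent.\<close>
definition quotient_dim :: "('b \<Rightarrow>\<^sub>0 'k::field) set \<Rightarrow> ('b \<Rightarrow>\<^sub>0 'k) set \<Rightarrow> enat" where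
  "quotient_dim Z B =
     Sup {enat (card S) | S. finite S \<and> S \<subseteq> Z \<and>
        (\<forall>a. (\<Sum>z\<in>S. Poly_Mapping.map ((*) (a z)) z) \<in> B \<longrightarrow> (\<forall>z\<in>S. a z = 0))}"

text \<open>In degree \<open>-1\<close> the augmented complex has homology \<open>'k\<close> for the empty space and \<open>0\<close> otherwise.\<close>
definition reduced_homology_dim :: "'k::field itself \<Rightarrow> int \<Rightarrow> 'a topology \<Rightarrow> enat" where
  "reduced_homology_dim k p T =
     (if p \<ge> 0 then
        quotient_dim (reduced_cycles (nat p) T :: ('a, 'k) field_chain set) (boundaries (nat p) T)
      else if p = -1 \<and> topspace T = {} then 1
      else 0)"


section \<open>Buchsbaum rings\<close>

definition frac_rel :: "('a, 'm) ring_scheme \<Rightarrow> 'a set \<Rightarrow> (('a \<times> 'a) \<times> ('a \<times> 'a)) set" where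
  "frac_rel R S = {((a, s), (b, t)). a \<in> carrier R \<and> s \<in> S \<and> b \<in> carrier R \<and> t \<in> S \<and>
     (\<exists>u\<in>S. u \<otimes>\<^bsub>R\<^esub> (a \<otimes>\<^bsub>R\<^esub> t) = u \<otimes>\<^bsub>R\<^esub> (b \<otimes>\<^bsub>R\<^esub> s))}"

definition localization :: "('a, 'm) ring_scheme \<Rightarrow> 'a set \<Rightarrow> ('a \<times> 'a) set ring" where
  "localization R S =
     \<lparr> carrier = (carrier R \<times> S) // frac_rel R S,
       monoid.mult = (\<lambda>A B. \<Union>(a, s)\<in>A. \<Union>(b, t)\<in>B. frac_rel R S `` {(a \<otimes>\<^bsub>R\<^esub> b, s \<otimes>\<^bsub>R\<^esub> t)}),
       monoid.one = frac_rel R S `` {(\<one>\<^bsub>R\<^esub>, \<one>\<^bsub>R\<^esub>)},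
       ring.zero = frac_rel R S `` {(\<zero>\<^bsub>R\<^esub>, \<one>\<^bsub>R\<^esub>)},
       ring.add = (\<lambda>A B. \<Union>(a, s)\<in>A. \<Union>(b, t)\<in>B.
                frac_rel R S `` {(a \<otimes>\<^bsub>R\<^esub> t \<oplus>\<^bsub>R\<^esub> b \<otimes>\<^bsub>R\<^esub> s, s \<otimes>\<^bsub>R\<^esub> t)}) \<rparr>"

definition krull_dim :: "('a, 'm) ring_scheme \<Rightarrow> enat" where
  "krull_dim R =
     Sup {enat n | n. \<exists>P. (\<forall>i\<le>n. primeideal (P i) R) \<and> (\<forall>i<n. P i \<subset> P (Suc i))}"

definition local_noetherian_ring :: "('a, 'm) ring_scheme \<Rightarrow> 'a set \<Rightarrow> bool" where
  "local_noetherian_ring R M \<longleftrightarrow>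
     cring R \<and> noetherian_ring R \<and> maximalideal M R \<and> (\<forall>N. maximalideal N R \<longrightarrow> N = M)"

text \<open>\<open>dim R\<close> many elements of the maximal ideal \<open>M\<close> generating an \<open>M\<close>-primary ideal, i.e. an ideal
  with radical \<open>M\<close>.\<close>
definition system_of_parameters :: "('a, 'm) ring_scheme \<Rightarrow> 'a set \<Rightarrow> 'a list \<Rightarrow> bool" where
  "system_of_parameters R M xs \<longleftrightarrow>
     set xs \<subseteq> M \<and> enat (length xs) = krull_dim R \<and>
     (\<forall>y\<in>M. \<exists>n::nat. y [^]\<^bsub>R\<^esub> n \<in> Idl\<^bsub>R\<^esub> (set xs))"

text \<open>\<open>M \<cdot> ((x\<^sub>1,\<dots>,x\<^sub>i) : x\<^bsub>i+1\<^esub>) \<subseteq> (x\<^sub>1,\<dots>,x\<^sub>i)\<close> for all \<open>i\<close>.\<close>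
definition weak_sequence :: "('a, 'm) ring_scheme \<Rightarrow> 'a set \<Rightarrow> 'a list \<Rightarrow> bool" where
  "weak_sequence R M xs \<longleftrightarrow>
     (\<forall>i<length xs. \<forall>a\<in>carrier R. a \<otimes>\<^bsub>R\<^esub> (xs ! i) \<in> Idl\<^bsub>R\<^esub> (set (take i xs)) \<longrightarrow>
        (\<forall>y\<in>M. y \<otimes>\<^bsub>R\<^esub> a \<in> Idl\<^bsub>R\<^esub> (set (take i xs))))"

definition buchsbaum_local_ring :: "('a, 'm) ring_scheme \<Rightarrow> bool" where
  "buchsbaum_local_ring R \<longleftrightarrow>
     (\<exists>M. local_noetherian_ring R M \<and>
          (\<forall>xs. system_of_parameters R M xs \<longrightarrow> weak_sequence R M xs))"

text \<open>For a standard graded algebra over a field this agrees with asking that the localization at the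
  irrelevant maximal ideal be Buchsbaum, because the other localizations are then Cohen-Macaulay.\<close>
definition buchsbaum_ring :: "('a, 'm) ring_scheme \<Rightarrow> bool" where
  "buchsbaum_ring R \<longleftrightarrow>
     cring R \<and> noetherian_ring R \<and>
     (\<forall>M. maximalideal M R \<longrightarrow> buchsbaum_local_ring (localization R (carrier R - M)))"


section \<open>Face rings and Buchsbaum* complexes\<close>

text \<open>The polynomial ring in the variables \<open>V\<close>; a monomial is a finitely supported exponent vector.\<close>
definition poly_ring :: "'v set \<Rightarrow> (('v \<Rightarrow>\<^sub>0 nat) \<Rightarrow>\<^sub>0 'k::field) ring" where
  "poly_ring V =
     \<lparr> carrier = {p. \<forall>m\<in>Poly_Mapping.keys p. Poly_Mapping.keys m \<subseteq> V},
       monoid.mult = (*), monoid.one = 1, ring.zero = 0, ring.add = (+) \<rparr>"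

definition squarefree_monomial :: "'v set \<Rightarrow> ('v \<Rightarrow>\<^sub>0 nat) \<Rightarrow>\<^sub>0 'k::field" where
  "squarefree_monomial F = Poly_Mapping.single (\<Sum>v\<in>F. Poly_Mapping.single v 1) 1"

definition face_ring :: "'k::field itself \<Rightarrow> 'v set set \<Rightarrow> (('v \<Rightarrow>\<^sub>0 nat) \<Rightarrow>\<^sub>0 'k) set ring" where
  "face_ring k \<Delta> =
     poly_ring (vertex_set \<Delta>) Quot
       (Idl\<^bsub>poly_ring (vertex_set \<Delta>)\<^esub> (squarefree_monomial ` {F. F \<subseteq> vertex_set \<Delta> \<and> F \<notin> \<Delta>}))"

definition buchsbaum :: "'k::field itself \<Rightarrow> 'v set set \<Rightarrow> bool" where
  "buchsbaum k \<Delta> \<longleftrightarrow> buchsbaum_ring (face_ring k \<Delta>)"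

text \<open>With \<open>dim \<Delta> = d - 1\<close>, the homological degree \<open>complex_dim \<Delta> - 1\<close> is \<open>d - 2\<close>.\<close>
definition buchsbaum_star :: "'k::field itself \<Rightarrow> 'v set set \<Rightarrow> bool" where
  "buchsbaum_star k \<Delta> \<longleftrightarrow>
     buchsbaum k \<Delta> \<and>
     (\<forall>p\<in>geometric_realization \<Delta>.
        reduced_homology_dim k (complex_dim \<Delta> - 1) (top_of_set (geometric_realization \<Delta> - {p})) =
        reduced_homology_dim k (complex_dim \<Delta> - 1) (top_of_set (geometric_realization \<Delta>)))"


section \<open>Generic rigidity\<close>

text \<open>A graph is a pair of its node set and its set of (two-element) edges.\<close>
type_synonym 'v ugraph = "'v set \<times> 'v set set"

definition complex_graph :: "'v set set \<Rightarrow> 'v ugraph" where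
  "complex_graph \<Delta> = (vertex_set \<Delta>, {e \<in> \<Delta>. card e = 2})"

text \<open>Maps \<open>V \<rightarrow> \<real>\<^sup>n\<close> are represented by extensional functions, so that they form the
  topological space \<open>(\<real>\<^sup>n)\<^sup>V\<close> below.\<close>
definition rigid_map :: "'v ugraph \<Rightarrow> ('v \<Rightarrow> real ^ 'n) \<Rightarrow> bool" where
  "rigid_map = (\<lambda>(V, E) f.
     \<exists>\<epsilon>>0. \<forall>g \<in> V \<rightarrow>\<^sub>E UNIV.
       (\<forall>v\<in>V. norm (f v - g v) < \<epsilon>) \<longrightarrow>
       (\<forall>u\<in>V. \<forall>v\<in>V. {u, v} \<in> E \<longrightarrow> norm (g u - g v) = norm (f u - f v)) \<longrightarrow>
       (\<forall>u\<in>V. \<forall>v\<in>V. norm (g u - g v) = norm (f u - f v)))"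

definition map_space :: "'v set \<Rightarrow> ('v \<Rightarrow> real ^ 'n) topology" where
  "map_space V = product_topology (\<lambda>_. euclidean) V"

text \<open>The usual wording ``the set of rigid maps is open and dense'' is to be read as ``contains an
  open dense set'': every constant map is rigid for a connected graph, and a small multiple of any
  flexible map is close to a constant one, so the set of all rigid maps is not open as soon as
  a connected graph admits a single non-rigid map (e.g. the graph of the octahedron in
  three-space).\<close>
definition generically_rigid :: "'n::finite itself \<Rightarrow> 'v ugraph \<Rightarrow> bool" where
  "generically_rigid n G \<longleftrightarrow>
     (\<exists>U. openin (map_space (fst G)) U \<and>
          map_space (fst G) closure_of U = topspace (map_space (fst G)) \<and>
          (\<forall>f\<in>U. rigid_map G (f :: 'v \<Rightarrow> real ^ 'n)))"

end

theory Submission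
 imports Defs
begin

text \<open>By Fogelsanger's argument, the vertices of a support-minimal simplicial cycle of dimension
 \<open>d - 1 \<ge> 2\<close> span a generically \<open>d\<close>-rigid subgraph: contract an edge, decompose the resulting cycle into
 minimal ones, apply induction, and undo the contraction by vertex splitting.  Two generically rigid
 graphs with at least \<open>d\<close> common vertices can be glued, so it suffices to put any two facets sharing
 a ridge into a common minimal cycle and to connect all facets through ridges.

 For the former, let \<open>p\<close> be the barycentre of the ridge.  Every cycle of dimension \<open>d - 2\<close> is homologous to a
 simplicial one avoiding \<open>p\<close>, so removing \<open>p\<close> induces a surjection of finite-dimensional homology spaces; by the
 Buchsbaum* condition it is an isomorphism.  Hence the boundary of the difference of the two facets bounds
 a chain avoiding \<open>p\<close>, and pushing that chain away from the ridge and approximating it simplicially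
 yields the cycle.

 For the latter, the elements \<open>e\<^sub>d, \<dots>, e\<^sub>1\<close>, where \<open>e\<^sub>j\<close> is the sum of the squarefree face monomials of
 degree \<open>j\<close>, form a system of parameters of the localized face ring.  The Buchsbaum property for
 \<open>e\<^sub>d\<close> gives purity, and for \<open>e\<^sub>d, e\<^bsub>d-1\<^esub>\<close> it shows that two classes of facets without a common ridge are disjoint,
 which is impossible in a connected complex.\<close>

section \<open>Finite linear systems\<close>

text \<open>Every rigidity statement is reduced to injectivity of a matrix whose entries are affine
  in the positions: one good placement then gives injectivity on an open dense set, so each
  construction needs a single explicit witness. Infinitesimal rigidity takes this form only after
  the trivial motions are removed by orthogonality. Contracting \<open>uv\<close> need not keep a
  cycle minimal and loses the facets through \<open>uv\<close>. So the part of a minimal cycle off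
  \<open>uv\<close> is decomposed before contraction, and the pieces are completed to cycles in
  order to be glued. The Buchsbaum* condition only compares dimensions, and infinity is a possible
  value; injectivity on homology follows because finitely many simplices carry all classes. The
  chain obtained in this way is singular, and its simplicial approximation must keep a prescribed
  boundary. This holds only after alternation: an alternating top-dimensional cycle on the vertices
  of one simplex is zero. The Krull dimension is bounded by counting monomials against power
  products of elements taken from a chain of primes.\<close>

lemma exists_nontrivial_solution:
 fixes M :: "'s => 'l => 'k::field"
 assumes "finite L" "finite S" "card L < card S"
 shows "\<exists>a. (\<exists>s\<in>S. a s ~= 0) \<and> (\<forall>l\<in>L. (\<Sum>s\<in>S. a s * M s l) = 0)"
 using assms
proof (induction L arbitrary: S M rule: finite_induct)
 case empty
 then obtain s where "s \<in> S" by fastforce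
 then show ?case by (intro exI[of _ "\<lambda>_. 1"]) auto
next
 case (insert l L)
 show ?case
 proof (cases "\<forall>s\<in>S. M s l = 0")
  case True
  from insert.IH[of S M] insert.prems insert.hyps obtain a where
   "\<exists>s\<in>S. a s ~= 0" "\<forall>l\<in>L. (\<Sum>s\<in>S. a s * M s l) = 0" by auto
  with True show ?thesis by (intro exI[of _ a]) auto
 next
  case False
  then obtain s0 where s0: "s0 \<in> S" "M s0 l ~= 0" by blast
  define S' where "S' = S - {s0}"
  \<comment> \<open>Solving equation \<open>l\<close> for the pivot unknown \<open>s0\<close> and
    substituting turns the coefficients into \<open>M'\<close>; \<open>c\<close> below is the value
    of the pivot unknown.\<close>
  define M' where "M' = (\<lambda>s l'. M s l' - M s l / M s0 l * M s0 l')"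
  have S: "S = insert s0 S'" "s0 \<notin> S'" "finite S'" using s0 insert.prems by (auto simp: S'_def)
  have "card L < card S'" using insert S by auto
  from insert.IH[OF S(3) this, of M'] obtain a where
   a: "\<exists>s\<in>S'. a s ~= 0" "\<forall>l'\<in>L. (\<Sum>s\<in>S'. a s * M' s l') = 0" by blast
  define c where "c = - (\<Sum>s\<in>S'. a s * M s l) / M s0 l"
  define b where "b = a(s0 := c)"
  have b: "(\<Sum>s\<in>S. b s * M s l') = c * M s0 l' + (\<Sum>s\<in>S'. a s * M s l')" for l'
  proof -
   have "(\<Sum>s\<in>S'. b s * M s l') = (\<Sum>s\<in>S'. a s * M s l')"
    by (rule sum.cong) (use S in \<open>auto simp: b_def\<close>)
   with S show ?thesis by (simp add: b_def)
  qed
  have "(\<Sum>s\<in>S. b s * M s l') = 0" if "l' \<in> insert l L" for l'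
  proof (cases "l' = l")
   case True
   then show ?thesis using s0 unfolding b c_def by simp
  next
   case False
   have "(\<Sum>s\<in>S'. a s * M' s l') = (\<Sum>s\<in>S'. a s * M s l') + c * M s0 l'"
    by (simp add: M'_def c_def algebra_simps sum_subtractf sum_distrib_left sum_distrib_right sum_divide_distrib)
   with a(2) that False show ?thesis unfolding b by (simp add: add.commute)
  qed
  moreover have "\<exists>s\<in>S. b s ~= 0" using a(1) S by (auto simp: b_def)
  ultimately show ?thesis by blast
 qed
qed

text \<open>Row \<open>j\<close>, column \<open>i\<close>. Injectivity takes the place of a
  determinant because rigidity matrices are in general not square.\<close>

definition trivial_kernel :: "'i set => 'j set => ('j => 'i => real) => bool" where
 "trivial_kernel I J c \<longleftrightarrow> (\<forall>x. (\<forall>j\<in>J. (\<Sum>i\<in>I. c j i * x i) = 0) --> (\<forall>i\<in>I. x i = 0))"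

text \<open>Columns are added one at a time. The new column is not a combination of the old ones, so
  it keeps a nonzero residue in some row \<open>j0\<close>, and that row recovers the new
  coordinate.\<close>

lemma left_inverse:
 assumes "finite I" "finite J" "trivial_kernel I J c"
 shows "\<exists>L. \<forall>x. \<forall>i\<in>I. x i = (\<Sum>j\<in>J. L i j * (\<Sum>k\<in>I. c j k * x k))"
 using assms
proof (induction I rule: finite_induct)
 case empty
 then show ?case by simp
next
 case (insert i0 I)
 have "trivial_kernel I J c" unfolding trivial_kernel_def
 proof (intro allI impI ballI)
  fix x i assume x: "\<forall>j\<in>J. (\<Sum>i\<in>I. c j i * x i) = 0" and i: "i \<in> I"
  have "(\<Sum>k\<in>insert i0 I. c j k * (x(i0 := 0)) k) = (\<Sum>i\<in>I. c j i * x i)" for j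
  proof -
   have "(\<Sum>k\<in>I. c j k * (x(i0 := 0)) k) = (\<Sum>i\<in>I. c j i * x i)"
    by (rule sum.cong) (use insert.hyps in auto)
   then show ?thesis using insert.hyps by simp
  qed
  with x insert.prems(2) have "\<forall>i\<in>insert i0 I. (x(i0 := 0)) i = 0"
   unfolding trivial_kernel_def by presburger
  with i insert.hyps show "x i = 0" by (metis fun_upd_other insertCI)
 qed
 with insert obtain L where
  L: "!!x i. i \<in> I ==> x i = (\<Sum>j\<in>J. L i j * (\<Sum>k\<in>I. c j k * x k))" by meson
 \<comment> \<open>\<open>w\<close> is what the old left inverse makes of the column
   \<open>i0\<close>, and \<open>e\<close> is the residue of that column. If \<open>e\<close>
   vanished, \<open>- w\<close> with entry 1 at \<open>i0\<close> would be a kernel vector.\<close>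
 define w where "w = (\<lambda>i. \<Sum>j\<in>J. L i j * c j i0)"
 define e where "e = (\<lambda>j. c j i0 - (\<Sum>i\<in>I. c j i * w i))"
 have "\<exists>j0\<in>J. e j0 ~= 0"
 proof (rule ccontr)
  assume "\<not> ?thesis"
  then have e0: "!!j. j \<in> J ==> e j = 0" by blast
  define x where "x = (\<lambda>i. if i = i0 then 1 else - w i)"
  have "(\<Sum>k\<in>insert i0 I. c j k * x k) = 0" if "j \<in> J" for j
  proof -
   have "(\<Sum>k\<in>I. c j k * x k) = - (\<Sum>i\<in>I. c j i * w i)"
    unfolding sum_negf[symmetric]
    by (rule sum.cong) (use insert.hyps in \<open>auto simp: x_def\<close>)
   then have "(\<Sum>k\<in>insert i0 I. c j k * x k) = c j i0 - (\<Sum>i\<in>I. c j i * w i)"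
    using insert.hyps by (simp add: x_def)
   also have "\<dots> = 0" using e0[OF that] by (simp add: e_def)
   finally show ?thesis .
  qed
  then have "x i0 = 0" using insert.prems(2) unfolding trivial_kernel_def by blast
  then show False by (simp add: x_def)
 qed
 then obtain j0 where j0: "j0 \<in> J" "e j0 ~= 0" by blast
 \<comment> \<open>Row \<open>j0\<close> of the residue of a right-hand side, divided by
   \<open>e j0\<close>: this functional returns the coordinate \<open>i0\<close>.\<close>
 define l where "l = (\<lambda>j. ((if j = j0 then 1 else 0) - (\<Sum>i\<in>I. c j0 i * L i j)) / e j0)"
 define L' where "L' = (\<lambda>i j. if i = i0 then l j else L i j - w i * l j)"
 have "x i = (\<Sum>j\<in>J. L' i j * (\<Sum>k\<in>insert i0 I. c j k * x k))" if i: "i \<in> insert i0 I" for x i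
 proof -
  define y where "y = (\<lambda>j. \<Sum>k\<in>insert i0 I. c j k * x k)"
  have y: "y j = (\<Sum>k\<in>I. c j k * x k) + c j i0 * x i0" for j
   using insert.hyps by (simp add: y_def)
  have Ly: "(\<Sum>j\<in>J. L i j * y j) = x i + w i * x i0" if "i \<in> I" for i
  proof -
   have "(\<Sum>j\<in>J. L i j * y j) = (\<Sum>j\<in>J. L i j * (\<Sum>k\<in>I. c j k * x k)) + (\<Sum>j\<in>J. L i j * c j i0) * x i0"
    by (simp add: y distrib_left sum.distrib sum_distrib_right mult.assoc)
   with L[OF that, of x] show ?thesis by (simp add: w_def)
  qed
  have "(\<Sum>j\<in>J. (\<Sum>i\<in>I. c j0 i * L i j) * y j) = (\<Sum>i\<in>I. c j0 i * (\<Sum>j\<in>J. L i j * y j))"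
   by (simp add: sum_distrib_left sum_distrib_right mult.assoc) (rule sum.swap)
  also have "\<dots> = (\<Sum>i\<in>I. c j0 i * x i) + (\<Sum>i\<in>I. c j0 i * w i) * x i0"
   by (simp add: Ly distrib_left sum.distrib sum_distrib_right mult.assoc)
  finally have 1: "(\<Sum>j\<in>J. (\<Sum>i\<in>I. c j0 i * L i j) * y j) = y j0 - e j0 * x i0"
   by (simp add: y e_def algebra_simps)
  have "(\<Sum>j\<in>J. l j * y j) = ((\<Sum>j\<in>J. (if j = j0 then 1 else 0) * y j) - (\<Sum>j\<in>J. (\<Sum>i\<in>I. c j0 i * L i j) * y j)) / e j0"
   by (simp add: l_def sum_subtractf[symmetric] sum_divide_distrib algebra_simps)
  also have "(\<Sum>j\<in>J. (if j = j0 then 1 else 0) * y j) = y j0"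
   using j0 insert.prems by (simp add: if_distrib[of "\<lambda>u. u * _"] cong: if_cong)
  finally have ly: "(\<Sum>j\<in>J. l j * y j) = x i0" using 1 j0 by simp
  show ?thesis
  proof (cases "i = i0")
   case True
   then show ?thesis using ly by (simp add: L'_def y_def)
  next
   case False
   then have iI: "i \<in> I" using i by simp
   have "(\<Sum>j\<in>J. L' i j * y j) = (\<Sum>j\<in>J. L i j * y j) - w i * (\<Sum>j\<in>J. l j * y j)"
    using False by (simp add: L'_def left_diff_distrib sum_subtractf sum_distrib_left mult.assoc)
   also have "\<dots> = x i" using Ly[OF iI] ly by simp
   finally show ?thesis by (simp add: y_def)
  qed
 qed
 then show ?case by blast
qed

lemma trivial_kernel_bounded_below:
 assumes "finite I" "finite J" "trivial_kernel I J c"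
 shows "\<exists>K>0. \<forall>x. \<forall>i\<in>I. \<bar>x i\<bar> \<le> K * (\<Sum>j\<in>J. \<bar>\<Sum>k\<in>I. c j k * x k\<bar>)"
proof -
 obtain L where L: "!!x i. i \<in> I ==> x i = (\<Sum>j\<in>J. L i j * (\<Sum>k\<in>I. c j k * x k))"
  using left_inverse[OF assms] by meson
 define K where "K = 1 + (\<Sum>i\<in>I. \<Sum>j\<in>J. \<bar>L i j\<bar>)"
 have KL: "\<bar>L i j\<bar> \<le> K" if "i \<in> I" "j \<in> J" for i j
 proof -
  have "\<bar>L i j\<bar> \<le> (\<Sum>j\<in>J. \<bar>L i j\<bar>)" using that assms by (intro member_le_sum) auto
  also have "\<dots> \<le> (\<Sum>i\<in>I. \<Sum>j\<in>J. \<bar>L i j\<bar>)"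
   using that assms by (intro member_le_sum[where f="\<lambda>i. \<Sum>j\<in>J. \<bar>L i j\<bar>"]) (auto intro: sum_nonneg)
  finally show ?thesis by (simp add: K_def)
 qed
 have "K > 0" unfolding K_def by (intro add_pos_nonneg sum_nonneg) auto
 moreover have "\<bar>x i\<bar> \<le> K * (\<Sum>j\<in>J. \<bar>\<Sum>k\<in>I. c j k * x k\<bar>)" if "i \<in> I" for x i
 proof -
  have "\<bar>x i\<bar> \<le> (\<Sum>j\<in>J. \<bar>L i j * (\<Sum>k\<in>I. c j k * x k)\<bar>)"
   by (subst L[OF that, of x]) (rule sum_abs)
  also have "\<dots> \<le> (\<Sum>j\<in>J. K * \<bar>\<Sum>k\<in>I. c j k * x k\<bar>)"
   by (intro sum_mono) (auto simp: abs_mult intro!: mult_right_mono KL that)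
  finally show ?thesis by (simp add: sum_distrib_left)
 qed
 ultimately show ?thesis by blast
qed

lemma trivial_kernel_stable:
 assumes fin: "finite I" "finite J" and triv: "trivial_kernel I J c"
 shows "\<exists>\<delta>>0. \<forall>c'. (\<forall>j\<in>J. \<forall>i\<in>I. \<bar>c' j i - c j i\<bar> \<le> \<delta>) --> trivial_kernel I J c'"
proof -
 obtain K where K: "K > 0" "!!x i. i \<in> I ==> \<bar>x i\<bar> \<le> K * (\<Sum>j\<in>J. \<bar>\<Sum>k\<in>I. c j k * x k\<bar>)"
  using trivial_kernel_bounded_below[OF fin triv] by metis
 define N where "N = real (card I) * real (card J) + 1"
 \<comment> \<open>With this choice the sum \<open>S\<close> of the absolute coordinates of a kernel
   vector of \<open>c'\<close> satisfies \<open>S \<le> 1/2 * S\<close>: the lower bound for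
   \<open>c\<close> costs a factor \<open>card I * card J * K\<close>, which \<open>N\<close> and
   \<open>K\<close> absorb.\<close>
 define \<delta> where "\<delta> = 1 / (2 * K * N * (real (card I) + 1))"
 have N: "N > 0" by (simp add: N_def add_nonneg_pos)
 have pos: "\<delta> > 0" using K N by (simp add: \<delta>_def)
 have "trivial_kernel I J c'" if c': "\<forall>j\<in>J. \<forall>i\<in>I. \<bar>c' j i - c j i\<bar> \<le> \<delta>" for c'
  unfolding trivial_kernel_def
 proof (intro allI impI ballI)
  fix x i assume x: "\<forall>j\<in>J. (\<Sum>i\<in>I. c' j i * x i) = 0" and i: "i \<in> I"
  define S where "S = (\<Sum>i\<in>I. \<bar>x i\<bar>)"
  have S0: "S \<ge> 0" by (auto simp: S_def intro: sum_nonneg)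
  have "\<bar>\<Sum>k\<in>I. c j k * x k\<bar> \<le> \<delta> * S" if "j \<in> J" for j
  proof -
   have "(\<Sum>k\<in>I. c j k * x k) = - (\<Sum>k\<in>I. (c' j k - c j k) * x k)"
    using x that by (simp add: left_diff_distrib sum_subtractf)
   then have "\<bar>\<Sum>k\<in>I. c j k * x k\<bar> = \<bar>\<Sum>k\<in>I. (c' j k - c j k) * x k\<bar>" by simp
   also have "\<dots> \<le> (\<Sum>k\<in>I. \<bar>(c' j k - c j k) * x k\<bar>)" by (rule sum_abs)
   also have "\<dots> \<le> (\<Sum>k\<in>I. \<delta> * \<bar>x k\<bar>)"
    by (intro sum_mono) (use c' that in \<open>auto simp: abs_mult intro!: mult_right_mono\<close>)
   finally show ?thesis by (simp add: S_def sum_distrib_left)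
  qed
  then have "(\<Sum>j\<in>J. \<bar>\<Sum>k\<in>I. c j k * x k\<bar>) \<le> real (card J) * (\<delta> * S)"
   using sum_mono[of J "\<lambda>j. \<bar>\<Sum>k\<in>I. c j k * x k\<bar>" "\<lambda>_. \<delta> * S"] by simp
  then have le: "\<bar>x i\<bar> \<le> K * (real (card J) * (\<delta> * S))" if "i \<in> I" for i
   using K(2)[OF that, of x] K(1) by (meson mult_left_mono less_imp_le order_trans)
  have "S \<le> real (card I) * (K * (real (card J) * (\<delta> * S)))"
   unfolding S_def using sum_mono[of I "\<lambda>i. \<bar>x i\<bar>" "\<lambda>_. K * (real (card J) * (\<delta> * S))"] le
   by (simp add: S_def)
  also have "\<dots> = (real (card I) * real (card J)) * (K * \<delta>) * S" by simp
  also have "\<dots> \<le> N * (K * \<delta>) * S"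
   using K pos S0 by (intro mult_right_mono) (auto simp: N_def)
  also have "N * (K * \<delta>) = 1 / (2 * (real (card I) + 1))" using K N by (simp add: \<delta>_def)
  finally have "S \<le> 1 / (2 * (real (card I) + 1)) * S" .
  moreover have "1 / (2 * (real (card I) + 1)) * S \<le> 1/2 * S"
   using S0 by (intro mult_right_mono) (auto simp: field_simps)
  ultimately have "S = 0" using S0 by linarith
  then show "x i = 0" using i fin by (simp add: S_def sum_nonneg_eq_0_iff)
 qed
 with pos show ?thesis by blast
qed

text \<open>Eigenvectors for distinct eigenvalues are independent, while \<open>Suc (card I)\<close>
  vectors with index set \<open>I\<close> are dependent.\<close>

lemma finite_eigenvalues:
 fixes C :: "'i => 'i => real"
 assumes fin: "finite I"
 shows "finite {\<mu>. \<exists>x. (\<exists>i\<in>I. x i ~= 0) \<and> (\<forall>i\<in>I. (\<Sum>k\<in>I. C i k * x k) = \<mu> * x i)}" (is "finite ?E")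
proof (rule ccontr)
 assume "infinite ?E"
 then obtain T where T: "T \<subseteq> ?E" "finite T" "card T = Suc (card I)"
  by (meson infinite_arbitrarily_large)
 from T(1) have "\<forall>\<mu>\<in>T. \<exists>x. (\<exists>i\<in>I. x i ~= 0) \<and> (\<forall>i\<in>I. (\<Sum>k\<in>I. C i k * x k) = \<mu> * x i)" by blast
 then obtain x where x: "!!\<mu>. \<mu> \<in> T ==> \<exists>i\<in>I. x \<mu> i ~= 0"
  "!!\<mu> i. \<mu> \<in> T ==> i \<in> I ==> (\<Sum>k\<in>I. C i k * x \<mu> k) = \<mu> * x \<mu> i" by metis
 have "\<forall>\<mu>\<in>T'. a \<mu> = 0" if "finite T'" "T' \<subseteq> T" "\<forall>i\<in>I. (\<Sum>\<mu>\<in>T'. a \<mu> * x \<mu> i) = 0" for T' a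
  using that
 proof (induction T' arbitrary: a rule: finite_induct)
  case (insert \<nu> T')
  \<comment> \<open>Applying \<open>C\<close> to the relation and subtracting \<open>\<nu>\<close>
    times the relation removes the term of \<open>\<nu>\<close> and multiplies the others by the
    nonzero \<open>\<mu> - \<nu>\<close>.\<close>
  have "(\<Sum>\<mu>\<in>T'. (a \<mu> * (\<mu> - \<nu>)) * x \<mu> i) = 0" if i: "i \<in> I" for i
  proof -
   have "0 = (\<Sum>k\<in>I. C i k * (\<Sum>\<mu>\<in>insert \<nu> T'. a \<mu> * x \<mu> k))" using insert.prems by simp
   also have "\<dots> = (\<Sum>\<mu>\<in>insert \<nu> T'. a \<mu> * (\<Sum>k\<in>I. C i k * x \<mu> k))"
    unfolding sum_distrib_left by (subst sum.swap) (simp add: mult.left_commute)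
   also have "\<dots> = (\<Sum>\<mu>\<in>insert \<nu> T'. a \<mu> * (\<mu> * x \<mu> i))"
    using insert.prems i by (intro sum.cong refl arg_cong2[of _ _ _ _ "(*)"] x(2)) auto
   finally have "(\<Sum>\<mu>\<in>insert \<nu> T'. a \<mu> * (\<mu> * x \<mu> i)) - \<nu> * (\<Sum>\<mu>\<in>insert \<nu> T'. a \<mu> * x \<mu> i) = 0"
    using insert.prems i by simp
   then show ?thesis using insert.hyps
    by (simp add: algebra_simps sum_subtractf sum_distrib_left)
  qed
  with insert.IH[of "\<lambda>\<mu>. a \<mu> * (\<mu> - \<nu>)"] insert.prems insert.hyps
  have a0: "\<forall>\<mu>\<in>T'. a \<mu> = 0" by fastforce
  from x(1)[of \<nu>] insert.prems obtain i where "i \<in> I" "x \<nu> i ~= 0" by blast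
  with insert.prems insert.hyps a0 have "a \<nu> = 0" by fastforce
  with a0 show ?case by simp
 qed simp
 with exists_nontrivial_solution[of I T x] fin T show False by auto
qed

text \<open>If \<open>x\<close> lies in the kernel at \<open>t\<close> and \<open>L\<close> is a
  left inverse at \<open>t0\<close>, then \<open>x = (t0 - t) L \<beta> x\<close>. So
  \<open>1 / (t0 - t)\<close> is one of the finitely many eigenvalues of
  \<open>L \<beta>\<close>.\<close>

lemma finite_degenerate_parameters:
 assumes fin: "finite I" "finite J" and triv: "trivial_kernel I J (\<lambda>j i. \<alpha> j i + t0 * \<beta> j i)"
 shows "finite {t. \<not> trivial_kernel I J (\<lambda>j i. \<alpha> j i + t * \<beta> j i)}" (is "finite ?B")
proof -
 obtain L where L: "!!x i. i \<in> I ==> x i = (\<Sum>j\<in>J. L i j * (\<Sum>k\<in>I. (\<alpha> j k + t0 * \<beta> j k) * x k))"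
  using left_inverse[OF fin triv] by meson
 define C where "C = (\<lambda>i k. \<Sum>j\<in>J. L i j * \<beta> j k)"
 let ?E = "{\<mu>. \<exists>x. (\<exists>i\<in>I. x i ~= 0) \<and> (\<forall>i\<in>I. (\<Sum>k\<in>I. C i k * x k) = \<mu> * x i)}"
 have "?B \<subseteq> (\<lambda>\<mu>. t0 - 1 / \<mu>) ` ?E"
 proof
  fix t assume "t \<in> ?B"
  then obtain x i0 where x: "\<forall>j\<in>J. (\<Sum>i\<in>I. (\<alpha> j i + t * \<beta> j i) * x i) = 0" "i0 \<in> I" "x i0 ~= 0"
   unfolding trivial_kernel_def by auto
  have tt: "t ~= t0" using x triv unfolding trivial_kernel_def by blast
  have "(\<Sum>k\<in>I. C i k * x k) = (1 / (t0 - t)) * x i" if "i \<in> I" for i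
  proof -
   have "x i = (\<Sum>j\<in>J. L i j * ((\<Sum>k\<in>I. (\<alpha> j k + t * \<beta> j k) * x k) + (t0 - t) * (\<Sum>k\<in>I. \<beta> j k * x k)))"
    by (subst L[OF that, of x]) (simp add: algebra_simps sum.distrib sum_distrib_left sum_subtractf)
   also have "\<dots> = (\<Sum>j\<in>J. L i j * ((t0 - t) * (\<Sum>k\<in>I. \<beta> j k * x k)))"
    by (rule sum.cong) (use x in auto)
   also have "\<dots> = (t0 - t) * (\<Sum>k\<in>I. C i k * x k)"
    unfolding C_def sum_distrib_left sum_distrib_right by (subst sum.swap) (simp add: mult_ac)
   finally show ?thesis using tt by (simp add: field_simps)
  qed
  with x have "1 / (t0 - t) \<in> ?E" by blast
  moreover have "t = t0 - 1 / (1 / (t0 - t))" using tt by simp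
  ultimately show "t \<in> (\<lambda>\<mu>. t0 - 1 / \<mu>) ` ?E" by blast
 qed
 then show ?thesis using finite_eigenvalues[OF fin(1), of C] by (meson finite_imageI finite_subset)
qed

section \<open>Infinitesimal rigidity\<close>

definition skew :: "real^'n^'n => bool" where
 "skew A \<longleftrightarrow> (\<forall>i j. A$i$j = - A$j$i)"

definition trivial_motion :: "'v set => ('v => real^'n) => ('v => real^'n) => bool" where
 "trivial_motion W f m \<longleftrightarrow> (\<exists>A a. skew A \<and> (\<forall>x\<in>W. m x = A *v f x + a))"

definition edge_motion :: "'v set set => 'v set => ('v => real^'n) => ('v => real^'n) => bool" where
 "edge_motion E W f m \<longleftrightarrow> (\<forall>x\<in>W. \<forall>y\<in>W. {x, y} \<in> E --> (f x - f y) \<bullet> (m x - m y) = 0)"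

definition inf_rigid :: "'v set set => 'v set => ('v => real^'n) => bool" where
 "inf_rigid E W f \<longleftrightarrow> (\<forall>m. edge_motion E W f m --> trivial_motion W f m)"

text \<open>Orthogonality to all trivial motions; unlike triviality this is an affine condition on \<open>f\<close>.\<close>
definition balanced :: "'v set => ('v => real^'n) => ('v => real^'n) => bool" where
 "balanced W f m \<longleftrightarrow> (\<Sum>x\<in>W. m x) = 0 \<and>
  (\<forall>k l. (\<Sum>x\<in>W. m x $ k * f x $ l - m x $ l * f x $ k) = 0)"

text \<open>The sum of \<open>m x \<bullet> m x\<close> equals the pairing of \<open>A\<close> with
  the moments \<open>S k l\<close> plus the pairing of \<open>a\<close> with the sum of
  \<open>m\<close>. The first vanishes because \<open>A\<close> is skew and \<open>S\<close>
  symmetric, the second because the sum of \<open>m\<close> is zero.\<close>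

lemma trivial_balanced_eq_0:
 fixes f m :: "'v => real^'n"
 assumes fin: "finite W" and "trivial_motion W f m" "balanced W f m" "x \<in> W"
 shows "m x = 0"
proof -
 obtain A a where A: "skew A" "!!x. x \<in> W ==> m x = A *v f x + a"
  using assms unfolding trivial_motion_def by blast
 define S where "S = (\<lambda>k l. \<Sum>x\<in>W. m x $ k * f x $ l)"
 have sym: "S k l = S l k" for k l
  using assms by (simp add: balanced_def S_def sum_subtractf)
 define T where "T = (\<Sum>k\<in>UNIV. \<Sum>l\<in>UNIV. A$k$l * S k l)"
 have "T = (\<Sum>k\<in>UNIV. \<Sum>l\<in>UNIV. - (A$l$k * S l k))"
  unfolding T_def by (intro sum.cong refl) (metis A(1) skew_def sym mult_minus_left)
 also have "\<dots> = - T" unfolding T_def sum_negf by (subst sum.swap) simp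
 finally have "T = 0" by simp
 moreover have "(\<Sum>x\<in>W. (A *v f x) \<bullet> m x) = T"
 proof -
  have "(\<Sum>x\<in>W. (A *v f x) \<bullet> m x) = (\<Sum>x\<in>W. \<Sum>k\<in>UNIV. \<Sum>l\<in>UNIV. A$k$l * (m x $ k * f x $ l))"
   by (simp add: inner_vec_def matrix_vector_mult_def sum_distrib_left sum_distrib_right mult_ac)
  also have "\<dots> = T" unfolding T_def S_def sum_distrib_left
   by (subst sum.swap) (intro sum.cong refl sum.swap)
  finally show ?thesis .
 qed
 moreover have "(\<Sum>x\<in>W. m x \<bullet> m x) = (\<Sum>x\<in>W. (A *v f x) \<bullet> m x) + a \<bullet> (\<Sum>x\<in>W. m x)"
 proof -
  have "(\<Sum>x\<in>W. m x \<bullet> m x) = (\<Sum>x\<in>W. (A *v f x + a) \<bullet> m x)"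
   by (rule sum.cong) (use A in auto)
  then show ?thesis by (simp add: inner_add_left sum.distrib inner_sum_right)
 qed
 ultimately have "(\<Sum>x\<in>W. m x \<bullet> m x) = 0" using assms by (simp add: balanced_def)
 then have "m x \<bullet> m x = 0" using fin \<open>x \<in> W\<close> by (subst (asm) sum_nonneg_eq_0_iff) auto
 then show ?thesis by simp
qed

text \<open>Gram-Schmidt without independence: \<open>v\<close> is the part of \<open>w s0\<close>
  orthogonal to the other vectors, and if it vanishes on \<open>W\<close> there is nothing to
  remove.\<close>

lemma exists_orthogonal_projection:
 fixes w :: "'s => 'v => real^'n"
 assumes "finite S" "finite W"
 shows "\<exists>c. \<forall>s\<in>S. (\<Sum>x\<in>W. (m x - (\<Sum>t\<in>S. c t *\<^sub>R w t x)) \<bullet> w s x) = 0"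
 using assms(1)
proof (induction S arbitrary: m rule: finite_induct)
 case (insert s0 S)
 define ip where "ip = (\<lambda>u v::'v => real^'n. \<Sum>x\<in>W. u x \<bullet> v x)"
 obtain c where c: "!!s. s \<in> S ==> ip (\<lambda>x. w s0 x - (\<Sum>t\<in>S. c t *\<^sub>R w t x)) (w s) = 0"
  using insert.IH[of "w s0"] unfolding ip_def by blast
 obtain b where b: "!!s. s \<in> S ==> ip (\<lambda>x. m x - (\<Sum>t\<in>S. b t *\<^sub>R w t x)) (w s) = 0"
  using insert.IH[of m] unfolding ip_def by blast
 define v where "v = (\<lambda>x. w s0 x - (\<Sum>t\<in>S. c t *\<^sub>R w t x))"
 define r where "r = (\<lambda>x. m x - (\<Sum>t\<in>S. b t *\<^sub>R w t x))"
 have ip_w: "ip u (w s0) = ip u v + (\<Sum>t\<in>S. c t * ip u (w t))" for u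
  unfolding ip_def v_def
  by (simp add: inner_diff_right sum_subtractf inner_sum_right sum_distrib_left)
   (rule sum.swap)
 define \<alpha> where "\<alpha> = ip r v / ip v v"
 define c' where "c' = (\<lambda>t. if t = s0 then \<alpha> else b t - \<alpha> * c t)"
 define r' where "r' = (\<lambda>x. r x - \<alpha> *\<^sub>R v x)"
 have r': "m x - (\<Sum>t\<in>insert s0 S. c' t *\<^sub>R w t x) = r' x" for x
 proof -
  have "(\<Sum>t\<in>S. c' t *\<^sub>R w t x) = (\<Sum>t\<in>S. b t *\<^sub>R w t x) - \<alpha> *\<^sub>R (\<Sum>t\<in>S. c t *\<^sub>R w t x)"
   unfolding scaleR_sum_right sum_subtractf[symmetric]
   by (rule sum.cong) (use insert.hyps in \<open>auto simp: c'_def algebra_simps\<close>)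
  then show ?thesis using insert.hyps
   by (simp add: c'_def r'_def r_def v_def algebra_simps)
 qed
 have ipr': "ip r' u = ip r u - \<alpha> * ip v u" for u
  by (simp add: ip_def r'_def inner_diff_left sum_subtractf sum_distrib_left)
 have 1: "ip r' (w s) = 0" if "s \<in> S" for s
  using b[OF that] c[OF that] by (simp add: ipr' r_def[symmetric] v_def[symmetric])
 have "ip r' v = 0"
 proof (cases "ip v v = 0")
  case True
  then have "\<forall>x\<in>W. v x = 0" using assms(2) by (simp add: ip_def sum_nonneg_eq_0_iff)
  then show ?thesis by (simp add: ip_def)
 next
  case False
  then show ?thesis by (simp add: ipr' \<alpha>_def)
 qed
 then have "ip r' (w s0) = 0" using 1 by (simp add: ip_w)
 with 1 have "\<forall>s\<in>insert s0 S. ip r' (w s) = 0" by blast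
 then show ?case unfolding r'[symmetric] ip_def by blast
qed simp

text \<open>A skew matrix maps every vector to one orthogonal to it.\<close>

lemma edge_motion_trivial:
 assumes "trivial_motion W f m" shows "edge_motion E W f m"
proof -
 obtain A a where A: "skew A" "!!x. x \<in> W ==> m x = A *v f x + a"
  using assms unfolding trivial_motion_def by blast
 have "w \<bullet> (A *v w) = 0" for w
 proof -
  have "w \<bullet> (A *v w) = (\<Sum>k\<in>UNIV. \<Sum>l\<in>UNIV. A$k$l * (w$k * w$l))"
   by (simp add: inner_vec_def matrix_vector_mult_def sum_distrib_left mult_ac)
  also have "\<dots> = (\<Sum>k\<in>UNIV. \<Sum>l\<in>UNIV. - (A$l$k * (w$l * w$k)))"
   by (intro sum.cong refl) (metis A(1) skew_def mult_minus_left mult.commute)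
  also have "\<dots> = - (\<Sum>k\<in>UNIV. \<Sum>l\<in>UNIV. A$k$l * (w$k * w$l))"
   unfolding sum_negf by (subst sum.swap) simp
  also have "(\<Sum>k\<in>UNIV. \<Sum>l\<in>UNIV. A$k$l * (w$k * w$l)) = w \<bullet> (A *v w)"
   by (simp add: inner_vec_def matrix_vector_mult_def sum_distrib_left mult_ac)
  finally show ?thesis by simp
 qed
 then show ?thesis unfolding edge_motion_def
  by (metis A(2) add_diff_cancel_right matrix_vector_mult_diff_distrib)
qed

text \<open>Subtracting from an edge motion its orthogonal projection onto the trivial motions
  leaves a balanced edge motion. This replaces triviality, which quantifies over \<open>A\<close>
  and \<open>a\<close>, by the vanishing of the solutions of one linear system.\<close>

lemma inf_rigid_iff:
 fixes f :: "'v => real^'n"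
 assumes fin: "finite W"
 shows "inf_rigid E W f \<longleftrightarrow> (\<forall>m. edge_motion E W f m \<and> balanced W f m --> (\<forall>x\<in>W. m x = 0))"
proof
 assume "inf_rigid E W f"
 then show "\<forall>m. edge_motion E W f m \<and> balanced W f m --> (\<forall>x\<in>W. m x = 0)"
  using trivial_balanced_eq_0[OF fin] unfolding inf_rigid_def by blast
next
 assume R: "\<forall>m. edge_motion E W f m \<and> balanced W f m --> (\<forall>x\<in>W. m x = 0)"
 show "inf_rigid E W f" unfolding inf_rigid_def
 proof (intro allI impI)
  fix m :: "'v => real^'n" assume m: "edge_motion E W f m"
  \<comment> \<open>The translations along the axes and, for all pairs \<open>(k, l)\<close>, the
    infinitesimal rotations of the coordinate planes. The family is redundant, but the projection
    needs no independence.\<close>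
  define w :: "'n + 'n \<times> 'n => 'v => real^'n" where
   "w = (\<lambda>s x. case s of Inl k => axis k 1
       | Inr (k, l) => axis k (f x $ l) - axis l (f x $ k))"
  obtain c where c: "!!s. (\<Sum>x\<in>W. (m x - (\<Sum>t\<in>UNIV. c t *\<^sub>R w t x)) \<bullet> w s x) = 0"
   using exists_orthogonal_projection[of "UNIV::('n + 'n \<times> 'n) set" W m w] fin by auto
  define t where "t = (\<lambda>x. \<Sum>s\<in>UNIV. c s *\<^sub>R w s x)"
  define A :: "real^'n^'n" where "A = (\<chi> i j. c (Inr (i, j)) - c (Inr (j, i)))"
  define a :: "real^'n" where "a = (\<chi> i. c (Inl i))"
  have tA: "t x = A *v f x + a" for x
  proof (rule vec_eq_iff[THEN iffD2, rule_format])
   fix i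
   have "t x $ i = (\<Sum>k\<in>UNIV. c (Inl k) * axis k 1 $ i)
     + (\<Sum>(k,l)\<in>UNIV. c (Inr (k,l)) * (axis k (f x $ l) $ i - axis l (f x $ k) $ i))"
   proof -
    have "(\<Sum>s\<in>UNIV. h s) = (\<Sum>k\<in>UNIV. h (Inl k)) + (\<Sum>p\<in>UNIV. h (Inr p))"
     for h :: "'n + 'n \<times> 'n => real"
     unfolding UNIV_Plus_UNIV[symmetric] by (subst sum.Plus) (simp_all add: comp_def del: UNIV_Plus_UNIV)
    then show ?thesis unfolding t_def by (simp add: w_def case_prod_unfold)
   qed
   also have "(\<Sum>k\<in>UNIV. c (Inl k) * axis k 1 $ i) = a $ i"
    by (simp add: axis_def a_def if_distrib[of "\<lambda>u. _ * u"] cong: if_cong)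
   also have "(\<Sum>(k,l)\<in>UNIV. c (Inr (k,l)) * (axis k (f x $ l) $ i - axis l (f x $ k) $ i))
    = (\<Sum>k\<in>UNIV. \<Sum>l\<in>UNIV. c (Inr (k,l)) * axis k (f x $ l) $ i) -
     (\<Sum>k\<in>UNIV. \<Sum>l\<in>UNIV. c (Inr (k,l)) * axis l (f x $ k) $ i)"
    unfolding UNIV_Times_UNIV[symmetric] sum.cartesian_product[symmetric]
    by (simp add: right_diff_distrib sum_subtractf)
   also have "(\<Sum>k\<in>UNIV. \<Sum>l\<in>UNIV. c (Inr (k,l)) * axis k (f x $ l) $ i)
     = (\<Sum>l\<in>UNIV. c (Inr (i,l)) * f x $ l)"
    by (subst sum.swap) (simp add: axis_def if_distrib[of "\<lambda>u. _ * u"] cong: if_cong)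
   also have "(\<Sum>k\<in>UNIV. \<Sum>l\<in>UNIV. c (Inr (k,l)) * axis l (f x $ k) $ i)
     = (\<Sum>k\<in>UNIV. c (Inr (k,i)) * f x $ k)"
    by (simp add: axis_def if_distrib[of "\<lambda>u. _ * u"] cong: if_cong)
   finally show "t x $ i = (A *v f x + a) $ i"
    by (simp add: A_def matrix_vector_mult_def left_diff_distrib sum_subtractf)
  qed
  have skA: "skew A" by (simp add: skew_def A_def)
  define m' where "m' = (\<lambda>x. m x - t x)"
  have "edge_motion E W f t" by (rule edge_motion_trivial) (use tA skA in \<open>auto simp: trivial_motion_def\<close>)
  then have e: "edge_motion E W f m'" using m
   unfolding edge_motion_def m'_def
   proof (intro ballI impI)
   fix x y assume xy: "x \<in> W" "y \<in> W" "{x, y} \<in> E"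
   have "(f x - f y) \<bullet> (m x - t x - (m y - t y)) = (f x - f y) \<bullet> (m x - m y) - (f x - f y) \<bullet> (t x - t y)"
    by (simp add: inner_diff_right)
   also have "\<dots> = 0" using \<open>edge_motion E W f t\<close> m xy unfolding edge_motion_def by simp
   finally show "(f x - f y) \<bullet> (m x - t x - (m y - t y)) = 0" .
  qed
  have c': "(\<Sum>x\<in>W. m' x \<bullet> w s x) = 0" for s using c by (simp add: m'_def t_def)
  have "balanced W f m'" unfolding balanced_def
  proof (intro conjI allI)
   show "(\<Sum>x\<in>W. m' x) = 0"
   proof (rule vec_eq_iff[THEN iffD2, rule_format])
    fix i show "(\<Sum>x\<in>W. m' x) $ i = 0 $ i"
     using c'[of "Inl i"] by (simp add: w_def inner_axis)
   qed
   fix k l show "(\<Sum>x\<in>W. m' x $ k * f x $ l - m' x $ l * f x $ k) = 0"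
    using c'[of "Inr (k, l)"] by (simp add: w_def inner_diff_right inner_axis)
  qed
  with e R have "\<forall>x\<in>W. m' x = 0" by blast
  then show "trivial_motion W f m" using tA skA by (auto simp: trivial_motion_def m'_def)
 qed
qed

text \<open>The linear system whose unknowns are the coordinates of a motion: row \<open>Inl (x, y)\<close> is the
 constraint of an edge in direction \<open>D (x, y)\<close>, the rows \<open>Inr\<close> express \<^const>\<open>balanced\<close>.\<close>
definition rigidity_rows :: "'v set set => 'v set => ('v \<times> 'v + 'n + 'n \<times> 'n) set" where
 "rigidity_rows E W = Inl ` {(x, y). x \<in> W \<and> y \<in> W \<and> {x, y} \<in> E} \<union> range Inr"

text \<open>The edge directions \<open>D\<close> are separate from the positions \<open>f\<close>
  because vertex splitting prescribes a direction for an edge whose ends coincide.\<close>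

definition rigidity_coeff ::
 "('v \<times> 'v => real^'n) => ('v => real^'n) => 'v \<times> 'v + 'n + 'n \<times> 'n => 'v \<times> 'n => real" where
 "rigidity_coeff D f j i = (case j of
   Inl e => (if fst i = fst e then D e $ snd i else 0) - (if fst i = snd e then D e $ snd i else 0)
  | Inr (Inl k) => (if snd i = k then 1 else 0)
  | Inr (Inr p) => (if snd i = fst p then f (fst i) $ snd p else 0) -
          (if snd i = snd p then f (fst i) $ fst p else 0))"

lemma sum_rigidity_coeff:
 fixes m :: "'v => real^'n"
 assumes fin: "finite W"
 shows "x \<in> W ==> y \<in> W ==> (\<Sum>i\<in>W \<times> UNIV. rigidity_coeff D f (Inl (x, y)) i * (m (fst i) $ snd i))
     = D (x, y) \<bullet> (m x - m y)"
  and "(\<Sum>i\<in>W \<times> UNIV. rigidity_coeff D f (Inr (Inl k)) i * (m (fst i) $ snd i)) = (\<Sum>x\<in>W. m x) $ k"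
  and "(\<Sum>i\<in>W \<times> UNIV. rigidity_coeff D f (Inr (Inr (k, l))) i * (m (fst i) $ snd i))
     = (\<Sum>x\<in>W. m x $ k * f x $ l - m x $ l * f x $ k)"
proof -
 have P: "(\<Sum>i\<in>W \<times> UNIV. g (fst i) (snd i)) = (\<Sum>x\<in>W. \<Sum>k\<in>UNIV. g x k)" for g :: "'v => 'n => real"
  by (simp add: sum.cartesian_product case_prod_unfold)
 show "(\<Sum>i\<in>W \<times> UNIV. rigidity_coeff D f (Inl (x, y)) i * (m (fst i) $ snd i)) = D (x, y) \<bullet> (m x - m y)"
  if "x \<in> W" "y \<in> W"
 proof -
  have "(\<Sum>i\<in>W \<times> UNIV. rigidity_coeff D f (Inl (x, y)) i * (m (fst i) $ snd i))
   = (\<Sum>z\<in>W. \<Sum>k\<in>UNIV. ((if z = x then D (x,y) $ k * m z $ k else 0) - (if z = y then D (x,y) $ k * m z $ k else 0)))"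
   unfolding P[symmetric] by (rule sum.cong) (auto simp: rigidity_coeff_def algebra_simps)
  also have "\<dots> = (\<Sum>k\<in>UNIV. D (x,y) $ k * m x $ k) - (\<Sum>k\<in>UNIV. D (x,y) $ k * m y $ k)"
   by (subst sum.swap) (simp add: sum_subtractf fin that)
  finally show ?thesis by (simp add: inner_vec_def right_diff_distrib sum_subtractf)
 qed
 have "(\<Sum>i\<in>W \<times> UNIV. rigidity_coeff D f (Inr (Inl k)) i * (m (fst i) $ snd i))
  = (\<Sum>z\<in>W. \<Sum>k'\<in>UNIV. if k' = k then m z $ k' else 0)"
  unfolding P[symmetric] by (rule sum.cong) (auto simp: rigidity_coeff_def)
 then show "(\<Sum>i\<in>W \<times> UNIV. rigidity_coeff D f (Inr (Inl k)) i * (m (fst i) $ snd i)) = (\<Sum>x\<in>W. m x) $ k"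
  by simp
 have "(\<Sum>i\<in>W \<times> UNIV. rigidity_coeff D f (Inr (Inr (k, l))) i * (m (fst i) $ snd i))
  = (\<Sum>z\<in>W. \<Sum>k'\<in>UNIV. ((if k' = k then m z $ k' * f z $ l else 0) - (if k' = l then m z $ k' * f z $ k else 0)))"
  unfolding P[symmetric] by (rule sum.cong) (auto simp: rigidity_coeff_def algebra_simps)
 then show "(\<Sum>i\<in>W \<times> UNIV. rigidity_coeff D f (Inr (Inr (k, l))) i * (m (fst i) $ snd i))
     = (\<Sum>x\<in>W. m x $ k * f x $ l - m x $ l * f x $ k)"
  by (simp add: sum_subtractf)
qed

lemma rigidity_rows_cases [consumes 1, case_names edge translation rotation]:
 assumes "j \<in> rigidity_rows E W"
 obtains x y where "j = Inl (x, y)" "x \<in> W" "y \<in> W" "{x, y} \<in> E"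
  | k where "j = Inr (Inl k)" | k l where "j = Inr (Inr (k, l))"
proof -
 from assms consider x y where "j = Inl (x, y)" "x \<in> W" "y \<in> W" "{x, y} \<in> E" | s where "j = Inr s"
  unfolding rigidity_rows_def by blast
 then show ?thesis
 proof cases
  case (2 s)
  then show ?thesis using that(2,3) by (cases s) auto
 qed (use that(1) in blast)
qed

lemma finite_rigidity_rows: "finite W ==> finite (rigidity_rows E W :: ('v \<times> 'v + 'n::finite + 'n \<times> 'n) set)"
 unfolding rigidity_rows_def
 by (intro finite_UnI finite_imageI finite_subset[of "{(x, y). x \<in> W \<and> y \<in> W \<and> {x, y} \<in> E}" "W \<times> W"]) auto

lemma trivial_kernel_rigidity_iff:
 fixes f :: "'v => real^'n"
 assumes fin: "finite W"
 shows "trivial_kernel (W \<times> UNIV) (rigidity_rows E W) (rigidity_coeff D f) \<longleftrightarrow>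
  (\<forall>m. (\<forall>x\<in>W. \<forall>y\<in>W. {x, y} \<in> E --> D (x, y) \<bullet> (m x - m y) = 0) \<and> balanced W f m --> (\<forall>x\<in>W. m x = 0))"
  (is "?L \<longleftrightarrow> ?R")
proof -
 have eq: "(\<forall>j\<in>rigidity_rows E W. (\<Sum>i\<in>W \<times> UNIV. rigidity_coeff D f j i * (m (fst i) $ snd i)) = 0) \<longleftrightarrow>
  (\<forall>x\<in>W. \<forall>y\<in>W. {x, y} \<in> E --> D (x, y) \<bullet> (m x - m y) = 0) \<and> balanced W f m" for m :: "'v => real^'n"
 proof -
  have J: "(\<forall>j\<in>rigidity_rows E W. P j) \<longleftrightarrow> (\<forall>x\<in>W. \<forall>y\<in>W. {x, y} \<in> E --> P (Inl (x, y))) \<and>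
   (\<forall>k. P (Inr (Inl k))) \<and> (\<forall>k l. P (Inr (Inr (k, l))))" for P :: "'v \<times> 'v + 'n + 'n \<times> 'n => bool"
  proof
   assume "\<forall>j\<in>rigidity_rows E W. P j"
   then show "(\<forall>x\<in>W. \<forall>y\<in>W. {x, y} \<in> E --> P (Inl (x, y))) \<and>
     (\<forall>k. P (Inr (Inl k))) \<and> (\<forall>k l. P (Inr (Inr (k, l))))"
    unfolding rigidity_rows_def by blast
  next
   assume *: "(\<forall>x\<in>W. \<forall>y\<in>W. {x, y} \<in> E --> P (Inl (x, y))) \<and>
     (\<forall>k. P (Inr (Inl k))) \<and> (\<forall>k l. P (Inr (Inr (k, l))))"
   show "\<forall>j\<in>rigidity_rows E W. P j"
   proof
    fix j :: "'v \<times> 'v + 'n + 'n \<times> 'n" assume "j \<in> rigidity_rows E W"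
    then show "P j" by (cases rule: rigidity_rows_cases) (use * in blast)+
   qed
  qed
  have 1: "(\<forall>x\<in>W. \<forall>y\<in>W. {x, y} \<in> E -->
     (\<Sum>i\<in>W \<times> UNIV. rigidity_coeff D f (Inl (x, y)) i * (m (fst i) $ snd i)) = 0) \<longleftrightarrow>
    (\<forall>x\<in>W. \<forall>y\<in>W. {x, y} \<in> E --> D (x, y) \<bullet> (m x - m y) = 0)"
   by (intro ball_cong imp_cong refl) (simp only: sum_rigidity_coeff(1)[OF fin])
  have 2: "(\<forall>k. (\<Sum>x\<in>W. m x) $ k = 0) \<longleftrightarrow> (\<Sum>x\<in>W. m x) = 0"
   by (simp add: vec_eq_iff del: sum_component)
  let ?P = "\<lambda>j. (\<Sum>i\<in>W \<times> UNIV. rigidity_coeff D f j i * (m (fst i) $ snd i)) = 0"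
  have 3: "(\<forall>k. ?P (Inr (Inl k))) \<longleftrightarrow> (\<Sum>x\<in>W. m x) = 0"
   unfolding sum_rigidity_coeff(2)[OF fin] by (rule 2)
  have 4: "(\<forall>k l. ?P (Inr (Inr (k, l)))) \<longleftrightarrow>
    (\<forall>k l. (\<Sum>x\<in>W. m x $ k * f x $ l - m x $ l * f x $ k) = 0)"
   by (intro iff_allI) (rule arg_cong[where f="\<lambda>u. u = 0"], rule sum_rigidity_coeff(3)[OF fin])
  have 5: "(\<forall>j\<in>rigidity_rows E W. ?P j) \<longleftrightarrow> (\<forall>x\<in>W. \<forall>y\<in>W. {x, y} \<in> E --> ?P (Inl (x, y))) \<and>
   (\<forall>k. ?P (Inr (Inl k))) \<and> (\<forall>k l. ?P (Inr (Inr (k, l))))"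
   by (fact J)
  show ?thesis unfolding balanced_def 5 1 3 4 by (rule refl)
 qed
 show ?thesis
 proof
  assume L: ?L
  show ?R
  proof (intro allI impI ballI)
   fix m :: "'v => real^'n" and x
   assume "(\<forall>x\<in>W. \<forall>y\<in>W. {x, y} \<in> E --> D (x, y) \<bullet> (m x - m y) = 0) \<and> balanced W f m" and x: "x \<in> W"
   then have "\<forall>j\<in>rigidity_rows E W. (\<Sum>i\<in>W \<times> UNIV. rigidity_coeff D f j i * (m (fst i) $ snd i)) = 0"
    unfolding eq by blast
   then have "\<forall>i\<in>W \<times> UNIV. m (fst i) $ snd i = 0"
    using L[unfolded trivial_kernel_def, rule_format, of "\<lambda>i. m (fst i) $ snd i"] by blast
   with x show "m x = 0" by (auto simp: vec_eq_iff)
  qed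
 next
  assume R: ?R
  show ?L unfolding trivial_kernel_def
  proof (intro allI impI ballI)
   fix \<xi> :: "'v \<times> 'n => real" and i :: "'v \<times> 'n"
   assume \<xi>: "\<forall>j\<in>rigidity_rows E W. (\<Sum>i\<in>W \<times> UNIV. rigidity_coeff D f j i * \<xi> i) = 0"
    and i: "i \<in> W \<times> UNIV"
   define m :: "'v => real^'n" where "m = (\<lambda>x. \<chi> k. \<xi> (x, k))"
   have "\<xi> i = m (fst i) $ snd i" for i by (simp add: m_def)
   with \<xi> have "\<forall>j\<in>rigidity_rows E W. (\<Sum>i\<in>W \<times> UNIV. rigidity_coeff D f j i * (m (fst i) $ snd i)) = 0"
    by simp
   then have "\<forall>x\<in>W. m x = 0" using R unfolding eq by blast
   with i show "\<xi> i = 0" by (auto simp: m_def vec_eq_iff)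
  qed
 qed
qed

lemma inf_rigid_iff_trivial_kernel:
 assumes "finite W"
 shows "inf_rigid E W f \<longleftrightarrow>
  trivial_kernel (W \<times> UNIV) (rigidity_rows E W) (rigidity_coeff (\<lambda>(x, y). f x - f y) f)"
 unfolding inf_rigid_iff[OF assms] trivial_kernel_rigidity_iff[OF assms] edge_motion_def by simp

section \<open>Generic properties\<close>

text \<open>Containing an open dense set, as in \<open>generically_rigid\<close>: in this form the
  notion is stable under weakening and under finite conjunctions.\<close>

definition generically :: "'v set => (('v => real^'n) => bool) => bool" where
 "generically V P \<longleftrightarrow> (\<exists>U. openin (map_space V) U \<and>
  map_space V closure_of U = topspace (map_space V) \<and> (\<forall>f\<in>U. P f))"

lemma topspace_map_space [simp]: "topspace (map_space V) = V \<rightarrow>\<^sub>E UNIV"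
 by (simp add: map_space_def)

lemma generically_mono: "generically V P ==> (!!f. P f ==> Q f) ==> generically V Q"
 unfolding generically_def by blast

lemma generically_conj:
 assumes "generically V P" "generically V Q"
 shows "generically V (\<lambda>f. P f \<and> Q f)"
proof -
 obtain S T where S: "openin (map_space V) S" "map_space V closure_of S = topspace (map_space V)" "\<forall>f\<in>S. P f"
  and T: "openin (map_space V) T" "map_space V closure_of T = topspace (map_space V)" "\<forall>f\<in>T. Q f"
  using assms unfolding generically_def by blast
 have "map_space V closure_of (S \<inter> T) = map_space V closure_of (S \<inter> map_space V closure_of T)"
  using closure_of_openin_Int_closure_of[OF S(1)] by metis
 also have "S \<inter> map_space V closure_of T = S" using T(2) openin_subset[OF S(1)] by blast
 finally show ?thesis unfolding generically_def using S T by (intro exI[of _ "S \<inter> T"]) auto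
qed

lemma generically_exists:
 fixes P :: "('v => real^'n) => bool"
 assumes "generically V P" shows "\<exists>f \<in> V \<rightarrow>\<^sub>E UNIV. P f"
proof -
 obtain U where U: "openin (map_space V) U" "map_space V closure_of U = topspace (map_space V)" "\<forall>f\<in>U. P f"
  using assms unfolding generically_def by blast
 have "U ~= {}"
 proof
  assume "U = {}"
  then have "topspace (map_space V :: ('v => real^'n) topology) = {}" using U(2) by (metis closure_of_empty)
  moreover have "(\<lambda>v\<in>V. 0) \<in> topspace (map_space V :: ('v => real^'n) topology)" by simp
  ultimately show False by blast
 qed
 then obtain f where "f \<in> U" by blast
 with U(3) openin_subset[OF U(1)] show ?thesis by (metis subsetD topspace_map_space)
qed

text \<open>Openness is the stability of a trivial kernel. For density, the matrix is affine along
  the line from any \<open>f\<close> to the good point \<open>f0\<close>, so all but finitely many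
  points of that line are good, among them some arbitrarily close to \<open>f\<close>.\<close>

lemma generically_trivial_kernel:
 fixes \<kappa> :: "('v => real^'n) => 'j => 'i => real"
 assumes fin: "finite V" "finite I" "finite J"
  and f0: "trivial_kernel I J (\<kappa> f0)"
  and affine: "!!f t j i. j \<in> J ==> i \<in> I ==>
   \<kappa> (\<lambda>v\<in>V. f v + t *\<^sub>R (f0 v - f v)) j i = \<kappa> f j i + t * (\<kappa> f0 j i - \<kappa> f j i)"
  and lip: "!!f g j i. j \<in> J ==> i \<in> I ==> \<bar>\<kappa> g j i - \<kappa> f j i\<bar> \<le> C * (\<Sum>v\<in>V. norm (g v - f v))"
 shows "generically V (\<lambda>f. trivial_kernel I J (\<kappa> f))"
proof -
 define U where "U = {f \<in> V \<rightarrow>\<^sub>E UNIV. trivial_kernel I J (\<kappa> f)}"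
 \<comment> \<open>At least 1, so that it can be divided by.\<close>
 define C' where "C' = max C 1"
 have lip': "\<bar>\<kappa> g j i - \<kappa> f j i\<bar> \<le> C' * (\<Sum>v\<in>V. norm (g v - f v))" if "j \<in> J" "i \<in> I" for f g j i
 proof -
  have "\<bar>\<kappa> g j i - \<kappa> f j i\<bar> \<le> C * (\<Sum>v\<in>V. norm (g v - f v))" by (rule lip[OF that])
  also have "\<dots> \<le> C' * (\<Sum>v\<in>V. norm (g v - f v))"
   by (intro mult_right_mono sum_nonneg) (auto simp: C'_def)
  finally show ?thesis .
 qed
 have "openin (map_space V) U"
  unfolding map_space_def openin_product_topology_alt
 proof
  fix f assume f: "f \<in> U"
  then obtain \<delta> where \<delta>: "\<delta> > 0"
   "!!c'. \<forall>j\<in>J. \<forall>i\<in>I. \<bar>c' j i - \<kappa> f j i\<bar> \<le> \<delta> ==> trivial_kernel I J c'"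
   using trivial_kernel_stable[OF fin(2,3), of "\<kappa> f"] unfolding U_def by blast
  \<comment> \<open>Moving every point by at most \<open>\<epsilon>\<close> changes each entry by at
    most \<open>C' * card V * \<epsilon>\<close>, hence by at most \<open>\<delta>\<close>.\<close>
  define \<epsilon> where "\<epsilon> = \<delta> / (C' * (real (card V) + 1))"
  have \<epsilon>: "\<epsilon> > 0" using \<delta> by (simp add: \<epsilon>_def C'_def)
  have "g \<in> U" if g: "g \<in> Pi\<^sub>E V (\<lambda>v. ball (f v) \<epsilon>)" for g
  proof -
   have "(\<Sum>v\<in>V. norm (g v - f v)) \<le> real (card V) * \<epsilon>"
   proof (rule sum_bounded_above)
    fix v assume "v \<in> V"
    then have "g v \<in> ball (f v) \<epsilon>" using g by auto
    then show "norm (g v - f v) \<le> \<epsilon>" by (simp add: dist_norm norm_minus_commute)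
   qed
   also have "\<dots> = \<delta> / C' * (real (card V) / (real (card V) + 1))" by (simp add: \<epsilon>_def)
   also have "\<dots> \<le> \<delta> / C' * 1"
    using \<delta> by (intro mult_left_mono) (auto simp: C'_def)
   finally have le: "C' * (\<Sum>v\<in>V. norm (g v - f v)) \<le> \<delta>" by (simp add: C'_def field_simps)
   then have "trivial_kernel I J (\<kappa> g)" by (intro \<delta>(2) ballI order_trans[OF lip'])
   with g show ?thesis by (auto simp: U_def PiE_def)
  qed
  then show "\<exists>B. finite {i \<in> V. B i ~= topspace euclidean} \<and> (\<forall>i\<in>V. openin euclidean (B i)) \<and>
    f \<in> Pi\<^sub>E V B \<and> Pi\<^sub>E V B \<subseteq> U"
   using fin f \<epsilon> by (intro exI[of _ "\<lambda>v. ball (f v) \<epsilon>"]) (auto simp: U_def)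
 qed
 moreover have "map_space V closure_of U = topspace (map_space V)"
 proof (intro equalityI closure_of_subset_topspace subsetI)
  fix f assume f: "f \<in> topspace (map_space V :: ('v => real^'n) topology)"
  show "f \<in> map_space V closure_of U" unfolding in_closure_of
  proof (intro conjI f allI impI)
   fix T assume T: "f \<in> T \<and> openin (map_space V) T"
   then obtain B where B: "finite {i \<in> V. B i ~= topspace euclidean}" "!!i. i \<in> V ==> openin euclidean (B i)"
     "f \<in> Pi\<^sub>E V B" "Pi\<^sub>E V B \<subseteq> T"
    using bspec[OF iffD1[OF openin_product_topology_alt conjunct2[OF T[unfolded map_space_def]]] conjunct1[OF T]]
    by (elim exE conjE) auto
   define F where "F = (\<lambda>t. \<lambda>v\<in>V. f v + t *\<^sub>R (f0 v - f v))"
   have "\<forall>\<^sub>F t in at 0. \<forall>v\<in>V. F t v \<in> B v"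
   proof (rule eventually_ball_finite[OF fin(1)], rule ballI)
    fix v assume v: "v \<in> V"
    have "((\<lambda>t. f v + t *\<^sub>R (f0 v - f v)) \<longlongrightarrow> f v + 0 *\<^sub>R (f0 v - f v)) (at 0)"
     by (intro tendsto_intros)
    moreover have "open (B v)" "f v \<in> B v" using B v by auto
    ultimately have "\<forall>\<^sub>F t in at 0. f v + t *\<^sub>R (f0 v - f v) \<in> B v"
     by (metis add.right_neutral scaleR_zero_left topological_tendstoD)
    then show "\<forall>\<^sub>F t in at 0. F t v \<in> B v" using v by (simp add: F_def)
   qed
   then obtain d where d: "d > 0" "!!t. t ~= 0 ==> \<bar>t\<bar> < d ==> \<forall>v\<in>V. F t v \<in> B v"
    unfolding eventually_at by (auto simp: dist_real_def)
   have cong: "trivial_kernel I J (\<kappa> (F t)) \<longleftrightarrow>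
     trivial_kernel I J (\<lambda>j i. \<kappa> f j i + t * (\<kappa> f0 j i - \<kappa> f j i))" for t
   proof -
    have "(\<Sum>i\<in>I. \<kappa> (F t) j i * x i) = (\<Sum>i\<in>I. (\<kappa> f j i + t * (\<kappa> f0 j i - \<kappa> f j i)) * x i)"
     if "j \<in> J" for j x
     unfolding F_def by (rule sum.cong) (simp_all only: affine[OF that])
    then have "(\<forall>j\<in>J. (\<Sum>i\<in>I. \<kappa> (F t) j i * x i) = 0) \<longleftrightarrow>
      (\<forall>j\<in>J. (\<Sum>i\<in>I. (\<kappa> f j i + t * (\<kappa> f0 j i - \<kappa> f j i)) * x i) = 0)" for x
     by (intro ball_cong) auto
    then show ?thesis unfolding trivial_kernel_def by presburger
   qed
   \<comment> \<open>At parameter 1 the matrix is that of \<open>f0\<close>, which serves as the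
     nondegenerate instance.\<close>
   have "finite {t. \<not> trivial_kernel I J (\<lambda>j i. \<kappa> f j i + t * (\<kappa> f0 j i - \<kappa> f j i))}"
    by (rule finite_degenerate_parameters[OF fin(2,3), of _ 1]) (simp add: f0)
   moreover have "infinite {0<..<d}" using d by (simp add: infinite_Ioo)
   ultimately obtain t where t: "t \<in> {0<..<d}" "trivial_kernel I J (\<kappa> (F t))"
    unfolding cong[symmetric] by (metis (mono_tags, lifting) finite_subset mem_Collect_eq subsetI)
   then have FB: "F t \<in> Pi\<^sub>E V B" using d(2)[of t] by (auto simp: F_def)
   moreover have "F t \<in> V \<rightarrow>\<^sub>E UNIV" by (simp add: F_def)
   ultimately have "F t \<in> U \<and> F t \<in> T" using t(2) B(4) by (auto simp: U_def)
   then show "\<exists>y. y \<in> U \<and> y \<in> T" by blast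
  qed
 qed
 ultimately show ?thesis unfolding generically_def U_def by blast
qed

lemma norm_component_diff_le_sum:
 fixes f g :: "'v => real^'n"
 assumes "finite V" "v \<in> V"
 shows "\<bar>g v $ k - f v $ k\<bar> \<le> (\<Sum>v\<in>V. norm (g v - f v))"
proof -
 have "\<bar>g v $ k - f v $ k\<bar> \<le> norm (g v - f v)"
  using component_le_norm_cart[of "g v - f v" k] by simp
 also have "\<dots> \<le> (\<Sum>v\<in>V. norm (g v - f v))" using assms by (intro member_le_sum) auto
 finally show ?thesis .
qed

text \<open>One rigid placement suffices, since the rigidity matrix is affine in the positions. The
  Lipschitz constant is 2 because edge rows contain differences of two positions.\<close>

lemma generically_inf_rigid:
 fixes f0 :: "'v => real^'n"
 assumes fin: "finite V" and W: "W \<subseteq> V" and f0: "inf_rigid E W f0"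
 shows "generically V (inf_rigid E W :: ('v => real^'n) => bool)"
proof -
 have finX: "finite W" using fin W finite_subset by blast
 define \<kappa> :: "('v => real^'n) => 'v \<times> 'v + 'n + 'n \<times> 'n => 'v \<times> 'n => real" where
  "\<kappa> = (\<lambda>f. rigidity_coeff (\<lambda>(x, y). f x - f y) f)"
 have "generically V (\<lambda>f. trivial_kernel (W \<times> UNIV) (rigidity_rows E W) (\<kappa> f))"
 proof (rule generically_trivial_kernel[where C=2 and ?f0.0=f0])
  show "trivial_kernel (W \<times> UNIV) (rigidity_rows E W) (\<kappa> f0)"
   using f0 by (simp add: \<kappa>_def inf_rigid_iff_trivial_kernel[OF finX, symmetric])
  show "\<kappa> (\<lambda>v\<in>V. f v + t *\<^sub>R (f0 v - f v)) j i = \<kappa> f j i + t * (\<kappa> f0 j i - \<kappa> f j i)"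
   if "j \<in> rigidity_rows E W" "i \<in> W \<times> UNIV" for f t j i
  proof -
   have i: "fst i \<in> V" using that W by auto
   from that(1) show ?thesis
   proof (cases rule: rigidity_rows_cases)
    case (edge x y)
    then have "x \<in> V" "y \<in> V" using W by auto
    then show ?thesis unfolding edge
     by (cases "fst i = x"; cases "fst i = y") (simp_all add: \<kappa>_def rigidity_coeff_def algebra_simps)
   next
    case (translation k)
    then show ?thesis by (simp add: \<kappa>_def rigidity_coeff_def)
   next
    case (rotation k l)
    then show ?thesis unfolding rotation using i
     by (cases "snd i = k"; cases "snd i = l") (simp_all add: \<kappa>_def rigidity_coeff_def algebra_simps)
   qed
  qed
  show "\<bar>\<kappa> g j i - \<kappa> f j i\<bar> \<le> 2 * (\<Sum>v\<in>V. norm (g v - f v))"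
   if j: "j \<in> rigidity_rows E W" and i: "i \<in> W \<times> UNIV" for f g j i
  proof -
   let ?N = "\<Sum>v\<in>V. norm (g v - f v)"
   have N: "\<bar>g v $ k - f v $ k\<bar> \<le> ?N" if "v \<in> W" for v k
    using norm_component_diff_le_sum[OF fin] that W by blast
   have N0: "?N \<ge> 0" by (simp add: sum_nonneg)
   from j show ?thesis
   proof (cases rule: rigidity_rows_cases)
    case (edge x y)
    have "\<bar>(g x - g y) $ k - (f x - f y) $ k\<bar> \<le> 2 * ?N"
      "\<bar>(f x - f y) $ k - (g x - g y) $ k\<bar> \<le> 2 * ?N" for k
     using N[OF edge(2), of k] N[OF edge(3), of k] unfolding vector_minus_component by linarith+
    then show ?thesis unfolding edge
     by (cases "fst i = x"; cases "fst i = y")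
      (simp_all add: \<kappa>_def rigidity_coeff_def N0 del: vector_minus_component)
   next
    case (translation k)
    then show ?thesis using N0 by (simp add: \<kappa>_def rigidity_coeff_def)
   next
    case (rotation k l)
    have "fst i \<in> W" using i by auto
    then have "\<bar>g (fst i) $ k - f (fst i) $ k\<bar> \<le> ?N" "\<bar>g (fst i) $ l - f (fst i) $ l\<bar> \<le> ?N"
     using N by auto
    then show ?thesis unfolding rotation using N0
     by (cases "snd i = k"; cases "snd i = l") (simp_all add: \<kappa>_def rigidity_coeff_def)
   qed
  qed
 qed (use fin finX finite_rigidity_rows in auto)
 then show ?thesis
  by (rule generically_mono) (simp add: \<kappa>_def inf_rigid_iff_trivial_kernel[OF finX])
qed

section \<open>Gluing, simplices and vertex splitting\<close>

text \<open>No nonzero infinitesimal isometry vanishes on \<open>Z\<close>. It is enough that the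
  points affinely span a hyperplane, because a nonzero skew matrix has rank at least 2; hence
  \<open>d\<close> generic points suffice.\<close>

definition hyper_spanning :: "'v set => ('v => real^'n) => bool" where
 "hyper_spanning Z f \<longleftrightarrow> (\<forall>A a. skew A --> (\<forall>z\<in>Z. A *v f z + a = 0) --> A = 0 \<and> a = 0)"

lemma skew_diff:
 assumes "skew A" "skew B" shows "skew (A - B)"
 unfolding skew_def
proof (intro allI)
 fix i j
 have "A $ i $ j = - A $ j $ i" "B $ i $ j = - B $ j $ i" using assms unfolding skew_def by blast+
 then show "(A - B) $ i $ j = - (A - B) $ j $ i" unfolding vector_minus_component by linarith
qed

lemma inf_rigid_mono:
 "inf_rigid E W f ==> (!!x y. x \<in> W ==> y \<in> W ==> {x, y} \<in> E ==> {x, y} \<in> E') ==> inf_rigid E' W f"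
 unfolding inf_rigid_def edge_motion_def by blast

text \<open>The two trivial motions agree on \<open>Z\<close>, so their difference is an
  infinitesimal isometry vanishing there and is therefore zero.\<close>

lemma inf_rigid_Un:
 assumes X: "inf_rigid E X1 f" and Y: "inf_rigid E Y1 f" and Z: "hyper_spanning Z f" "Z \<subseteq> X1 \<inter> Y1"
 shows "inf_rigid E (X1 \<union> Y1) f"
 unfolding inf_rigid_def
proof (intro allI impI)
 fix m assume "edge_motion E (X1 \<union> Y1) f m"
 then have "edge_motion E X1 f m" "edge_motion E Y1 f m" by (auto simp: edge_motion_def)
 with X Y obtain A a B b where
  A: "skew A" "!!x. x \<in> X1 ==> m x = A *v f x + a" and
  B: "skew B" "!!x. x \<in> Y1 ==> m x = B *v f x + b"
  unfolding inf_rigid_def trivial_motion_def by metis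
 have "(A - B) *v f z + (a - b) = 0" if "z \<in> Z" for z
 proof -
  have "m z = A *v f z + a" "m z = B *v f z + b" using that Z A B by auto
  then have "A *v f z + a = B *v f z + b" by simp
  then show ?thesis by (simp add: matrix_vector_mult_diff_rdistrib algebra_simps)
 qed
 then have "A - B = 0 \<and> a - b = 0" using Z(1) skew_diff[OF A(1) B(1)] unfolding hyper_spanning_def by blast
 then show "trivial_motion (X1 \<union> Y1) f m" unfolding trivial_motion_def
  using A B by (intro exI[of _ A] exI[of _ a]) auto
qed

text \<open>Again a trivial kernel: the unknowns are the entries of \<open>A\<close> and
  \<open>a\<close>, the equations are vanishing on \<open>Z\<close> and skewness.\<close>

lemma generically_hyper_spanning:
 assumes fin: "finite V" and Z: "Z \<subseteq> V" "CARD('n) \<le> card Z"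
 shows "generically V (hyper_spanning Z :: ('v => real^'n) => bool)"
proof -
 have finZ: "finite Z" using fin Z finite_subset by blast
 define I :: "('n \<times> 'n + 'n) set" where "I = UNIV"
 define J :: "('v \<times> 'n + 'n \<times> 'n) set" where "J = Z \<times> UNIV <+> UNIV"
 define \<kappa> :: "('v => real^'n) => 'v \<times> 'n + 'n \<times> 'n => 'n \<times> 'n + 'n => real" where
  "\<kappa> = (\<lambda>f j i. case j of
    Inl (z, k) => (case i of Inl (k', l) => if k' = k then f z $ l else 0 | Inr k' => if k' = k then 1 else 0)
   | Inr (k, l) => (case i of Inl p => (if p = (k, l) then 1 else 0) + (if p = (l, k) then 1 else 0) | Inr _ => 0))"
 have sumI: "(\<Sum>i\<in>I. h i) = (\<Sum>k\<in>UNIV. \<Sum>l\<in>UNIV. h (Inl (k, l))) + (\<Sum>k\<in>UNIV. h (Inr k))" for h :: "_ => real"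
 proof -
  have "(\<Sum>i\<in>I. h i) = (\<Sum>p\<in>UNIV. h (Inl p)) + (\<Sum>k\<in>UNIV. h (Inr k))"
   unfolding I_def UNIV_Plus_UNIV[symmetric] by (subst sum.Plus) (simp_all add: comp_def del: UNIV_Plus_UNIV)
  then show ?thesis by (simp add: UNIV_Times_UNIV[symmetric] sum.cartesian_product del: UNIV_Times_UNIV)
 qed
 have tk: "trivial_kernel I J (\<kappa> f) \<longleftrightarrow> hyper_spanning Z f" for f
 proof -
  have rows: "(\<forall>j\<in>J. (\<Sum>i\<in>I. \<kappa> f j i * \<xi> i) = 0) \<longleftrightarrow>
   skew (\<chi> k l. \<xi> (Inl (k, l))) \<and> (\<forall>z\<in>Z. (\<chi> k l. \<xi> (Inl (k, l))) *v f z + (\<chi> k. \<xi> (Inr k)) = 0)" for \<xi>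
  proof -
   have 1: "(\<Sum>i\<in>I. \<kappa> f (Inl (z, k)) i * \<xi> i) = ((\<chi> k l. \<xi> (Inl (k, l))) *v f z + (\<chi> k. \<xi> (Inr k))) $ k" for z k
   proof -
    have "(\<Sum>k'\<in>UNIV. \<Sum>l\<in>UNIV. \<kappa> f (Inl (z, k)) (Inl (k', l)) * \<xi> (Inl (k', l)))
      = (\<Sum>k'\<in>UNIV. if k' = k then \<Sum>l\<in>UNIV. f z $ l * \<xi> (Inl (k', l)) else 0)"
     by (rule sum.cong) (auto simp: \<kappa>_def)
    moreover have "(\<Sum>k'\<in>UNIV. \<kappa> f (Inl (z, k)) (Inr k') * \<xi> (Inr k')) = (\<Sum>k'\<in>UNIV. if k' = k then \<xi> (Inr k') else 0)"
     by (rule sum.cong) (auto simp: \<kappa>_def)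
    ultimately show ?thesis unfolding sumI by (simp add: matrix_vector_mult_def mult.commute)
   qed
   have 2: "(\<Sum>i\<in>I. \<kappa> f (Inr (k, l)) i * \<xi> i) = \<xi> (Inl (k, l)) + \<xi> (Inl (l, k))" for k l
   proof -
    have a: "\<kappa> f (Inr (k, l)) (Inl p) * \<xi> (Inl p)
      = (if p = (k, l) then \<xi> (Inl p) else 0) + (if p = (l, k) then \<xi> (Inl p) else 0)" for p
    proof (cases "k = l")
     case True
     then show ?thesis by (cases "p = (k, l)") (simp_all add: \<kappa>_def)
    next
     case False
     then have "(k, l) ~= (l, k)" by auto
     then show ?thesis
      by (cases "p = (k, l)"; cases "p = (l, k)") (simp_all add: \<kappa>_def del: prod.inject)
    qed
    have b: "\<kappa> f (Inr (k, l)) (Inr k') * \<xi> (Inr k') = 0" for k' by (simp add: \<kappa>_def)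
    have "(\<Sum>i\<in>I. \<kappa> f (Inr (k, l)) i * \<xi> i) = (\<Sum>p\<in>UNIV. \<kappa> f (Inr (k, l)) (Inl p) * \<xi> (Inl p))
      + (\<Sum>k'\<in>UNIV. \<kappa> f (Inr (k, l)) (Inr k') * \<xi> (Inr k'))"
     unfolding sumI sum.cartesian_product UNIV_Times_UNIV by (simp only: case_prod_unfold prod.collapse)
    also have "\<dots> = (\<Sum>p\<in>UNIV. (if p = (k, l) then \<xi> (Inl p) else 0) + (if p = (l, k) then \<xi> (Inl p) else 0))"
     unfolding a b by simp
    finally have "(\<Sum>i\<in>I. \<kappa> f (Inr (k, l)) i * \<xi> i) =
      (\<Sum>p\<in>UNIV. (if p = (k, l) then \<xi> (Inl p) else 0) + (if p = (l, k) then \<xi> (Inl p) else 0))" .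
    then show ?thesis by (simp add: sum.distrib)
   qed
   have "(\<forall>j\<in>J. P j) \<longleftrightarrow> (\<forall>z\<in>Z. \<forall>k. P (Inl (z, k))) \<and> (\<forall>k l. P (Inr (k, l)))" for P
    unfolding J_def by (force elim!: PlusE)
   then show ?thesis
    by (simp add: 1 2 skew_def vec_eq_iff eq_neg_iff_add_eq_0 conj_commute)
  qed
  show ?thesis
  proof
   assume L: "trivial_kernel I J (\<kappa> f)"
   show "hyper_spanning Z f" unfolding hyper_spanning_def
   proof (intro allI impI)
    fix A :: "real^'n^'n" and a assume A: "skew A" "\<forall>z\<in>Z. A *v f z + a = 0"
    define \<xi> where "\<xi> = (\<lambda>i. case i of Inl (k, l) => A $ k $ l | Inr k => a $ k)"
    have eq: "(\<chi> k l. \<xi> (Inl (k, l))) = A" "(\<chi> k. \<xi> (Inr k)) = a" by (simp_all add: \<xi>_def vec_eq_iff)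
    have "\<forall>j\<in>J. (\<Sum>i\<in>I. \<kappa> f j i * \<xi> i) = 0" unfolding rows eq using A by blast
    then have "\<forall>i\<in>I. \<xi> i = 0" using L unfolding trivial_kernel_def by blast
    then have "\<xi> (Inl (k, l)) = 0" "\<xi> (Inr k) = 0" for k l by (auto simp: I_def)
    then show "A = 0 \<and> a = 0" by (simp add: \<xi>_def vec_eq_iff)
   qed
  next
   assume R: "hyper_spanning Z f"
   show "trivial_kernel I J (\<kappa> f)" unfolding trivial_kernel_def rows
   proof (intro allI impI ballI)
    fix \<xi> i assume "skew (\<chi> k l. \<xi> (Inl (k, l))) \<and> (\<forall>z\<in>Z. (\<chi> k l. \<xi> (Inl (k, l))) *v f z + (\<chi> k. \<xi> (Inr k)) = 0)"
    then have "(\<chi> k l. \<xi> (Inl (k, l))) = 0 \<and> (\<chi> k. \<xi> (Inr k)) = 0" using R unfolding hyper_spanning_def by blast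
    then have "\<xi> (Inl (k, l)) = 0" "\<xi> (Inr k) = 0" for k l by (auto simp: vec_eq_iff)
    then show "\<xi> i = 0" by (cases i) auto
   qed
  qed
 qed
 obtain g :: "'n => 'v" where g: "inj g" "range g \<subseteq> Z"
  using Z(2) finZ card_le_inj[of "UNIV :: 'n set" Z] by auto
 obtain k0 :: 'n where True by blast
 \<comment> \<open>The origin and all unit vectors except that of \<open>k0\<close>. Vanishing there
   kills \<open>a\<close> and every column but \<open>k0\<close>, and skewness kills the last
   column.\<close>
 define f0 :: "'v => real^'n" where "f0 = (\<lambda>v. if v \<in> g ` (- {k0}) then axis (inv_into UNIV g v) 1 else 0)"
 have f0g: "f0 (g k) = (if k = k0 then 0 else axis k 1)" for k
  using g(1) by (auto simp: f0_def inj_image_mem_iff)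
 have f0: "hyper_spanning Z f0" unfolding hyper_spanning_def
 proof (intro allI impI)
  fix A :: "real^'n^'n" and a assume A: "skew A" and eq: "\<forall>z\<in>Z. A *v f0 z + a = 0"
  have eq': "A *v f0 (g k) + a = 0" for k using eq g(2) by blast
  have a: "a = 0" using eq'[of k0] by (simp add: f0g)
  have off: "A $ i $ k = 0" if "k ~= k0" for i k
  proof -
   have "column k A = 0" using eq'[of k] that a by (simp add: f0g matrix_vector_mult_basis)
   then show ?thesis by (simp add: column_def vec_eq_iff)
  qed
  have sk: "A $ i $ k = - A $ k $ i" for i k using A unfolding skew_def by blast
  have "A $ i $ k = 0" for i k
  proof (cases "k = k0")
   case True
   show ?thesis
   proof (cases "i = k0")
    case True
    with \<open>k = k0\<close> sk[of k0 k0] show ?thesis by simp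
   next
    case False
    with \<open>k = k0\<close> sk[of i k0] off[of i k0] show ?thesis by simp
   qed
  qed (rule off)
  then show "A = 0 \<and> a = 0" using a by (simp add: vec_eq_iff)
 qed
 have J_cases: thesis if "j \<in> J" "!!z k. j = Inl (z, k) ==> z \<in> Z ==> thesis" "!!k l. j = Inr (k, l) ==> thesis" for j thesis
  using that unfolding J_def by (auto elim!: PlusE)
 have "generically V (\<lambda>f. trivial_kernel I J (\<kappa> f))"
 proof (rule generically_trivial_kernel[where C=1 and ?f0.0=f0])
  show "trivial_kernel I J (\<kappa> f0)" using f0 tk by blast
  show "\<kappa> (\<lambda>v\<in>V. f v + t *\<^sub>R (f0 v - f v)) j i = \<kappa> f j i + t * (\<kappa> f0 j i - \<kappa> f j i)"
   if "j \<in> J" for f t j i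
   using that
  proof (rule J_cases)
   fix z k assume j: "j = Inl (z, k)" "z \<in> Z"
   then have "z \<in> V" using Z by blast
   then show ?thesis unfolding j by (cases i) (auto simp: \<kappa>_def algebra_simps)
  qed (auto simp: \<kappa>_def split: sum.splits)
  show "\<bar>\<kappa> g j i - \<kappa> f j i\<bar> \<le> 1 * (\<Sum>v\<in>V. norm (g v - f v))" if "j \<in> J" for f g j i
  proof -
   have N0: "(\<Sum>v\<in>V. norm (g v - f v)) \<ge> 0" by (simp add: sum_nonneg)
   from that show ?thesis
   proof (rule J_cases)
    fix z k assume j: "j = Inl (z, k)" "z \<in> Z"
    then have "z \<in> V" using Z by blast
    then show ?thesis unfolding j using norm_component_diff_le_sum[OF fin, of z g _ f]
     by (cases i) (auto simp: \<kappa>_def N0)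
   qed (auto simp: \<kappa>_def N0 split: sum.splits)
  qed
 qed (use fin finZ in \<open>auto simp: I_def J_def\<close>)
 then show ?thesis by (rule generically_mono) (simp add: tk)
qed

lemma generically_inf_rigid_Un:
 fixes V :: "'v set"
 assumes fin: "finite V" and sub: "X1 \<subseteq> V" "Y1 \<subseteq> V" and card: "CARD('n) \<le> card (X1 \<inter> Y1)"
  and X: "generically V (inf_rigid E X1 :: ('v => real^'n) => bool)"
  and Y: "generically V (inf_rigid E Y1 :: ('v => real^'n) => bool)"
 shows "generically V (inf_rigid E (X1 \<union> Y1) :: ('v => real^'n) => bool)"
proof -
 have "generically V (hyper_spanning (X1 \<inter> Y1) :: ('v => real^'n) => bool)"
  by (rule generically_hyper_spanning) (use fin sub card in auto)
 from generically_conj[OF this generically_conj[OF X Y]] show ?thesis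
  by (rule generically_mono) (use inf_rigid_Un in blast)
qed

text \<open>Witness: the origin and the unit vectors. The velocities relative to \<open>x0\<close>
  are the columns of a matrix; the edges at \<open>x0\<close> make its diagonal zero, and the other
  edges make it skew.\<close>

lemma generically_inf_rigid_simplex:
 fixes V :: "'v set"
 assumes fin: "finite V" and W: "W \<subseteq> V" "card W = Suc CARD('n)"
  and E: "!!x y. x \<in> W ==> y \<in> W ==> x ~= y ==> {x, y} \<in> E"
 shows "generically V (inf_rigid E W :: ('v => real^'n) => bool)"
proof -
 obtain x0 where x0: "x0 \<in> W" using W by fastforce
 have finW: "finite W" using fin W finite_subset by blast
 have "card (W - {x0}) = CARD('n)" using W x0 finW by simp
 then obtain g :: "'n => 'v" where g: "bij_betw g UNIV (W - {x0})"
  using finite_same_card_bij[of "UNIV :: 'n set" "W - {x0}"] finW by auto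
 then have gi: "inj g" and gr: "range g = W - {x0}" by (auto simp: bij_betw_def)
 define f0 :: "'v => real^'n" where "f0 = (\<lambda>v. if v = x0 then 0 else axis (inv_into UNIV g v) 1)"
 have gx: "g k ~= x0" "g k \<in> W" for k using gr by auto
 have f0g: "f0 (g k) = axis k 1" "f0 x0 = 0" for k using gi gx by (auto simp: f0_def)
 have "inf_rigid E W f0" unfolding inf_rigid_def
 proof (intro allI impI)
  fix m :: "'v => real^'n" assume m: "edge_motion E W f0 m"
  define A :: "real^'n^'n" where "A = (\<chi> i k. (m (g k) - m x0) $ i)"
  have d: "A $ k $ k = 0" for k
  proof -
   have "(f0 (g k) - f0 x0) \<bullet> (m (g k) - m x0) = 0"
    using m E[of "g k" x0] gx x0 unfolding edge_motion_def by blast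
   then show ?thesis by (simp add: f0g A_def inner_axis' inner_diff_left)
  qed
  have "skew A" unfolding skew_def
  proof (intro allI)
   fix k l
   show "A $ k $ l = - A $ l $ k"
   proof (cases "k = l")
    case True
    then show ?thesis using d by simp
   next
    case False
    then have "g k ~= g l" using gi by (auto dest: injD)
    then have "(f0 (g k) - f0 (g l)) \<bullet> (m (g k) - m (g l)) = 0"
     using m E[of "g k" "g l"] gx unfolding edge_motion_def by blast
    moreover have "m (g k) - m (g l) = (m (g k) - m x0) - (m (g l) - m x0)" by simp
    ultimately have "(axis k 1 - axis l 1) \<bullet> ((m (g k) - m x0) - (m (g l) - m x0)) = 0"
     by (simp only: f0g)
    then have "A $ k $ k - A $ k $ l - (A $ l $ k - A $ l $ l) = 0"
     by (simp add: inner_diff_left inner_axis' A_def)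
    with d show ?thesis by simp
   qed
  qed
  moreover have "m x = A *v f0 x + m x0" if "x \<in> W" for x
  proof (cases "x = x0")
   case False
   then obtain k where "x = g k" using gr \<open>x \<in> W\<close> by blast
   then show ?thesis by (simp add: f0g matrix_vector_mult_basis column_def A_def vec_eq_iff)
  qed (simp add: f0g)
  ultimately show "trivial_motion W f0 m" unfolding trivial_motion_def by blast
 qed
 from generically_inf_rigid[OF fin W(1) this] show ?thesis .
qed

text \<open>At \<open>t = 0\<close> the vertices \<open>u\<close> and \<open>v\<close> coincide and the constraint of the edge \<open>uv\<close> is replaced
 by a direction \<open>h\<close> which, with the edges to the common neighbours, forces \<open>m u = m v\<close>.\<close>
lemma generically_inf_rigid_vertex_split:
 fixes V :: "'v set"
 assumes fin: "finite V" and W: "W \<subseteq> V" and uv: "u \<in> W" "v \<in> W" "u ~= v" "{u, v} \<in> E"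
  and Cm: "Cm \<subseteq> W - {u, v}" "CARD('n) \<le> Suc (card Cm)" "!!c. c \<in> Cm ==> {u, c} \<in> E \<and> {v, c} \<in> E"
  and E': "!!x y. x \<in> W - {u, v} ==> y \<in> W - {u, v} ==> {x, y} \<in> E' ==> {x, y} \<in> E"
   "!!y. y \<in> W - {u, v} ==> {u, y} \<in> E' ==> {u, y} \<in> E \<or> {v, y} \<in> E"
  and rigid: "generically V (inf_rigid E' (W - {v}) :: ('v => real^'n) => bool)"
 shows "generically V (inf_rigid E W :: ('v => real^'n) => bool)"
proof -
 have finW: "finite W" using fin W finite_subset by blast
 then have finC: "finite Cm" using Cm finite_subset by blast
 have "u \<notin> Cm" using Cm by blast
 then have "generically V (hyper_spanning (insert u Cm) :: ('v => real^'n) => bool)"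
  using generically_hyper_spanning[of V "insert u Cm"] fin W uv Cm finC by auto
 from generically_exists[OF generically_conj[OF this rigid]]
 obtain q :: "'v => real^'n" where q: "hyper_spanning (insert u Cm) q" "inf_rigid E' (W - {v}) q" by blast
 \<comment> \<open>The values of \<open>m u - m v\<close> that the edges to the common neighbours
   allow at \<open>t = 0\<close>. Two independent ones would give the infinitesimal rotation
   \<open>A\<close> below, which fixes \<open>u\<close> and \<open>Cm\<close>; so \<open>N\<close>
   is at most a line.\<close>
 define N where "N = {w. \<forall>c\<in>Cm. (q u - q c) \<bullet> w = 0}"
 have par: "w1 $ i * w2 $ j = w2 $ i * w1 $ j" if "w1 \<in> N" "w2 \<in> N" for w1 w2 i j
 proof -
  define A :: "real^'n^'n" where "A = (\<chi> i j. w1 $ i * w2 $ j - w2 $ i * w1 $ j)"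
  have Ax: "A *v x = (w2 \<bullet> x) *\<^sub>R w1 - (w1 \<bullet> x) *\<^sub>R w2" for x
   by (simp add: vec_eq_iff A_def matrix_vector_mult_def inner_vec_def
     sum_distrib_right sum_distrib_left algebra_simps sum_subtractf)
  have "skew A" by (simp add: skew_def A_def)
  moreover have "A *v q z + - (A *v q u) = 0" if z: "z \<in> insert u Cm" for z
  proof -
   have "A *v (q u - q z) = 0"
   proof (cases "z = u")
    case False
    then have "z \<in> Cm" using z by blast
    then have "(q u - q z) \<bullet> w1 = 0" "(q u - q z) \<bullet> w2 = 0" using \<open>w1 \<in> N\<close> \<open>w2 \<in> N\<close> by (auto simp: N_def)
    then show ?thesis by (simp add: Ax inner_commute)
   qed simp
   then show ?thesis by (simp add: matrix_vector_mult_diff_distrib)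
  qed
  ultimately have "A = 0" using q(1) unfolding hyper_spanning_def by blast
  then have "A $ i $ j = 0" by simp
  then show ?thesis by (simp add: A_def)
 qed
 \<comment> \<open>A spanning vector of \<open>N\<close>; if \<open>N\<close> is zero, any vector
   serves.\<close>
 obtain h where h: "!!w. w \<in> N ==> h \<bullet> w = 0 ==> w = 0"
 proof (cases "\<exists>h\<in>N. h ~= 0")
  case True
  then obtain h where hN: "h \<in> N" "h ~= 0" by blast
  show thesis
  proof (rule that)
   fix w assume w: "w \<in> N" "h \<bullet> w = 0"
   have "(h \<bullet> h) * w $ j = 0" for j
   proof -
    have "(h \<bullet> h) * w $ j = (\<Sum>i\<in>UNIV. h $ i * (h $ i * w $ j))"
     by (simp add: inner_vec_def sum_distrib_right mult.assoc)
    also have "\<dots> = (\<Sum>i\<in>UNIV. h $ i * (w $ i * h $ j))" using par[OF hN(1) w(1)] by simp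
    also have "\<dots> = (h \<bullet> w) * h $ j" by (simp add: inner_vec_def sum_distrib_right mult.assoc)
    finally show ?thesis using w by simp
   qed
   moreover have "h \<bullet> h ~= 0" using hN by simp
   ultimately have "w $ j = 0" for j by (metis mult_eq_0_iff)
   then show "w = 0" by (simp add: vec_eq_iff)
  qed
 qed (use that in blast)
 \<comment> \<open>\<open>v\<close> leaves the position of \<open>u\<close> in direction
   \<open>h\<close>. The row of the edge \<open>uv\<close> is divided by \<open>t\<close>: it then
   survives at \<open>t = 0\<close>, and the system stays affine in \<open>t\<close>.\<close>
 define qt where "qt = (\<lambda>t. q(v := q u + t *\<^sub>R h))"
 define Dt where "Dt = (\<lambda>t (x, y). if (x, y) = (u, v) then - h else if (x, y) = (v, u) then h else qt t x - qt t y)"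
 let ?I = "W \<times> (UNIV :: 'n set)" and ?J = "rigidity_rows E W :: ('v \<times> 'v + 'n + 'n \<times> 'n) set"
 define \<alpha> where "\<alpha> = rigidity_coeff (Dt 0) (qt 0)"
 define \<beta> where "\<beta> = (\<lambda>j i. rigidity_coeff (Dt 1) (qt 1) j i - \<alpha> j i)"
 have aff: "rigidity_coeff (Dt t) (qt t) j i = \<alpha> j i + t * \<beta> j i" for t j i
 proof -
  have qt: "qt t x = qt 0 x + t *\<^sub>R (qt 1 x - qt 0 x)" for x
   by (simp add: qt_def algebra_simps)
  have Dt: "Dt t e = Dt 0 e + t *\<^sub>R (Dt 1 e - Dt 0 e)" for e
   using qt[of "fst e"] qt[of "snd e"] by (cases e) (simp add: Dt_def algebra_simps)
  show ?thesis unfolding \<alpha>_def \<beta>_def rigidity_coeff_def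
   by (simp add: Dt qt algebra_simps split: sum.split)
 qed
 have 0: "trivial_kernel ?I ?J (\<lambda>j i. \<alpha> j i + 0 * \<beta> j i)"
 proof -
  \<comment> \<open>At \<open>t = 0\<close> a motion takes equal values at \<open>u\<close> and
    \<open>v\<close>, so it restricts to a motion of the contracted graph, which is rigid at
    \<open>q\<close>.\<close>
  have "trivial_kernel ?I ?J \<alpha>" unfolding \<alpha>_def trivial_kernel_rigidity_iff[OF finW]
  proof (intro allI impI, elim conjE)
   fix m :: "'v => real^'n"
   assume m: "\<forall>x\<in>W. \<forall>y\<in>W. {x, y} \<in> E --> Dt 0 (x, y) \<bullet> (m x - m y) = 0" and b: "balanced W (qt 0) m"
   have qv: "qt 0 v = q u" "qt 0 x = q x" if "x ~= v" for x using that by (auto simp: qt_def)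
   have qu: "qt 0 u = q u" using uv by (auto simp: qt_def)
   have "Dt 0 (u, v) \<bullet> (m u - m v) = 0" using m uv by blast
   then have muv: "h \<bullet> (m u - m v) = 0" by (simp add: Dt_def)
   have "m u - m v \<in> N" unfolding N_def
   proof safe
    fix c assume c: "c \<in> Cm"
    then have cW: "c \<in> W" "c ~= u" "c ~= v" using Cm by auto
    have "Dt 0 (u, c) = q u - q c" "Dt 0 (v, c) = q u - q c"
     using cW uv by (auto simp: Dt_def qt_def)
    then have "(q u - q c) \<bullet> (m u - m c) = 0" "(q u - q c) \<bullet> (m v - m c) = 0"
     using m Cm(3)[OF c] cW uv by (metis)+
    then have "(q u - q c) \<bullet> ((m u - m c) - (m v - m c)) = 0" by (simp only: inner_diff_right[of _ "m u - m c"])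
    then show "(q u - q c) \<bullet> (m u - m v) = 0" by simp
   qed
   then have eq: "m u = m v" using h[of "m u - m v"] muv by simp
   have D0: "Dt 0 (x, y) = q x - q y" if "x ~= v" "y ~= v" for x y
    using that by (auto simp: Dt_def qt_def)
   have D0v: "Dt 0 (v, y) = q u - q y" "Dt 0 (y, v) = q y - q u" if "y ~= v" "y ~= u" for y
    using that uv by (auto simp: Dt_def qt_def)
   have mE: "Dt 0 (x, y) \<bullet> (m x - m y) = 0" if "x \<in> W" "y \<in> W" "{x, y} \<in> E" for x y
    using m that by blast
   have key: "(q u - q y) \<bullet> (m u - m y) = 0" if "y \<in> W - {u, v}" "{u, y} \<in> E'" for y
    using E'(2)[OF that]
   proof
    assume "{u, y} \<in> E"
    then show ?thesis using mE[of u y] uv that D0[of u y] by simp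
   next
    assume "{v, y} \<in> E"
    then show ?thesis using mE[of v y] uv that D0v(1)[of y] eq by simp
   qed
   have "edge_motion E' (W - {v}) q m" unfolding edge_motion_def
   proof (intro ballI impI)
    fix x y assume xy: "x \<in> W - {v}" "y \<in> W - {v}" "{x, y} \<in> E'"
    consider "x = y" | "x = u" "y ~= u" | "y = u" "x ~= u" | "x ~= u" "y ~= u" by blast
    then show "(q x - q y) \<bullet> (m x - m y) = 0"
    proof cases
     case 2
     then show ?thesis using key[of y] xy by simp
    next
     case 3
     then have "(q u - q x) \<bullet> (m u - m x) = 0" using key[of x] xy by (simp add: insert_commute)
     then show ?thesis using 3 by (simp add: inner_diff_left inner_diff_right)
    next
     case 4
     then have "{x, y} \<in> E" using xy E'(1) by auto
     then show ?thesis using mE[of x y] xy D0[of x y] by simp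
    qed simp
   qed
   then obtain A a where A: "skew A" "!!x. x \<in> W - {v} ==> m x = A *v q x + a"
    using q(2) unfolding inf_rigid_def trivial_motion_def by blast
   have "m x = A *v qt 0 x + a" if "x \<in> W" for x
    using A(2)[of x] A(2)[of u] that uv eq by (cases "x = v") (auto simp: qt_def)
   then have "trivial_motion W (qt 0) m" using A(1) unfolding trivial_motion_def by blast
   then show "\<forall>x\<in>W. m x = 0" using trivial_balanced_eq_0[OF finW _ b] by blast
  qed
  then show ?thesis by simp
 qed
 have "finite {t. \<not> trivial_kernel ?I ?J (\<lambda>j i. \<alpha> j i + t * \<beta> j i)}"
  by (rule finite_degenerate_parameters[OF _ _ 0]) (auto simp: finW finite_rigidity_rows)
 moreover have "infinite {0<..<1::real}" by (simp add: infinite_Ioo)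
 \<comment> \<open>For a nondegenerate \<open>t > 0\<close> the placement \<open>qt t\<close> is
   rigid itself, since scaling the row of \<open>uv\<close> by \<open>t\<close> does not change the
   kernel.\<close>
 ultimately obtain t where t: "t \<in> {0<..<1}" "trivial_kernel ?I ?J (\<lambda>j i. \<alpha> j i + t * \<beta> j i)"
  by (metis (mono_tags, lifting) finite_subset mem_Collect_eq subsetI)
 have "rigidity_coeff (Dt t) (qt t) = (\<lambda>j i. \<alpha> j i + t * \<beta> j i)" by (intro ext) (rule aff)
 with t have tk: "trivial_kernel ?I ?J (rigidity_coeff (Dt t) (qt t))" by simp
 have "inf_rigid E W (qt t)" unfolding inf_rigid_iff[OF finW]
 proof (intro allI impI, elim conjE)
  fix m assume m: "edge_motion E W (qt t) m" and b: "balanced W (qt t) m"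
  have "Dt t (x, y) \<bullet> (m x - m y) = 0" if xy: "x \<in> W" "y \<in> W" "{x, y} \<in> E" for x y
  proof -
   have e: "(qt t x - qt t y) \<bullet> (m x - m y) = 0" by (rule m[unfolded edge_motion_def, rule_format, OF xy])
   have d: "qt t u - qt t v = - (t *\<^sub>R h)" "qt t v - qt t u = t *\<^sub>R h" using uv by (auto simp: qt_def)
   consider "x = u \<and> y = v" | "x = v \<and> y = u" | "(x, y) ~= (u, v)" "(x, y) ~= (v, u)" by blast
   then show ?thesis
   proof cases
    case 1
    then show ?thesis using e d t(1) by (simp add: Dt_def)
   next
    case 2
    then show ?thesis using e d t(1) uv by (simp add: Dt_def)
   next
    case 3
    have "Dt t (x, y) = qt t x - qt t y"
     unfolding Dt_def prod.case if_not_P[OF 3(1)] if_not_P[OF 3(2)] ..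
    then show ?thesis using e by simp
   qed
  qed
  with b tk show "\<forall>x\<in>W. m x = 0" unfolding trivial_kernel_rigidity_iff[OF finW] by blast
 qed
 from generically_inf_rigid[OF fin W this] show ?thesis .
qed

section \<open>Infinitesimally rigid maps are rigid\<close>

lemma orthogonal_matrix_norm: "orthogonal_matrix Q ==> norm (Q *v x) = norm (x :: real^'n)"
 using orthogonal_transformation_norm[of "(*v) Q" x]
 by (simp add: orthogonal_transformation_matrix)

text \<open>The orthogonal matrices form a compact set. A maximiser is a best alignment of
  \<open>G\<close> with \<open>F\<close> in the sense of least squares.\<close>

lemma exists_optimal_rotation:
 fixes F G :: "'v => real^'n"
 shows "\<exists>Q. orthogonal_matrix Q \<and> (\<forall>Q'. orthogonal_matrix Q' --> (\<Sum>x\<in>W. F x \<bullet> (Q' *v G x)) \<le> (\<Sum>x\<in>W. F x \<bullet> (Q *v G x)))"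
proof -
 let ?O = "{Q :: real^'n^'n. orthogonal_matrix Q}"
 have "closed ?O"
 proof -
  have eq: "?O = (\<lambda>Q. transpose Q ** Q) -` {mat 1}" by (auto simp: orthogonal_matrix)
  have "continuous_on UNIV (\<lambda>Q :: real^'n^'n. transpose Q ** Q)"
   unfolding transpose_def matrix_matrix_mult_def by (intro continuous_intros continuous_on_vec_lambda)
  then show ?thesis unfolding eq by (intro closed_vimage closed_singleton)
 qed
 moreover have "bounded ?O"
 proof (rule boundedI)
  fix Q assume "Q \<in> ?O"
  then have n: "norm (column k Q) = 1" for k
   using orthogonal_matrix_norm[of Q "axis k 1"] by (simp add: matrix_vector_mult_basis)
  have "norm Q \<le> (\<Sum>i\<in>UNIV. norm (Q $ i))" by (simp add: norm_vec_def L2_set_le_sum)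
  also have "\<dots> \<le> (\<Sum>i\<in>(UNIV::'n set). \<Sum>j\<in>(UNIV::'n set). 1)"
  proof (intro sum_mono)
   fix i
   have "norm (Q $ i) \<le> (\<Sum>j\<in>UNIV. \<bar>Q $ i $ j\<bar>)" by (rule norm_le_l1_cart)
   also have "\<dots> \<le> (\<Sum>j\<in>(UNIV::'n set). 1)"
   proof (rule sum_mono)
    fix j show "\<bar>Q $ i $ j\<bar> \<le> 1"
     using component_le_norm_cart[of "column j Q" i] n[of j] by (simp add: column_def)
   qed
   finally show "norm (Q $ i) \<le> (\<Sum>j\<in>(UNIV::'n set). 1)" .
  qed
  finally show "norm Q \<le> real (CARD('n) * CARD('n))" by simp
 qed
 ultimately have "compact ?O" by (simp add: compact_eq_bounded_closed)
 moreover have "mat 1 \<in> ?O" by (simp add: orthogonal_matrix_id)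
 moreover have "continuous_on ?O (\<lambda>Q. \<Sum>x\<in>W. F x \<bullet> (Q *v G x))"
  unfolding matrix_vector_mult_def by (intro continuous_intros continuous_on_vec_lambda)
 ultimately show ?thesis using continuous_attains_sup[of ?O "\<lambda>Q. \<Sum>x\<in>W. F x \<bullet> (Q *v G x)"] by blast
qed

definition plane_rotation :: "'n => 'n => real => real^'n => real^'n" where
 "plane_rotation k l t y = (\<chi> i. if i = k then cos t * y $ k - sin t * y $ l
  else if i = l then sin t * y $ k + cos t * y $ l else y $ i)"

lemma orthogonal_transformation_plane_rotation:
 fixes k l :: "'n::finite"
 assumes "k ~= l" shows "orthogonal_transformation (plane_rotation k l t)"
 unfolding orthogonal_transformation
proof
 show "linear (plane_rotation k l t)"
  by (rule linearI) (auto simp: plane_rotation_def vec_eq_iff algebra_simps)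
 show "\<forall>v. norm (plane_rotation k l t v) = norm v"
 proof
  fix v :: "real^'n"
  have split: "(\<Sum>i\<in>UNIV. h i) = h k + h l + (\<Sum>i\<in>UNIV - {k, l}. h i)" for h :: "'n => real"
  proof -
   have "(\<Sum>i\<in>UNIV. h i) = (\<Sum>i\<in>{k, l}. h i) + (\<Sum>i\<in>UNIV - {k, l}. h i)"
    by (subst sum.subset_diff[of "{k,l}" UNIV]) (auto simp: add.commute)
   then show ?thesis using assms by simp
  qed
  define a b c s where abcs: "a = v $ k" "b = v $ l" "c = cos t" "s = sin t"
  have cs: "c * c + s * s = 1" unfolding abcs by (simp flip: power2_eq_square)
  have "(c * a - s * b) * (c * a - s * b) + (s * a + c * b) * (s * a + c * b) = (c * c + s * s) * (a * a + b * b)"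
   by (simp add: algebra_simps)
  then have *: "(c * a - s * b) * (c * a - s * b) + (s * a + c * b) * (s * a + c * b) = a * a + b * b"
   by (simp add: cs)
  have "plane_rotation k l t v \<bullet> plane_rotation k l t v = v \<bullet> v"
   unfolding inner_vec_def split using assms *
   by (simp add: plane_rotation_def abcs inner_real_def)
  then show "norm (plane_rotation k l t v) = norm v" by (simp add: norm_eq_sqrt_inner)
 qed
qed

text \<open>The bound is attained at \<open>t = 0\<close>, so the derivative \<open>b\<close>
  vanishes there.\<close>

lemma sin_coefficient_eq_0:
 fixes a b :: real
 assumes "!!t. a * cos t + b * sin t \<le> a" shows "b = 0"
proof -
 have 1: "((\<lambda>t. a * cos t + b * sin t) has_real_derivative b) (at 0)"
  by (auto intro!: derivative_eq_intros)
 have "\<forall>y. \<bar>0 - y\<bar> < 1 --> a * cos y + b * sin y \<le> a * cos 0 + b * sin 0" using assms by simp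
 from DERIV_local_max[OF 1 zero_less_one this] show ?thesis .
qed

text \<open>Once \<open>g\<close> is aligned with \<open>f\<close> by a best rotation, the
  displacement \<open>h\<close> is balanced, so the rigidity matrix bounds it from below. Equal edge
  lengths make the edge rows quadratic in \<open>h\<close>, and a quantity bounded by a multiple of
  its square is zero when it is small.\<close>

lemma inf_rigid_imp_rigid_map:
 fixes f :: "'v => real^'n"
 assumes fin: "finite V" and rigid: "inf_rigid E V f"
 shows "rigid_map (V, E) f"
proof -
 let ?I = "V \<times> (UNIV :: 'n set)" and ?J = "rigidity_rows E V :: ('v \<times> 'v + 'n + 'n \<times> 'n) set"
 let ?c = "rigidity_coeff (\<lambda>(x, y). f x - f y) f"
 have finJ: "finite ?J" by (rule finite_rigidity_rows[OF fin])
 have finI: "finite ?I" using fin by simp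
 have tk: "trivial_kernel ?I ?J ?c" using rigid unfolding inf_rigid_iff_trivial_kernel[OF fin] .
 obtain K where K: "K > 0" "!!\<xi> i. i \<in> ?I ==> \<bar>\<xi> i\<bar> \<le> K * (\<Sum>j\<in>?J. \<bar>\<Sum>i\<in>?I. ?c j i * \<xi> i\<bar>)"
  using trivial_kernel_bounded_below[OF finI finJ tk] by blast
 define n where "n = real (card V)"
 \<comment> \<open>The sum \<open>H\<close> of the norms of \<open>h\<close> will satisfy
   \<open>H \<le> K' * (H * H)\<close> and also \<open>H \<le> n * (n * (2 * \<epsilon>))\<close>;
   \<open>D\<close> is chosen to make the second bound smaller than \<open>1 / K'\<close>.\<close>
 define K' where "K' = n * CARD('n) * (K * card ?J) + 1"
 define D where "D = (n + 1) * (n + 1) * K'"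
 define \<epsilon> where "\<epsilon> = 1 / (2 * D)"
 have n0: "n \<ge> 0" by (simp add: n_def)
 have K'0: "K' > 0" unfolding K'_def using K(1) n0 by (intro add_nonneg_pos mult_nonneg_nonneg) auto
 have D0: "D > 0" using n0 K'0 by (simp add: D_def)
 then have \<epsilon>0: "\<epsilon> > 0" by (simp add: \<epsilon>_def)
 show ?thesis unfolding rigid_map_def prod.case
 proof (intro exI[of _ \<epsilon>] conjI \<epsilon>0 ballI impI)
  fix g :: "'v => real^'n" and u0 v0
  assume g: "\<forall>v\<in>V. norm (f v - g v) < \<epsilon>"
   and len: "\<forall>u\<in>V. \<forall>v\<in>V. {u, v} \<in> E --> norm (g u - g v) = norm (f u - f v)"
   and uv0: "u0 \<in> V" "v0 \<in> V"
  have n1: "n \<ge> 1" using fin uv0 by (cases "card V") (auto simp: n_def)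
  define fb where "fb = (1 / n) *\<^sub>R (\<Sum>x\<in>V. f x)"
  define gb where "gb = (1 / n) *\<^sub>R (\<Sum>x\<in>V. g x)"
  define F where "F = (\<lambda>x. f x - fb)"
  define G where "G = (\<lambda>x. g x - gb)"
  have sF: "(\<Sum>x\<in>V. F x) = 0" "(\<Sum>x\<in>V. G x) = 0"
   unfolding F_def G_def fb_def gb_def sum_subtractf sum_constant_scaleR n_def[symmetric] using n1 by simp_all
  obtain Q where Q: "orthogonal_matrix Q"
   "!!Q'. orthogonal_matrix Q' ==> (\<Sum>x\<in>V. F x \<bullet> (Q' *v G x)) \<le> (\<Sum>x\<in>V. F x \<bullet> (Q *v G x))"
   using exists_optimal_rotation[of F G V] by blast
  define y where "y = (\<lambda>x. Q *v G x)"
  define h where "h = (\<lambda>x. y x - F x)"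
  have sy: "(\<Sum>x\<in>V. y x) = 0"
   unfolding y_def by (simp add: linear_sum[OF matrix_vector_mul_linear, symmetric] sF(2))
  have sh: "(\<Sum>x\<in>V. h x) = 0" by (simp add: h_def sum_subtractf sy sF)
  \<comment> \<open>First-order optimality: rotating \<open>y\<close> in the plane of
    \<open>k\<close> and \<open>l\<close> does not improve the alignment, so the coefficient of
    \<open>sin t\<close> vanishes. This is the symmetry of moments that \<open>balanced\<close>
    requires.\<close>
  have rot: "(\<Sum>x\<in>V. y x $ k * F x $ l - y x $ l * F x $ k) = 0" for k l :: 'n
  proof (cases "k = l")
   case False
   define a where "a = (\<Sum>x\<in>V. F x $ k * y x $ k + F x $ l * y x $ l)"
   define b where "b = (\<Sum>x\<in>V. F x $ l * y x $ k - F x $ k * y x $ l)"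
   have "a * cos t + b * sin t \<le> a" for t
   proof -
    let ?R = "plane_rotation k l t"
    have oR: "orthogonal_transformation ?R" by (rule orthogonal_transformation_plane_rotation[OF False])
    then have R: "?R z = matrix ?R *v z" for z
     by (simp add: matrix_works orthogonal_transformation_def)
    have "orthogonal_matrix (matrix ?R ** Q)"
     using oR Q(1) by (simp add: orthogonal_matrix_mul orthogonal_transformation_matrix)
    from Q(2)[OF this] have "(\<Sum>x\<in>V. F x \<bullet> ?R (y x)) \<le> (\<Sum>x\<in>V. F x \<bullet> y x)"
     by (simp add: R y_def matrix_vector_mul_assoc)
    moreover have d: "F x \<bullet> ?R (y x) - F x \<bullet> y x = (F x $ k * y x $ k + F x $ l * y x $ l) * (cos t - 1)
      + (F x $ l * y x $ k - F x $ k * y x $ l) * sin t" for x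
    proof -
     have "F x \<bullet> ?R (y x) - F x \<bullet> y x = (\<Sum>i\<in>UNIV. F x $ i * (?R (y x) $ i - y x $ i))"
      by (simp add: inner_vec_def right_diff_distrib sum_subtractf)
     also have "\<dots> = (\<Sum>i\<in>{k, l}. F x $ i * (?R (y x) $ i - y x $ i))"
      by (rule sum.mono_neutral_right) (auto simp: plane_rotation_def)
     finally show ?thesis using False by (simp add: plane_rotation_def algebra_simps)
    qed
    have "(\<Sum>x\<in>V. F x \<bullet> ?R (y x)) - (\<Sum>x\<in>V. F x \<bullet> y x) = a * (cos t - 1) + b * sin t"
     unfolding sum_subtractf[symmetric] d a_def b_def sum_distrib_right
     by (rule sum.distrib)
    ultimately show ?thesis by (simp add: algebra_simps)
   qed
   then have "b = 0" by (rule sin_coefficient_eq_0)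
   then show ?thesis by (simp add: b_def mult.commute)
  qed simp
  have bal: "balanced V f h" unfolding balanced_def
  proof (intro conjI sh allI)
   fix k l :: 'n
   have d: "h x $ k * f x $ l - h x $ l * f x $ k =
     (y x $ k * F x $ l - y x $ l * F x $ k) + (h x $ k * fb $ l - h x $ l * fb $ k)" for x
    by (simp add: h_def F_def algebra_simps)
   have "(\<Sum>x\<in>V. h x $ k * f x $ l - h x $ l * f x $ k) =
     (\<Sum>x\<in>V. y x $ k * F x $ l - y x $ l * F x $ k) + (\<Sum>x\<in>V. h x $ k * fb $ l - h x $ l * fb $ k)"
    unfolding d by (rule sum.distrib)
   also have "(\<Sum>x\<in>V. h x $ k * fb $ l - h x $ l * fb $ k) = (\<Sum>x\<in>V. h x) $ k * fb $ l - (\<Sum>x\<in>V. h x) $ l * fb $ k"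
    by (simp only: sum_subtractf sum_component sum_distrib_right)
   finally show "(\<Sum>x\<in>V. h x $ k * f x $ l - h x $ l * f x $ k) = 0"
    by (simp only: rot sh zero_index)
  qed
  have yy: "norm (y x - y z) = norm (g x - g z)" for x z :: 'v
   unfolding y_def by (simp add: matrix_vector_mult_diff_distrib[symmetric] orthogonal_matrix_norm[OF Q(1)] G_def)
  define H where "H = (\<Sum>x\<in>V. norm (h x))"
  have hH: "norm (h x) \<le> H" if "x \<in> V" for x
   unfolding H_def by (rule member_le_sum) (use that fin in auto)
  have H0: "H \<ge> 0" by (simp add: H_def sum_nonneg)
  \<comment> \<open>Comparing the squared lengths of \<open>y x - y z\<close> and
    \<open>f x - f z\<close> leaves \<open>2 * ((f x - f z) \<bullet> (h x - h z))\<close> equal to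
    minus the squared norm of \<open>h x - h z\<close>.\<close>
  have edge: "\<bar>(f x - f z) \<bullet> (h x - h z)\<bar> \<le> H * H" if "x \<in> V" "z \<in> V" "{x, z} \<in> E" for x z :: 'v
  proof (cases "x = z")
   case False
   have "norm (y x - y z) = norm (f x - f z)" using yy len that by simp
   moreover have "y x - y z = (f x - f z) + (h x - h z)" by (simp add: h_def F_def)
   ultimately have "((f x - f z) + (h x - h z)) \<bullet> ((f x - f z) + (h x - h z)) = (f x - f z) \<bullet> (f x - f z)"
    by (metis norm_eq_sqrt_inner real_sqrt_eq_iff)
   then have "2 * ((f x - f z) \<bullet> (h x - h z)) = - ((h x - h z) \<bullet> (h x - h z))"
    by (simp add: inner_add_left inner_add_right inner_commute)
   then have "2 * \<bar>(f x - f z) \<bullet> (h x - h z)\<bar> = norm (h x - h z) * norm (h x - h z)"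
    by (simp add: power2_norm_eq_inner[symmetric] power2_eq_square[symmetric]) (smt (verit) zero_le_power2)
   moreover have "norm (h x - h z) \<le> H"
   proof -
    have "norm (h x - h z) \<le> (\<Sum>x\<in>{x, z}. norm (h x))" using False by (simp add: norm_triangle_ineq4)
    also have "\<dots> \<le> H" unfolding H_def by (rule sum_mono2) (use that fin in auto)
    finally show ?thesis .
   qed
   then have "norm (h x - h z) * norm (h x - h z) \<le> H * H" by (intro mult_mono) (auto simp: H0)
   ultimately show ?thesis by linarith
  qed (simp add: H0)
  define \<xi> where "\<xi> = (\<lambda>i. h (fst i) $ snd i)"
  have row: "\<bar>\<Sum>i\<in>?I. ?c j i * \<xi> i\<bar> \<le> H * H" if "j \<in> ?J" for j
   using that
  proof (cases rule: rigidity_rows_cases)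
   case (edge x z)
   then show ?thesis using \<open>!!x z. x \<in> V ==> z \<in> V ==> {x, z} \<in> E ==> \<bar>(f x - f z) \<bullet> (h x - h z)\<bar> \<le> H * H\<close>[of x z]
    unfolding edge(1) \<xi>_def by (subst sum_rigidity_coeff(1)[OF fin]) auto
  next
   case (translation k)
   show ?thesis unfolding translation \<xi>_def sum_rigidity_coeff(2)[OF fin] by (simp add: sh del: sum_component)
  next
   case (rotation k l)
   show ?thesis unfolding rotation \<xi>_def sum_rigidity_coeff(3)[OF fin] using bal
    by (simp add: balanced_def)
  qed
  have \<xi>b: "\<bar>h x $ k\<bar> \<le> K * card ?J * (H * H)" if "x \<in> V" for x k
  proof -
   have "\<bar>\<xi> (x, k)\<bar> \<le> K * (\<Sum>j\<in>?J. \<bar>\<Sum>i\<in>?I. ?c j i * \<xi> i\<bar>)" using that by (intro K(2)) auto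
   also have "\<dots> \<le> K * (real (card ?J) * (H * H))"
    using K(1) row by (intro mult_left_mono sum_bounded_above) auto
   finally show ?thesis by (simp add: \<xi>_def mult.assoc)
  qed
  have "H \<le> (\<Sum>x\<in>V. \<Sum>k\<in>UNIV. \<bar>h x $ k\<bar>)" unfolding H_def by (intro sum_mono norm_le_l1_cart)
  also have "\<dots> \<le> (\<Sum>x\<in>V. \<Sum>k\<in>(UNIV::'n set). K * card ?J * (H * H))" by (intro sum_mono \<xi>b)
  also have "\<dots> = (K' - 1) * (H * H)" by (simp add: K'_def n_def)
  also have "\<dots> \<le> K' * (H * H)" by (intro mult_right_mono) (auto simp: H0)
  finally have HK: "H \<le> K' * (H * H)" .
  \<comment> \<open>The identity matrix competes with \<open>Q\<close>, so alignment does not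
    increase the sum of squared displacements of the centred configurations.\<close>
  have "(\<Sum>x\<in>V. (norm (h x))\<^sup>2) \<le> (\<Sum>x\<in>V. (norm (G x - F x))\<^sup>2)"
  proof -
   have sq: "(norm (w - F x))\<^sup>2 = (norm w)\<^sup>2 + (norm (F x))\<^sup>2 - 2 * (F x \<bullet> w)" for w x
    by (simp add: power2_norm_eq_inner inner_diff_left inner_diff_right inner_commute)
   have "(\<Sum>x\<in>V. F x \<bullet> (mat 1 *v G x)) \<le> (\<Sum>x\<in>V. F x \<bullet> y x)"
    unfolding y_def by (rule Q(2)[OF orthogonal_matrix_id])
   then show ?thesis unfolding h_def
    by (simp add: sq sum.distrib sum_subtractf y_def orthogonal_matrix_norm[OF Q(1)] sum_distrib_left[symmetric])
  qed
  also have "\<dots> \<le> (\<Sum>x\<in>V. (2 * \<epsilon>)\<^sup>2)"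
  proof (rule sum_mono)
   fix x assume x: "x \<in> V"
   have "gb - fb = (1 / n) *\<^sub>R (\<Sum>x\<in>V. g x - f x)" by (simp add: fb_def gb_def sum_subtractf scaleR_diff_right)
   moreover have "norm (\<Sum>x\<in>V. g x - f x) \<le> n * \<epsilon>"
    unfolding n_def using g by (intro sum_norm_bound) (auto simp: norm_minus_commute intro: less_imp_le)
   ultimately have "norm (gb - fb) \<le> \<epsilon>" using n1 by (simp add: field_simps)
   moreover have "norm (g x - f x) \<le> \<epsilon>" using g x by (auto simp: norm_minus_commute intro: less_imp_le)
   moreover have "G x - F x = (g x - f x) - (gb - fb)" by (simp add: G_def F_def)
   ultimately have "norm (G x - F x) \<le> 2 * \<epsilon>" using norm_triangle_ineq4[of "g x - f x" "gb - fb"] by simp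
   then show "(norm (G x - F x))\<^sup>2 \<le> (2 * \<epsilon>)\<^sup>2" by (rule power_mono) simp
  qed
  also have "\<dots> = n * (2 * \<epsilon>)\<^sup>2" by (simp add: n_def)
  \<comment> \<open>The estimate \<open>n \<le> n * n\<close> avoids a square root of
    \<open>n\<close>.\<close>
  also have "\<dots> \<le> (n * (2 * \<epsilon>))\<^sup>2"
  proof -
   have "n * 1 \<le> n * n" using n1 by (intro mult_left_mono) auto
   then have "n * (2 * \<epsilon>)\<^sup>2 \<le> n * n * (2 * \<epsilon>)\<^sup>2" by (intro mult_right_mono) auto
   then show ?thesis by (simp add: power_mult_distrib power2_eq_square mult_ac)
  qed
  finally have S: "(\<Sum>x\<in>V. (norm (h x))\<^sup>2) \<le> (n * (2 * \<epsilon>))\<^sup>2" .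
  have "norm (h x) \<le> n * (2 * \<epsilon>)" if "x \<in> V" for x
  proof (rule power2_le_imp_le)
   have "(norm (h x))\<^sup>2 \<le> (\<Sum>x\<in>V. (norm (h x))\<^sup>2)" by (rule member_le_sum) (use that fin in auto)
   with S show "(norm (h x))\<^sup>2 \<le> (n * (2 * \<epsilon>))\<^sup>2" by linarith
  qed (use n0 \<epsilon>0 in simp)
  then have "H \<le> n * (n * (2 * \<epsilon>))" unfolding H_def n_def by (intro sum_bounded_above) (simp add: n_def)
  also have "\<dots> = n * n / D" by (simp add: \<epsilon>_def)
  finally have "K' * H \<le> K' * (n * n / D)" using K'0 by (intro mult_left_mono) auto
  also have "\<dots> = n * n / ((n + 1) * (n + 1))" using K'0 by (simp add: D_def)
  also have "\<dots> < 1" using n0 by (simp add: divide_less_eq) (simp add: algebra_simps)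
  finally have lt: "K' * H < 1" .
  have "H = 0"
  proof (rule ccontr)
   assume "H ~= 0"
   with H0 have "H > 0" by simp
   then have "K' * H * H < 1 * H" using lt by (intro mult_strict_right_mono)
   with HK show False by (simp add: mult.assoc)
  qed
  then have h0: "h x = 0" if "x \<in> V" for x using hH[OF that] by simp
  have "norm (g u0 - g v0) = norm (y u0 - y v0)" using yy by simp
  also have "y u0 - y v0 = f u0 - f v0" using h0[OF uv0(1)] h0[OF uv0(2)] by (simp add: h_def F_def)
  finally show "norm (g u0 - g v0) = norm (f u0 - f v0)" .
 qed
qed

lemma generically_rigidI:
 fixes V :: "'v set"
 assumes "finite V" "generically V (inf_rigid E V :: ('v => real^'n) => bool)"
 shows "generically_rigid TYPE('n) (V, E)"
 using assms inf_rigid_imp_rigid_map unfolding generically_def generically_rigid_def fst_conv by metis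

section \<open>Alternating chains\<close>

definition rp :: "'v => 'v => 'v list => 'v list" where
 "rp v x tp = map (\<lambda>y. if y = v then x else y) tp"

definition swp :: "'v => 'v => 'v => 'v" where
 "swp a b y = (if y = a then b else if y = b then a else y)"

text \<open>A chain is a function on ordered tuples; with this encoding the boundary of an alternating chain
 is \<open>tp \<mapsto> \<Sum>x. z (x # tp)\<close>, without any signs.\<close>
definition alternating :: "nat => 'v set => ('v list => 'k::field) => bool" where
 "alternating d V z \<longleftrightarrow> (\<forall>tp. z tp ~= 0 --> length tp = d \<and> set tp \<subseteq> V \<and> distinct tp) \<and>
  (\<forall>tp a b. a \<in> set tp --> b \<in> set tp --> a ~= b --> z (map (swp a b) tp) = - z tp)"

definition cycle_on :: "'v set => ('v list => 'k::field) => bool" where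
 "cycle_on V z \<longleftrightarrow> (\<forall>tp. (\<Sum>x\<in>V. z (x # tp)) = 0)"

definition supp :: "('a => 'k::zero) => 'a set" where
 "supp z = {tp. z tp ~= 0}"

definition chain_verts :: "('v list => 'k::zero) => 'v set" where
 "chain_verts z = (\<Union>tp\<in>supp z. set tp)"

definition chain_edges :: "('v list => 'k::zero) => 'v set set" where
 "chain_edges z = {{x, y} |x y. x ~= y \<and> (\<exists>tp\<in>supp z. x \<in> set tp \<and> y \<in> set tp)}"

text \<open>The elements of minimal nonempty support, that is, the circuits of the space
  \<open>N\<close> up to scaling.\<close>

definition minimal_in :: "('a => 'k::zero) set => ('a => 'k) => bool" where
 "minimal_in N w \<longleftrightarrow> w \<in> N \<and> supp w ~= {} \<and> (\<forall>y\<in>N. supp y \<subseteq> supp w --> supp y ~= {} --> supp y = supp w)"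

definition cycles :: "nat => 'v set => ('v list => 'k::field) set" where
 "cycles d V = {z. alternating d V z \<and> cycle_on V z}"

definition subspace_fun :: "('a => 'k::field) set => bool" where
 "subspace_fun N \<longleftrightarrow> (\<lambda>_. 0) \<in> N \<and> (\<forall>f\<in>N. \<forall>g\<in>N. \<forall>c. (\<lambda>tp. f tp + c * g tp) \<in> N)"

lemma rp_simps [simp]: "rp v x [] = []" "rp v x (y # tp) = (if y = v then x else y) # rp v x tp"
 by (auto simp: rp_def)

lemma length_rp [simp]: "length (rp v x tp) = length tp" by (simp add: rp_def)

lemma rp_notin: "v \<notin> set tp ==> rp v x tp = tp" by (induction tp) auto

lemma rp_same [simp]: "rp v v tp = tp" by (induction tp) auto

lemma rp_rp: "x \<notin> set tp ==> rp x y (rp v x tp) = rp v y tp" by (induction tp) auto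

lemma set_rp: "set (rp v x tp) = (if v \<in> set tp then insert x (set tp - {v}) else set tp)"
 by (induction tp) auto

lemma distinct_rp: "distinct (rp v x tp) \<longleftrightarrow> distinct tp \<and> (v \<in> set tp --> x ~= v --> x \<notin> set tp)"
 by (induction tp) (auto simp: set_rp)

lemma swp_commute: "swp a b = swp b a" by (auto simp: swp_def)

lemma map_swp_notin: "a \<notin> set tp ==> b \<notin> set tp ==> map (swp a b) tp = tp"
 by (induction tp) (auto simp: swp_def)

lemma rp_map_swp_other: "a ~= v ==> b ~= v ==> x ~= a ==> x ~= b ==> rp v x (map (swp a b) tp) = map (swp a b) (rp v x tp)"
 by (induction tp) (auto simp: swp_def)

lemma rp_map_swp_same: "x \<notin> set tp ==> b ~= v ==> x ~= b ==> rp v x (map (swp v b) tp) = map (swp x b) (rp v x tp)"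
 by (induction tp) (auto simp: swp_def)

lemma map_swp_rp_notin: "p \<notin> set \<rho> ==> x \<notin> set \<rho> ==> map (swp p x) (rp v x \<rho>) = rp v p \<rho>"
 by (induction \<rho>) (auto simp: swp_def)

lemma set_map_swp: "a \<in> set tp ==> b \<in> set tp ==> set (map (swp a b) tp) = set tp"
proof -
 assume ab: "a \<in> set tp" "b \<in> set tp"
 have "swp a b (swp a b y) = y" "y \<in> set tp ==> swp a b y \<in> set tp" for y using ab by (auto simp: swp_def)
 then show ?thesis by (auto simp: image_iff) metis
qed

lemma distinct_map_swp: "distinct (map (swp a b) tp) \<longleftrightarrow> distinct tp"
proof -
 have "inj_on (swp a b) (set tp)" by (rule inj_onI) (auto simp: swp_def split: if_splits)
 then show ?thesis by (simp add: distinct_map)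
qed

lemma alternatingD:
 assumes "alternating d V z"
 shows "z tp ~= 0 ==> length tp = d" "z tp ~= 0 ==> set tp \<subseteq> V" "z tp ~= 0 ==> distinct tp" "\<not> distinct tp ==> z tp = 0"
  "a \<in> set tp ==> b \<in> set tp ==> a ~= b ==> z (map (swp a b) tp) = - z tp"
 using assms unfolding alternating_def by blast+

lemma finite_supp: "finite V ==> alternating d V z ==> finite (supp z)"
 by (rule finite_subset[OF _ finite_lists_length_eq[of V d]]) (auto simp: supp_def alternating_def)

text \<open>Transpositions turn \<open>tp\<close> into \<open>tp'\<close> position by position, and
  each of them only changes the sign of \<open>z\<close>.\<close>

lemma alternating_perm:
 assumes "distinct tp" "distinct tp'" "set tp = set tp'" "z tp ~= 0" "alternating d V z"
 shows "z tp' ~= 0"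
proof -
 have len: "length tp = length tp'" using distinct_card[OF assms(1)] distinct_card[OF assms(2)] assms(3) by simp
 have "\<exists>sg. distinct sg \<and> set sg = set tp' \<and> length sg = length tp' \<and> take n sg = take n tp' \<and> z sg ~= 0" if "n \<le> length tp'" for n
  using that
 proof (induction n)
  case 0
  then show ?case using assms len by (intro exI[of _ tp]) auto
 next
  case (Suc n)
  then obtain sg where s: "distinct sg" "set sg = set tp'" "length sg = length tp'" "take n sg = take n tp'" "z sg ~= 0" by auto
  define a where "a = sg ! n"
  define b where "b = tp' ! n"
  have n: "n < length tp'" "n < length sg" using Suc.prems s by auto
  have "a \<in> set sg" unfolding a_def using n(2) by (rule nth_mem)
  moreover have "b \<in> set tp'" unfolding b_def using n(1) by (rule nth_mem)
  ultimately have ab: "a \<in> set sg" "b \<in> set sg" unfolding s(2) by blast+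
  have na: "a \<notin> set (take n sg)"
   using distinct_take[OF s(1), of "Suc n"] n(2) by (simp add: take_Suc_conv_app_nth a_def)
  have nb: "b \<notin> set (take n tp')"
   using distinct_take[OF assms(2), of "Suc n"] n(1) by (simp add: take_Suc_conv_app_nth b_def)
  show ?case
  proof (cases "a = b")
   case True
   then show ?thesis using s n by (intro exI[of _ sg]) (simp add: take_Suc_conv_app_nth a_def b_def)
  next
   case False
   let ?sg = "map (swp a b) sg"
   have "take n ?sg = take n tp'" using na nb s(4) by (simp add: take_map map_swp_notin)
   moreover have "?sg ! n = b" using n by (simp add: a_def[symmetric] swp_def)
   ultimately have "take (Suc n) ?sg = take (Suc n) tp'" using n by (simp add: take_Suc_conv_app_nth b_def)
   moreover have "z ?sg ~= 0" using alternatingD(5)[OF assms(5) ab False] s(5) by simp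
   ultimately show ?thesis using s ab
    by (intro exI[of _ ?sg]) (simp add: set_map_swp[simplified] distinct_map_swp[simplified])
  qed
 qed
 from this[of "length tp'"] show ?thesis by auto
qed

lemma alternating_supp_cong:
 assumes "alternating d V z" "tp \<in> supp z" "set tp' = set tp" "length tp' = length tp"
 shows "tp' \<in> supp z"
proof -
 have d: "distinct tp" using assms by (auto simp: supp_def alternating_def)
 moreover have "distinct tp'" using distinct_card[OF d] assms(3,4) by (intro card_distinct) simp
 ultimately show ?thesis using alternating_perm[of tp tp' z d V] assms by (auto simp: supp_def)
qed

text \<open>The tuples differ by swapping \<open>p\<close> and \<open>x\<close>, unless these
  coincide or one of them occurs in the rest; then both sides vanish through a repeated
  entry.\<close>

lemma alternating_exchange:
 assumes z: "alternating d V z" and v: "v \<in> set \<rho>" "v ~= p" "v ~= x"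
 shows "z (p # rp v x \<rho>) = - z (x # rp v p \<rho>)"
proof -
 consider "x = p" | "x \<in> set \<rho>" | "p \<in> set \<rho>" | "x ~= p" "x \<notin> set \<rho>" "p \<notin> set \<rho>" by blast
 then show ?thesis
 proof cases
  case 4
  have "x # rp v p \<rho> = map (swp p x) (p # rp v x \<rho>)"
   using 4 by (simp add: map_swp_rp_notin) (simp add: swp_def)
  then show ?thesis using alternatingD(5)[OF z, of p "p # rp v x \<rho>" x] 4 v by (simp add: set_rp)
 qed (use v in \<open>simp_all add: alternatingD(4)[OF z] set_rp distinct_rp\<close>)
qed

text \<open>The cycle condition at any entry \<open>v\<close> instead of the head: bringing
  \<open>v\<close> to the front changes all summands by the same sign. In consequence a facet of the
  support has another one across each of its ridges.\<close>

lemma cycle_replace: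
 assumes z: "alternating d V z" and c: "cycle_on V z" and tp: "distinct tp" "v \<in> set tp" and V: "finite V" "set tp \<subseteq> V"
 shows "(\<Sum>x\<in>V. z (rp v x tp)) = 0"
proof (cases tp)
 case Nil
 then show ?thesis using tp by simp
next
 case (Cons p \<rho>)
 show ?thesis
 proof (cases "p = v")
  case True
  then have "v \<notin> set \<rho>" using Cons tp by auto
  then show ?thesis using c Cons True by (simp add: cycle_on_def rp_notin)
 next
  case False
  then have v: "v \<in> set \<rho>" "p \<notin> set \<rho>" using Cons tp by auto
  have "z (rp v x tp) = - z (x # rp v p \<rho>)" if "x ~= v" for x
   using alternating_exchange[OF z v(1), of p x] False that Cons by simp
  moreover have "z (rp v v tp) = - z (v # rp v p \<rho>)"
  proof -
   have "v # rp v p \<rho> = map (swp p v) (p # \<rho>)" using False v tp Cons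
    by (induction \<rho>) (auto simp: swp_def rp_def)
   then show ?thesis using alternatingD(5)[OF z, of p "p # \<rho>" v] False v Cons by simp
  qed
  ultimately have "z (rp v x tp) = - z (x # rp v p \<rho>)" for x by metis
  then show ?thesis using c by (simp add: cycle_on_def sum_negf)
 qed
qed

text \<open>The zero diagonal is a separate hypothesis because antisymmetry does not imply it in
  characteristic 2.\<close>

lemma sum_antisymmetric:
 fixes g :: "'a => 'a => 'k::field"
 assumes "finite A" "!!x y. x \<in> A ==> y \<in> A ==> x ~= y ==> g x y = - g y x" "!!x. x \<in> A ==> g x x = 0"
 shows "(\<Sum>x\<in>A. \<Sum>y\<in>A. g x y) = 0"
 using assms
proof (induction A rule: finite_induct)
 case (insert a A)
 have "(\<Sum>x\<in>A. g x a) = (\<Sum>x\<in>A. - g a x)"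
 proof (rule sum.cong[OF refl])
  fix x assume "x \<in> A"
  with insert.hyps(2) have "x ~= a" by blast
  with \<open>x \<in> A\<close> show "g x a = - g a x" by (intro insert.prems(1)) auto
 qed
 moreover have "(\<Sum>x\<in>A. \<Sum>y\<in>A. g x y) = 0"
  by (rule insert.IH; (rule insert.prems(1))?) (auto intro: insert.prems(2))
 moreover have "g a a = 0" by (rule insert.prems(2)) simp
 ultimately show ?case using insert.hyps by (simp add: sum.distrib sum_negf)
qed simp

section \<open>Spaces of functions and decomposition into elements of minimal support\<close>

lemma subspace_cycles: "subspace_fun (cycles d V)"
proof -
 have "cycle_on V (\<lambda>tp. f tp + c * g tp)" if "cycle_on V f" "cycle_on V g" for f g :: "'a list => 'b::field" and c
  unfolding cycle_on_def
 proof
  fix tp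
  have "(\<Sum>x\<in>V. f (x # tp) + c * g (x # tp)) = (\<Sum>x\<in>V. f (x # tp)) + c * (\<Sum>x\<in>V. g (x # tp))"
   by (simp only: sum.distrib sum_distrib_left)
  then show "(\<Sum>x\<in>V. f (x # tp) + c * g (x # tp)) = 0" using that by (simp add: cycle_on_def)
 qed
 moreover have "alternating d V (\<lambda>tp. f tp + c * g tp)" if "alternating d V f" "alternating d V g" for f g :: "'a list => 'b" and c
  unfolding alternating_def
 proof (intro conjI allI impI)
  fix tp and a b :: 'a assume "a \<in> set tp" "b \<in> set tp" "a ~= b"
  then show "f (map (swp a b) tp) + c * g (map (swp a b) tp) = - (f tp + c * g tp)"
   using alternatingD(5)[OF that(1)] alternatingD(5)[OF that(2)] by (simp add: algebra_simps)
 next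
  fix tp :: "'a list" assume "f tp + c * g tp ~= 0"
  then consider "f tp ~= 0" | "g tp ~= 0" by fastforce
  then have "length tp = d \<and> set tp \<subseteq> V \<and> distinct tp"
   by cases (use alternatingD(1-3)[OF that(1), of tp] alternatingD(1-3)[OF that(2), of tp] in simp_all)
  then show "length tp = d" "set tp \<subseteq> V" "distinct tp" by simp_all
 qed
 moreover have "alternating d V (\<lambda>_. 0 :: 'b)" "cycle_on V (\<lambda>_. 0 :: 'b)"
  by (simp_all add: alternating_def cycle_on_def)
 ultimately show ?thesis unfolding subspace_fun_def cycles_def by blast
qed

lemma subspace_funD:
 assumes "subspace_fun N"
 shows "(\<lambda>_. 0) \<in> N" "f \<in> N ==> g \<in> N ==> (\<lambda>tp. f tp + c * g tp) \<in> N"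
 using assms unfolding subspace_fun_def by blast+

lemma subspace_fun_scale: "subspace_fun N ==> f \<in> N ==> (\<lambda>tp. c * f tp) \<in> N"
 using subspace_funD(2)[OF _ subspace_funD(1), of N f c] by simp

lemma subspace_fun_sum:
 assumes "subspace_fun N" "finite I" "!!i. i \<in> I ==> f i \<in> N"
 shows "(\<lambda>tp. \<Sum>i\<in>I. f i tp) \<in> N"
 using assms(2,3)
proof (induction I rule: finite_induct)
 case empty
 then show ?case using assms(1) by (simp add: subspace_fun_def)
next
 case (insert i I)
 have "(\<lambda>tp. (\<lambda>tp. \<Sum>i\<in>I. f i tp) tp + 1 * f i tp) \<in> N"
  by (intro subspace_funD(2)[OF assms(1)] insert.IH insert.prems) auto
 then show ?case using insert by (simp add: add.commute)
qed

lemma exists_minimal_in: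
 assumes "!!f. f \<in> N ==> finite (supp f)" "f \<in> N" "supp f ~= {}"
 shows "\<exists>w. minimal_in N w \<and> supp w \<subseteq> supp f"
 using assms(2,3)
proof (induction "card (supp f)" arbitrary: f rule: less_induct)
 case less
 show ?case
 proof (cases "minimal_in N f")
  case False
  then obtain y where y: "y \<in> N" "supp y \<subset> supp f" "supp y ~= {}"
   using less.prems unfolding minimal_in_def by blast
  then have "card (supp y) < card (supp f)" using assms(1) less.prems by (intro psubset_card_mono) auto
  from less.hyps[OF this y(1,3)] y(2) show ?thesis by blast
 qed auto
qed

lemma minimal_in_scale:
 assumes "subspace_fun N" "minimal_in N w" "c ~= 0"
 shows "minimal_in N (\<lambda>tp. c * w tp)"
 using assms subspace_fun_scale[OF assms(1)] unfolding minimal_in_def by (auto simp: supp_def)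

text \<open>A suitable multiple of a minimal element inside \<open>supp f\<close> cancels one entry
  of \<open>f\<close> and creates no new one; induction on the size of the support.\<close>

lemma exists_minimal_decomposition:
 fixes f :: "'a => 'k::field"
 assumes sub: "subspace_fun N" and fin: "!!f. f \<in> N ==> finite (supp f)" and f: "f \<in> N"
 shows "\<exists>S. finite S \<and> (\<forall>w\<in>S. minimal_in N w \<and> supp w \<subseteq> supp f) \<and> (\<forall>tp. f tp = (\<Sum>w\<in>S. w tp))"
 using f
proof (induction "card (supp f)" arbitrary: f rule: less_induct)
 case less
 show ?case
 proof (cases "supp f = {}")
  case True
  then show ?thesis by (intro exI[of _ "{}"]) (auto simp: supp_def)
 next
  case False
  obtain w where w: "minimal_in N w" "supp w \<subseteq> supp f" using exists_minimal_in[OF fin less.prems False] by blast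
  then obtain tp0 where t: "w tp0 ~= 0" by (auto simp: minimal_in_def supp_def)
  define c where "c = f tp0 / w tp0"
  have ft: "f tp0 ~= 0" using w(2) t by (auto simp: supp_def)
  then have c0: "c ~= 0" using t by (simp add: c_def)
  define f' where "f' = (\<lambda>tp. f tp + (- c) * w tp)"
  have f': "f' \<in> N" unfolding f'_def
   using w(1) by (intro subspace_funD(2)[OF sub] less.prems) (auto simp: minimal_in_def)
  have "f' tp0 = 0" using t by (simp add: f'_def c_def)
  then have ss: "supp f' \<subseteq> supp f - {tp0}" using w(2) by (auto simp: supp_def f'_def)
  then have "card (supp f') < card (supp f)"
   using ft fin[OF less.prems] by (intro psubset_card_mono) (auto simp: supp_def)
  from less.hyps[OF this f'] obtain S where S: "finite S" "!!w. w \<in> S ==> minimal_in N w \<and> supp w \<subseteq> supp f'"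
   "!!tp. f' tp = (\<Sum>w\<in>S. w tp)" by blast
  define w' where "w' = (\<lambda>tp. c * w tp)"
  have "tp0 \<in> supp w'" using c0 t by (simp add: w'_def supp_def)
  then have "w' \<notin> S" using S(2) ss by blast
  then have "f tp = (\<Sum>w\<in>insert w' S. w tp)" for tp using S(1) S(3)[of tp] by (simp add: w'_def f'_def diff_eq_eq add.commute)
  moreover have "minimal_in N w'" unfolding w'_def by (rule minimal_in_scale[OF sub w(1) c0])
  moreover have "supp w' \<subseteq> supp f" using w(2) by (auto simp: w'_def supp_def)
  moreover have "supp v \<subseteq> supp f" if "v \<in> S" for v using S(2)[OF that] ss by blast
  ultimately show ?thesis using S(1,2) by (intro exI[of _ "insert w' S"] conjI ballI allI) auto
 qed
qed

text \<open>In a decomposition with fewest members no nonempty subfamily can sum to zero, as it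
  could be dropped. The gluing step of \<open>minimal_cycle_rigid\<close> depends on this.\<close>

lemma exists_irredundant_decomposition:
 fixes f :: "'a => 'k::field"
 assumes sub: "subspace_fun N" and fin: "!!f. f \<in> N ==> finite (supp f)" and f: "f \<in> N"
 shows "\<exists>S. finite S \<and> (\<forall>w\<in>S. minimal_in N w \<and> supp w \<subseteq> supp f) \<and> (\<forall>tp. f tp = (\<Sum>w\<in>S. w tp)) \<and>
  (\<forall>I\<subseteq>S. I ~= {} --> (\<exists>tp. (\<Sum>w\<in>I. w tp) ~= 0))"
proof -
 define Q where "Q = (\<lambda>S. finite S \<and> (\<forall>w\<in>S. minimal_in N w \<and> supp w \<subseteq> supp f) \<and> (\<forall>tp. f tp = (\<Sum>w\<in>S. w tp)))"
 obtain S where S: "Q S" "!!S'. Q S' ==> card S \<le> card S'"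
 proof -
  have "\<exists>S. Q S" using exists_minimal_decomposition[OF assms] by (simp only: Q_def)
  then obtain S0 where "Q S0" ..
  from ex_has_least_nat[of Q S0 card, OF this]
  obtain S where "Q S \<and> (\<forall>S'. Q S' --> card S \<le> card S')" ..
  then show thesis by (intro that[of S]) simp_all
 qed
 have "\<exists>tp. (\<Sum>w\<in>I. w tp) ~= 0" if I: "I \<subseteq> S" "I ~= {}" for I
 proof (rule ccontr)
  assume "\<not> ?thesis"
  then have "(\<Sum>w\<in>S. w tp) = (\<Sum>w\<in>S - I. w tp)" for tp
   using S(1) I by (subst sum.subset_diff[of I S]) (auto simp: Q_def)
  then have "Q (S - I)" using S(1) by (auto simp: Q_def)
  moreover have "card (S - I) < card S" using S(1) I by (intro psubset_card_mono) (auto simp: Q_def)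
  ultimately show False using S(2) by (meson not_less)
 qed
 then show ?thesis using S(1) unfolding Q_def by blast
qed

text \<open>Cancelling one entry of \<open>y\<close> by a multiple of \<open>z\<close> leaves a
  cycle whose support is strictly inside that of \<open>z\<close>, hence zero.\<close>

lemma minimal_cycle_proportional:
 assumes z: "minimal_in (cycles d V) z" and y: "y \<in> cycles d V" "supp y \<subseteq> supp z"
 shows "\<exists>c. \<forall>tp. y tp = c * z tp"
proof -
 obtain tp0 where t: "z tp0 ~= 0" using z by (auto simp: minimal_in_def supp_def)
 define c where "c = y tp0 / z tp0"
 define f where "f = (\<lambda>tp. y tp + (- c) * z tp)"
 have "f \<in> cycles d V" unfolding f_def
  using z by (intro subspace_funD(2)[OF subspace_cycles] y(1)) (auto simp: minimal_in_def)
 moreover have "f tp0 = 0" using t by (simp add: f_def c_def)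
 then have "supp f \<subseteq> supp z - {tp0}" using y(2) by (auto simp: supp_def f_def)
 ultimately have "supp f = {}" using z t unfolding minimal_in_def by (auto simp: supp_def)
 then show ?thesis by (intro exI[of _ c]) (auto simp: f_def supp_def)
qed

section \<open>Fogelsanger's theorem\<close>

text \<open>The push-forward under the map sending \<open>v\<close> to \<open>u\<close>: if
  \<open>u\<close> occurs in \<open>tp\<close> and \<open>v\<close> does not, both \<open>tp\<close>
  and \<open>rp u v tp\<close> are sent to \<open>tp\<close>.\<close>

definition chain_contract :: "'v => 'v => ('v list => 'k::field) => 'v list => 'k" where
 "chain_contract u v w tp = (if v \<in> set tp then 0 else if u \<in> set tp then w tp + w (rp u v tp) else w tp)"

text \<open>On a tuple through \<open>u\<close> and \<open>v\<close> the value is forced by the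
  cycle condition at the entry \<open>v\<close>, see \<open>cycle_replace\<close>; the other tuples
  in that condition no longer contain \<open>v\<close>.\<close>

definition chain_ext :: "'v => 'v => 'v set => ('v list => 'k::field) => 'v list => 'k" where
 "chain_ext u v V w tp = (if u \<in> set tp \<and> v \<in> set tp then - (\<Sum>x\<in>V - {v}. w (rp v x tp)) else w tp)"

text \<open>Chains without facets through the edge \<open>uv\<close> that become cycles when \<open>v\<close> is identified with
 \<open>u\<close>; \<^const>\<open>chain_ext\<close> completes them to cycles in a unique way.\<close>
definition precycles :: "nat => 'v set => 'v => 'v => 'v list set => ('v list => 'k::field) set" where
 "precycles d V u v B = {w. alternating d V w \<and> supp w \<subseteq> B \<and> (\<forall>tp\<in>supp w. \<not> (u \<in> set tp \<and> v \<in> set tp)) \<and>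
  cycle_on V (chain_contract u v w)}"

lemma sum_remove: "finite V ==> a \<in> V ==> (\<Sum>x\<in>V. g x) = g a + (\<Sum>x\<in>V - {a}. g x)"
 for g :: "'a => 'k::field"
 by (rule sum.remove)

lemma alternating_extend:
 assumes w: "alternating d V w" and uv: "u ~= v" "v \<in> V"
 shows "alternating d V (chain_ext u v V w)"
 unfolding alternating_def
proof (rule conjI; intro allI impI)
 fix tp assume "chain_ext u v V w tp ~= 0"
 then consider "w tp ~= 0" | "u \<in> set tp" "v \<in> set tp" "(\<Sum>x\<in>V - {v}. w (rp v x tp)) ~= 0"
  unfolding chain_ext_def by (metis neg_equal_0_iff_equal)
 then show "length tp = d \<and> set tp \<subseteq> V \<and> distinct tp"
 proof cases
  case 1
  then show ?thesis using alternatingD(1-3)[OF w] by simp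
 next
  case 2
  then obtain x where "x \<in> V - {v}" and x: "w (rp v x tp) ~= 0" by (meson sum.neutral)
  from alternatingD(1)[OF w x] alternatingD(2)[OF w x] alternatingD(3)[OF w x] show ?thesis
   using uv(2) 2 by (auto simp: set_rp distinct_rp)
 qed
next
 fix tp and a b :: 'a assume ab: "a \<in> set tp" "b \<in> set tp" "a ~= b"
 have st: "set (map (swp a b) tp) = set tp" by (rule set_map_swp[OF ab(1,2)])
 have rpz: "w (rp v x sg) = 0" if "v \<in> set sg" "x \<in> set sg" "x ~= v" for x sg
  by (rule alternatingD(4)[OF w]) (use that in \<open>simp add: distinct_rp\<close>)
 show "chain_ext u v V w (map (swp a b) tp) = - chain_ext u v V w tp"
 proof (cases "u \<in> set tp \<and> v \<in> set tp")
  case False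
  then show ?thesis unfolding chain_ext_def st if_not_P[OF False] by (intro alternatingD(5)[OF w ab])
 next
  case True
  have "w (rp v x (map (swp a b) tp)) = - w (rp v x tp)" if x: "x \<in> V - {v}" for x
  proof (cases "x \<in> set tp")
   case xt: True
   have "v \<in> set (map (swp a b) tp)" "x \<in> set (map (swp a b) tp)" unfolding st using True xt by blast+
   then have "w (rp v x (map (swp a b) tp)) = 0" using x by (intro rpz) simp_all
   moreover have "w (rp v x tp) = 0" using True xt x by (intro rpz) simp_all
   ultimately show ?thesis by simp
  next
   case xt: False
   then have xab: "x ~= a" "x ~= b" using ab by auto
   consider "a ~= v" "b ~= v" | "a = v" | "b = v" by blast
   then show ?thesis
   proof cases
    case 1
    have "w (map (swp a b) (rp v x tp)) = - w (rp v x tp)"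
     by (rule alternatingD(5)[OF w]) (use ab 1 in \<open>auto simp: set_rp\<close>)
    then show ?thesis by (simp only: rp_map_swp_other[OF 1 xab])
   next
    case 2
    have bv: "b ~= v" using 2 ab by simp
    have "w (map (swp x b) (rp v x tp)) = - w (rp v x tp)"
     by (rule alternatingD(5)[OF w]) (use ab True bv xab in \<open>auto simp: set_rp\<close>)
    then show ?thesis unfolding 2 by (simp only: rp_map_swp_same[OF xt bv xab(2)])
   next
    case 3
    have av: "a ~= v" using 3 ab by simp
    have "w (map (swp x a) (rp v x tp)) = - w (rp v x tp)"
     by (rule alternatingD(5)[OF w]) (use ab True av xab in \<open>auto simp: set_rp\<close>)
    then show ?thesis unfolding 3 swp_commute[of a v] by (simp only: rp_map_swp_same[OF xt av xab(1)])
   qed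
  qed
  then have "(\<Sum>x\<in>V - {v}. w (rp v x (map (swp a b) tp))) = - (\<Sum>x\<in>V - {v}. w (rp v x tp))"
   by (simp only: sum_negf[symmetric] cong: sum.cong)
  then show ?thesis unfolding chain_ext_def st using True by simp
 qed
qed

text \<open>Four cases according to which of \<open>u\<close>, \<open>v\<close> occur in the ridge.
  With neither, the sum is that of the contraction; with \<open>u\<close> alone it vanishes by the
  definition of the extension; with \<open>v\<close> alone the contraction is evaluated at
  \<open>rp v u tp\<close>; with both, an antisymmetric double sum appears.\<close>

lemma cycle_extend:
 assumes fin: "finite V" and w: "alternating d V w" and uv: "u ~= v" "u \<in> V" "v \<in> V"
  and c: "cycle_on V (chain_contract u v w)"
 shows "cycle_on V (chain_ext u v V w)"
 unfolding cycle_on_def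
proof
 fix tp
 let ?e = "chain_ext u v V w"
 have rep: "w (x # tp') = 0" if "x \<in> set tp'" for x tp' by (rule alternatingD(4)[OF w]) (use that in simp)
 have push: "(\<Sum>x\<in>V. chain_contract u v w (x # tp')) = 0" for tp' using c by (simp add: cycle_on_def)
 have sv: "(\<Sum>x\<in>V. g x) = g v + (\<Sum>x\<in>V - {v}. g x)" for g :: "'a => 'b"
  by (rule sum_remove[OF fin uv(3)])
 have suv: "(\<Sum>x\<in>V - {v}. g x) = g u + (\<Sum>x\<in>V - {v} - {u}. g x)" for g :: "'a => 'b"
  by (rule sum_remove) (use fin uv in auto)
 consider (n) "u \<notin> set tp" "v \<notin> set tp" | (u) "u \<in> set tp" "v \<notin> set tp"
  | (v) "u \<notin> set tp" "v \<in> set tp" | (b) "u \<in> set tp" "v \<in> set tp" by blast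
 then show "(\<Sum>x\<in>V. ?e (x # tp)) = 0"
 proof cases
  case n
  have "?e (x # tp) = w (x # tp)" for x using n uv by (auto simp: chain_ext_def)
  then have "(\<Sum>x\<in>V. ?e (x # tp)) = w (v # tp) + (w (u # tp) + (\<Sum>x\<in>V - {v} - {u}. w (x # tp)))"
   by (simp only: sv suv)
  also have "(\<Sum>x\<in>V - {v} - {u}. w (x # tp)) = (\<Sum>x\<in>V - {v} - {u}. chain_contract u v w (x # tp))"
   by (rule sum.cong) (use n in \<open>auto simp: chain_contract_def\<close>)
  also have "w (v # tp) + (w (u # tp) + \<dots>) = (\<Sum>x\<in>V. chain_contract u v w (x # tp))"
   unfolding sv suv using n uv by (simp add: chain_contract_def rp_notin)
  finally show ?thesis by (simp only: push)
 next
  case u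
  have "?e (x # tp) = w (x # tp)" if "x \<in> V - {v}" for x using u that by (auto simp: chain_ext_def)
  moreover have "?e (v # tp) = - (\<Sum>x\<in>V - {v}. w (x # tp))" using u by (simp add: chain_ext_def rp_notin)
  ultimately show ?thesis unfolding sv by simp
 next
  case v
  have ex: "w (u # rp v x tp) = - w (x # rp v u tp)" if "x \<in> V - {v}" for x
   by (intro alternating_exchange[OF w v(2)]) (use uv that in auto)
  have eu: "?e (u # tp) = (\<Sum>x\<in>V - {v}. w (x # rp v u tp))"
  proof -
   have "?e (u # tp) = - (\<Sum>x\<in>V - {v}. w (u # rp v x tp))" using v uv by (simp add: chain_ext_def)
   also have "(\<Sum>x\<in>V - {v}. w (u # rp v x tp)) = (\<Sum>x\<in>V - {v}. - w (x # rp v u tp))"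
    by (rule sum.cong[OF refl]) (rule ex)
   finally show ?thesis by (simp only: sum_negf minus_minus)
  qed
  have s: "u \<in> set (rp v u tp)" "v \<notin> set (rp v u tp)" using v uv by (auto simp: set_rp)
  have rr: "rp u v (rp v u tp) = tp" using rp_rp[OF v(1), of v v] by simp
  have "(\<Sum>x\<in>V. chain_contract u v w (x # rp v u tp)) = (\<Sum>x\<in>V - {v}. chain_contract u v w (x # rp v u tp))"
   unfolding sv by (simp add: chain_contract_def)
  also have "\<dots> = (\<Sum>x\<in>V - {v}. w (x # rp v u tp) + (if x = u then 0 else w (x # tp)))"
  proof (rule sum.cong[OF refl])
   fix x assume x: "x \<in> V - {v}"
   show "chain_contract u v w (x # rp v u tp) = w (x # rp v u tp) + (if x = u then 0 else w (x # tp))"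
    using s x rep[of v tp] v uv by (auto simp: chain_contract_def rr)
  qed
  also have "\<dots> = (\<Sum>x\<in>V - {v}. w (x # rp v u tp)) + (\<Sum>x\<in>V - {v}. if x = u then 0 else w (x # tp))"
   by (rule sum.distrib)
  also have "(\<Sum>x\<in>V - {v}. if x = u then 0 else w (x # tp)) = (\<Sum>x\<in>V - {v} - {u}. w (x # tp))"
  proof -
   have "(\<Sum>x\<in>V - {v} - {u}. if x = u then 0 else w (x # tp)) = (\<Sum>x\<in>V - {v} - {u}. w (x # tp))"
    by (rule sum.cong) auto
   then show ?thesis by (simp only: suv if_True refl add_0_left)
  qed
  finally have e1: "?e (u # tp) + (\<Sum>x\<in>V - {v} - {u}. w (x # tp)) = 0" unfolding eu by (simp only: push)
  have "(\<Sum>x\<in>V - {v} - {u}. ?e (x # tp)) = (\<Sum>x\<in>V - {v} - {u}. w (x # tp))"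
   by (rule sum.cong) (use v in \<open>auto simp: chain_ext_def\<close>)
  moreover have "?e (v # tp) = 0" using v uv rep[of v tp] by (simp add: chain_ext_def)
  ultimately show ?thesis by (simp only: sv suv e1 add_0_left)
 next
  case b
  have "?e (v # tp) = 0"
  proof -
   have "w (x # rp v x tp) = 0" for x by (rule rep) (use b in \<open>simp add: set_rp\<close>)
   then show ?thesis using b by (simp add: chain_ext_def)
  qed
  moreover have "(\<Sum>x\<in>V - {v}. ?e (x # tp)) = - (\<Sum>x\<in>V - {v}. \<Sum>y\<in>V - {v}. w (x # rp v y tp))"
   unfolding sum_negf[symmetric] by (rule sum.cong) (use b in \<open>auto simp: chain_ext_def sum_negf\<close>)
  moreover have "(\<Sum>x\<in>V - {v}. \<Sum>y\<in>V - {v}. w (x # rp v y tp)) = 0"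
  proof (rule sum_antisymmetric)
   show "w (x # rp v y tp) = - w (y # rp v x tp)" if "x \<in> V - {v}" "y \<in> V - {v}" for x y
    by (intro alternating_exchange[OF w b(2)]) (use that in auto)
   show "w (x # rp v x tp) = 0" for x by (rule rep) (use b in \<open>simp add: set_rp\<close>)
  qed (use fin in simp)
  ultimately show ?thesis unfolding sv by simp
 qed
qed

lemma alternating_rp_swap:
 assumes w: "alternating d V w" and ab: "a \<in> set tp" "b \<in> set tp" "a ~= b" and v: "v \<notin> set tp" "u \<in> set tp"
 shows "w (rp u v (map (swp a b) tp)) = - w (rp u v tp)"
proof -
 have vab: "v ~= a" "v ~= b" using ab v by auto
 consider "a ~= u" "b ~= u" | "a = u" | "b = u" by blast
 then show ?thesis
 proof cases
  case 1
  have "w (map (swp a b) (rp u v tp)) = - w (rp u v tp)"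
   by (rule alternatingD(5)[OF w]) (use ab 1 in \<open>auto simp: set_rp\<close>)
  then show ?thesis by (simp only: rp_map_swp_other[OF 1 vab])
 next
  case 2
  have bu: "b ~= u" using 2 ab by simp
  have "w (map (swp v b) (rp u v tp)) = - w (rp u v tp)"
   by (rule alternatingD(5)[OF w]) (use ab v bu vab in \<open>auto simp: set_rp\<close>)
  then show ?thesis unfolding 2 by (simp only: rp_map_swp_same[OF v(1) bu vab(2)])
 next
  case 3
  have au: "a ~= u" using 3 ab by simp
  have "w (map (swp v a) (rp u v tp)) = - w (rp u v tp)"
   by (rule alternatingD(5)[OF w]) (use ab v au vab in \<open>auto simp: set_rp\<close>)
  then show ?thesis unfolding 3 swp_commute[of a u] by (simp only: rp_map_swp_same[OF v(1) au vab(1)])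
 qed
qed

lemma contract_alternating:
 assumes w: "alternating d V w" and uv: "u ~= v" "u \<in> V" and no: "\<forall>tp\<in>supp w. \<not> (u \<in> set tp \<and> v \<in> set tp)"
 shows "alternating d V (chain_contract u v w)"
 unfolding alternating_def
proof (rule conjI; intro allI impI)
 fix tp assume "chain_contract u v w tp ~= 0"
 then consider "w tp ~= 0" | "v \<notin> set tp" "u \<in> set tp" "w (rp u v tp) ~= 0"
  by (cases "w tp = 0") (auto simp: chain_contract_def split: if_splits)
 then show "length tp = d \<and> set tp \<subseteq> V \<and> distinct tp"
 proof cases
  case 1
  then show ?thesis using alternatingD(1-3)[OF w] by simp
 next
  case 2
  from alternatingD(1)[OF w 2(3)] alternatingD(2)[OF w 2(3)] alternatingD(3)[OF w 2(3)] 2 uv show ?thesis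
   by (auto simp: set_rp distinct_rp)
 qed
next
 fix tp and a b :: 'a assume ab: "a \<in> set tp" "b \<in> set tp" "a ~= b"
 have st: "set (map (swp a b) tp) = set tp" by (rule set_map_swp[OF ab(1,2)])
 have "w (rp u v (map (swp a b) tp)) = - w (rp u v tp)" if "v \<notin> set tp" "u \<in> set tp"
  by (rule alternating_rp_swap[OF w ab that])
 then show "chain_contract u v w (map (swp a b) tp) = - chain_contract u v w tp"
  unfolding chain_contract_def st using alternatingD(5)[OF w ab] by simp
qed

lemma subspace_precycles: "subspace_fun (precycles d V u v B)"
proof -
 have lin: "chain_contract u v (\<lambda>tp. f tp + c * g tp) = (\<lambda>tp. chain_contract u v f tp + c * chain_contract u v g tp)"
  for f g :: "'a list => 'b::field" and c by (rule ext) (simp add: chain_contract_def algebra_simps)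
 have "(\<lambda>tp. f tp + c * g tp) \<in> precycles d V u v B"
  if f: "f \<in> precycles d V u v B" and g: "g \<in> precycles d V u v B" for f g :: "'a list => 'b" and c
 proof -
  let ?h = "\<lambda>tp. f tp + c * g tp"
  have "(\<lambda>tp. chain_contract u v f tp + c * chain_contract u v g tp) \<in> {z. cycle_on V z}"
  proof -
   have "(\<Sum>x\<in>V. chain_contract u v f (x # tp) + c * chain_contract u v g (x # tp)) =
    (\<Sum>x\<in>V. chain_contract u v f (x # tp)) + c * (\<Sum>x\<in>V. chain_contract u v g (x # tp))" for tp
    by (simp only: sum.distrib sum_distrib_left)
   then show ?thesis using f g by (simp add: precycles_def cycle_on_def)
  qed
  moreover have "supp ?h \<subseteq> supp f \<union> supp g" by (auto simp: supp_def)
  moreover have "alternating d V ?h"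
  proof -
   have "alternating d V f" "alternating d V g" using f g by (simp_all add: precycles_def)
   show ?thesis unfolding alternating_def
   proof (rule conjI; intro allI impI)
    fix tp assume "?h tp ~= 0"
    then consider "f tp ~= 0" | "g tp ~= 0" by fastforce
    then show "length tp = d \<and> set tp \<subseteq> V \<and> distinct tp"
     by cases (use alternatingD(1-3)[OF \<open>alternating d V f\<close>, of tp] alternatingD(1-3)[OF \<open>alternating d V g\<close>, of tp] in simp_all)
   next
    fix tp and a b :: 'a assume "a \<in> set tp" "b \<in> set tp" "a ~= b"
    then show "?h (map (swp a b) tp) = - ?h tp"
     using alternatingD(5)[OF \<open>alternating d V f\<close>] alternatingD(5)[OF \<open>alternating d V g\<close>] by (simp add: algebra_simps)
   qed
  qed
  moreover have "supp f \<subseteq> B" "supp g \<subseteq> B" "\<forall>tp\<in>supp f. \<not> (u \<in> set tp \<and> v \<in> set tp)"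
    "\<forall>tp\<in>supp g. \<not> (u \<in> set tp \<and> v \<in> set tp)" using f g by (simp_all add: precycles_def)
  ultimately have "supp ?h \<subseteq> B" "\<forall>tp\<in>supp ?h. \<not> (u \<in> set tp \<and> v \<in> set tp)" "cycle_on V (chain_contract u v ?h)"
   unfolding lin by blast+
  with \<open>alternating d V ?h\<close> show ?thesis by (simp add: precycles_def)
 qed
 moreover have "(\<lambda>_. 0 :: 'b) \<in> precycles d V u v B"
 proof -
  have "chain_contract u v (\<lambda>_. 0 :: 'b) = (\<lambda>_. 0)" by (rule ext) (simp add: chain_contract_def)
  then show ?thesis by (simp add: precycles_def alternating_def supp_def cycle_on_def)
 qed
 ultimately show ?thesis unfolding subspace_fun_def by blast
qed

lemma extend_sum: "chain_ext u v V (\<lambda>tp. \<Sum>i\<in>I. w i tp) tp = (\<Sum>i\<in>I. chain_ext u v V (w i) tp)"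
proof (cases "u \<in> set tp \<and> v \<in> set tp")
 case True
 then show ?thesis by (simp add: chain_ext_def sum_negf) (rule sum.swap)
qed (auto simp: chain_ext_def)

text \<open>The omitted values are recovered by \<open>cycle_replace\<close> at the entry
  \<open>v\<close>.\<close>

lemma extend_restrict:
 assumes fin: "finite V" and z: "alternating d V z" "cycle_on V z" and uv: "u ~= v" "v \<in> V"
 shows "chain_ext u v V (\<lambda>tp. if u \<in> set tp \<and> v \<in> set tp then 0 else z tp) = z" (is "chain_ext u v V ?n = z")
proof
 fix tp
 show "chain_ext u v V ?n tp = z tp"
 proof (cases "u \<in> set tp \<and> v \<in> set tp")
  case False
  then show ?thesis by (simp only: chain_ext_def if_not_P[OF False] if_False)
 next
  case True
  have n: "?n (rp v x tp) = z (rp v x tp)" if "x ~= v" for x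
   using that by (auto simp: set_rp)
  have "(\<Sum>x\<in>V - {v}. ?n (rp v x tp)) = (\<Sum>x\<in>V - {v}. z (rp v x tp))"
   by (rule sum.cong[OF refl], rule n) simp
  then have e: "chain_ext u v V ?n tp = - (\<Sum>x\<in>V - {v}. z (rp v x tp))"
   by (simp only: chain_ext_def if_P[OF True])
  show ?thesis
  proof (cases "distinct tp \<and> set tp \<subseteq> V")
   case d: True
   have "z tp + (\<Sum>x\<in>V - {v}. z (rp v x tp)) = (\<Sum>x\<in>V. z (rp v x tp))"
    using sum_remove[OF fin uv(2), of "\<lambda>x. z (rp v x tp)"] by (simp only: rp_same)
   also have "\<dots> = 0" by (rule cycle_replace[OF z]) (use d True fin in auto)
   finally show ?thesis unfolding e by (simp only: add_eq_0_iff2)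
  next
   case d: False
   then have "z tp = 0" using alternatingD(2,3)[OF z(1)] by blast
   moreover have "z (rp v x tp) = 0" if "x \<in> V - {v}" for x
   proof (rule ccontr)
    assume a: "z (rp v x tp) ~= 0"
    from alternatingD(2)[OF z(1) a] alternatingD(3)[OF z(1) a] True uv(2) d show False
     by (auto simp: set_rp distinct_rp)
   qed
   ultimately show ?thesis unfolding e by simp
  qed
 qed
qed

text \<open>At a ridge through \<open>u\<close> but not \<open>v\<close>, the cycle conditions at
  \<open>tp\<close> and at \<open>rp u v tp\<close> are added; the two omitted facets through
  \<open>uv\<close> have opposite values and cancel.\<close>

lemma restrict_in_precycles:
 assumes fin: "finite V" and z: "alternating d V z" "cycle_on V z" and uv: "u ~= v" "u \<in> V" "v \<in> V"
 shows "(\<lambda>tp. if u \<in> set tp \<and> v \<in> set tp then 0 else z tp) \<in> precycles d V u v (supp z)" (is "?n \<in> _")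
proof -
 have "alternating d V ?n" unfolding alternating_def
 proof (rule conjI; intro allI impI)
  fix tp assume "?n tp ~= 0"
  then have "z tp ~= 0" by (simp split: if_splits)
  then show "length tp = d \<and> set tp \<subseteq> V \<and> distinct tp" using alternatingD(1-3)[OF z(1)] by simp
 next
  fix tp and a b :: 'a assume ab: "a \<in> set tp" "b \<in> set tp" "a ~= b"
  show "?n (map (swp a b) tp) = - ?n tp"
   unfolding set_map_swp[OF ab(1,2)] using alternatingD(5)[OF z(1) ab] by simp
 qed
 moreover have "cycle_on V (chain_contract u v ?n)" unfolding cycle_on_def
 proof
  fix tp
  have zc: "(\<Sum>x\<in>V. z (x # tp')) = 0" for tp' using z(2) by (simp add: cycle_on_def)
  have rep: "z (x # tp') = 0" if "x \<in> set tp'" for x tp' by (rule alternatingD(4)[OF z(1)]) (use that in simp)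
  have sv: "(\<Sum>x\<in>V. g x) = g v + (\<Sum>x\<in>V - {v}. g x)" for g :: "'a => 'b"
   by (rule sum_remove[OF fin uv(3)])
  have suv: "(\<Sum>x\<in>V - {v}. g x) = g u + (\<Sum>x\<in>V - {v} - {u}. g x)" for g :: "'a => 'b"
   by (rule sum_remove) (use fin uv in auto)
  consider (v) "v \<in> set tp" | (n) "v \<notin> set tp" "u \<notin> set tp" | (u) "v \<notin> set tp" "u \<in> set tp" by blast
  then show "(\<Sum>x\<in>V. chain_contract u v ?n (x # tp)) = 0"
  proof cases
   case v
   then show ?thesis by (simp add: chain_contract_def)
  next
   case n
   have "(\<Sum>x\<in>V - {v} - {u}. chain_contract u v ?n (x # tp)) = (\<Sum>x\<in>V - {v} - {u}. z (x # tp))"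
    by (rule sum.cong) (use n in \<open>auto simp: chain_contract_def\<close>)
   moreover have "chain_contract u v ?n (v # tp) = 0" "chain_contract u v ?n (u # tp) = z (u # tp) + z (v # tp)"
    using n uv by (auto simp: chain_contract_def rp_notin)
   ultimately have "(\<Sum>x\<in>V. chain_contract u v ?n (x # tp)) = (\<Sum>x\<in>V. z (x # tp))"
    unfolding sv suv by simp
   then show ?thesis by (simp only: zc)
  next
   case u
   have sr: "u \<notin> set (rp u v tp)" "v \<in> set (rp u v tp)" using u uv by (auto simp: set_rp)
   have "(\<Sum>x\<in>V - {v} - {u}. chain_contract u v ?n (x # tp)) = (\<Sum>x\<in>V - {v} - {u}. z (x # tp) + z (x # rp u v tp))"
    by (rule sum.cong) (use u sr in \<open>auto simp: chain_contract_def\<close>)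
   also have "\<dots> = (\<Sum>x\<in>V - {v} - {u}. z (x # tp)) + (\<Sum>x\<in>V - {v} - {u}. z (x # rp u v tp))"
    by (rule sum.distrib)
   also have "(\<Sum>x\<in>V - {v} - {u}. z (x # tp)) = - z (v # tp)"
    using zc[of tp] rep[of u tp] u unfolding sv suv by (simp add: add_eq_0_iff)
   also have "(\<Sum>x\<in>V - {v} - {u}. z (x # rp u v tp)) = - z (u # rp u v tp)"
    using zc[of "rp u v tp"] rep[of v "rp u v tp"] sr unfolding sv suv by (simp add: add_eq_0_iff)
   also have "z (u # rp u v tp) = - z (v # tp)"
   proof -
    have "u # rp u v tp = map (swp u v) (v # tp)" using u(1) by (induction tp) (auto simp: swp_def)
    then show ?thesis using alternatingD(5)[OF z(1), of u "v # tp" v] u uv by simp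
   qed
   finally have "(\<Sum>x\<in>V - {v} - {u}. chain_contract u v ?n (x # tp)) = 0" by simp
   moreover have "chain_contract u v ?n (v # tp) = 0" by (simp add: chain_contract_def)
   moreover have "chain_contract u v ?n (u # tp) = 0" using u uv sr rep[of u tp] rep[of v "rp u v tp"] by (auto simp: chain_contract_def)
   ultimately show ?thesis unfolding sv suv by simp
  qed
 qed
 ultimately show ?thesis by (auto simp: precycles_def supp_def)
qed

section \<open>Graph of a chain and contraction of minimal precycles\<close>

lemma chain_edgesI: "tp \<in> supp z ==> x \<in> set tp ==> y \<in> set tp ==> x ~= y ==> {x, y} \<in> chain_edges z"
 unfolding chain_edges_def by blast

lemma chain_vertsI: "tp \<in> supp z ==> x \<in> set tp ==> x \<in> chain_verts z"
 unfolding chain_verts_def by blast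

lemma chain_edgesE:
 assumes "{x, y} \<in> chain_edges z"
 obtains tp where "tp \<in> supp z" "x \<in> set tp" "y \<in> set tp" "x ~= y"
proof -
 from assms obtain a b tp where *: "{x, y} = {a, b}" "a ~= b" "tp \<in> supp z" "a \<in> set tp" "b \<in> set tp"
  unfolding chain_edges_def by blast
 have "x \<in> set tp" "y \<in> set tp" "x ~= y" using * by (auto simp: doubleton_eq_iff)
 with *(3) that show thesis by blast
qed

lemma minimal_inD:
 assumes "minimal_in N w"
 shows "w \<in> N" "supp w ~= {}" "y \<in> N ==> supp y \<subseteq> supp w ==> supp y ~= {} ==> supp y = supp w"
 using assms unfolding minimal_in_def by (simp_all only: simp_thms)

text \<open>This is the case in which contraction loses support. The two facets, taken with opposite
  values, form a precycle \<open>r\<close> contracting to 0, and minimality of \<open>w\<close>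
  leaves room for no further facet.\<close>

lemma minimal_precycle_pair:
 assumes w: "minimal_in (precycles d V u v B) w" and tp: "u \<in> set tp" "v \<notin> set tp" "w tp ~= 0" "w (rp u v tp) ~= 0"
 shows "sg \<in> supp w ==> set sg = set tp \<or> set sg = insert v (set tp - {u})"
proof -
 have wN: "alternating d V w" "supp w \<subseteq> B" "\<forall>tp\<in>supp w. \<not> (u \<in> set tp \<and> v \<in> set tp)"
  using w by (auto simp: minimal_in_def precycles_def)
 have uv: "u ~= v" using tp by auto
 define F where "F = set tp"
 define r where "r = (\<lambda>sg. if set sg = insert v (F - {u}) then w sg else if set sg = F then - w (rp u v sg) else 0)"
 have ne: "insert v (F - {u}) ~= F" using tp by (auto simp: F_def)
 have sub: "supp r \<subseteq> supp w"
 proof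
  fix sg assume "sg \<in> supp r"
  then consider "w sg ~= 0" | "set sg = F" "w (rp u v sg) ~= 0" by (auto simp: supp_def r_def split: if_splits)
  then show "sg \<in> supp w"
  proof cases
   case 2
   have "length sg = length tp" using alternatingD(1)[OF wN(1) 2(2)] alternatingD(1)[OF wN(1) tp(3)] by simp
   moreover have "tp \<in> supp w" using tp by (simp add: supp_def)
   ultimately show ?thesis using alternating_supp_cong[OF wN(1), of tp sg] 2(1) by (simp add: F_def)
  qed (simp add: supp_def)
 qed
 have "alternating d V r" unfolding alternating_def
 proof (rule conjI; intro allI impI)
  fix sg assume "r sg ~= 0"
  then have "w sg ~= 0" using sub by (auto simp: supp_def)
  then show "length sg = d \<and> set sg \<subseteq> V \<and> distinct sg" using alternatingD(1-3)[OF wN(1)] by simp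
 next
  fix sg and a b :: 'a assume ab: "a \<in> set sg" "b \<in> set sg" "a ~= b"
  have 1: "w (map (swp a b) sg) = - w sg" by (rule alternatingD(5)[OF wN(1) ab])
  have 2: "w (rp u v (map (swp a b) sg)) = - w (rp u v sg)" if "set sg = F"
   by (rule alternating_rp_swap[OF wN(1) ab]) (use that tp in \<open>auto simp: F_def\<close>)
  show "r (map (swp a b) sg) = - r sg"
   unfolding r_def set_map_swp[OF ab(1,2)] using 1 2 by simp
 qed
 moreover have "chain_contract u v r = (\<lambda>_. 0)"
 proof
  fix sg
  have v: "r sg + r (rp u v sg) = 0" if s: "v \<notin> set sg" "u \<in> set sg"
  proof -
   have sr: "set (rp u v sg) = insert v (set sg - {u})" using s by (simp add: set_rp)
   have n1: "set sg ~= insert v (F - {u})" using s by blast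
   show ?thesis
   proof (cases "set sg = F")
    case True
    then show ?thesis using n1 sr by (simp add: r_def)
   next
    case False
    have "insert v (set sg - {u}) ~= insert v (F - {u})"
    proof
     assume "insert v (set sg - {u}) = insert v (F - {u})"
     then have "set sg - {u} = F - {u}" using s tp(2) uv by (auto simp: F_def insert_eq_iff)
     then show False using False s tp(1) by (auto simp: F_def)
    qed
    moreover have "insert v (set sg - {u}) ~= F" using tp(2) by (auto simp: F_def)
    ultimately show ?thesis using n1 False sr by (simp add: r_def)
   qed
  qed
  have n: "r sg = 0" if s: "v \<notin> set sg" "u \<notin> set sg"
   using s tp(1) by (auto simp: r_def F_def)
  show "chain_contract u v r sg = 0" unfolding chain_contract_def using v n by simp
 qed
 ultimately have "r \<in> precycles d V u v B" using sub wN by (auto simp: precycles_def cycle_on_def)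
 moreover have "rp u v tp \<in> supp r" using tp by (simp add: supp_def r_def F_def set_rp)
 then have "supp r ~= {}" by blast
 ultimately have eq: "supp r = supp w" by (rule minimal_inD(3)[OF w _ sub])
 assume "sg \<in> supp w"
 then have "r sg ~= 0" unfolding eq[symmetric] by (simp add: supp_def)
 then show "set sg = set tp \<or> set sg = insert v (set tp - {u})" by (auto simp: r_def F_def split: if_splits)
qed

text \<open>When no two facets of \<open>w\<close> are identified, contraction merely relabels the
  support. A cycle \<open>y\<close> inside the contracted support then lifts to the precycle
  \<open>l\<close>, to which the minimality of \<open>w\<close> applies.\<close>

lemma minimal_precycle_contract:
 fixes w :: "'v list => 'k::field"
 assumes w: "minimal_in (precycles d V u v B) w" and uv: "u ~= v" "u \<in> V"
  and np_all: "\<forall>tp. u \<in> set tp --> v \<notin> set tp --> w tp = 0 \<or> w (rp u v tp) = 0"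
 shows "minimal_in (cycles d V) (chain_contract u v w)"
  and "tp \<in> supp w ==> v \<notin> set tp ==> tp \<in> supp (chain_contract u v w)"
  and "tp \<in> supp w ==> v \<in> set tp ==> rp v u tp \<in> supp (chain_contract u v w)"
  and "tp \<in> supp (chain_contract u v w) ==> v \<notin> set tp \<and> (tp \<in> supp w \<or> u \<in> set tp \<and> rp u v tp \<in> supp w)"
proof -
 let ?z = "chain_contract u v w"
 have wN: "alternating d V w" "supp w \<subseteq> B" "\<forall>tp\<in>supp w. \<not> (u \<in> set tp \<and> v \<in> set tp)" "cycle_on V ?z"
  using w by (auto simp: minimal_in_def precycles_def)
 have np: "w tp = 0 \<or> w (rp u v tp) = 0" if "u \<in> set tp" "v \<notin> set tp" for tp
  by (rule np_all[rule_format, OF that])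
 have A: "?z tp ~= 0" if "w tp ~= 0" "v \<notin> set tp" for tp
  using that np[of tp] by (auto simp: chain_contract_def)
 have B: "?z (rp v u tp) ~= 0" if t: "w tp ~= 0" "v \<in> set tp" for tp
 proof -
  have u: "u \<notin> set tp" using wN(3) t by (auto simp: supp_def)
  have s: "u \<in> set (rp v u tp)" "v \<notin> set (rp v u tp)" using t u uv by (auto simp: set_rp)
  have r: "rp u v (rp v u tp) = tp" using rp_rp[OF u, of v v] by simp
  have "w (rp v u tp) = 0" using np[OF s] t unfolding r by simp
  then show ?thesis using s t by (simp add: chain_contract_def r)
 qed
 have C: "v \<notin> set tp \<and> (w tp ~= 0 \<or> u \<in> set tp \<and> w (rp u v tp) ~= 0)" if "?z tp ~= 0" for tp
  using that by (cases "w tp = 0") (auto simp: chain_contract_def split: if_splits)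
 show "tp \<in> supp w ==> v \<notin> set tp ==> tp \<in> supp ?z" using A by (simp add: supp_def)
 show "tp \<in> supp w ==> v \<in> set tp ==> rp v u tp \<in> supp ?z" using B by (simp add: supp_def)
 show "tp \<in> supp ?z ==> v \<notin> set tp \<and> (tp \<in> supp w \<or> u \<in> set tp \<and> rp u v tp \<in> supp w)" using C by (simp add: supp_def)
 have za: "alternating d V ?z" by (rule contract_alternating[OF wN(1) uv wN(3)])
 show "minimal_in (cycles d V) ?z" unfolding minimal_in_def
 proof (intro conjI ballI impI)
  show "?z \<in> cycles d V" using za wN(4) by (simp add: cycles_def)
  obtain tp where "w tp ~= 0" using w by (auto simp: minimal_in_def supp_def)
  then show "supp ?z ~= {}" using A[of tp] B[of tp] by (cases "v \<in> set tp") (auto simp: supp_def)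
  fix y :: "'v list => 'k" assume y: "y \<in> cycles d V" and ys: "supp y \<subseteq> supp ?z" and yn: "supp y ~= {}"
  have ya: "alternating d V y" "cycle_on V y" using y by (simp_all add: cycles_def)
  have yz: "?z tp ~= 0" if "y tp ~= 0" for tp using ys that by (auto simp: supp_def)
  define l where "l = (\<lambda>sg. if w sg ~= 0 then y (rp v u sg) else 0)"
  have ls: "supp l \<subseteq> supp w" by (auto simp: supp_def l_def)
  have "alternating d V l" unfolding alternating_def
  proof (rule conjI; intro allI impI)
   fix sg assume "l sg ~= 0"
   then have "w sg ~= 0" using ls by (auto simp: supp_def)
   then show "length sg = d \<and> set sg \<subseteq> V \<and> distinct sg" using alternatingD(1-3)[OF wN(1)] by simp
  next
   fix sg and a b :: 'v assume ab: "a \<in> set sg" "b \<in> set sg" "a ~= b"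
   have 1: "w (map (swp a b) sg) ~= 0 \<longleftrightarrow> w sg ~= 0" using alternatingD(5)[OF wN(1) ab] by simp
   have 2: "y (rp v u (map (swp a b) sg)) = - y (rp v u sg)" if "w sg ~= 0"
   proof (cases "v \<in> set sg")
    case True
    then have "u \<notin> set sg" using wN(3) that by (auto simp: supp_def)
    then show ?thesis by (rule alternating_rp_swap[OF ya(1) ab _ True])
   next
    case False
    have f: "v \<notin> set (map (swp a b) sg)" unfolding set_map_swp[OF ab(1,2)] by (rule False)
    show ?thesis unfolding rp_notin[OF False] rp_notin[OF f] by (rule alternatingD(5)[OF ya(1) ab])
   qed
   show "l (map (swp a b) sg) = - l sg" unfolding l_def 1 using 2 by simp
  qed
  moreover have lc: "chain_contract u v l = y"
  proof
   fix tp
   have "y tp = 0" if "v \<in> set tp" using yz[of tp] C[of tp] that by blast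
   moreover have "l tp + l (rp u v tp) = y tp" if t: "v \<notin> set tp" "u \<in> set tp"
   proof -
    have r: "rp v u (rp u v tp) = tp" using rp_rp[OF t(1), of u u] by simp
    consider "w tp ~= 0" "w (rp u v tp) = 0" | "w tp = 0" "w (rp u v tp) ~= 0" | "w tp = 0" "w (rp u v tp) = 0"
     using np[OF t(2,1)] by blast
    then show ?thesis
    proof cases
     case 3
     then have "y tp = 0" using yz[of tp] C[of tp] by blast
     then show ?thesis using 3 by (simp add: l_def)
    qed (simp_all add: l_def r rp_notin[OF t(1)])
   qed
   moreover have "l tp = y tp" if t: "v \<notin> set tp" "u \<notin> set tp"
    using yz[of tp] C[of tp] t by (auto simp: l_def rp_notin)
   ultimately show "chain_contract u v l tp = y tp" by (simp add: chain_contract_def)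
  qed
  ultimately have "l \<in> precycles d V u v B"
   using ls wN(2,3) ya(2) by (auto simp: precycles_def)
  moreover have "supp l ~= {}"
  proof
   assume "supp l = {}"
   then have "l tp = 0" for tp by (auto simp: supp_def)
   then have "y tp = 0" for tp unfolding lc[symmetric] by (simp add: chain_contract_def)
   then show False using yn by (simp add: supp_def)
  qed
  ultimately have eq: "supp l = supp w" by (rule minimal_inD(3)[OF w _ ls])
  have lw: "y (rp v u sg) ~= 0" if "w sg ~= 0" for sg
  proof -
   have "sg \<in> supp l" unfolding eq using that by (simp add: supp_def)
   then have "l sg ~= 0" by (simp add: supp_def)
   with that show ?thesis by (simp add: l_def)
  qed
  show "supp y = supp ?z"
  proof (rule equalityI[OF ys], rule subsetI)
   fix tp assume "tp \<in> supp ?z"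
   then have "?z tp ~= 0" by (simp add: supp_def)
   from C[OF this] have v: "v \<notin> set tp" and c: "w tp ~= 0 \<or> w (rp u v tp) ~= 0" by auto
   have r: "rp v u (rp u v tp) = tp" using rp_rp[OF v, of u u] by simp
   from c have "y tp ~= 0"
   proof
    assume "w tp ~= 0"
    from lw[OF this] show ?thesis by (simp only: rp_notin[OF v]) simp
   next
    assume "w (rp u v tp) ~= 0"
    from lw[OF this] show ?thesis by (simp only: r) simp
   qed
   then show "tp \<in> supp y" by (simp add: supp_def)
  qed
 qed
qed

text \<open>The pieces are minimal precycles whose sum is the part of \<open>z\<close> off
  \<open>uv\<close>. Their completions sum to \<open>z\<close>, and two completions with a common
  facet through \<open>uv\<close> share \<open>d\<close> vertices, enough for gluing.\<close>

theorem minimal_cycle_rigid: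
 fixes z :: "'v list => 'k::field" and V :: "'v set"
 assumes fin: "finite V" and d: "CARD('n::finite) = d" "d \<ge> 3" and "minimal_in (cycles d V) z"
 shows "generically V (inf_rigid (chain_edges z) (chain_verts z) :: ('v => real^'n) => bool)"
 using assms(4)
proof (induction "card (chain_verts z)" arbitrary: z rule: less_induct)
 case (less z)
 let ?E = "chain_edges z"
 let ?GR = "\<lambda>A. generically V (inf_rigid ?E A :: ('v => real^'n) => bool)"
 have zc: "alternating d V z" "cycle_on V z" using less.prems by (auto simp: minimal_in_def cycles_def)
 have sV: "set tp \<subseteq> V" if "tp \<in> supp z" for tp using alternatingD(2)[OF zc(1)] that by (simp add: supp_def)
 have zV: "chain_verts z \<subseteq> V" using sV by (auto simp: chain_verts_def)
 obtain tp0 where t0: "z tp0 ~= 0" using less.prems by (auto simp: minimal_in_def supp_def)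
 have l0: "length tp0 = d" "set tp0 \<subseteq> V" "distinct tp0" using alternatingD(1-3)[OF zc(1) t0] by auto
 obtain u v \<rho> where uvr: "tp0 = u # v # \<rho>"
  using l0(1) d(2) by (cases tp0; cases "tl tp0") auto
 have uv: "u ~= v" "u \<in> V" "v \<in> V" and uv0: "u \<in> set tp0" "v \<in> set tp0" using l0 uvr by auto
 have t0s: "tp0 \<in> supp z" using t0 by (simp add: supp_def)
 have Euv: "{u, v} \<in> ?E" by (rule chain_edgesI[OF t0s uv0 uv(1)])
 let ?N = "precycles d V u v (supp z) :: ('v list => 'k) set"
 let ?e = "chain_ext u v V"
 define nz where "nz = (\<lambda>tp. if u \<in> set tp \<and> v \<in> set tp then 0 else z tp)"
 have nzN: "nz \<in> ?N" unfolding nz_def by (rule restrict_in_precycles[OF fin zc uv])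
 have finN: "finite (supp f)" if "f \<in> ?N" for f using finite_supp[OF fin] that by (auto simp: precycles_def)
 obtain S where S: "finite S" "!!w. w \<in> S ==> minimal_in ?N w" "!!w. w \<in> S ==> supp w \<subseteq> supp nz"
  "!!tp. nz tp = (\<Sum>w\<in>S. w tp)" "!!I. I \<subseteq> S ==> I ~= {} ==> \<exists>tp. (\<Sum>w\<in>I. w tp) ~= 0"
  using exists_irredundant_decomposition[OF subspace_precycles finN nzN] by metis
 have wN: "alternating d V w" "supp w \<subseteq> supp z" "\<forall>tp\<in>supp w. \<not> (u \<in> set tp \<and> v \<in> set tp)"
   "cycle_on V (chain_contract u v w)" if "w \<in> S" for w
  using S(2)[OF that] by (auto simp: minimal_in_def precycles_def)
 have ea: "alternating d V (?e w)" and ec: "cycle_on V (?e w)" if "w \<in> S" for w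
  using alternating_extend[OF wN(1)[OF that] uv(1,3)] cycle_extend[OF fin wN(1)[OF that] uv wN(4)[OF that]] by auto
 have zsum: "z tp = (\<Sum>w\<in>S. ?e w tp)" for tp
 proof -
  have "z = ?e nz" unfolding nz_def by (rule extend_restrict[OF fin zc uv(1,3), symmetric])
  also have "nz = (\<lambda>tp. \<Sum>w\<in>S. w tp)" by (rule ext) (rule S(4))
  finally have "z tp = ?e (\<lambda>tp. \<Sum>w\<in>S. w tp) tp" by (rule fun_cong)
  then show ?thesis by (simp only: extend_sum)
 qed
 have en: "?e w tp = w tp" if "\<not> (u \<in> set tp \<and> v \<in> set tp)" for w tp
  by (simp only: chain_ext_def if_not_P[OF that])
 have eu: "\<exists>x\<in>V - {v}. w (rp v x sg) ~= 0" if "u \<in> set sg" "v \<in> set sg" "?e w sg ~= 0" for w sg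
 proof (rule ccontr)
  assume "\<not> ?thesis"
  then have "(\<Sum>x\<in>V - {v}. w (rp v x sg)) = 0" by (intro sum.neutral) blast
  then show False using that by (simp add: chain_ext_def)
 qed
 \<comment> \<open>\<open>u\<close> and \<open>v\<close> are included even if \<open>w\<close>
   misses one of them, so that \<open>Y w\<close> contains all facets of the completion of
   \<open>w\<close>.\<close>
 define Y where "Y = (\<lambda>w :: 'v list => 'k. insert u (insert v (chain_verts w)))"
 have YV: "Y w \<subseteq> chain_verts z" if "w \<in> S" for w
  using wN(2)[OF that] t0s uv0 by (auto simp: Y_def chain_verts_def)
 have uvY: "set sg \<subseteq> Y w" if suv: "u \<in> set sg" "v \<in> set sg" "?e w sg ~= 0" for w sg
 proof -
  obtain x where "w (rp v x sg) ~= 0" using eu[OF suv] by blast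
  then have "set (rp v x sg) \<subseteq> chain_verts w" by (auto simp: chain_verts_def supp_def)
  then show ?thesis using suv(2) by (auto simp: set_rp Y_def)
 qed
 have member: "?GR (Y w)" if w: "w \<in> S" for w
 proof (cases "\<exists>tp. u \<in> set tp \<and> v \<notin> set tp \<and> w tp ~= 0 \<and> w (rp u v tp) ~= 0")
  \<comment> \<open>A collapsing piece consists of two facets, so \<open>Y w\<close> has
    \<open>d + 1\<close> vertices; every pair of them lies in one of these facets or is
    \<open>uv\<close>.\<close>
  case True
  then obtain tp where t: "u \<in> set tp" "v \<notin> set tp" "w tp ~= 0" "w (rp u v tp) ~= 0" by blast
  have ts: "tp \<in> supp w" "rp u v tp \<in> supp w" using t by (simp_all add: supp_def)
  have "chain_verts w \<subseteq> insert v (set tp)"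
  proof
   fix x assume "x \<in> chain_verts w"
   then obtain sg where "sg \<in> supp w" "x \<in> set sg" by (auto simp: chain_verts_def)
   with minimal_precycle_pair[OF S(2)[OF w] t, of sg] show "x \<in> insert v (set tp)" by blast
  qed
  then have Yeq: "Y w = insert v (set tp)" using t(1) chain_vertsI[OF ts(1)] by (auto simp: Y_def)
  have "card (set tp) = d" using alternatingD(1)[OF wN(1)[OF w] t(3)] distinct_card[OF alternatingD(3)[OF wN(1)[OF w] t(3)]] by simp
  then have "card (Y w) = Suc CARD('n)" unfolding Yeq using t(2) d by simp
  moreover have "Y w \<subseteq> V" by (rule subset_trans[OF YV[OF w] zV])
  moreover have "{x, y} \<in> ?E" if xy: "x \<in> Y w" "y \<in> Y w" "x ~= y" for x y
  proof -
   have s2: "set (rp u v tp) = insert v (set tp - {u})" by (simp only: set_rp if_P[OF t(1)])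
   have tz: "tp \<in> supp z" "rp u v tp \<in> supp z" by (rule subsetD[OF wN(2)[OF w] ts(1)], rule subsetD[OF wN(2)[OF w] ts(2)])
   consider "x \<in> set tp" "y \<in> set tp" | "x \<in> set (rp u v tp)" "y \<in> set (rp u v tp)" | "{x, y} = {u, v}"
    using xy unfolding Yeq s2 by blast
   then show ?thesis
   proof cases
    case 1 then show ?thesis by (intro chain_edgesI[OF tz(1)] xy(3))
   next
    case 2 then show ?thesis by (intro chain_edgesI[OF tz(2)] xy(3))
   next
    case 3 then show ?thesis using Euv by simp
   qed
  qed
  ultimately show ?thesis by (intro generically_inf_rigid_simplex[OF fin])
 next
  case False
  then have np: "\<forall>tp. u \<in> set tp --> v \<notin> set tp --> w tp = 0 \<or> w (rp u v tp) = 0" by blast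
  let ?z = "chain_contract u v w"
  note mc = minimal_precycle_contract[OF S(2)[OF w] uv(1,2) np]
  have zv: "v \<notin> chain_verts ?z" using mc(4) by (auto simp: chain_verts_def)
  have zsub: "chain_verts ?z \<subseteq> chain_verts w \<union> {u}"
  proof
   fix x assume "x \<in> chain_verts ?z"
   then obtain tp where t: "tp \<in> supp ?z" "x \<in> set tp" by (auto simp: chain_verts_def)
   show "x \<in> chain_verts w \<union> {u}"
   proof (cases "tp \<in> supp w")
    case True
    then show ?thesis using chain_vertsI[OF True t(2)] by simp
   next
    case False
    then have "u \<in> set tp" "rp u v tp \<in> supp w" using mc(4)[OF t(1)] by simp_all
    then show ?thesis using chain_vertsI[of "rp u v tp" w x] t(2) by (auto simp: set_rp)
   qed
  qed
  have wsub: "chain_verts w \<subseteq> insert v (chain_verts ?z)"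
  proof
   fix x assume "x \<in> chain_verts w"
   then obtain tp where t: "tp \<in> supp w" "x \<in> set tp" by (auto simp: chain_verts_def)
   show "x \<in> insert v (chain_verts ?z)"
   proof (cases "v \<in> set tp")
    case True
    then show ?thesis using t chain_vertsI[OF mc(3)[OF t(1) True], of x] by (auto simp: set_rp)
   next
    case False
    then show ?thesis using t chain_vertsI[OF mc(2)[OF t(1) False], of x] by auto
   qed
  qed
  have "chain_verts ?z \<subset> chain_verts z"
   using zsub zv YV[OF w] by (auto simp: Y_def)
  then have "card (chain_verts ?z) < card (chain_verts z)"
   by (intro psubset_card_mono) (use zV fin finite_subset in auto)
  from less.hyps[OF this mc(1)] have IH: "generically V (inf_rigid (chain_edges ?z) (chain_verts ?z) :: ('v => real^'n) => bool)" .
  \<comment> \<open>Otherwise \<open>w\<close> is its own completion, a cycle inside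
    \<open>z\<close>, and has the same support as \<open>z\<close>; but \<open>tp0\<close> passes
    through \<open>u\<close> and \<open>v\<close>.\<close>
  have "\<exists>sg. u \<in> set sg \<and> v \<in> set sg \<and> ?e w sg ~= 0"
  proof (rule ccontr)
   assume n: "\<not> ?thesis"
   have eww: "?e w = w"
   proof
    fix sg show "?e w sg = w sg"
    proof (cases "u \<in> set sg \<and> v \<in> set sg")
     case True
     moreover have "w sg = 0" using wN(3)[OF w] True by (auto simp: supp_def)
     ultimately show ?thesis using n by auto
    qed (rule en)
   qed
   have "?e w \<in> cycles d V" unfolding cycles_def using ea[OF w] ec[OF w] by (intro CollectI conjI)
   then have "w \<in> cycles d V" by (simp only: eww)
   moreover have "supp w ~= {}" using S(2)[OF w] by (simp add: minimal_in_def)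
   ultimately have "supp w = supp z" by (rule minimal_inD(3)[OF less.prems _ wN(2)[OF w]])
   then have "tp0 \<in> supp w" using t0s by (simp only:)
   then show False using wN(3)[OF w] uv0 by blast
  qed
  then obtain sg where s: "u \<in> set sg" "v \<in> set sg" "?e w sg ~= 0" by blast
  \<comment> \<open>Each further vertex \<open>c\<close> of a completed facet through
    \<open>uv\<close> is a common neighbour: exchanging \<open>v\<close> yields a facet of
    \<open>w\<close> through \<open>u\<close> and \<open>c\<close>, exchanging \<open>u\<close> one
    through \<open>v\<close> and \<open>c\<close>.\<close>
  have nb: "{u, c} \<in> ?E \<and> {v, c} \<in> ?E \<and> c \<in> chain_verts ?z \<and> u \<in> chain_verts ?z"
   if s: "u \<in> set sg" "v \<in> set sg" "?e w sg ~= 0" and c: "c \<in> set sg" "c ~= u" "c ~= v" for sg c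
  proof -
   obtain x where x: "x \<in> V - {v}" "w (rp v x sg) ~= 0" using eu[OF s] by blast
   have r: "u \<in> set (rp v x sg)" "c \<in> set (rp v x sg)" "v \<notin> set (rp v x sg)"
    using s c x uv by (auto simp: set_rp)
   have rs: "rp v x sg \<in> supp w" using x by (simp add: supp_def)
   have 1: "{u, c} \<in> ?E" using chain_edgesI[of "rp v x sg" z u c] rs wN(2)[OF w] r c by blast
   have 2: "c \<in> chain_verts ?z" "u \<in> chain_verts ?z" using chain_vertsI[OF mc(2)[OF rs r(3)]] r by blast+
   have sd: "distinct sg" "set sg \<subseteq> V" using alternatingD(2,3)[OF ea[OF w] s(3)] by auto
   have "(\<Sum>x\<in>V. ?e w (rp u x sg)) = 0" by (rule cycle_replace[OF ea[OF w] ec[OF w] sd(1) s(1) fin sd(2)])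
   then have "?e w (rp u u sg) + (\<Sum>x\<in>V - {u}. ?e w (rp u x sg)) = 0"
    using sum_remove[OF fin uv(2), of "\<lambda>x. ?e w (rp u x sg)"] by simp
   then have "(\<Sum>x\<in>V - {u}. ?e w (rp u x sg)) ~= 0" using s(3) by auto
   then obtain y where y: "y \<in> V - {u}" "?e w (rp u y sg) ~= 0" by (meson sum.neutral)
   have ry: "u \<notin> set (rp u y sg)" "v \<in> set (rp u y sg)" "c \<in> set (rp u y sg)"
    using s c y uv by (auto simp: set_rp)
   have "w (rp u y sg) ~= 0" using y(2) en[of "rp u y sg" w] ry(1) by simp
   then have "rp u y sg \<in> supp z" using wN(2)[OF w] by (auto simp: supp_def)
   then have "{v, c} \<in> ?E" using chain_edgesI[of "rp u y sg" z v c] ry c by blast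
   with 1 2 show ?thesis by blast
  qed
  have sd: "distinct sg" "set sg \<subseteq> V" "length sg = d" using alternatingD(1-3)[OF ea[OF w] s(3)] by auto
  have cs: "card (set sg) = d" using distinct_card[OF sd(1)] sd(3) by simp
  \<comment> \<open>The facet supplies only \<open>d - 2\<close> common neighbours, one too few for
    the vertex split. Exchanging a third vertex \<open>c0\<close>, which exists because
    \<open>d \<ge> 3\<close>, gives another facet through \<open>uv\<close> and the missing
    neighbour \<open>x\<close>.\<close>
  then have "card (set sg - {u, v}) = d - 2" using s(1,2) uv(1) by (simp add: card_Diff_subset)
  then have "card (set sg - {u, v}) ~= 0" using d(2) by simp
  then obtain c0 where c0: "c0 \<in> set sg" "c0 ~= u" "c0 ~= v" by (metis DiffE card.empty ex_in_conv insertCI)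
  have c0V: "c0 \<in> V" using c0 sd by blast
  have "(\<Sum>x\<in>V. ?e w (rp c0 x sg)) = 0" by (rule cycle_replace[OF ea[OF w] ec[OF w] sd(1) c0(1) fin sd(2)])
  then have "?e w (rp c0 c0 sg) + (\<Sum>x\<in>V - {c0}. ?e w (rp c0 x sg)) = 0"
   using sum_remove[OF fin c0V, of "\<lambda>x. ?e w (rp c0 x sg)"] by simp
  then have "(\<Sum>x\<in>V - {c0}. ?e w (rp c0 x sg)) ~= 0" using s(3) by auto
  then obtain x where x: "x \<in> V - {c0}" "?e w (rp c0 x sg) ~= 0" by (meson sum.neutral)
  have xs: "x \<notin> set sg" using alternatingD(3)[OF ea[OF w] x(2)] c0(1) x(1) by (auto simp: distinct_rp)
  have s': "u \<in> set (rp c0 x sg)" "v \<in> set (rp c0 x sg)" "x \<in> set (rp c0 x sg)"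
   using s c0 by (auto simp: set_rp)
  define Cm where "Cm = insert x (set sg - {u, v})"
  have xuv: "x ~= u" "x ~= v" using xs s by auto
  have nbC: "{u, c} \<in> ?E \<and> {v, c} \<in> ?E \<and> c \<in> chain_verts ?z \<and> u \<in> chain_verts ?z" if "c \<in> Cm" for c
  proof (cases "c = x")
   case True
   then show ?thesis using nb[OF s'(1,2) x(2) s'(3) xuv] by simp
  next
   case False
   then show ?thesis using that nb[OF s, of c] by (auto simp: Cm_def)
  qed
  have "card Cm = Suc (d - 2)" using xs \<open>card (set sg - {u, v}) = d - 2\<close> by (simp add: Cm_def)
  then have cardC: "CARD('n) \<le> Suc (card Cm)" using d by simp
  have uz: "u \<in> chain_verts ?z" using nbC[of x] by (simp add: Cm_def)
  have Yeq: "Y w = insert v (chain_verts ?z)" using zsub wsub uz by (auto simp: Y_def)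
  have Yv: "Y w - {v} = chain_verts ?z" using zv by (auto simp: Yeq)
  show ?thesis
  proof (rule generically_inf_rigid_vertex_split[OF fin _ _ _ uv(1) Euv, where E'="chain_edges ?z" and Cm=Cm])
   show "Y w \<subseteq> V" by (rule subset_trans[OF YV[OF w] zV])
   show "u \<in> Y w" "v \<in> Y w" by (simp_all add: Y_def)
   show "Cm \<subseteq> Y w - {u, v}" using nbC xuv by (auto simp: Yeq) (auto simp: Cm_def)
   show "CARD('n) \<le> Suc (card Cm)" by (rule cardC)
   show "{u, c} \<in> ?E \<and> {v, c} \<in> ?E" if "c \<in> Cm" for c using nbC[OF that] by blast
   show "{x, y} \<in> ?E" if xy: "x \<in> Y w - {u, v}" "y \<in> Y w - {u, v}" "{x, y} \<in> chain_edges ?z" for x y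
   proof -
    obtain tp where t: "tp \<in> supp ?z" "x \<in> set tp" "y \<in> set tp" "x ~= y" using chain_edgesE[OF xy(3)] by blast
    from mc(4)[OF t(1)] have "tp \<in> supp w \<or> u \<in> set tp \<and> rp u v tp \<in> supp w" by blast
    then show ?thesis
    proof
     assume "tp \<in> supp w"
     then show ?thesis using wN(2)[OF w] t by (intro chain_edgesI[of tp]) auto
    next
     assume "u \<in> set tp \<and> rp u v tp \<in> supp w"
     then show ?thesis using wN(2)[OF w] t xy by (intro chain_edgesI[of "rp u v tp"]) (auto simp: set_rp)
    qed
   qed
   show "{u, y} \<in> ?E \<or> {v, y} \<in> ?E" if y: "y \<in> Y w - {u, v}" "{u, y} \<in> chain_edges ?z" for y
   proof -
    obtain tp where t: "tp \<in> supp ?z" "u \<in> set tp" "y \<in> set tp" "u ~= y" using chain_edgesE[OF y(2)] by blast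
    from mc(4)[OF t(1)] have "tp \<in> supp w \<or> rp u v tp \<in> supp w" by blast
    then show ?thesis
    proof
     assume "tp \<in> supp w"
     then have "{u, y} \<in> ?E" using wN(2)[OF w] t by (intro chain_edgesI[of tp]) auto
     then show ?thesis ..
    next
     assume "rp u v tp \<in> supp w"
     then have "{v, y} \<in> ?E" using wN(2)[OF w] t y by (intro chain_edgesI[of "rp u v tp"]) (auto simp: set_rp)
     then show ?thesis ..
    qed
   qed
   show "generically V (inf_rigid (chain_edges ?z) (Y w - {v}) :: ('v => real^'n) => bool)"
    unfolding Yv by (rule IH)
  qed
 qed
 \<comment> \<open>A maximal subfamily with rigid union will turn out to be all of
   \<open>S\<close>.\<close>
 define Q where "Q = {I. I \<subseteq> S \<and> I ~= {} \<and> ?GR (\<Union>w\<in>I. Y w)}"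
 have Sne: "S ~= {}"
 proof
  assume "S = {}"
  then have "z tp0 = 0" by (simp add: zsum)
  then show False using t0 by simp
 qed
 then obtain w0 where "w0 \<in> S" by blast
 then have "{w0} \<in> Q" using member[of w0] by (simp add: Q_def)
 moreover have "finite Q" using S(1) by (intro finite_subset[of Q "Pow S"]) (auto simp: Q_def)
 ultimately obtain I where I: "I \<in> Q" "!!I'. I' \<in> Q ==> I \<subseteq> I' ==> I = I'"
  using finite_has_maximal[of Q] by blast
 have IS: "I \<subseteq> S" "I ~= {}" "?GR (\<Union>w\<in>I. Y w)" using I(1) by (auto simp: Q_def)
 have "I = S"
 proof (rule ccontr)
  assume IneS: "I ~= S"
  \<comment> \<open>If the two groups shared no facet through \<open>uv\<close>, the sum
    \<open>y\<close> over \<open>I\<close> would be a cycle inside \<open>z\<close>, so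
    \<open>y = c * z\<close>. Irredundance gives \<open>c ~= 0\<close> and \<open>c ~= 1\<close>;
    then both groups are nonzero at \<open>tp0\<close> and share it after all.\<close>
  have "\<exists>w1\<in>I. \<exists>w2\<in>S - I. \<exists>sg. u \<in> set sg \<and> v \<in> set sg \<and> ?e w1 sg ~= 0 \<and> ?e w2 sg ~= 0"
  proof (rule ccontr)
   assume ns: "\<not> ?thesis"
   define y where "y = (\<lambda>tp. \<Sum>w\<in>I. ?e w tp)"
   have finI: "finite I" using IS(1) S(1) finite_subset by blast
   have zy: "z tp = y tp + (\<Sum>w\<in>S - I. ?e w tp)" for tp
    unfolding zsum y_def using sum.subset_diff[OF IS(1) S(1), of "\<lambda>w. ?e w tp"] by (simp add: add.commute)
   have yc: "y \<in> cycles d V" unfolding y_def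
    by (rule subspace_fun_sum[OF subspace_cycles finI]) (use IS(1) ea ec in \<open>auto simp: cycles_def\<close>)
   have "supp y \<subseteq> supp z"
   proof
    fix sg assume "sg \<in> supp y"
    then have y0: "y sg ~= 0" by (simp add: supp_def)
    then obtain w1 where w1: "w1 \<in> I" "?e w1 sg ~= 0" unfolding y_def by (meson sum.neutral)
    show "sg \<in> supp z"
    proof (cases "u \<in> set sg \<and> v \<in> set sg")
     case True
     then have "?e w2 sg = 0" if "w2 \<in> S - I" for w2 using ns w1 that by blast
     then have "(\<Sum>w\<in>S - I. ?e w sg) = 0" by (intro sum.neutral) blast
     then show ?thesis using zy[of sg] y0 by (simp add: supp_def)
    next
     case False
     have "w1 sg ~= 0" using w1(2) unfolding en[OF False] .
     then have "sg \<in> supp w1" by (simp add: supp_def)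
     then show ?thesis by (rule subsetD[OF wN(2)[OF subsetD[OF IS(1) w1(1)]]])
    qed
   qed
   from minimal_cycle_proportional[OF less.prems yc this] obtain c where "\<forall>tp. y tp = c * z tp" ..
   then have c: "y tp = c * z tp" for tp by (rule spec)
   have nonuv: "(\<Sum>w\<in>I'. ?e w tp) ~= 0" if I': "I' \<subseteq> S" "(\<Sum>w\<in>I'. w tp) ~= 0" for I' tp
   proof -
    obtain w where w: "w \<in> I'" "w tp ~= 0" using sum.not_neutral_contains_not_neutral[OF I'(2)] by blast
    have "tp \<in> supp w" using w(2) by (simp add: supp_def)
    then have n: "\<not> (u \<in> set tp \<and> v \<in> set tp)" by (rule bspec[OF wN(3)[OF subsetD[OF I'(1) w(1)]]])
    show ?thesis using I'(2) by (simp only: en[OF n]) simp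
   qed
   obtain tp1 where t1: "(\<Sum>w\<in>I. w tp1) ~= 0" using S(5)[OF IS(1,2)] by blast
   have "y tp1 ~= 0" unfolding y_def by (rule nonuv[OF IS(1) t1])
   then have c0: "c ~= 0" using c[of tp1] by auto
   have "S - I ~= {}" using IS(1) IneS by blast
   then obtain tp2 where t2: "(\<Sum>w\<in>S - I. w tp2) ~= 0" using S(5)[of "S - I"] by blast
   have "(\<Sum>w\<in>S - I. ?e w tp2) ~= 0" by (rule nonuv[OF _ t2]) blast
   then have "c ~= 1" using zy[of tp2] c[of tp2] by auto
   have "y tp0 ~= 0" using c[of tp0] c0 t0 by simp
   then obtain w1 where w1: "w1 \<in> I" "?e w1 tp0 ~= 0" unfolding y_def by (meson sum.neutral)
   have "(\<Sum>w\<in>S - I. ?e w tp0) = (1 - c) * z tp0" using zy[of tp0] c[of tp0] by (simp add: algebra_simps)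
   then have "(\<Sum>w\<in>S - I. ?e w tp0) ~= 0" using \<open>c ~= 1\<close> t0 by simp
   then obtain w2 where "w2 \<in> S - I" "?e w2 tp0 ~= 0" by (meson sum.neutral)
   with w1 ns uv0 show False by blast
  qed
  then obtain w1 w2 sg where w12: "w1 \<in> I" "w2 \<in> S - I" "u \<in> set sg" "v \<in> set sg" "?e w1 sg ~= 0" "?e w2 sg ~= 0"
   by blast
  have "set sg \<subseteq> Y w1" "set sg \<subseteq> Y w2" using uvY w12 by blast+
  then have sub: "set sg \<subseteq> (\<Union>w\<in>I. Y w) \<inter> Y w2" using w12(1) by blast
  have VV: "(\<Union>w\<in>I. Y w) \<subseteq> V" "Y w2 \<subseteq> V" using YV zV IS(1) w12(2) by blast+
  have w2S: "w2 \<in> S" using w12(2) by blast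
  have "card (set sg) = d" using alternatingD(1)[OF ea[OF w2S] w12(6)] distinct_card[OF alternatingD(3)[OF ea[OF w2S] w12(6)]] by simp
  then have "CARD('n) \<le> card ((\<Union>w\<in>I. Y w) \<inter> Y w2)"
  proof -
   have "finite ((\<Union>w\<in>I. Y w) \<inter> Y w2)" using finite_subset[OF VV(2) fin] by blast
   from card_mono[OF this sub] show ?thesis using \<open>card (set sg) = d\<close> d(1) by simp
  qed
  from generically_inf_rigid_Un[OF fin VV this IS(3) member[OF w2S]]
  have "?GR (\<Union>w\<in>insert w2 I. Y w)" by (simp add: Un_commute)
  then have "insert w2 I \<in> Q" using IS w2S by (simp add: Q_def)
  then have "I = insert w2 I" by (rule I(2)) blast
  then show False using w12(2) by blast
 qed
 moreover have "(\<Union>w\<in>S. Y w) = chain_verts z"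
 proof (rule equalityI)
  show "(\<Union>w\<in>S. Y w) \<subseteq> chain_verts z" using YV by blast
  show "chain_verts z \<subseteq> (\<Union>w\<in>S. Y w)"
  proof
   fix x assume "x \<in> chain_verts z"
   then obtain tp where t: "z tp ~= 0" "x \<in> set tp" by (auto simp: chain_verts_def supp_def)
   then obtain w where w: "w \<in> S" "?e w tp ~= 0" unfolding zsum by (meson sum.neutral)
   show "x \<in> (\<Union>w\<in>S. Y w)"
   proof (cases "u \<in> set tp \<and> v \<in> set tp")
    case True
    then show ?thesis using uvY[of tp w] w t(2) by blast
   next
    case False
    have "w tp ~= 0" using w(2) unfolding en[OF False] .
    then have "x \<in> chain_verts w" using t(2) by (auto simp: chain_verts_def supp_def)
    then show ?thesis using w(1) by (auto simp: Y_def)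
   qed
  qed
 qed
 ultimately show ?case using IS(3) by simp
qed

section \<open>Linear extension of maps between bases\<close>

abbreviation "lkp \<equiv> Poly_Mapping.lookup"
abbreviation "kys \<equiv> Poly_Mapping.keys"
abbreviation "sgl \<equiv> Poly_Mapping.single"

definition scl :: "'k::field => ('a \<Rightarrow>\<^sub>0 'k) => 'a \<Rightarrow>\<^sub>0 'k" where
 "scl a c = Poly_Mapping.map ((*) a) c"

definition kext :: "('a => 'b \<Rightarrow>\<^sub>0 'k::field) => ('a \<Rightarrow>\<^sub>0 'k) => 'b \<Rightarrow>\<^sub>0 'k" where
 "kext f c = (\<Sum>x\<in>kys c. scl (lkp c x) (f x))"

definition emb :: "('a \<Rightarrow>\<^sub>0 int) => 'a \<Rightarrow>\<^sub>0 'k::field" where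
 "emb c = Poly_Mapping.map of_int c"

lemma lookup_scl [simp]: "lkp (scl a c) x = a * lkp c x"
 by (simp add: scl_def Poly_Mapping.map.rep_eq when_def)

lemma lookup_emb [simp]: "lkp (emb c) x = of_int (lkp c x)"
 by (simp add: emb_def Poly_Mapping.map.rep_eq when_def)

lemma lookup_kext: "lkp (kext f c) y = (\<Sum>x\<in>kys c. lkp c x * lkp (f x) y)"
 by (simp add: kext_def lookup_sum)

lemma lookup_kext_superset:
 assumes "finite S" "kys c \<subseteq> S"
 shows "lkp (kext f c) y = (\<Sum>x\<in>S. lkp c x * lkp (f x) y)"
 unfolding lookup_kext by (rule sum.mono_neutral_left) (use assms in \<open>auto simp: in_keys_iff\<close>)

lemma kext_add: "kext f (a + b) = kext f a + kext f b"
proof (rule poly_mapping_eqI)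
 fix y
 let ?S = "kys a \<union> kys b"
 have k: "kys (a + b) \<subseteq> ?S" by (rule keys_add)
 have "lkp (kext f (a + b)) y = (\<Sum>x\<in>?S. lkp (a + b) x * lkp (f x) y)"
  by (rule lookup_kext_superset) (use k in auto)
 also have "\<dots> = (\<Sum>x\<in>?S. lkp a x * lkp (f x) y) + (\<Sum>x\<in>?S. lkp b x * lkp (f x) y)"
  by (simp add: lookup_add distrib_right sum.distrib)
 also have "(\<Sum>x\<in>?S. lkp a x * lkp (f x) y) = lkp (kext f a) y" by (rule lookup_kext_superset[symmetric]) auto
 also have "(\<Sum>x\<in>?S. lkp b x * lkp (f x) y) = lkp (kext f b) y" by (rule lookup_kext_superset[symmetric]) auto
 finally show "lkp (kext f (a + b)) y = lkp (kext f a + kext f b) y" by (simp add: lookup_add)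
qed

lemma kext_scl: "kext f (scl r a) = scl r (kext f a)"
proof (rule poly_mapping_eqI)
 fix y
 have "kys (scl r a) \<subseteq> kys a" by (auto simp: in_keys_iff)
 then have "lkp (kext f (scl r a)) y = (\<Sum>x\<in>kys a. lkp (scl r a) x * lkp (f x) y)"
  by (intro lookup_kext_superset) auto
 then show "lkp (kext f (scl r a)) y = lkp (scl r (kext f a)) y"
  by (simp add: lookup_kext sum_distrib_left mult.assoc)
qed

lemma scl_simps: "scl 1 c = c" "scl 0 c = 0" "scl r 0 = 0" "scl r (scl s c) = scl (r * s) c"
 "scl r (a + b) = scl r a + scl r b" "scl r (a - b) = scl r a - scl r b" "scl (-1) c = - c"
 "scl (r + s) c = scl r c + scl s c" "scl r (sgl x s) = sgl x (r * s)"
 by (rule poly_mapping_eqI; simp add: lookup_add lookup_minus algebra_simps lookup_single when_def)+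

lemma scl_sum: "scl r (\<Sum>i\<in>I. f i) = (\<Sum>i\<in>I. scl r (f i))"
 by (rule poly_mapping_eqI) (simp add: lookup_sum sum_distrib_left)

lemma kext_0 [simp]: "kext f 0 = 0"
 by (simp add: kext_def)

lemma kext_single [simp]: "kext f (sgl x a) = scl a (f x)"
 by (cases "a = 0") (simp_all add: kext_def scl_simps)

lemma kext_uminus: "kext f (- a) = - kext f a"
 using kext_scl[of f "-1" a] by (simp add: scl_simps)

lemma kext_diff: "kext f (a - b) = kext f a - kext f b"
 using kext_add[of f a "- b"] by (simp add: kext_uminus)

lemma kext_sum: "kext f (\<Sum>i\<in>I. g i) = (\<Sum>i\<in>I. kext f (g i))"
 by (induction I rule: infinite_finite_induct) (simp_all add: kext_add)

lemma kext_kext: "kext g (kext f c) = kext (\<lambda>x. kext g (f x)) c"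
 unfolding kext_def[of f] kext_def[of "\<lambda>x. kext g (f x)"] by (simp add: kext_sum kext_scl)

lemma kext_cong: "(!!x. x \<in> kys c ==> f x = g x) ==> kext f c = kext g c"
 unfolding kext_def by (rule sum.cong) auto

lemma kext_fun_add: "kext (\<lambda>x. f x + g x) c = kext f c + kext g c"
 by (simp add: kext_def scl_simps sum.distrib)

lemma kext_fun_diff: "kext (\<lambda>x. f x - g x) c = kext f c - kext g c"
 by (simp add: kext_def scl_simps sum_subtractf)

lemma kext_ident: "kext (\<lambda>x. sgl x 1) c = c"
proof (rule poly_mapping_eqI)
 fix y show "lkp (kext (\<lambda>x. sgl x 1) c) y = lkp c y"
  by (simp add: lookup_kext lookup_single when_def if_distrib[of "\<lambda>u. _ * u"] in_keys_iff cong: if_cong)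
qed

lemma keys_kext: "kys (kext f c) \<subseteq> (\<Union>x\<in>kys c. kys (f x))"
proof
 fix y assume "y \<in> kys (kext f c)"
 then have "(\<Sum>x\<in>kys c. lkp c x * lkp (f x) y) ~= 0" by (simp only: in_keys_iff lookup_kext not_False_eq_True)
 from sum.not_neutral_contains_not_neutral[OF this] obtain x where "x \<in> kys c" "lkp c x * lkp (f x) y ~= 0" .
 then show "y \<in> (\<Union>x\<in>kys c. kys (f x))"
  by (intro UN_I[of x]) (simp_all add: in_keys_iff)
qed

lemma keys_kextE:
 assumes "y \<in> kys (kext f c)"
 obtains x where "x \<in> kys c" "y \<in> kys (f x)"
proof -
 have "y \<in> (\<Union>x\<in>kys c. kys (f x))" by (rule subsetD[OF keys_kext assms])
 then show ?thesis using that by (rule UN_E)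
qed

lemma poly_mapping_expand: "(\<Sum>x\<in>kys c. sgl x (lkp c x)) = c"
 for c :: "'a \<Rightarrow>\<^sub>0 'k::field"
 using kext_ident[of c] unfolding kext_def by (simp only: scl_simps mult_1_right)

lemma mult_expand: "p * q = (\<Sum>x\<in>kys p. \<Sum>y\<in>kys q. sgl (x + y) (lkp p x * lkp q y))"
 for p q :: "'a::comm_monoid_add \<Rightarrow>\<^sub>0 'k::field"
proof -
 have "p * q = (\<Sum>x\<in>kys p. sgl x (lkp p x)) * (\<Sum>y\<in>kys q. sgl y (lkp q y))"
  by (simp only: poly_mapping_expand)
 also have "\<dots> = (\<Sum>x\<in>kys p. \<Sum>y\<in>kys q. sgl (x + y) (lkp p x * lkp q y))"
  by (simp only: sum_product mult_single)
 finally show ?thesis .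
qed

lemma scl_eq_mult: "scl a u = sgl 0 a * u"
 for u :: "'a::comm_monoid_add \<Rightarrow>\<^sub>0 'k::field"
 unfolding scl_def by (rule mult_map_scale_conv_mult)

lemma scl_mult_scl: "scl a u * scl b v = scl (a * b) (u * v)"
 for u v :: "'a::comm_monoid_add \<Rightarrow>\<^sub>0 'k::field"
proof -
 have "sgl 0 (a * b) = sgl (0::'a) a * sgl 0 b"
  by (simp add: mult_single)
 then show ?thesis unfolding scl_eq_mult by (simp only: mult_ac)
qed

lemma kext_mult:
 fixes f :: "'a::comm_monoid_add => 'b::comm_monoid_add \<Rightarrow>\<^sub>0 'k::field"
 assumes "!!x y. f (x + y) = f x * f y"
 shows "kext f (p * q) = kext f p * kext f q"
proof -
 have "kext f (p * q) = (\<Sum>x\<in>kys p. \<Sum>y\<in>kys q. scl (lkp p x) (f x) * scl (lkp q y) (f y))"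
  by (simp only: mult_expand[of p q] kext_sum kext_single assms scl_mult_scl)
 also have "\<dots> = kext f p * kext f q" by (simp only: kext_def sum_product)
 finally show ?thesis .
qed

lemma lookup_times_single:
 fixes p :: "('v \<Rightarrow>\<^sub>0 nat) \<Rightarrow>\<^sub>0 'k::field"
 shows "lkp (p * sgl m c) (k + m) = lkp p k * c"
  and "(!!a. k' ~= a + m) ==> lkp (p * sgl m c) k' = 0"
proof -
 have *: "lkp (p * sgl m c) k = (\<Sum>x\<in>kys p. if x + m = k then lkp p x * c else 0)" for k
 proof (cases "c = 0")
  case True
  then have "(\<Sum>x\<in>kys p. if x + m = k then lkp p x * c else 0) = 0"
   by (intro sum.neutral) auto
  then show ?thesis using True by simp
 next
  case False
  have "kys (sgl m c) = {m}" using False by simp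
  then have "lkp (p * sgl m c) k = (\<Sum>x\<in>kys p. lkp (sgl (x + m) (lkp p x * c)) k)"
   unfolding mult_expand[of p "sgl m c"] lookup_sum by (simp only: lookup_single_eq sum.insert finite.emptyI empty_iff not_False_eq_True sum.empty add_0_right)
  then show ?thesis by (simp only: lookup_single when_def)
 qed
 have "lkp (p * sgl m c) (k + m) = (\<Sum>x\<in>kys p. if x = k then lkp p x * c else 0)"
  unfolding * by (intro sum.cong) auto
 also have "\<dots> = lkp p k * c" by (simp add: in_keys_iff)
 finally show "lkp (p * sgl m c) (k + m) = lkp p k * c" .
 assume "!!a. k' ~= a + m"
 then show "lkp (p * sgl m c) k' = 0" unfolding * by (intro sum.neutral) auto
qed

lemma emb_simps: "emb 0 = 0" "emb (a + b) = emb a + emb b" "emb (a - b) = emb a - emb b"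
 "emb (frag_of x) = sgl x 1" "emb (frag_cmul n a) = scl (of_int n) (emb a)" "emb (- a) = - emb a"
 by (rule poly_mapping_eqI; simp add: lookup_add lookup_minus lookup_single when_def)+

lemma emb_sum: "emb (\<Sum>i\<in>I. f i) = (\<Sum>i\<in>I. emb (f i))"
 by (induction I rule: infinite_finite_induct) (simp_all add: emb_simps)

lemma keys_emb: "kys (emb c) \<subseteq> kys c"
 by (auto simp: in_keys_iff)

text \<open>Lets additive operators on integral chains act over the field: on images of integral
  chains, linear extension from the generators gives the same result.\<close>

lemma kext_emb:
 assumes "!!a b. T (a - b) = T a - (T b :: 'b \<Rightarrow>\<^sub>0 int)"
 shows "kext (\<lambda>x. emb (T (frag_of x))) (emb c) = emb (T c)"
proof -
 have T0: "T 0 = 0" using assms[of 0 0] by simp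
 have "kys c \<subseteq> UNIV" by simp
 then show ?thesis
  by (induction c rule: frag_induction) (simp_all add: T0 emb_simps kext_diff assms scl_simps)
qed

section \<open>Polynomials modulo a face ideal\<close>

type_synonym ('v, 'k) mpoly = "('v \<Rightarrow>\<^sub>0 nat) \<Rightarrow>\<^sub>0 'k"

text \<open>An ideal in the polynomials over all variables of the type. A variable that is not a
  vertex belongs to it, so the quotient is still the face ring.\<close>

definition nonface_ideal :: "'v set set => ('v, 'k::field) mpoly set" where
 "nonface_ideal \<Delta> = {p. \<forall>m\<in>kys p. kys m \<notin> \<Delta>}"

text \<open>Ideals of a type-class ring, which keeps the polynomial computations free of carrier
  sets.\<close>

definition pideal :: "'a::comm_ring_1 set => bool" where
 "pideal J \<longleftrightarrow> 0 \<in> J \<and> (\<forall>p\<in>J. \<forall>q\<in>J. p + q \<in> J) \<and> (\<forall>p\<in>J. \<forall>r. r * p \<in> J)"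

definition square_exponent :: "'v set => 'v \<Rightarrow>\<^sub>0 nat" where
 "square_exponent F = (\<Sum>v\<in>F. sgl v 1)"

definition face_sum :: "'v set set => nat => ('v, 'k::field) mpoly" where
 "face_sum \<Delta> j = (\<Sum>F | F \<in> \<Delta> \<and> card F = j. squarefree_monomial F)"

lemma pidealD:
 assumes "pideal J"
 shows "0 \<in> J" "p \<in> J ==> q \<in> J ==> p + q \<in> J" "p \<in> J ==> r * p \<in> J" "p \<in> J ==> p * r \<in> J"
  "p \<in> J ==> - p \<in> J" "p \<in> J ==> q \<in> J ==> p - q \<in> J"
proof -
 show "0 \<in> J" and A: "!!p q. p \<in> J ==> q \<in> J ==> p + q \<in> J" and B: "!!p r. p \<in> J ==> r * p \<in> J"
  using assms unfolding pideal_def by auto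
 show "p \<in> J ==> p * r \<in> J" using B[of p r] by (simp only: mult.commute)
 show C: "- p \<in> J" if "p \<in> J" for p using B[OF that, of "-1"] by simp
 show "p \<in> J ==> q \<in> J ==> p - q \<in> J" using A[of p "- q"] C[of q] by simp
qed

lemma pideal_sum: "pideal J ==> (!!i. i \<in> I ==> f i \<in> J) ==> (\<Sum>i\<in>I. f i) \<in> J"
 by (induction I rule: infinite_finite_induct) (auto intro: pidealD)

lemma keys_add_nat: "kys (m + n) = kys m \<union> kys n" for m n :: "'v \<Rightarrow>\<^sub>0 nat"
 by (auto simp: in_keys_iff lookup_add)

lemma exponent_sum_0: "x + y = 0 \<longleftrightarrow> x = 0 \<and> y = 0" for x y :: "'v \<Rightarrow>\<^sub>0 nat"
 by (metis keys_add_nat keys_eq_empty Un_empty)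

lemma lookup_prod_0: "lkp (p * q) 0 = lkp p 0 * lkp q 0" for p q :: "('v, 'k::field) mpoly"
proof -
 have "lkp (p * q) 0 = (\<Sum>x\<in>kys p. \<Sum>y\<in>kys q. (if x = 0 then lkp p x else 0) * (if y = 0 then lkp q y else 0))"
  unfolding mult_expand[of p q] lookup_sum lookup_single
  by (intro sum.cong refl) (auto simp: when_def exponent_sum_0)
 also have "\<dots> = (\<Sum>x\<in>kys p. (if x = 0 then lkp p x else 0)) * (\<Sum>y\<in>kys q. (if y = 0 then lkp q y else 0))"
  by (simp only: sum_product)
 also have "\<dots> = lkp p 0 * lkp q 0" by (simp add: in_keys_iff)
 finally show ?thesis .
qed

lemma lookup_power_0: "lkp (p ^ n) 0 = lkp p 0 ^ n" for p :: "('v, 'k::field) mpoly"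
 by (induction n) (simp_all add: lookup_prod_0 lookup_one)

lemma pideal_nonface_ideal:
 assumes "abstract_simplicial_complex \<Delta>"
 shows "pideal (nonface_ideal \<Delta> :: ('v, 'k::field) mpoly set)"
 unfolding pideal_def nonface_ideal_def
proof (intro conjI ballI allI CollectI)
 fix p q :: "('v, 'k) mpoly" and m assume "p \<in> {p. \<forall>m\<in>kys p. kys m \<notin> \<Delta>}" "q \<in> {p. \<forall>m\<in>kys p. kys m \<notin> \<Delta>}" "m \<in> kys (p + q)"
 then show "kys m \<notin> \<Delta>" using keys_add[of p q] by blast
next
 fix p r :: "('v, 'k) mpoly" and m assume p: "p \<in> {p. \<forall>m\<in>kys p. kys m \<notin> \<Delta>}" and m: "m \<in> kys (r * p)"
 obtain a b where "b \<in> kys p" "m = a + b" using m keys_mult[of r p] by blast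
 then have "kys b \<notin> \<Delta>" "kys b \<subseteq> kys m" using p by (auto simp: keys_add_nat)
 then show "kys m \<notin> \<Delta>" using assms unfolding abstract_simplicial_complex_def by blast
qed simp

lemma keys_square_exponent: "finite F ==> kys (square_exponent F) = F"
 and lookup_square_exponent: "finite F ==> lkp (square_exponent F) v = (if v \<in> F then 1 else 0)"
proof -
 show *: "lkp (square_exponent F) v = (if v \<in> F then 1 else 0)" if "finite F" for v
  using that by (simp add: square_exponent_def lookup_sum lookup_single when_def)
 show "kys (square_exponent F) = F" if f: "finite F"
 proof (rule Set.set_eqI)
  fix v show "v \<in> kys (square_exponent F) \<longleftrightarrow> v \<in> F"
   by (cases "v \<in> F") (simp_all only: in_keys_iff *[OF f] if_True if_False, simp_all)
 qed
qed

lemma squarefree_monomial_eq: "squarefree_monomial F = sgl (square_exponent F) 1"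
 by (simp add: squarefree_monomial_def square_exponent_def)

definition pradical :: "'a::comm_ring_1 set => 'a set" where
 "pradical J = {p. \<exists>n. p ^ n \<in> J}"

lemma pideal_pradical:
 assumes J: "pideal J"
 shows "pideal (pradical J)"
 unfolding pideal_def pradical_def
proof (intro conjI ballI allI CollectI)
 show "\<exists>n. 0 ^ n \<in> J" by (rule exI[of _ 1]) (simp add: pidealD(1)[OF J])
next
 fix p q assume "p \<in> {p. \<exists>n. p ^ n \<in> J}" "q \<in> {p. \<exists>n. p ^ n \<in> J}"
 then obtain i j where i: "p ^ i \<in> J" and j: "q ^ j \<in> J" by auto
 have "of_nat (i + j choose k) * p ^ k * q ^ (i + j - k) \<in> J" if "k \<le> i + j" for k
 proof (cases "i \<le> k")
  case True
  then have "p ^ k = p ^ (k - i) * p ^ i" by (simp flip: power_add)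
  then have "of_nat (i + j choose k) * p ^ k * q ^ (i + j - k) = (of_nat (i + j choose k) * q ^ (i + j - k) * p ^ (k - i)) * p ^ i"
   by (simp only: mult_ac)
  then show ?thesis using pidealD(3)[OF J i] by simp
 next
  case False
  then have "q ^ (i + j - k) = q ^ (i - k) * q ^ j" by (simp flip: power_add)
  then have "of_nat (i + j choose k) * p ^ k * q ^ (i + j - k) = (of_nat (i + j choose k) * p ^ k * q ^ (i - k)) * q ^ j"
   by (simp only: mult_ac)
  then show ?thesis using pidealD(3)[OF J j] by simp
 qed
 then have "(p + q) ^ (i + j) \<in> J" unfolding binomial_ring by (intro pideal_sum[OF J]) auto
 then show "\<exists>n. (p + q) ^ n \<in> J" by blast
next
 fix p r assume "p \<in> {p. \<exists>n. p ^ n \<in> J}"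
 then obtain i where "p ^ i \<in> J" by auto
 then have "(r * p) ^ i \<in> J" by (simp add: power_mult_distrib pidealD[OF J])
 then show "\<exists>n. (r * p) ^ n \<in> J" by blast
qed

lemma subset_pradical: "J \<subseteq> pradical J"
 unfolding pradical_def by (auto intro: exI[of _ "Suc 0"])

text \<open>Monomials are treated by decreasing size of their support \<open>F\<close>. In the
  product of the squarefree monomial of \<open>F\<close> with the face sum of degree
  \<open>card F\<close>, all terms except the square of that monomial have larger support, so the
  square lies in the radical too.\<close>

lemma face_sums_radical:
 fixes J :: "('v, 'k::field) mpoly set"
 assumes cx: "abstract_simplicial_complex \<Delta>" and J: "pideal J" and sub: "nonface_ideal \<Delta> \<subseteq> J"
  and dim: "!!F. F \<in> \<Delta> ==> card F \<le> d" and e: "!!j. 1 \<le> j ==> j \<le> d ==> face_sum \<Delta> j \<in> J"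
  and p0: "lkp p 0 = 0"
 shows "p \<in> pradical J"
proof -
 note R = pidealD[OF pideal_pradical[OF J]]
 have finD: "finite \<Delta>" "!!F. F \<in> \<Delta> ==> finite F" using cx by (auto simp: abstract_simplicial_complex_def)
 have mono: "sgl m c \<in> pradical J" if "kys m ~= {}" for m c
  using that
 proof (induction "Suc d - card (kys m)" arbitrary: m c rule: less_induct)
  case less
  show ?case
  proof (cases "kys m \<in> \<Delta>")
   case False
   then have "sgl m c \<in> nonface_ideal \<Delta>" by (auto simp: nonface_ideal_def split: if_splits)
   then show ?thesis using sub subset_pradical by blast
  next
   case True
   define F where "F = kys m"
   define S where "S = {G. G \<in> \<Delta> \<and> card G = card F}"
   have fF: "finite F" by (simp add: F_def)
   have FS: "F \<in> S" "finite S" using True finD by (auto simp: S_def F_def)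
   let ?x = "squarefree_monomial :: 'v set => ('v, 'k) mpoly"
   have cF: "1 \<le> card F" "card F \<le> d" using less.prems fF True dim by (auto simp: F_def Suc_le_eq card_gt_0_iff)
   have "?x F * ?x G \<in> pradical J" if "G \<in> S - {F}" for G
   proof -
    have fG: "finite G" using that finD by (auto simp: S_def)
    have "\<not> G \<subseteq> F" using that fF fG card_subset_eq[of F G] by (auto simp: S_def)
    then have "F \<subset> F \<union> G" by auto
    then have lt: "card F < card (F \<union> G)" using fF fG by (intro psubset_card_mono) auto
    have k: "kys (square_exponent F + square_exponent G) = F \<union> G" by (simp only: keys_add_nat keys_square_exponent[OF fF] keys_square_exponent[OF fG])
    have "sgl (square_exponent F + square_exponent G) (1::'k) \<in> pradical J"
    proof (rule less.hyps)
     show "Suc d - card (kys (square_exponent F + square_exponent G)) < Suc d - card (kys m)"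
      unfolding k using lt cF unfolding F_def by linarith
     show "kys (square_exponent F + square_exponent G) ~= {}" unfolding k using less.prems F_def by simp
    qed
    then show ?thesis by (simp only: squarefree_monomial_eq mult_single mult_1_right)
   qed
   then have "(\<Sum>G\<in>S - {F}. ?x F * ?x G) \<in> pradical J" by (intro pideal_sum[OF pideal_pradical[OF J]])
   moreover have "?x F * face_sum \<Delta> (card F) \<in> pradical J"
    using pidealD(3)[OF J e[OF cF], of "?x F"] subset_pradical by blast
   moreover have "?x F * face_sum \<Delta> (card F) = ?x F * ?x F + (\<Sum>G\<in>S - {F}. ?x F * ?x G)"
    unfolding face_sum_def S_def[symmetric] sum_distrib_left by (rule sum.remove[OF FS(2) FS(1)])
   ultimately have "?x F * ?x F \<in> pradical J" using R(6) by (metis add_diff_cancel_right')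
   then obtain n where "(?x F * ?x F) ^ n \<in> J" by (auto simp: pradical_def)
   then have "?x F ^ (2 * n) \<in> J" by (simp add: power_mult power2_eq_square)
   then have xF: "?x F \<in> pradical J" by (auto simp: pradical_def)
   have "m = (m - square_exponent F) + square_exponent F"
   proof (rule poly_mapping_eqI)
    fix v show "lkp m v = lkp (m - square_exponent F + square_exponent F) v"
     using fF by (auto simp: lookup_add lookup_minus lookup_square_exponent F_def in_keys_iff)
   qed
   then have "sgl m c = sgl (m - square_exponent F) c * ?x F"
    by (simp only: squarefree_monomial_eq mult_single mult_1_right)
   then show ?thesis using R(3)[OF xF] by simp
  qed
 qed
 have "(\<Sum>m\<in>kys p. sgl m (lkp p m)) \<in> pradical J"
 proof (rule pideal_sum[OF pideal_pradical[OF J]])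
  fix m assume "m \<in> kys p"
  then have "m ~= 0" using p0 by (auto simp: in_keys_iff)
  then show "sgl m (lkp p m) \<in> pradical J" by (intro mono) auto
 qed
 then show ?thesis by (simp only: poly_mapping_expand)
qed

subsection \<open>Algebraic independence along chains of primes\<close>

fun list_power :: "'a::comm_ring_1 list => nat list => 'a" where
 "list_power (p # ps) (j # js) = p ^ j * list_power ps js"
| "list_power _ _ = 1"

abbreviation exponent_lists :: "nat => nat => nat list set" where
 "exponent_lists n N \<equiv> {js. length js = n \<and> set js \<subseteq> {..<N}}"

text \<open>Sort a relation by powers of the first element \<open>p\<close>. The coefficients
  \<open>g j\<close> fall into \<open>Q 1\<close> one after another: the lower ones are already
  zero, the factor \<open>p ^ j\<close> is outside the prime \<open>Q 0\<close> and cancels, and the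
  terms above \<open>j\<close> are multiples of \<open>p\<close>. Then the rest of the chain applies
  to each \<open>g j\<close>.\<close>

lemma prime_chain_independent:
 fixes Q :: "nat => ('v, 'k::field) mpoly set"
 assumes "!!i. i \<le> length ps ==> pideal (Q i)"
  and "!!i p q. i \<le> length ps ==> p * q \<in> Q i ==> p \<in> Q i \<or> q \<in> Q i"
  and "!!i. i < length ps ==> Q i \<subseteq> Q (Suc i) \<and> ps ! i \<in> Q (Suc i) - Q i"
  and "1 \<notin> Q (length ps)"
  and "(\<Sum>js\<in>exponent_lists (length ps) N. scl (a js) (list_power ps js)) \<in> Q 0"
  and "js \<in> exponent_lists (length ps) N"
 shows "a js = 0"
 using assms
proof (induction ps arbitrary: Q a js)
 case Nil
 have "exponent_lists 0 N = {[]}" by auto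
 then have m: "scl (a []) 1 \<in> Q 0" using Nil.prems(5) by simp
 show ?case
 proof (rule ccontr)
  assume "a js ~= 0"
  then have "a [] ~= 0" using Nil.prems(6) by simp
  then have "(1 :: ('v, 'k) mpoly) = scl (1 / a []) (scl (a []) 1)" by (simp add: scl_simps)
  also have "\<dots> \<in> Q 0" unfolding scl_eq_mult[of "1 / a []"] using Nil.prems(1)[of 0] m by (intro pidealD(3)) auto
  finally show False using Nil.prems(4) by simp
 qed
next
 case (Cons p ps)
 let ?T = "exponent_lists (length ps) N"
 define g where "g j = (\<Sum>js\<in>?T. scl (a (j # js)) (list_power ps js))" for j
 have Q0: "pideal (Q 0)" and Q1: "pideal (Q 1)" using Cons.prems(1)[of 0] Cons.prems(1)[of 1] by auto
 have p01: "Q 0 \<subseteq> Q 1" "p \<in> Q 1" "p \<notin> Q 0" using Cons.prems(3)[of 0] by auto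
 have IHg: "a (j # js) = 0" if "g j \<in> Q 1" "js \<in> ?T" for j js
  by (rule Cons.IH[of "\<lambda>i. Q (Suc i)" "\<lambda>js. a (j # js)" js])
   (use Cons.prems(1)[of "Suc _"] Cons.prems(2)[of "Suc _"] Cons.prems(3)[of "Suc _"] Cons.prems(4) that in \<open>auto simp: g_def\<close>)
 have E: "exponent_lists (length (p # ps)) N = (\<lambda>(j, js). j # js) ` ({..<N} \<times> ?T)"
 proof (rule Set.set_eqI)
  fix l show "l \<in> exponent_lists (length (p # ps)) N \<longleftrightarrow> l \<in> (\<lambda>(j, js). j # js) ` ({..<N} \<times> ?T)"
   by (cases l) auto
 qed
 have inj: "inj_on (\<lambda>(j, js). j # js) ({..<N} \<times> ?T)" by (auto simp: inj_on_def)
 have "(\<Sum>js\<in>exponent_lists (length (p # ps)) N. scl (a js) (list_power (p # ps) js))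
   = (\<Sum>j<N. \<Sum>js\<in>?T. scl (a (j # js)) (p ^ j * list_power ps js))"
  unfolding E sum.reindex[OF inj] by (simp add: sum.cartesian_product split_def)
 also have "\<dots> = (\<Sum>j<N. p ^ j * g j)"
  by (simp add: g_def sum_distrib_left scl_eq_mult mult_ac)
 finally have tot: "(\<Sum>j<N. p ^ j * g j) \<in> Q 0" using Cons.prems(5) by simp
 have one: "1 \<notin> Q 0"
 proof
  assume "1 \<in> Q 0"
  then have "p \<in> Q 0" using pidealD(3)[OF Q0, of 1 p] by simp
  then show False using p01 by simp
 qed
 have pow: "p ^ j \<notin> Q 0" for j
  by (induction j) (use one p01 Cons.prems(2)[of 0 p] in auto)
 have "j < N --> g j \<in> Q 1" for j
 proof (induction j rule: less_induct)
  case (less j)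
  show ?case
  proof
   assume jN: "j < N"
   have z: "g i = 0" if "i < j" for i
   proof -
    have gi: "g i \<in> Q 1" using less that jN by auto
    have "scl (a (i # js)) (list_power ps js) = 0" if "js \<in> ?T" for js
     using IHg[OF gi that] by (simp only: scl_simps)
    then show ?thesis unfolding g_def[of i] by (intro sum.neutral ballI)
   qed
   have "(\<Sum>i<N. p ^ i * g i) = (\<Sum>i\<in>{j..<N}. p ^ i * g i)"
    by (rule sum.mono_neutral_right) (auto simp: z)
   also have "\<dots> = (\<Sum>i\<in>{j..<N}. p ^ j * (p ^ (i - j) * g i))"
    by (intro sum.cong refl) (simp add: mult.assoc[symmetric] power_add[symmetric])
   also have "\<dots> = p ^ j * (\<Sum>i\<in>{j..<N}. p ^ (i - j) * g i)" by (simp only: sum_distrib_left)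
   finally have "p ^ j * (\<Sum>i\<in>{j..<N}. p ^ (i - j) * g i) \<in> Q 0" using tot by simp
   then have 1: "(\<Sum>i\<in>{j..<N}. p ^ (i - j) * g i) \<in> Q 1"
    using Cons.prems(2)[of 0 "p ^ j"] pow p01 by auto
   have 2: "(\<Sum>i\<in>{j<..<N}. p ^ (i - j) * g i) \<in> Q 1"
   proof (rule pideal_sum[OF Q1])
    fix i assume "i \<in> {j<..<N}"
    then have "p ^ (i - j) * g i = (p ^ (i - j - 1) * g i) * p"
     by (cases "i - j") (auto simp: mult_ac)
    then show "p ^ (i - j) * g i \<in> Q 1" using pidealD(3)[OF Q1 p01(2)] by simp
   qed
   have "{j..<N} = insert j {j<..<N}" using jN by auto
   then have "(\<Sum>i\<in>{j..<N}. p ^ (i - j) * g i) = g j + (\<Sum>i\<in>{j<..<N}. p ^ (i - j) * g i)" by simp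
   then show "g j \<in> Q 1" using pidealD(6)[OF Q1 1 2] by simp
  qed
 qed
 moreover obtain j js' where "js = j # js'" "j < N" "js' \<in> ?T" using Cons.prems(6) by (cases js) auto
 ultimately show ?case using IHg by simp
qed

section \<open>Dependence of power products by counting monomials\<close>

definition exponents_le :: "nat => ('v, 'k::field) mpoly => bool" where
 "exponents_le b p \<longleftrightarrow> (\<forall>m\<in>kys p. \<forall>v. lkp m v \<le> b)"

lemma exponents_le_mult: "exponents_le b p ==> exponents_le c q ==> exponents_le (b + c) (p * q)"
 unfolding exponents_le_def
proof (intro ballI allI)
 fix m v assume *: "\<forall>m\<in>kys p. \<forall>v. lkp m v \<le> b" "\<forall>m\<in>kys q. \<forall>v. lkp m v \<le> c" and "m \<in> kys (p * q)"
 then obtain x y where "x \<in> kys p" "y \<in> kys q" "m = x + y" using keys_mult[of p q] by blast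
 then show "lkp m v \<le> b + c" using * by (simp add: lookup_add add_mono)
qed

lemma exponents_le_one: "exponents_le b 1"
 by (simp add: exponents_le_def keys_one)

lemma exponents_le_power: "exponents_le b p ==> exponents_le (j * b) (p ^ j)"
 by (induction j) (simp_all add: exponents_le_one exponents_le_mult)

lemma exponents_le_list_power:
 assumes "!!p. p \<in> set ps ==> exponents_le D p" "js \<in> exponent_lists (length ps) N"
 shows "exponents_le (length ps * (N * D)) (list_power ps js)"
 using assms
proof (induction ps arbitrary: js)
 case (Cons p ps)
 obtain j js' where j: "js = j # js'" "j < N" "js' \<in> exponent_lists (length ps) N" using Cons.prems(2) by (cases js) auto
 have 1: "exponents_le (j * D) (p ^ j)" using Cons.prems(1) by (intro exponents_le_power) auto
 have "exponents_le (length ps * (N * D)) (list_power ps js')" using Cons j by auto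
 from exponents_le_mult[OF 1 this] have "exponents_le (j * D + length ps * (N * D)) (list_power (p # ps) js)"
  using j by simp
 moreover have "j * D + length ps * (N * D) \<le> length (p # ps) * (N * D)" using j by (simp add: mult_right_mono)
 ultimately show ?case unfolding exponents_le_def using le_trans by blast
qed (simp add: exponents_le_one)

lemma card_bounded_exponents:
 assumes "finite F"
 shows "finite {m :: 'v \<Rightarrow>\<^sub>0 nat. kys m \<subseteq> F \<and> (\<forall>v. lkp m v \<le> b)} \<and>
  card {m :: 'v \<Rightarrow>\<^sub>0 nat. kys m \<subseteq> F \<and> (\<forall>v. lkp m v \<le> b)} \<le> Suc b ^ card F"
proof -
 let ?A = "{m :: 'v \<Rightarrow>\<^sub>0 nat. kys m \<subseteq> F \<and> (\<forall>v. lkp m v \<le> b)}"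
 let ?f = "\<lambda>m :: 'v \<Rightarrow>\<^sub>0 nat. restrict (lkp m) F"
 have inj: "inj_on ?f ?A"
 proof (rule inj_onI)
  fix m n assume m: "m \<in> ?A" "n \<in> ?A" and e: "?f m = ?f n"
  show "m = n"
  proof (rule poly_mapping_eqI)
   fix v
   show "lkp m v = lkp n v"
   proof (cases "v \<in> F")
    case True then show ?thesis using fun_cong[OF e, of v] by simp
   next
    case False
    then have "v \<notin> kys m" "v \<notin> kys n" using m by auto
    then show ?thesis by (simp add: in_keys_iff)
   qed
  qed
 qed
 have sub: "?f ` ?A \<subseteq> (F \<rightarrow>\<^sub>E {..b})" by auto
 have fin: "finite (F \<rightarrow>\<^sub>E {..b})" using assms by (intro finite_PiE) auto
 have "card ?A \<le> card (F \<rightarrow>\<^sub>E {..b})" using card_inj_on_le[OF inj sub fin] .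
 moreover have "card (F \<rightarrow>\<^sub>E {..b}) = Suc b ^ card F" using assms by (simp add: card_PiE)
 ultimately show ?thesis using inj_on_finite[OF inj sub fin] by simp
qed

text \<open>There are \<open>N ^ Suc d\<close> power products with exponents below \<open>N\<close>.
  The face monomials occurring in them have at most \<open>d\<close> variables and exponents of
  order \<open>N\<close>, so their number is at most a constant times \<open>N ^ d\<close>.\<close>

lemma face_polynomials_dependent:
 fixes ps :: "('v, 'k::field) mpoly list"
 assumes cx: "abstract_simplicial_complex \<Delta>" and dim: "!!F. F \<in> \<Delta> ==> card F \<le> d" and len: "length ps = Suc d"
 obtains N a js where "js \<in> exponent_lists (length ps) N" "a js ~= 0"
  "(\<Sum>js\<in>exponent_lists (length ps) N. scl (a js) (list_power ps js)) \<in> nonface_ideal \<Delta>"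
proof -
 have finD: "finite \<Delta>" "!!F. F \<in> \<Delta> ==> finite F" using cx by (auto simp: abstract_simplicial_complex_def)
 have "finite (\<Union>p\<in>set ps. \<Union>m\<in>kys p. lkp m ` kys m)" by auto
 then obtain D0 where D0: "\<forall>x\<in>(\<Union>p\<in>set ps. \<Union>m\<in>kys p. lkp m ` kys m). x \<le> D0" by (meson finite_nat_set_iff_bounded_le)
 define D where "D = Suc D0"
 have D: "exponents_le D p" if "p \<in> set ps" for p
  unfolding exponents_le_def
 proof (intro ballI allI)
  fix m v assume "m \<in> kys p"
  then have "lkp m v \<le> D0" if "v \<in> kys m" using D0 \<open>p \<in> set ps\<close> that by blast
  then show "lkp m v \<le> D" by (cases "v \<in> kys m") (auto simp: D_def in_keys_iff)
 qed
 \<comment> \<open>One more than the constant in the estimate below. \<open>D\<close> is a successor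
   so that \<open>Suc B\<close> is at most twice \<open>Suc d * D * N\<close>.\<close>
 define N where "N = Suc (card \<Delta> * (2 * (Suc d * D)) ^ d)"
 define B where "B = Suc d * (N * D)"
 define Fm where "Fm = (\<Union>F\<in>\<Delta>. {m :: 'v \<Rightarrow>\<^sub>0 nat. kys m \<subseteq> F \<and> (\<forall>v. lkp m v \<le> B)})"
 let ?S = "exponent_lists (length ps) N"
 have finS: "finite ?S" and cardS: "card ?S = N ^ Suc d"
  using finite_lists_length_eq[of "{..<N}" "length ps"] card_lists_length_eq[of "{..<N}" "length ps"] len by (auto simp: conj_commute)
 have finF: "finite Fm" unfolding Fm_def using card_bounded_exponents finD by blast
 have SB: "Suc B \<le> 2 * (Suc d * D) * N" by (simp add: B_def D_def N_def algebra_simps)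
 have "card Fm \<le> (\<Sum>F\<in>\<Delta>. card {m :: 'v \<Rightarrow>\<^sub>0 nat. kys m \<subseteq> F \<and> (\<forall>v. lkp m v \<le> B)})"
  unfolding Fm_def by (rule card_UN_le[OF finD(1)])
 also have "\<dots> \<le> (\<Sum>F\<in>\<Delta>. Suc B ^ d)"
 proof (rule sum_mono)
  fix F assume F: "F \<in> \<Delta>"
  have "card {m :: 'v \<Rightarrow>\<^sub>0 nat. kys m \<subseteq> F \<and> (\<forall>v. lkp m v \<le> B)} \<le> Suc B ^ card F"
   using card_bounded_exponents[OF finD(2)[OF F], of B] by simp
  also have "\<dots> \<le> Suc B ^ d" by (rule power_increasing) (use dim[OF F] in auto)
  finally show "card {m :: 'v \<Rightarrow>\<^sub>0 nat. kys m \<subseteq> F \<and> (\<forall>v. lkp m v \<le> B)} \<le> Suc B ^ d" .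
 qed
 also have "\<dots> = card \<Delta> * Suc B ^ d" by simp
 also have "\<dots> \<le> card \<Delta> * (2 * (Suc d * D) * N) ^ d" using SB by (intro mult_le_mono2 power_mono) auto
 also have "\<dots> = (card \<Delta> * (2 * (Suc d * D)) ^ d) * N ^ d" by (simp only: power_mult_distrib mult.assoc)
 also have "\<dots> < N * N ^ d" unfolding N_def by (intro mult_strict_right_mono) auto
 finally have lt: "card Fm < card ?S" using cardS by simp
 obtain a where a: "\<exists>s\<in>?S. a s ~= 0" "\<forall>l\<in>Fm. (\<Sum>s\<in>?S. a s * lkp (list_power ps s) l) = 0"
  using exists_nontrivial_solution[OF finF finS lt, of "\<lambda>s l. lkp (list_power ps s) l"] by blast
 have "(\<Sum>js\<in>?S. scl (a js) (list_power ps js)) \<in> nonface_ideal \<Delta>"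
  unfolding nonface_ideal_def
 proof (intro CollectI ballI notI)
  fix m assume m: "m \<in> kys (\<Sum>js\<in>?S. scl (a js) (list_power ps js))" and mD: "kys m \<in> \<Delta>"
  then have ne: "(\<Sum>js\<in>?S. a js * lkp (list_power ps js) m) ~= 0" by (simp add: in_keys_iff lookup_sum)
  then obtain js where js: "js \<in> ?S" "a js * lkp (list_power ps js) m ~= 0" by (meson sum.neutral)
  then have "m \<in> kys (list_power ps js)" by (auto simp: in_keys_iff)
  moreover have "exponents_le B (list_power ps js)"
   using exponents_le_list_power[OF D js(1)] len by (simp add: B_def)
  ultimately have "m \<in> Fm" using mD unfolding Fm_def exponents_le_def by blast
  then show False using a(2) ne by blast
 qed
 with a(1) show ?thesis using that by blast
qed

subsection \<open>The local ring of a complex\<close>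

text \<open>An interface to the localization of the face ring at the irrelevant ideal:
  \<open>h\<close> sends a polynomial to its image, and \<open>lkp u 0 ~= 0\<close> describes the
  admissible denominators. All later arguments take place among polynomials instead of classes of
  fractions of cosets.\<close>

locale face_local_ring = cring L for L (structure) +
 fixes \<Delta> :: "'v set set" and h :: "('v, 'k::field) mpoly => 'a"
 assumes cx: "abstract_simplicial_complex \<Delta>" and nonvoid: "{} \<in> \<Delta>"
  and h_closed: "h p \<in> carrier L"
  and h_add: "h (p + q) = h p \<oplus> h q"
  and h_mult: "h (p * q) = h p \<otimes> h q"
  and h_one: "h 1 = \<one>"
  and h_zero: "h p = \<zero> \<longleftrightarrow> (\<exists>u. lkp u 0 ~= 0 \<and> u * p \<in> nonface_ideal \<Delta>)"
  and h_unit: "lkp u 0 ~= 0 ==> h u \<in> Units L"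
  and h_surj: "y \<in> carrier L ==> \<exists>p u. lkp u 0 ~= 0 \<and> y \<otimes> h u = h p"
begin

lemma finite_faces: "finite \<Delta>" "F \<in> \<Delta> ==> finite F" "F \<in> \<Delta> ==> G \<subseteq> F ==> G \<in> \<Delta>"
 using cx by (auto simp: abstract_simplicial_complex_def)

lemmas N = pidealD[OF pideal_nonface_ideal[OF cx]]

lemma h_eq: "h p = h q \<longleftrightarrow> (\<exists>u. lkp u 0 ~= 0 \<and> u * (p - q) \<in> nonface_ideal \<Delta>)"
proof -
 have "h p = h (p - q) \<oplus> h q" using h_add[of "p - q" q] by simp
 then have "h p = h q \<longleftrightarrow> h (p - q) = \<zero>"
  by (metis add.r_cancel_one h_closed l_zero)
 then show ?thesis by (simp only: h_zero)
qed

lemma h_0: "h 0 = \<zero>"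
 unfolding h_zero by (rule exI[of _ 1]) (simp add: N(1) lookup_one)

lemma h_nonface: "p \<in> nonface_ideal \<Delta> ==> h p = \<zero>"
 unfolding h_zero by (rule exI[of _ 1]) (simp add: lookup_one)

definition ext :: "('v, 'k) mpoly set => 'a set" where
 "ext J = {y \<in> carrier L. \<exists>p u. p \<in> J \<and> lkp u 0 ~= 0 \<and> y \<otimes> h u = h p}"

lemma ideal_ext:
 assumes J: "pideal J"
 shows "ideal (ext J) L"
proof (rule idealI)
 note J = pidealD[OF J]
 have mult: "x \<otimes> a \<in> ext J" if a: "a \<in> ext J" and x: "x \<in> carrier L" for a x
 proof -
  obtain p u where p: "a \<in> carrier L" "p \<in> J" "lkp u 0 ~= 0" "a \<otimes> h u = h p" using a by (auto simp: ext_def)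
  obtain q w where q: "lkp w 0 ~= 0" "x \<otimes> h w = h q" using h_surj[OF x] by auto
  have "(x \<otimes> a) \<otimes> h (w * u) = (x \<otimes> h w) \<otimes> (a \<otimes> h u)" using x p(1) h_closed[of w] h_closed[of u] by (simp add: h_mult m_ac)
  also have "\<dots> = h (q * p)" using p q by (simp add: h_mult)
  finally have "(x \<otimes> a) \<otimes> h (w * u) = h (q * p)" .
  moreover have "lkp (w * u) 0 ~= 0" using p q by (simp add: lookup_prod_0)
  moreover have "q * p \<in> J" using J p by simp
  ultimately show ?thesis using x p(1) unfolding ext_def by blast
 qed
 show "ring L" by unfold_locales
 show "x \<otimes> a \<in> ext J" if "a \<in> ext J" "x \<in> carrier L" for a x by (rule mult[OF that])
 have sub: "ext J \<subseteq> carrier L" by (auto simp: ext_def)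
 show "a \<otimes> x \<in> ext J" if "a \<in> ext J" "x \<in> carrier L" for a x
  using mult[OF that] m_comm[of a x] that sub by auto
 show "subgroup (ext J) (add_monoid L)"
 proof (rule add.subgroupI)
  show "ext J \<subseteq> carrier L" by (rule sub)
  have "\<zero> \<in> ext J" unfolding ext_def mem_Collect_eq
   by (rule conjI, simp, rule exI[of _ 0], rule exI[of _ 1]) (simp add: J(1) lookup_one h_0 h_one)
  then show "ext J ~= {}" by force
  show "\<ominus> a \<in> ext J" if a: "a \<in> ext J" for a
  proof -
   have "\<ominus> \<one> \<otimes> a \<in> ext J" by (rule mult[OF a]) simp
   moreover have "\<ominus> \<one> \<otimes> a = \<ominus> a" using subsetD[OF sub a] by (simp only: l_minus one_closed l_one)
   ultimately show ?thesis by (simp only:)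
  qed
  show "a \<oplus> b \<in> ext J" if a: "a \<in> ext J" and b: "b \<in> ext J" for a b
  proof -
   obtain p u where p: "a \<in> carrier L" "p \<in> J" "lkp u 0 ~= 0" "a \<otimes> h u = h p" using a by (auto simp: ext_def)
   obtain q w where q: "b \<in> carrier L" "q \<in> J" "lkp w 0 ~= 0" "b \<otimes> h w = h q" using b by (auto simp: ext_def)
   have "(a \<oplus> b) \<otimes> h (u * w) = (a \<otimes> h u) \<otimes> h w \<oplus> (b \<otimes> h w) \<otimes> h u"
    using p(1) q(1) h_closed[of w] h_closed[of u] by (simp add: h_mult l_distr r_distr m_ac)
   also have "\<dots> = h (w * p + u * q)" using p q h_closed by (simp add: h_mult h_add m_comm)
   finally have "(a \<oplus> b) \<otimes> h (u * w) = h (w * p + u * q)" .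
   moreover have "lkp (u * w) 0 ~= 0" using p q by (simp add: lookup_prod_0)
   moreover have "w * p + u * q \<in> J" using J p q by simp
   ultimately show ?thesis using p(1) q(1) unfolding ext_def by blast
  qed
 qed
qed

lemma h_in_ext:
 assumes J: "pideal J" and hp: "h p \<in> ext J"
 shows "\<exists>u q. lkp u 0 ~= 0 \<and> q \<in> J \<and> u * p - q \<in> nonface_ideal \<Delta>"
proof -
 obtain q u where q: "q \<in> J" "lkp u 0 ~= 0" "h p \<otimes> h u = h q" using hp by (auto simp: ext_def)
 then have "h (p * u) = h q" by (simp add: h_mult)
 then obtain w where w: "lkp w 0 ~= 0" "w * (p * u - q) \<in> nonface_ideal \<Delta>" unfolding h_eq by blast
 have "w * (p * u - q) = (w * u) * p - w * q" by (simp add: algebra_simps)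
 moreover have "lkp (w * u) 0 ~= 0" using w q by (simp add: lookup_prod_0)
 moreover have "w * q \<in> J" using pidealD(3)[OF J q(1)] .
 ultimately show ?thesis using w(2) by metis
qed

lemma ext_h: "p \<in> J ==> h p \<in> ext J"
 unfolding ext_def mem_Collect_eq
 by (rule conjI, rule h_closed, rule exI[of _ p], rule exI[of _ 1]) (simp add: lookup_one h_one h_closed)

lemma pideal_preimage:
 assumes "ideal P L"
 shows "pideal {p. h p \<in> P}"
proof -
 interpret P: ideal P L by fact
 show ?thesis unfolding pideal_def
  using P.a_closed P.I_l_closed P.zero_closed by (auto simp: h_0 h_add h_mult h_closed)
qed

lemma h_cancel_unit:
 assumes P: "ideal P L" and y: "y \<in> carrier L" and u: "lkp u 0 ~= 0" and m: "y \<otimes> h u \<in> P"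
 shows "y \<in> P"
proof -
 interpret P: ideal P L by fact
 have U: "h u \<in> Units L" using h_unit[OF u] .
 have "(y \<otimes> h u) \<otimes> inv (h u) \<in> P" by (rule P.I_r_closed[OF m Units_inv_closed[OF U]])
 moreover have "(y \<otimes> h u) \<otimes> inv (h u) = y"
  by (simp only: m_assoc[OF y h_closed Units_inv_closed[OF U]] Units_r_inv[OF U] r_one[OF y])
 ultimately show ?thesis by (simp only:)
qed

section \<open>The maximal ideal and the Krull dimension\<close>

definition maxid :: "'a set" where
 "maxid = ext {p. lkp p 0 = 0}"

lemma pideal_0: "pideal {p :: ('v, 'k) mpoly. lkp p 0 = 0}"
 unfolding pideal_def by (auto simp: lookup_add lookup_prod_0)

lemma h_maxid: "h p \<in> maxid \<longleftrightarrow> lkp p 0 = 0"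
proof
 assume "h p \<in> maxid"
 then obtain u q where u: "lkp u 0 ~= 0" "lkp q 0 = 0" "u * p - q \<in> nonface_ideal \<Delta>"
  using h_in_ext[OF pideal_0, of p] unfolding maxid_def by auto
 have "lkp (u * p - q) 0 = 0"
 proof (rule ccontr)
  assume "lkp (u * p - q) 0 ~= 0"
  then have "0 \<in> kys (u * p - q)" by (simp only: in_keys_iff not_False_eq_True)
  then show False using u(3) nonvoid unfolding nonface_ideal_def by force
 qed
 then show "lkp p 0 = 0" using u by (simp add: lookup_minus lookup_prod_0)
next
 show "lkp p 0 = 0 ==> h p \<in> maxid" unfolding maxid_def by (rule ext_h) simp
qed

lemma maximalideal_maxid: "maximalideal maxid L"
proof (rule maximalidealI)
 show "ideal maxid L" unfolding maxid_def by (rule ideal_ext[OF pideal_0])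
 have "h 1 \<notin> maxid" unfolding h_maxid by (simp add: lookup_one)
 then show "carrier L ~= maxid" using h_closed by metis
 fix J assume J: "ideal J L" "maxid \<subseteq> J" "J \<subseteq> carrier L"
 interpret J: ideal J L by fact
 show "J = maxid \<or> J = carrier L"
 proof (cases "J \<subseteq> maxid")
  case False
  then obtain y where y: "y \<in> J" "y \<notin> maxid" by blast
  then have yc: "y \<in> carrier L" using J(3) by blast
  obtain p u where u: "lkp u 0 ~= 0" "y \<otimes> h u = h p" using h_surj[OF yc] by blast
  have "lkp p 0 ~= 0" using y(2) yc u unfolding maxid_def ext_def by blast
  moreover have "\<one> \<otimes> h p \<in> J" using J.I_r_closed[OF y(1) h_closed[of u]] u(2) h_closed[of p] by simp
  ultimately have "\<one> \<in> J" using h_cancel_unit[OF J(1) one_closed] by blast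
  then show ?thesis using J.one_imp_carrier by blast
 qed (use J in blast)
qed

text \<open>A longer chain, contracted to polynomials, would yield \<open>d + 1\<close> elements
  independent modulo \<open>Q 0\<close>. As \<open>Q 0\<close> contains
  \<open>nonface_ideal\<close>, this contradicts the counting of monomials.\<close>

lemma prime_upper_bound:
 assumes dim: "!!F. F \<in> \<Delta> ==> card F \<le> d"
  and P: "!!i. i \<le> n ==> primeideal (P i) L" "!!i. i < n ==> P i \<subset> P (Suc i)"
 shows "n \<le> d"
proof (rule ccontr)
 assume "\<not> n \<le> d"
 then have n: "Suc d \<le> n" by simp
 define Q where "Q i = {p. h p \<in> P i}" for i
 have id: "ideal (P i) L" if "i \<le> n" for i using P(1)[OF that] by (rule primeideal.axioms(1))
 have "\<exists>p. p \<in> Q (Suc i) - Q i" if lt: "i < n" for i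
 proof -
  obtain y where y: "y \<in> P (Suc i)" "y \<notin> P i" using P(2)[OF lt] by blast
  have i: "ideal (P i) L" "ideal (P (Suc i)) L" using id lt by auto
  then have yc: "y \<in> carrier L" using y(1) ideal.Icarr by metis
  obtain p u where u: "lkp u 0 ~= 0" "y \<otimes> h u = h p" using h_surj[OF yc] by blast
  have "h p \<in> P (Suc i)" using ideal.I_r_closed[OF i(2) y(1) h_closed[of u]] u by simp
  moreover have "h p \<notin> P i" using h_cancel_unit[OF i(1) yc u(1)] u(2) y(2) by auto
  ultimately show ?thesis by (auto simp: Q_def)
 qed
 then have "\<forall>i. \<exists>p. i < n --> p \<in> Q (Suc i) - Q i" by blast
 from choice[OF this] obtain r where r: "!!i. i < n ==> r i \<in> Q (Suc i) - Q i" by blast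
 define ps where "ps = map r [0..<Suc d]"
 have len: "length ps = Suc d" by (simp add: ps_def)
 obtain N a js where js: "js \<in> exponent_lists (length ps) N" "a js ~= 0"
  and dep: "(\<Sum>js\<in>exponent_lists (length ps) N. scl (a js) (list_power ps js)) \<in> nonface_ideal \<Delta>"
  using face_polynomials_dependent[OF cx dim len] .
 have "a js = 0"
 proof (rule prime_chain_independent[where ps = ps and Q = Q and N = N and a = a])
  show "pideal (Q i)" if "i \<le> length ps" for i unfolding Q_def using id that n len by (intro pideal_preimage) auto
  show "p \<in> Q i \<or> q \<in> Q i" if "i \<le> length ps" "p * q \<in> Q i" for i p q
   using primeideal.I_prime[OF P(1), of i "h p" "h q"] that n len by (auto simp: Q_def h_mult h_closed)
  show "Q i \<subseteq> Q (Suc i) \<and> ps ! i \<in> Q (Suc i) - Q i" if "i < length ps" for i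
  proof
   have i: "i < n" using that n len by simp
   show "Q i \<subseteq> Q (Suc i)" using P(2)[OF i] by (auto simp: Q_def)
   have "ps ! i = r i" unfolding ps_def using that len by (simp del: upt_Suc)
   then show "ps ! i \<in> Q (Suc i) - Q i" using r[OF i] by simp
  qed
  show "1 \<notin> Q (length ps)"
  proof
   assume "1 \<in> Q (length ps)"
   then have "\<one> \<in> P (Suc d)" by (simp add: Q_def h_one len)
   then show False using ideal.one_imp_carrier[OF id[OF n]] primeideal.I_notcarr[OF P(1)[OF n]] by simp
  qed
  have "ideal (P 0) L" by (rule id) simp
  then show "(\<Sum>js\<in>exponent_lists (length ps) N. scl (a js) (list_power ps js)) \<in> Q 0"
   unfolding Q_def mem_Collect_eq h_nonface[OF dep] using additive_subgroup.zero_closed ideal.axioms(1) by metis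
 qed (rule js(1))
 then show False using js(2) by simp
qed

text \<open>Restriction to the variables of a face. They are renamed to natural numbers because
  exponent vectors over a linearly ordered type are ordered, by which the target ring has no zero
  divisors.\<close>

definition subst_mon :: "('v => nat) => 'v set => ('v \<Rightarrow>\<^sub>0 nat) => (nat \<Rightarrow>\<^sub>0 nat) \<Rightarrow>\<^sub>0 'k" where
 "subst_mon g G m = (if kys m \<subseteq> G then sgl (\<Sum>v\<in>G. sgl (g v) (lkp m v)) 1 else 0)"

lemma subst_mon_add: "subst_mon g G (x + y) = subst_mon g G x * subst_mon g G y"
proof -
 have "(\<Sum>v\<in>G. sgl (g v) (lkp (x + y) v)) = (\<Sum>v\<in>G. sgl (g v) (lkp x v)) + (\<Sum>v\<in>G. sgl (g v) (lkp y v))"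
  by (simp add: lookup_add single_add sum.distrib)
 then show ?thesis by (simp add: subst_mon_def keys_add_nat mult_single)
qed

lemma lookup_subst:
 assumes G: "finite G" "inj_on g G" and m: "kys m \<subseteq> G"
 shows "lkp (kext (subst_mon g G) p) (\<Sum>v\<in>G. sgl (g v) (lkp m v)) = lkp p m"
proof -
 let ?f = "\<lambda>m. \<Sum>v\<in>G. sgl (g v) (lkp m v)"
 have l: "lkp (?f x) (g w) = lkp x w" if "w \<in> G" for x w
 proof -
  have "lkp (?f x) (g w) = (\<Sum>v\<in>G. if v = w then lkp x v else 0)"
   unfolding lookup_sum lookup_single by (intro sum.cong refl) (use inj_onD[OF G(2)] that in \<open>auto simp: when_def\<close>)
  also have "\<dots> = lkp x w" using G(1) that by simp
  finally show ?thesis .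
 qed
 have eq: "x = m" if x: "kys x \<subseteq> G" and f: "?f x = ?f m" for x
 proof (rule poly_mapping_eqI)
  fix w
  show "lkp x w = lkp m w"
  proof (cases "w \<in> G")
   case True then show ?thesis using l[OF True, of x] l[OF True, of m] f by simp
  next
   case False
   then have "w \<notin> kys x" "w \<notin> kys m" using x m by auto
   then show ?thesis by (simp only: in_keys_iff not_not)
  qed
 qed
 have "lkp (kext (subst_mon g G) p) (?f m) = (\<Sum>x\<in>kys p. if x = m then lkp p x else 0)"
  unfolding lookup_kext
 proof (rule sum.cong[OF refl])
  fix x
  show "lkp p x * lkp (subst_mon g G x) (?f m) = (if x = m then lkp p x else 0)"
  proof (cases "x = m")
   case True then show ?thesis using m by (simp add: subst_mon_def)
  next
   case False
   then have "\<not> (kys x \<subseteq> G \<and> ?f x = ?f m)" using eq by blast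
   then show ?thesis using False by (auto simp: subst_mon_def lookup_single when_def)
  qed
 qed
 also have "\<dots> = lkp p m" by (simp add: not_in_keys_iff_lookup_eq_zero)
 finally show ?thesis .
qed

definition face_kernel :: "('v => nat) => 'v set => ('v, 'k) mpoly set" where
 "face_kernel g G = {p. kext (subst_mon g G) p = 0}"

text \<open>The kernel of a map to a domain is prime. The second claim says that its extension
  contracts back to it, so strict inclusions between such kernels survive in
  \<open>L\<close>.\<close>

lemma primeideal_face_kernel:
 assumes G: "G \<in> \<Delta>" "inj_on g G"
 shows "primeideal (ext (face_kernel g G)) L" and "h p \<in> ext (face_kernel g G) ==> p \<in> face_kernel g G"
proof -
 let ?s = "kext (subst_mon g G)"
 have s_mult: "?s (p * q) = ?s p * ?s q" for p q by (rule kext_mult) (rule subst_mon_add)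
 have pid: "pideal (face_kernel g G)"
  unfolding pideal_def face_kernel_def by (auto simp: kext_add s_mult)
 have s0: "?s u ~= 0" if "lkp u 0 ~= 0" for u
  using lookup_subst[OF finite_faces(2)[OF G(1)] G(2), of 0 u] that by auto
 have nf: "?s p = 0" if "p \<in> nonface_ideal \<Delta>" for p
  unfolding kext_def
 proof (rule sum.neutral, rule ballI)
  fix m assume "m \<in> kys p"
  then have "kys m \<notin> \<Delta>" using that by (auto simp: nonface_ideal_def)
  then have "\<not> kys m \<subseteq> G" using finite_faces(3)[OF G(1)] by blast
  then show "scl (lkp p m) (subst_mon g G m) = 0" by (simp add: subst_mon_def scl_simps)
 qed
 show m: "p \<in> face_kernel g G" if "h p \<in> ext (face_kernel g G)" for p
 proof -
  obtain u q where u: "lkp u 0 ~= 0" "q \<in> face_kernel g G" "u * p - q \<in> nonface_ideal \<Delta>"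
   using h_in_ext[OF pid \<open>h p \<in> _\<close>] by blast
  have "?s u * ?s p = ?s (u * p - q)" using u(2) by (simp add: kext_diff s_mult face_kernel_def)
  then have "?s p = 0" using nf[OF u(3)] s0[OF u(1)] by simp
  then show ?thesis by (simp add: face_kernel_def)
 qed
 show "primeideal (ext (face_kernel g G)) L"
 proof (rule primeidealI)
  show id: "ideal (ext (face_kernel g G)) L" by (rule ideal_ext[OF pid])
  show "cring L" by unfold_locales
  have "h 1 \<notin> ext (face_kernel g G)"
  proof
   assume "h 1 \<in> ext (face_kernel g G)"
   from m[OF this] show False using s0[of 1] by (simp add: face_kernel_def lookup_one)
  qed
  then show "carrier L ~= ext (face_kernel g G)" using h_closed by metis
  fix a b assume a: "a \<in> carrier L" and b: "b \<in> carrier L" and ab: "a \<otimes> b \<in> ext (face_kernel g G)"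
  obtain p u where p: "lkp u 0 ~= 0" "a \<otimes> h u = h p" using h_surj[OF a] by blast
  obtain q w where q: "lkp w 0 ~= 0" "b \<otimes> h w = h q" using h_surj[OF b] by blast
  have "h (p * q) = (a \<otimes> b) \<otimes> h (u * w)"
   unfolding h_mult p(2)[symmetric] q(2)[symmetric] using a b h_closed[of u] h_closed[of w] by (simp add: m_ac)
  also have "\<dots> \<in> ext (face_kernel g G)" by (rule ideal.I_r_closed[OF id ab h_closed])
  finally have "?s (p * q) = 0" using m unfolding face_kernel_def by blast
  then have "?s p = 0 \<or> ?s q = 0" by (simp add: s_mult)
  then have "p \<in> face_kernel g G \<or> q \<in> face_kernel g G" by (simp add: face_kernel_def)
  then show "a \<in> ext (face_kernel g G) \<or> b \<in> ext (face_kernel g G)"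
   unfolding ext_def using a b p q by blast
 qed
qed

text \<open>For the lower bound, the vertices of a facet are deleted one by one. The kernels of the
  restrictions to the remaining faces grow, and the variable of the deleted vertex separates
  consecutive ones.\<close>

lemma krull_dim_eq:
 assumes dim: "!!F. F \<in> \<Delta> ==> card F \<le> d" and F: "F \<in> \<Delta>" "card F = d"
 shows "krull_dim L = enat d"
proof (rule antisym)
 show "krull_dim L \<le> enat d"
  unfolding krull_dim_def
 proof (rule Sup_least)
  fix x assume "x \<in> {enat n |n. \<exists>P. (\<forall>i\<le>n. primeideal (P i) L) \<and> (\<forall>i<n. P i \<subset> P (Suc i))}"
  then obtain n P where "x = enat n" "\<forall>i\<le>n. primeideal (P i) L" "\<forall>i<n. P i \<subset> P (Suc i)" by blast
  then show "x \<le> enat d" using prime_upper_bound[OF dim, of n P] by simp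
 qed
 obtain vs where vs: "set vs = F" "distinct vs" using finite_distinct_list[OF finite_faces(2)[OF F(1)]] by blast
 have len: "length vs = d" using distinct_card[OF vs(2)] vs(1) F(2) by simp
 obtain g :: "'v => nat" where g: "inj_on g F" by (meson finite_imp_inj_to_nat_seg finite_faces(2)[OF F(1)])
 define G where "G i = set (take (d - i) vs)" for i
 have GF: "G i \<subseteq> F" for i using set_take_subset[of _ vs] vs unfolding G_def by blast
 have GD: "G i \<in> \<Delta>" "inj_on g (G i)" for i
  using finite_faces(3)[OF F(1) GF] inj_on_subset[OF g GF] by auto
 have "\<exists>P. (\<forall>i\<le>d. primeideal (P i) L) \<and> (\<forall>i<d. P i \<subset> P (Suc i))"
 proof (intro exI[of _ "\<lambda>i. ext (face_kernel g (G i))"] conjI allI impI)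
  show "primeideal (ext (face_kernel g (G i))) L" for i by (rule primeideal_face_kernel[OF GD])
  fix i assume i: "i < d"
  have sub: "G (Suc i) \<subseteq> G i" unfolding G_def by (rule set_take_subset_set_take) simp
  define v where "v = vs ! (d - Suc i)"
  have "take (d - i) vs = take (d - Suc i) vs @ [v]"
   using take_Suc_conv_app_nth[of "d - Suc i" vs] len i by (simp add: v_def Suc_diff_Suc)
  moreover have "distinct (take (d - i) vs)" using vs by simp
  ultimately have v: "v \<in> G i" "v \<notin> G (Suc i)" unfolding G_def by auto
  have kv: "kys (sgl v (1::nat)) = {v}" by simp
  have K: "face_kernel g (G i) \<subseteq> face_kernel g (G (Suc i))"
  proof
   fix p assume p: "p \<in> face_kernel g (G i)"
   have "scl (lkp p m) (subst_mon g (G (Suc i)) m) = 0" for m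
   proof (cases "kys m \<subseteq> G (Suc i)")
    case True
    then have "lkp p m = 0" using lookup_subst[OF finite_faces(2)[OF GD(1)] GD(2), of m i p] sub p
     by (auto simp: face_kernel_def)
    then show ?thesis by (simp add: scl_simps)
   qed (simp add: subst_mon_def scl_simps)
   then show "p \<in> face_kernel g (G (Suc i))" by (simp add: face_kernel_def kext_def)
  qed
  have "sgl (sgl v 1) 1 \<in> face_kernel g (G (Suc i))"
   using v kv by (simp add: face_kernel_def subst_mon_def scl_simps)
  then have 1: "h (sgl (sgl v 1) 1) \<in> ext (face_kernel g (G (Suc i)))" by (rule ext_h)
  have "sgl (sgl v 1) 1 \<notin> face_kernel g (G i)"
  proof
   assume "sgl (sgl v 1) 1 \<in> face_kernel g (G i)"
   moreover have "lkp (kext (subst_mon g (G i)) (sgl (sgl v 1) 1)) (\<Sum>w\<in>G i. sgl (g w) (lkp (sgl v (1::nat)) w)) = 1"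
    using lookup_subst[OF finite_faces(2)[OF GD(1)] GD(2), of "sgl v 1" i "sgl (sgl v 1) 1"] v kv by simp
   ultimately show False unfolding face_kernel_def by (simp del: kext_single)
  qed
  then have 2: "h (sgl (sgl v 1) 1) \<notin> ext (face_kernel g (G i))" using primeideal_face_kernel(2)[OF GD] by blast
  have "ext (face_kernel g (G i)) \<subseteq> ext (face_kernel g (G (Suc i)))" using K unfolding ext_def by blast
  then show "ext (face_kernel g (G i)) \<subset> ext (face_kernel g (G (Suc i)))" using 1 2 by blast
 qed
 then show "enat d \<le> krull_dim L" unfolding krull_dim_def by (intro Sup_upper) blast
qed

text \<open>The order matters: the weak sequence condition is only applied at the first two
  positions, which hold the face sums of degrees \<open>d\<close> and \<open>d - 1\<close>.\<close>

definition params :: "nat => 'a list" where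
 "params d = map (\<lambda>i. h (face_sum \<Delta> (d - i))) [0..<d]"

lemma params_system:
 assumes dim: "!!F. F \<in> \<Delta> ==> card F \<le> d" and F: "F \<in> \<Delta>" "card F = d"
 shows "system_of_parameters L maxid (params d)"
 unfolding system_of_parameters_def
proof (intro conjI ballI)
 have e0: "lkp (face_sum \<Delta> j :: ('v, 'k) mpoly) 0 = 0" if "0 < j" for j
  unfolding face_sum_def lookup_sum
 proof (rule sum.neutral, rule ballI)
  fix F assume "F \<in> {F \<in> \<Delta>. card F = j}"
  then have "finite F" "F ~= {}" using that finite_faces by auto
  then have "square_exponent F ~= 0" using keys_square_exponent[of F] by auto
  then show "lkp (squarefree_monomial F :: ('v, 'k) mpoly) 0 = 0" by (simp add: squarefree_monomial_eq lookup_single when_def)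
 qed
 show "set (params d) \<subseteq> maxid" by (auto simp: params_def h_maxid e0)
 then have carr: "set (params d) \<subseteq> carrier L" unfolding maxid_def ext_def by auto
 show "enat (length (params d)) = krull_dim L" using krull_dim_eq[OF dim F] by (simp add: params_def)
 fix y assume y: "y \<in> maxid"
 define I where "I = Idl (set (params d))"
 have I: "ideal I L" unfolding I_def by (rule genideal_ideal[OF carr])
 have pid: "pideal {p. h p \<in> I}" by (rule pideal_preimage[OF I])
 obtain p u where p: "y \<in> carrier L" "lkp p 0 = 0" "lkp u 0 ~= 0" "y \<otimes> h u = h p" using y unfolding maxid_def ext_def by auto
 have "p \<in> pradical {p. h p \<in> I}"
 proof (rule face_sums_radical[OF cx pid _ dim _ p(2)])
  show "nonface_ideal \<Delta> \<subseteq> {p. h p \<in> I}" using h_nonface additive_subgroup.zero_closed[OF ideal.axioms(1)[OF I]] by auto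
  fix j assume j: "1 \<le> j" "j \<le> d"
  have "d - (d - j) = j" using j by simp
  then have "h (face_sum \<Delta> j) \<in> set (params d)" using j unfolding params_def set_map
   by (intro image_eqI[of _ _ "d - j"]) auto
  then show "face_sum \<Delta> j \<in> {p. h p \<in> I}" unfolding I_def using genideal_self[OF carr] by auto
 qed
 then obtain n where n: "h (p ^ n) \<in> I" unfolding pradical_def by auto
 have hp: "h (q ^ n) = h q [^] n" for q by (induction n) (simp_all add: h_one h_mult m_comm h_closed)
 have "y [^] n \<otimes> h (u ^ n) = h (p ^ n)" unfolding hp p(4)[symmetric] using p(1) h_closed[of u] by (simp add: pow_mult_distrib m_comm)
 then have "y [^] n \<in> I" using h_cancel_unit[OF I, of "y [^] n" "u ^ n"] n p(1,3) by (simp add: lookup_power_0)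
 then show "\<exists>n::nat. y [^] n \<in> Idl (set (params d))" unfolding I_def by blast
qed

end

subsection \<open>Consequences of the weak sequence condition\<close>

context face_local_ring begin

definition xs :: "'v set => ('v, 'k) mpoly" where
 "xs F = squarefree_monomial F"

lemma single_nonface: "kys m \<notin> \<Delta> ==> sgl m c \<in> nonface_ideal \<Delta>"
 by (auto simp: nonface_ideal_def split: if_splits)

lemma coeff_nonface: "p \<in> nonface_ideal \<Delta> ==> kys m \<in> \<Delta> ==> lkp p m = 0"
 unfolding nonface_ideal_def using in_keys_iff[of m p] by blast

text \<open>The condition at position \<open>i\<close>, in polynomials: \<open>E\<close> presents
  the ideal of the first \<open>i\<close> parameters, and the factor \<open>u\<close> with nonzero
  constant term is a cleared denominator.\<close>

lemma weak_sequence_step: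
 assumes weak: "weak_sequence L maxid (params d)" and i: "i < d"
  and E: "pideal E" "!!j. j < i ==> face_sum \<Delta> (d - j) \<in> E"
  and sub: "!!q. q \<in> E ==> h q \<in> Idl (set (take i (params d)))"
  and y: "q \<in> E" "y * face_sum \<Delta> (d - i) - q \<in> nonface_ideal \<Delta>" and x: "lkp x 0 = 0"
 shows "\<exists>u q. lkp u 0 ~= 0 \<and> q \<in> E \<and> u * (x * y) - q \<in> nonface_ideal \<Delta>"
proof -
 let ?I = "Idl (set (take i (params d)))"
 have len: "length (params d) = d" by (simp add: params_def)
 have nth: "params d ! j = h (face_sum \<Delta> (d - j))" if "j < d" for j using that by (simp add: params_def)
 have set: "set (take i (params d)) = (\<lambda>j. h (face_sum \<Delta> (d - j))) ` {..<i}"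
 proof -
  have "take i (params d) = map (\<lambda>i. h (face_sum \<Delta> (d - i))) [0..<i]" using i by (simp add: params_def take_map)
  then show ?thesis by (auto simp: lessThan_atLeast0)
 qed
 have "h (y * face_sum \<Delta> (d - i)) = h q" unfolding h_eq by (rule exI[of _ 1]) (simp add: y lookup_one)
 then have "h y \<otimes> params d ! i \<in> ?I" using sub[OF y(1)] i by (simp add: nth h_mult)
 moreover have "h x \<in> maxid" using x by (simp add: h_maxid)
 ultimately have "h x \<otimes> h y \<in> ?I" using weak i h_closed[of y] unfolding weak_sequence_def len by blast
 moreover have "?I \<subseteq> ext E"
 proof (rule genideal_minimal[OF ideal_ext[OF E(1)]])
  show "set (take i (params d)) \<subseteq> ext E" unfolding set using ext_h E(2) by auto
 qed
 ultimately have "h (x * y) \<in> ext E" by (auto simp: h_mult)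
 then show ?thesis using h_in_ext[OF E(1)] by blast
qed

lemma var_0: "lkp (sgl (sgl v 1) 1 :: ('v, 'k) mpoly) 0 = 0"
proof -
 have "sgl v (1::nat) ~= 0"
 proof
  assume "sgl v (1::nat) = 0"
  from arg_cong[OF this, of "\<lambda>x. lkp x v"] show False by simp
 qed
 then show ?thesis by (simp add: lookup_single when_def)
qed

text \<open>If a maximal face \<open>F\<close> had fewer than \<open>d\<close> elements, its union
  with any \<open>d\<close>-element face would not be a face, so the first parameter would
  annihilate \<open>xs F\<close>. The condition then kills \<open>xs F\<close> times the variable of
  some \<open>v\<close> in \<open>F\<close>, a monomial supported on the face
  \<open>F\<close>.\<close>

lemma maximal_faces_pure:
 assumes weak: "weak_sequence L maxid (params d)" and d: "0 < d"
  and dim: "!!F. F \<in> \<Delta> ==> card F \<le> d"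
  and F: "F \<in> \<Delta>" "!!G. G \<in> \<Delta> ==> F \<subseteq> G ==> G = F" and ne: "F ~= {}"
 shows "card F = d"
proof (rule ccontr)
 assume "card F ~= d"
 obtain v where v: "v \<in> F" using ne by blast
 have fF: "finite F" using finite_faces(2)[OF F(1)] .
 have z: "pideal {0 :: ('v, 'k) mpoly}" by (simp add: pideal_def)
 have e: "xs F * face_sum \<Delta> d \<in> nonface_ideal \<Delta>"
  unfolding face_sum_def sum_distrib_left
 proof (rule pideal_sum[OF pideal_nonface_ideal[OF cx]])
  fix G assume G: "G \<in> {G \<in> \<Delta>. card G = d}"
  then have fG: "finite G" using finite_faces by auto
  have "F \<union> G \<notin> \<Delta>"
  proof
   assume "F \<union> G \<in> \<Delta>"
   then have "F \<union> G = F" using F(2) by blast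
   then have "G \<subseteq> F" by blast
   then have "card G \<le> card F" by (rule card_mono[OF fF])
   then show False using G dim[OF F(1)] \<open>card F ~= d\<close> by simp
  qed
  moreover have "kys (square_exponent F + square_exponent G) = F \<union> G"
   by (simp only: keys_add_nat keys_square_exponent[OF fF] keys_square_exponent[OF fG])
  ultimately show "xs F * squarefree_monomial G \<in> nonface_ideal \<Delta>"
   unfolding xs_def squarefree_monomial_eq mult_single by (intro single_nonface) simp
 qed
 have "\<exists>u q. lkp u 0 ~= 0 \<and> q \<in> {0} \<and> u * (sgl (sgl v 1) 1 * xs F) - q \<in> nonface_ideal \<Delta>"
 proof (rule weak_sequence_step[OF weak d z])
  show "h q \<in> Idl (set (take 0 (params d)))" if "q \<in> {0}" for q
   using that additive_subgroup.zero_closed[OF ideal.axioms(1)[OF genideal_ideal, of "{}"]] by (simp add: h_0)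
  show "xs F * face_sum \<Delta> (d - 0) - 0 \<in> nonface_ideal \<Delta>" using e by simp
 qed (use var_0 in auto)
 then obtain u where u: "lkp u 0 ~= 0" "u * (sgl (sgl v 1) 1 * xs F) \<in> nonface_ideal \<Delta>" by auto
 let ?m = "sgl v 1 + square_exponent F"
 have eq: "u * (sgl (sgl v 1) 1 * xs F) = u * sgl ?m 1" by (simp add: xs_def squarefree_monomial_eq mult_single)
 have "kys ?m = F" using v by (auto simp: keys_add_nat keys_square_exponent[OF fF])
 then have "lkp (u * sgl ?m 1) ?m = 0" using coeff_nonface[OF u(2)] F(1) unfolding eq by simp
 then show False using lookup_times_single(1)[of u ?m 1 0] u(1) by simp
qed

text \<open>Choose a pair across the classes with largest intersection \<open>s\<close>. The second
  parameter multiplies \<open>y\<close>, which collects the facets of \<open>A\<close> through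
  \<open>s\<close>, into the ideal of the first parameter; so a variable times \<open>y\<close> lies
  in that ideal. Comparing coefficients at a facet of \<open>A\<close> and one of \<open>B\<close>,
  both through \<open>s\<close>, gives a contradiction.\<close>

lemma facets_not_separated:
 assumes weak: "weak_sequence L maxid (params d)" and d: "1 < d"
  and dim: "!!F. F \<in> \<Delta> ==> card F \<le> d"
  and A: "!!F. F \<in> A ==> F \<in> \<Delta> \<and> card F = d" and B: "!!F. F \<in> \<Delta> ==> card F = d ==> F \<notin> A ==> F \<in> B"
   "!!F. F \<in> B ==> F \<in> \<Delta> \<and> card F = d \<and> F \<notin> A"
  and cross: "!!F G. F \<in> A ==> G \<in> B ==> card (F \<inter> G) < d - 1"
  and FG: "F \<in> A" "G \<in> B"
 shows "F \<inter> G = {}"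
proof (rule ccontr)
 assume ne: "F \<inter> G ~= {}"
 define C where "C = (\<lambda>(F, G). card (F \<inter> G)) ` (A \<times> B)"
 have fin: "finite A" "finite B"
  using finite_subset[of A \<Delta>] finite_subset[of B \<Delta>] A B(2) finite_faces(1) by auto
 have finC: "finite C" "C ~= {}" using fin FG by (auto simp: C_def)
 obtain F0 G0 where F0: "F0 \<in> A" "G0 \<in> B" "card (F0 \<inter> G0) = Max C" using Max_in[OF finC] by (auto simp: C_def)
 define s where "s = F0 \<inter> G0"
 have max: "card (F' \<inter> G') \<le> card s" if "F' \<in> A" "G' \<in> B" for F' G'
  unfolding s_def F0(3) using Max_ge[OF finC(1), of "card (F' \<inter> G')"] that by (force simp: C_def)
 have sF: "s \<subseteq> F0" "s \<subseteq> G0" by (auto simp: s_def)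
 have F0D: "F0 \<in> \<Delta>" "card F0 = d" "G0 \<in> \<Delta>" "card G0 = d" "G0 \<notin> A" using F0 A B(2) by auto
 have fs: "finite s" using sF finite_faces(2)[OF F0D(1)] finite_subset by blast
 have "0 < card (F \<inter> G)" using ne finite_faces(2) A[OF FG(1)] by (simp add: card_gt_0_iff)
 then have "0 < card s" using max[OF FG] by simp
 then have "s ~= {}" by auto
 then obtain v where v: "v \<in> s" by blast
 have cs: "card s < d - 1" unfolding s_def by (rule cross[OF F0(1,2)])
 define Fs where "Fs = {F \<in> \<Delta>. card F = d}"
 define Rs where "Rs = {R \<in> \<Delta>. card R = d - 1}"
 have finR: "finite Rs" "finite Fs" using finite_faces(1) by (auto simp: Rs_def Fs_def)
 \<comment> \<open>\<open>a\<close> selects the facets of \<open>A\<close> through \<open>s\<close>,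
   and \<open>b\<close> is chosen so that \<open>a F = b R\<close> whenever \<open>s\<close>,
   \<open>F\<close> and \<open>R\<close> lie in one face. This makes
   \<open>y * face_sum \<Delta> (d - 1)\<close> equal to \<open>face_sum \<Delta> d * q\<close>
   modulo nonfaces.\<close>
 define a where "a F = (if F \<in> A \<and> s \<subseteq> F then 1 else 0 :: 'k)" for F
 define b where "b R = (if \<exists>F\<in>A. R \<union> s \<subseteq> F then 1 else 0 :: 'k)" for R
 define y where "y = xs s * (\<Sum>F\<in>Fs. scl (a F) (xs F))"
 define q where "q = xs s * (\<Sum>R\<in>Rs. scl (b R) (xs R))"
 define E where "E = {face_sum \<Delta> d * c | c :: ('v, 'k) mpoly. True}"
 let ?e = "face_sum \<Delta> d :: ('v, 'k) mpoly"
 have pE: "pideal E" unfolding pideal_def E_def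
 proof (intro conjI ballI allI)
  show "0 \<in> {?e * c |c. True}" by (auto intro: exI[of _ 0])
  fix p r assume "p \<in> {?e * c |c. True}"
  then obtain c where p: "p = ?e * c" by auto
  have "r * p = ?e * (r * c)" unfolding p by (simp only: mult_ac)
  then show "r * p \<in> {?e * c |c. True}" by blast
 next
  fix p r assume "p \<in> {?e * c |c. True}" "r \<in> {?e * c |c. True}"
  then obtain c c' where p: "p = ?e * c" "r = ?e * c'" by auto
  have "p + r = ?e * (c + c')" unfolding p by (simp only: distrib_left)
  then show "p + r \<in> {?e * c |c. True}" by blast
 qed
 have key: "kys (square_exponent s + (square_exponent F + square_exponent R)) = s \<union> (F \<union> R)"
  if "finite F" "finite R" for F R
  using that fs by (simp only: keys_add_nat keys_square_exponent)
 have "y * face_sum \<Delta> (d - 1) - ?e * q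
   = xs s * ((\<Sum>F\<in>Fs. scl (a F) (xs F)) * (\<Sum>R\<in>Rs. xs R) - (\<Sum>F\<in>Fs. xs F) * (\<Sum>R\<in>Rs. scl (b R) (xs R)))"
  unfolding y_def q_def face_sum_def Fs_def Rs_def xs_def by (simp only: right_diff_distrib mult_ac)
 also have "\<dots> = xs s * (\<Sum>F\<in>Fs. \<Sum>R\<in>Rs. scl (a F - b R) (xs F * xs R))"
  unfolding sum_product sum_subtractf[symmetric] scl_eq_mult single_diff left_diff_distrib by (simp only: mult_ac)
 also have "\<dots> = (\<Sum>F\<in>Fs. \<Sum>R\<in>Rs. xs s * scl (a F - b R) (xs F * xs R))" by (simp only: sum_distrib_left)
 also have "\<dots> \<in> nonface_ideal \<Delta>"
 proof (intro pideal_sum[OF pideal_nonface_ideal[OF cx]])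
  fix F R assume F: "F \<in> Fs" and R: "R \<in> Rs"
  have fF: "finite F" "finite R" using F R finite_faces(2) by (auto simp: Fs_def Rs_def)
  show "xs s * scl (a F - b R) (xs F * xs R) \<in> nonface_ideal \<Delta>"
  proof (cases "s \<union> (F \<union> R) \<in> \<Delta>")
   case False
   then show ?thesis
    unfolding xs_def squarefree_monomial_eq mult_single scl_simps by (intro single_nonface) (simp only: key[OF fF] not_False_eq_True)
  next
   case True
   have fin: "finite (s \<union> (F \<union> R))" using fF fs by simp
   have "card (s \<union> (F \<union> R)) \<le> card F" using dim[OF True] F by (simp add: Fs_def)
   then have "F = s \<union> (F \<union> R)" using card_seteq[OF fin, of F] by blast
   then have sub: "s \<subseteq> F" "R \<union> s \<subseteq> F" by auto
   have "a F = b R"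
   proof (cases "F \<in> A")
    case True
    then have "\<exists>F\<in>A. R \<union> s \<subseteq> F" using sub by blast
    then show ?thesis using True sub by (simp add: a_def b_def)
   next
    case False
    then have FB: "F \<in> B" using B(1) F by (simp add: Fs_def)
    \<comment> \<open>Otherwise \<open>F\<close> in \<open>B\<close> and a facet of \<open>A\<close>
      would have the \<open>d - 1\<close> elements of \<open>R\<close> in common, more than the
      maximum \<open>card s\<close>.\<close>
    have "\<not> (\<exists>F\<in>A. R \<union> s \<subseteq> F)"
    proof
     assume "\<exists>F\<in>A. R \<union> s \<subseteq> F"
     then obtain F1 where F1: "F1 \<in> A" "R \<union> s \<subseteq> F1" by blast
     have "R \<subseteq> F1 \<inter> F" using F1 sub by blast
     then have "card R \<le> card (F1 \<inter> F)" using fF by (intro card_mono) auto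
     then show False using max[OF F1(1) FB] cs R by (simp add: Rs_def)
    qed
    then show ?thesis using False by (simp add: a_def b_def)
   qed
   then show ?thesis by (simp only: diff_self scl_simps mult_zero_right N(1))
  qed
 qed
 finally have ye: "y * face_sum \<Delta> (d - 1) - ?e * q \<in> nonface_ideal \<Delta>" .
 have I1: "take 1 (params d) = [h ?e]" using d by (cases d) (auto simp: params_def upt_rec)
 have "\<exists>u q. lkp u 0 ~= 0 \<and> q \<in> E \<and> u * (sgl (sgl v 1) 1 * y) - q \<in> nonface_ideal \<Delta>"
 proof (rule weak_sequence_step[OF weak d pE])
  show "face_sum \<Delta> (d - j) \<in> E" if "j < 1" for j using that by (auto simp: E_def intro: exI[of _ 1])
  show "h r \<in> Idl (set (take 1 (params d)))" if r: "r \<in> E" for r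
  proof -
   have sub: "{h ?e} \<subseteq> carrier L" using h_closed by simp
   obtain c where "r = ?e * c" using r by (auto simp: E_def)
   then have "h r = h ?e \<otimes> h c" by (simp add: h_mult)
   also have "\<dots> \<in> Idl {h ?e}"
    using genideal_self[OF sub] by (intro ideal.I_r_closed[OF genideal_ideal[OF sub]] h_closed) simp
   finally show ?thesis unfolding I1 by simp
  qed
  show "?e * q \<in> E" by (auto simp: E_def)
 qed (rule ye, rule var_0)
 then obtain u c where u: "lkp u 0 ~= 0" and n: "u * (sgl (sgl v 1) 1 * y) - ?e * c \<in> nonface_ideal \<Delta>"
  unfolding E_def by blast
 define m where "m = sgl v 1 + square_exponent s"
 have km: "kys m = s" using v by (auto simp: m_def keys_add_nat keys_square_exponent[OF fs])
 have yv: "u * (sgl (sgl v 1) 1 * y) = (\<Sum>F\<in>Fs. u * sgl (m + square_exponent F) (a F))"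
  unfolding y_def xs_def squarefree_monomial_eq scl_simps sum_distrib_left mult_single m_def by (simp add: add.assoc)
 have ev: "?e * c = (\<Sum>F\<in>Fs. c * sgl (square_exponent F) 1)"
  unfolding face_sum_def Fs_def squarefree_monomial_eq sum_distrib_right by (simp only: mult.commute)
 have div: "F = H" if F: "F \<in> Fs" "H \<in> Fs" "s \<subseteq> H" and m: "m + square_exponent H = x + square_exponent F" for F H x
 proof -
  have fin: "finite F" "finite H" using F finite_faces(2) by (auto simp: Fs_def)
  have "kys (m + square_exponent H) = H" using F(3) by (auto simp: keys_add_nat km keys_square_exponent[OF fin(2)])
  moreover have "F \<subseteq> kys (x + square_exponent F)" by (simp add: keys_add_nat keys_square_exponent[OF fin(1)])
  ultimately have "F \<subseteq> H" using m by simp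
  then show ?thesis using F card_seteq[OF fin(2), of F] by (simp add: Fs_def)
 qed
 \<comment> \<open>At \<open>m\<close> times the monomial of a facet \<open>H\<close> through
   \<open>s\<close>, only the term \<open>F = H\<close> contributes on either side, and the
   coefficient \<open>lkp c m\<close> on the right does not depend on \<open>H\<close>.\<close>
 have coeff: "lkp u 0 * a H = lkp c m" if H: "H \<in> Fs" "s \<subseteq> H" for H
 proof -
  have fH: "finite H" using H finite_faces(2) by (auto simp: Fs_def)
  have "kys (m + square_exponent H) = H" using H(2) by (auto simp: keys_add_nat km keys_square_exponent[OF fH])
  then have "lkp (u * (sgl (sgl v 1) 1 * y) - ?e * c) (m + square_exponent H) = 0"
   using coeff_nonface[OF n] H by (simp add: Fs_def)
  moreover have "lkp (u * (sgl (sgl v 1) 1 * y)) (m + square_exponent H) = lkp u 0 * a H"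
  proof -
   have "lkp (u * (sgl (sgl v 1) 1 * y)) (m + square_exponent H) = (\<Sum>F\<in>Fs. if F = H then lkp u 0 * a F else 0)"
    unfolding yv lookup_sum
   proof (rule sum.cong[OF refl])
    fix F assume F: "F \<in> Fs"
    show "lkp (u * sgl (m + square_exponent F) (a F)) (m + square_exponent H) = (if F = H then lkp u 0 * a F else 0)"
    proof (cases "F = H")
     case True
     then show ?thesis using lookup_times_single(1)[of u "m + square_exponent F" "a F" 0] by simp
    next
     case False
     have "m + square_exponent H ~= x + (m + square_exponent F)" for x
     proof
      assume "m + square_exponent H = x + (m + square_exponent F)"
      then have "m + square_exponent H = (x + m) + square_exponent F" by (simp only: add.assoc)
      from div[OF F H this] show False using False by simp
     qed
     from lookup_times_single(2)[OF this] show ?thesis using False by simp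
    qed
   qed
   also have "\<dots> = lkp u 0 * a H" using finR H by simp
   finally show ?thesis .
  qed
  moreover have "lkp (?e * c) (m + square_exponent H) = lkp c m"
  proof -
   have "lkp (?e * c) (m + square_exponent H) = (\<Sum>F\<in>Fs. if F = H then lkp c m else 0)"
    unfolding ev lookup_sum
   proof (rule sum.cong[OF refl])
    fix F assume F: "F \<in> Fs"
    show "lkp (c * sgl (square_exponent F) 1) (m + square_exponent H) = (if F = H then lkp c m else 0)"
    proof (cases "F = H")
     case True
     then show ?thesis using lookup_times_single(1)[of c "square_exponent F" 1 m] by simp
    next
     case False
     have "m + square_exponent H ~= x + square_exponent F" for x
      using div[OF F H] False by blast
     from lookup_times_single(2)[OF this] show ?thesis using False by simp
    qed
   qed
   also have "\<dots> = lkp c m" using finR H by simp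
   finally show ?thesis .
  qed
  ultimately show ?thesis by (simp add: lookup_minus)
 qed
 have "a F0 = 1" "a G0 = 0" using F0 sF F0D by (auto simp: a_def)
 moreover have "lkp u 0 * a F0 = lkp u 0 * a G0"
  using coeff[of F0] coeff[of G0] sF F0D by (simp add: Fs_def)
 ultimately show False using u by simp
qed

end

subsection \<open>Localizations and face rings\<close>

locale ring_of_fractions = cring R for R (structure) +
 fixes S :: "'a set"
 assumes S_sub: "S \<subseteq> carrier R" and S_one: "\<one> \<in> S" and S_mult: "s \<in> S ==> t \<in> S ==> s \<otimes> t \<in> S"
begin

definition cl :: "'a => 'a => ('a \<times> 'a) set" where
 "cl a s = frac_rel R S `` {(a, s)}"

lemma S_carr: "s \<in> S ==> s \<in> carrier R"
 using S_sub by blast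

lemma frac_rel_iff: "((a, s), (b, t)) \<in> frac_rel R S \<longleftrightarrow> a \<in> carrier R \<and> s \<in> S \<and> b \<in> carrier R \<and> t \<in> S \<and>
  (\<exists>u\<in>S. u \<otimes> (a \<otimes> t) = u \<otimes> (b \<otimes> s))"
 by (simp add: frac_rel_def)

lemma equiv_frac_rel: "equiv (carrier R \<times> S) (frac_rel R S)"
proof (rule equivI)
 show "frac_rel R S \<subseteq> (carrier R \<times> S) \<times> (carrier R \<times> S)" by (auto simp: frac_rel_def)
 show "refl_on (carrier R \<times> S) (frac_rel R S)"
  using S_one by (auto simp: refl_on_def frac_rel_def)
 show "sym (frac_rel R S)"
 proof (rule symI)
  fix x y assume "(x, y) \<in> frac_rel R S"
  then show "(y, x) \<in> frac_rel R S"
   by (cases x, cases y) (force simp: frac_rel_iff)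
 qed
 show "trans (frac_rel R S)"
 proof (rule transI)
  fix x y z assume xy: "(x, y) \<in> frac_rel R S" and yz: "(y, z) \<in> frac_rel R S"
  obtain a s b t c r where e: "x = (a, s)" "y = (b, t)" "z = (c, r)" by (cases x, cases y, cases z)
  obtain u where u: "u \<in> S" "u \<otimes> (a \<otimes> t) = u \<otimes> (b \<otimes> s)" using xy unfolding e frac_rel_iff by blast
  obtain w where w: "w \<in> S" "w \<otimes> (b \<otimes> r) = w \<otimes> (c \<otimes> t)" using yz unfolding e frac_rel_iff by blast
  have m: "a \<in> carrier R" "b \<in> carrier R" "c \<in> carrier R" "s \<in> S" "t \<in> S" "r \<in> S"
   using xy yz unfolding e frac_rel_iff by auto
  have c: "s \<in> carrier R" "t \<in> carrier R" "r \<in> carrier R" "u \<in> carrier R" "w \<in> carrier R"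
   using m u w S_carr by auto
  have "(u \<otimes> w \<otimes> t) \<otimes> (a \<otimes> r) = (w \<otimes> r) \<otimes> (u \<otimes> (a \<otimes> t))" using c m(1-3) by (simp add: m_ac)
  also have "\<dots> = (u \<otimes> s) \<otimes> (w \<otimes> (b \<otimes> r))" unfolding u(2) using c m(1-3) by (simp add: m_ac)
  also have "\<dots> = (u \<otimes> w \<otimes> t) \<otimes> (c \<otimes> s)" unfolding w(2) using c m(1-3) by (simp add: m_ac)
  finally show "(x, z) \<in> frac_rel R S" unfolding e frac_rel_iff using m u(1) w(1) S_mult by blast
 qed
qed

lemma cl_eq:
 assumes "a \<in> carrier R" "s \<in> S" "b \<in> carrier R" "t \<in> S"
 shows "cl a s = cl b t \<longleftrightarrow> (\<exists>u\<in>S. u \<otimes> (a \<otimes> t) = u \<otimes> (b \<otimes> s))"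
proof -
 have "cl a s = cl b t \<longleftrightarrow> ((a, s), (b, t)) \<in> frac_rel R S"
  unfolding cl_def by (rule eq_equiv_class_iff[OF equiv_frac_rel]) (use assms in auto)
 then show ?thesis using assms by (simp add: frac_rel_iff)
qed

lemma mem_cl: "(b, t) \<in> cl a s \<longleftrightarrow> ((a, s), (b, t)) \<in> frac_rel R S"
 by (simp add: cl_def)

lemma cl_self: "a \<in> carrier R ==> s \<in> S ==> (a, s) \<in> cl a s"
 unfolding mem_cl frac_rel_iff using S_one by blast

text \<open>Operations on fractions are unions over all representatives; they collapse once the
  result is known to be independent of the representatives.\<close>

lemma Union_const: "x0 \<in> A ==> y0 \<in> B ==> (!!x y. x \<in> A ==> y \<in> B ==> g x y = C) ==> (\<Union>x\<in>A. \<Union>y\<in>B. g x y) = C"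
 by auto

lemma cl_mult:
 assumes a: "a \<in> carrier R" "s \<in> S" and b: "b \<in> carrier R" "t \<in> S"
 shows "cl a s \<otimes>\<^bsub>localization R S\<^esub> cl b t = cl (a \<otimes> b) (s \<otimes> t)"
proof -
 have "cl a s \<otimes>\<^bsub>localization R S\<^esub> cl b t
   = (\<Union>x\<in>cl a s. \<Union>y\<in>cl b t. cl (fst x \<otimes> fst y) (snd x \<otimes> snd y))"
  by (simp add: localization_def cl_def split_def)
 also have "\<dots> = cl (a \<otimes> b) (s \<otimes> t)"
 proof (rule Union_const[OF cl_self[OF a] cl_self[OF b]])
  fix x y assume x: "x \<in> cl a s" and y: "y \<in> cl b t"
  obtain a' s' b' t' where e: "x = (a', s')" "y = (b', t')" by (cases x, cases y)
  obtain u where u: "u \<in> S" "u \<otimes> (a \<otimes> s') = u \<otimes> (a' \<otimes> s)" using x unfolding e mem_cl frac_rel_iff by blast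
  obtain w where w: "w \<in> S" "w \<otimes> (b \<otimes> t') = w \<otimes> (b' \<otimes> t)" using y unfolding e mem_cl frac_rel_iff by blast
  have m: "a' \<in> carrier R" "b' \<in> carrier R" "s' \<in> S" "t' \<in> S" using x y unfolding e mem_cl frac_rel_iff by auto
  have c: "s \<in> carrier R" "t \<in> carrier R" "s' \<in> carrier R" "t' \<in> carrier R" "u \<in> carrier R" "w \<in> carrier R"
   using m u w a b S_carr by auto
  have "(u \<otimes> w) \<otimes> ((a' \<otimes> b') \<otimes> (s \<otimes> t)) = (u \<otimes> (a' \<otimes> s)) \<otimes> (w \<otimes> (b' \<otimes> t))" using c m(1,2) by (simp add: m_ac)
  also have "\<dots> = (u \<otimes> w) \<otimes> ((a \<otimes> b) \<otimes> (s' \<otimes> t'))" unfolding u(2)[symmetric] w(2)[symmetric] using c m(1,2) a(1) b(1) by (simp add: m_ac)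
  finally have "(u \<otimes> w) \<otimes> ((a' \<otimes> b') \<otimes> (s \<otimes> t)) = (u \<otimes> w) \<otimes> ((a \<otimes> b) \<otimes> (s' \<otimes> t'))" .
  then have "cl (a' \<otimes> b') (s' \<otimes> t') = cl (a \<otimes> b) (s \<otimes> t)"
   using m a b S_mult[OF u(1) w(1)] by (subst cl_eq) (auto intro: S_mult)
  then show "cl (fst x \<otimes> fst y) (snd x \<otimes> snd y) = cl (a \<otimes> b) (s \<otimes> t)" by (simp add: e)
 qed
 finally show ?thesis .
qed

lemma cl_add:
 assumes a: "a \<in> carrier R" "s \<in> S" and b: "b \<in> carrier R" "t \<in> S"
 shows "cl a s \<oplus>\<^bsub>localization R S\<^esub> cl b t = cl (a \<otimes> t \<oplus> b \<otimes> s) (s \<otimes> t)"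
proof -
 have "cl a s \<oplus>\<^bsub>localization R S\<^esub> cl b t
   = (\<Union>x\<in>cl a s. \<Union>y\<in>cl b t. cl (fst x \<otimes> snd y \<oplus> fst y \<otimes> snd x) (snd x \<otimes> snd y))"
  by (simp add: localization_def cl_def split_def)
 also have "\<dots> = cl (a \<otimes> t \<oplus> b \<otimes> s) (s \<otimes> t)"
 proof (rule Union_const[OF cl_self[OF a] cl_self[OF b]])
  fix x y assume x: "x \<in> cl a s" and y: "y \<in> cl b t"
  obtain a' s' b' t' where e: "x = (a', s')" "y = (b', t')" by (cases x, cases y)
  obtain u where u: "u \<in> S" "u \<otimes> (a \<otimes> s') = u \<otimes> (a' \<otimes> s)" using x unfolding e mem_cl frac_rel_iff by blast
  obtain w where w: "w \<in> S" "w \<otimes> (b \<otimes> t') = w \<otimes> (b' \<otimes> t)" using y unfolding e mem_cl frac_rel_iff by blast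
  have m: "a' \<in> carrier R" "b' \<in> carrier R" "s' \<in> S" "t' \<in> S" using x y unfolding e mem_cl frac_rel_iff by auto
  have c: "s \<in> carrier R" "t \<in> carrier R" "s' \<in> carrier R" "t' \<in> carrier R" "u \<in> carrier R" "w \<in> carrier R"
   using m u w a b S_carr by auto
  have "(u \<otimes> w) \<otimes> ((a' \<otimes> t' \<oplus> b' \<otimes> s') \<otimes> (s \<otimes> t))
    = (u \<otimes> (a' \<otimes> s)) \<otimes> (w \<otimes> (t' \<otimes> t)) \<oplus> (w \<otimes> (b' \<otimes> t)) \<otimes> (u \<otimes> (s' \<otimes> s))"
   using c m(1,2) by (simp add: l_distr r_distr m_ac)
  also have "\<dots> = (u \<otimes> w) \<otimes> ((a \<otimes> t \<oplus> b \<otimes> s) \<otimes> (s' \<otimes> t'))"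
   unfolding u(2)[symmetric] w(2)[symmetric] using c m(1,2) a(1) b(1) by (simp add: l_distr r_distr m_ac)
  finally have "(u \<otimes> w) \<otimes> ((a' \<otimes> t' \<oplus> b' \<otimes> s') \<otimes> (s \<otimes> t)) = (u \<otimes> w) \<otimes> ((a \<otimes> t \<oplus> b \<otimes> s) \<otimes> (s' \<otimes> t'))" .
  moreover have "a' \<otimes> t' \<oplus> b' \<otimes> s' \<in> carrier R" "a \<otimes> t \<oplus> b \<otimes> s \<in> carrier R" using c m(1,2) a(1) b(1) by simp_all
  ultimately have "cl (a' \<otimes> t' \<oplus> b' \<otimes> s') (s' \<otimes> t') = cl (a \<otimes> t \<oplus> b \<otimes> s) (s \<otimes> t)"
   using m a b S_mult[OF u(1) w(1)] by (subst cl_eq) (auto intro: S_mult)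
  then show "cl (fst x \<otimes> snd y \<oplus> fst y \<otimes> snd x) (snd x \<otimes> snd y) = cl (a \<otimes> t \<oplus> b \<otimes> s) (s \<otimes> t)" by (simp add: e)
 qed
 finally show ?thesis .
qed

lemma cl_carrier: "a \<in> carrier R ==> s \<in> S ==> cl a s \<in> carrier (localization R S)"
 unfolding localization_def cl_def by (simp add: quotientI)

lemma cl_cases: "y \<in> carrier (localization R S) ==> (!!a s. a \<in> carrier R ==> s \<in> S ==> y = cl a s ==> P) ==> P"
 unfolding localization_def cl_def by (auto elim!: quotientE)

lemma cl_one: "\<one>\<^bsub>localization R S\<^esub> = cl \<one> \<one>" and cl_zero: "\<zero>\<^bsub>localization R S\<^esub> = cl \<zero> \<one>"
 by (simp_all add: localization_def cl_def)

end

text \<open>Sets the variables outside \<open>V\<close> to zero. With this retraction the map to the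
  face ring is defined on all polynomials of the type, as \<open>face_local_ring\<close>
  requires.\<close>

definition poly_restrict :: "'v set => ('v, 'k::field) mpoly => ('v, 'k) mpoly" where
 "poly_restrict V = kext (\<lambda>m. if kys m \<subseteq> V then sgl m 1 else 0)"

lemma poly_restrict_mult: "poly_restrict V (p * q) = poly_restrict V p * poly_restrict V q"
 unfolding poly_restrict_def by (rule kext_mult) (auto simp: keys_add_nat mult_single)

lemma lookup_poly_restrict: "lkp (poly_restrict V p) m = (if kys m \<subseteq> V then lkp p m else 0)"
proof -
 have "lkp (poly_restrict V p) m = (\<Sum>x\<in>kys p. if x = m then (if kys m \<subseteq> V then lkp p m else 0) else 0)"
  unfolding poly_restrict_def lookup_kext by (intro sum.cong refl) (auto simp: lookup_single when_def)
 also have "\<dots> = (if kys m \<subseteq> V then lkp p m else 0)" by (simp add: not_in_keys_iff_lookup_eq_zero)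
 finally show ?thesis .
qed

section \<open>The polynomial ring, the face ring and its localization\<close>

lemma poly_ring_simps: "x \<otimes>\<^bsub>poly_ring V\<^esub> y = x * y" "\<one>\<^bsub>poly_ring V\<^esub> = 1" "\<zero>\<^bsub>poly_ring V\<^esub> = 0" "x \<oplus>\<^bsub>poly_ring V\<^esub> y = x + y"
 "p \<in> carrier (poly_ring V) \<longleftrightarrow> (\<forall>m\<in>kys p. kys m \<subseteq> V)"
 by (simp_all add: poly_ring_def)

lemma poly_ring_closed:
 assumes "p \<in> carrier (poly_ring V)" "q \<in> carrier (poly_ring V)"
 shows "p + q \<in> carrier (poly_ring V)" "p * q \<in> carrier (poly_ring V)" "- p \<in> carrier (poly_ring V)" "p - q \<in> carrier (poly_ring V)"
proof -
 show "p + q \<in> carrier (poly_ring V)" using assms keys_add[of p q] unfolding poly_ring_simps by blast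
 show "p * q \<in> carrier (poly_ring V)" unfolding poly_ring_simps
 proof
  fix m assume "m \<in> kys (p * q)"
  then obtain a b where "a \<in> kys p" "b \<in> kys q" "m = a + b" using keys_mult[of p q] by blast
  then show "kys m \<subseteq> V" using assms unfolding poly_ring_simps by (simp add: keys_add_nat)
 qed
 show "- p \<in> carrier (poly_ring V)" using assms unfolding poly_ring_simps by simp
 show "p - q \<in> carrier (poly_ring V)" using assms keys_diff[of p q] unfolding poly_ring_simps by blast
qed

lemma cring_poly_ring: "cring (poly_ring V :: ('v, 'k::field) mpoly ring)"
proof (rule cringI)
 show "abelian_group (poly_ring V :: ('v, 'k) mpoly ring)"
 proof (rule abelian_groupI)
  fix x :: "('v, 'k) mpoly" assume x: "x \<in> carrier (poly_ring V)"
  show "\<exists>y\<in>carrier (poly_ring V). y \<oplus>\<^bsub>poly_ring V\<^esub> x = \<zero>\<^bsub>poly_ring V\<^esub>"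
   by (rule bexI[of _ "- x"]) (use poly_ring_closed(3)[OF x x] in \<open>simp_all add: poly_ring_simps(1-4)\<close>)
 qed (simp_all add: poly_ring_simps(1-4) poly_ring_closed add.assoc add.commute, simp add: poly_ring_simps)
 show "comm_monoid (poly_ring V :: ('v, 'k) mpoly ring)"
  by (rule comm_monoidI) (simp_all add: poly_ring_simps(1-4) poly_ring_closed mult.assoc mult.commute, simp add: poly_ring_simps keys_one)
qed (simp add: poly_ring_simps(1-4) distrib_right)

definition nonface_polys :: "'v set set => ('v, 'k::field) mpoly set" where
 "nonface_polys \<Delta> = carrier (poly_ring (vertex_set \<Delta>)) \<inter> nonface_ideal \<Delta>"

lemma poly_ring_minus:
 fixes x y :: "('v, 'k::field) mpoly"
 assumes "x \<in> carrier (poly_ring V)" "y \<in> carrier (poly_ring V)"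
 shows "\<ominus>\<^bsub>poly_ring V\<^esub> y = - y" "x \<ominus>\<^bsub>poly_ring V\<^esub> y = x - y"
proof -
 interpret A: cring "poly_ring V :: ('v, 'k) mpoly ring" by (rule cring_poly_ring)
 show *: "\<ominus>\<^bsub>poly_ring V\<^esub> y = - y"
  using assms(2) poly_ring_closed(3)[OF assms(2) assms(2)] by (intro A.minus_equality) (simp_all add: poly_ring_simps(1-4))
 show "x \<ominus>\<^bsub>poly_ring V\<^esub> y = x - y" unfolding a_minus_def * by (simp add: poly_ring_simps(1-4))
qed

lemma ideal_nonface_polys:
 assumes "abstract_simplicial_complex \<Delta>"
 shows "ideal (nonface_polys \<Delta> :: ('v, 'k::field) mpoly set) (poly_ring (vertex_set \<Delta>))"
proof (rule idealI)
 let ?A = "poly_ring (vertex_set \<Delta>) :: ('v, 'k) mpoly ring"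
 let ?N = "nonface_polys \<Delta> :: ('v, 'k) mpoly set"
 interpret A: cring ?A by (rule cring_poly_ring)
 note N = pidealD[OF pideal_nonface_ideal[OF assms, where 'k = 'k]]
 show "ring ?A" by unfold_locales
 show "subgroup (?N) (add_monoid ?A)"
 proof (rule A.add.subgroupI)
  show "?N \<subseteq> carrier ?A" by (auto simp: nonface_polys_def)
  have "0 \<in> ?N" using N(1) A.zero_closed by (simp add: nonface_polys_def poly_ring_simps(1-4))
  then show "?N ~= {}" by (intro notI) simp
 qed (auto simp: nonface_polys_def poly_ring_minus poly_ring_simps(1-4) intro: N poly_ring_closed)
qed (auto simp: nonface_polys_def poly_ring_simps(1-4) intro: pidealD[OF pideal_nonface_ideal[OF assms]] poly_ring_closed)

text \<open>Each monomial is divisible by the squarefree monomial of its support.\<close>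

lemma genideal_nonfaces:
 assumes cx: "abstract_simplicial_complex \<Delta>"
 shows "Idl\<^bsub>poly_ring (vertex_set \<Delta>)\<^esub> (squarefree_monomial ` {F. F \<subseteq> vertex_set \<Delta> \<and> F \<notin> \<Delta>})
  = (nonface_polys \<Delta> :: ('v, 'k::field) mpoly set)"
proof (rule equalityI)
 let ?A = "poly_ring (vertex_set \<Delta>) :: ('v, 'k) mpoly ring"
 let ?G = "squarefree_monomial ` {F. F \<subseteq> vertex_set \<Delta> \<and> F \<notin> \<Delta>} :: ('v, 'k) mpoly set"
 interpret A: cring ?A by (rule cring_poly_ring)
 have finD: "finite \<Delta>" using cx by (auto simp: abstract_simplicial_complex_def)
 have "inj_on (\<lambda>v. {v}) (vertex_set \<Delta>)" "(\<lambda>v. {v}) ` vertex_set \<Delta> \<subseteq> \<Delta>" by (auto simp: vertex_set_def inj_on_def)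
 then have finV: "finite (vertex_set \<Delta>)" using inj_on_finite finD by blast
 have sub: "?G \<subseteq> nonface_polys \<Delta>"
 proof
  fix x assume "x \<in> ?G"
  then obtain F where F: "F \<subseteq> vertex_set \<Delta>" "F \<notin> \<Delta>" "x = squarefree_monomial F" by auto
  then have "kys (square_exponent F) = F" using finV finite_subset keys_square_exponent by blast
  then show "x \<in> nonface_polys \<Delta>" using F
   by (simp add: squarefree_monomial_eq nonface_polys_def nonface_ideal_def poly_ring_simps)
 qed
 show "Idl\<^bsub>?A\<^esub> ?G \<subseteq> nonface_polys \<Delta>" by (rule A.genideal_minimal[OF ideal_nonface_polys[OF cx] sub])
 have GA: "?G \<subseteq> carrier ?A" using sub by (auto simp: nonface_polys_def)
 interpret J: ideal "Idl\<^bsub>?A\<^esub> ?G" ?A by (rule A.genideal_ideal[OF GA])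
 show "nonface_polys \<Delta> \<subseteq> Idl\<^bsub>?A\<^esub> ?G"
 proof
  fix p :: "('v, 'k) mpoly" assume p: "p \<in> nonface_polys \<Delta>"
  have mono: "sgl m c \<in> Idl\<^bsub>?A\<^esub> ?G" if m: "m \<in> kys p" for m c
  proof -
   have mV: "kys m \<subseteq> vertex_set \<Delta>" "kys m \<notin> \<Delta>" using p m by (auto simp: nonface_polys_def nonface_ideal_def poly_ring_simps)
   let ?r = "m - square_exponent (kys m)"
   have l: "m = ?r + square_exponent (kys m)"
   proof (rule poly_mapping_eqI)
    fix v show "lkp m v = lkp (m - square_exponent (kys m) + square_exponent (kys m)) v"
     by (auto simp: lookup_add lookup_minus lookup_square_exponent in_keys_iff)
   qed
   have "kys ?r \<subseteq> kys (?r + square_exponent (kys m))" by (simp only: keys_add_nat Un_upper1)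
   then have "kys ?r \<subseteq> kys m" by (simp only: l[symmetric])
   then have "sgl ?r c \<in> carrier ?A" using mV by (auto simp: poly_ring_simps)
   moreover have "squarefree_monomial (kys m) \<in> Idl\<^bsub>?A\<^esub> ?G" using A.genideal_self[OF GA] mV by blast
   ultimately have "sgl ?r c \<otimes>\<^bsub>?A\<^esub> squarefree_monomial (kys m) \<in> Idl\<^bsub>?A\<^esub> ?G" by (intro J.I_l_closed)
   moreover have "sgl ?r c * squarefree_monomial (kys m) = sgl m c"
    unfolding squarefree_monomial_eq mult_single l[symmetric] by simp
   ultimately show ?thesis by (simp add: poly_ring_simps(1-4))
  qed
  have "(\<Sum>m\<in>T. sgl m (lkp p m)) \<in> Idl\<^bsub>?A\<^esub> ?G" if "finite T" "T \<subseteq> kys p" for T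
   using that
  proof (induction T)
   case empty
   then show ?case using J.zero_closed by (simp add: poly_ring_simps(1-4))
  next
   case (insert m T)
   then show ?case using J.a_closed mono by (simp add: poly_ring_simps(1-4))
  qed
  from this[of "kys p"] show "p \<in> Idl\<^bsub>?A\<^esub> ?G" by (simp add: poly_mapping_expand)
 qed
qed

text \<open>Of all localizations only the one at the irrelevant maximal ideal \<open>M\<close> is
  used, which consists of the classes of polynomials without constant term.\<close>

lemma buchsbaum_face_local_ring:
 fixes \<Delta> :: "'v set set"
 assumes cx: "abstract_simplicial_complex \<Delta>" and nonvoid: "{} \<in> \<Delta>" and bb: "buchsbaum (k :: 'k::field itself) \<Delta>"
 shows "\<exists>(L :: ((('v, 'k) mpoly set \<times> ('v, 'k) mpoly set) set) ring) (h :: ('v, 'k) mpoly => _). face_local_ring L \<Delta> h \<and> buchsbaum_local_ring L"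
proof -
 define V where "V = vertex_set \<Delta>"
 define A where "A = (poly_ring V :: ('v, 'k) mpoly ring)"
 define I where "I = (nonface_polys \<Delta> :: ('v, 'k) mpoly set)"
 define R where "R = A Quot I"
 interpret A: cring A unfolding A_def by (rule cring_poly_ring)
 interpret I: ideal I A unfolding A_def I_def V_def by (rule ideal_nonface_polys[OF cx])
 interpret R: cring R unfolding R_def by (rule I.quotient_is_cring) unfold_locales
 note N = pidealD[OF pideal_nonface_ideal[OF cx, where 'k = 'k]]
 have fr: "face_ring k \<Delta> = R" unfolding face_ring_def R_def A_def I_def V_def genideal_nonfaces[OF cx] ..
 have S: "x \<otimes>\<^bsub>A\<^esub> y = x * y" "\<one>\<^bsub>A\<^esub> = 1" "\<zero>\<^bsub>A\<^esub> = 0" "x \<oplus>\<^bsub>A\<^esub> y = x + y" for x y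
  by (simp_all add: A_def poly_ring_simps(1-4))
 have C: "p + q \<in> carrier A" "p * q \<in> carrier A" "- p \<in> carrier A" "p - q \<in> carrier A"
  if "p \<in> carrier A" "q \<in> carrier A" for p q
  using poly_ring_closed[of p V q] that unfolding A_def by simp_all
 define f where "f p = I +>\<^bsub>A\<^esub> p" for p
 have fh: "f \<in> ring_hom A R" unfolding f_def[abs_def] R_def by (rule I.rcos_ring_hom)
 have f_closed: "f p \<in> carrier R" if "p \<in> carrier A" for p by (rule ring_hom_closed[OF fh that])
 have f_mult: "f (p * q) = f p \<otimes>\<^bsub>R\<^esub> f q" and f_add: "f (p + q) = f p \<oplus>\<^bsub>R\<^esub> f q" if "p \<in> carrier A" "q \<in> carrier A" for p q
  using ring_hom_mult[OF fh that] ring_hom_add[OF fh that] by (simp_all add: S)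
 have f_one: "f 1 = \<one>\<^bsub>R\<^esub>" using ring_hom_one[OF fh] by (simp add: S)
 have f_zero: "f 0 = \<zero>\<^bsub>R\<^esub>" using ring_hom_zero[OF fh] A.ring_axioms R.ring_axioms by (simp add: S)
 have f_eq: "f p = f q \<longleftrightarrow> p - q \<in> nonface_ideal \<Delta>" if "p \<in> carrier A" "q \<in> carrier A" for p q
 proof -
  have "f p = f q \<longleftrightarrow> p \<ominus>\<^bsub>A\<^esub> q \<in> I" unfolding f_def
   using A.quotient_eq_iff_same_a_r_cos[OF I.ideal_axioms that] by simp
  also have "p \<ominus>\<^bsub>A\<^esub> q = p - q" using poly_ring_minus(2)[of p V q] that unfolding A_def by simp
  also have "p - q \<in> I \<longleftrightarrow> p - q \<in> nonface_ideal \<Delta>" using C(4)[OF that] by (simp add: I_def nonface_polys_def A_def V_def)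
  finally show ?thesis .
 qed
 have f_surj: "\<exists>p\<in>carrier A. r = f p" if "r \<in> carrier R" for r
  using that unfolding R_def FactRing_def f_def A_RCOSETS_def' by auto
 have nf0: "lkp p 0 = 0" if "p \<in> nonface_ideal \<Delta>" for p :: "('v, 'k) mpoly"
 proof (rule ccontr)
  assume "lkp p 0 ~= 0"
  then have "0 \<in> kys p" by (simp only: in_keys_iff not_False_eq_True)
  then show False using that nonvoid unfolding nonface_ideal_def by force
 qed
 define M where "M = f ` {p \<in> carrier A. lkp p 0 = 0}"
 have f_M: "f p \<in> M \<longleftrightarrow> lkp p 0 = 0" if p: "p \<in> carrier A" for p
 proof
  assume "f p \<in> M"
  then obtain q where q: "q \<in> carrier A" "lkp q 0 = 0" "f p = f q" by (auto simp: M_def)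
  then have "lkp (p - q) 0 = 0" using f_eq[OF p q(1)] nf0 by blast
  then show "lkp p 0 = 0" using q by (simp add: lookup_minus)
 qed (use p in \<open>auto simp: M_def\<close>)
 have M_carr: "M \<subseteq> carrier R" unfolding M_def using f_closed by auto
 have M_mult: "x \<otimes>\<^bsub>R\<^esub> a \<in> M" if a: "a \<in> M" and x: "x \<in> carrier R" for a x
 proof -
  obtain p where p: "p \<in> carrier A" "lkp p 0 = 0" "a = f p" using a by (auto simp: M_def)
  obtain q where q: "q \<in> carrier A" "x = f q" using f_surj[OF x] by (rule bexE)
  have "x \<otimes>\<^bsub>R\<^esub> a = f (q * p)" unfolding p(3) q(2) by (rule f_mult[OF q(1) p(1), symmetric])
  then show ?thesis using f_M[OF C(2)[OF q(1) p(1)]] p(2) by (simp add: lookup_prod_0)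
 qed
 have M_ideal: "ideal M R"
 proof (rule idealI)
  show "ring R" by unfold_locales
  show "x \<otimes>\<^bsub>R\<^esub> a \<in> M" if "a \<in> M" "x \<in> carrier R" for a x by (rule M_mult[OF that])
  show "a \<otimes>\<^bsub>R\<^esub> x \<in> M" if "a \<in> M" "x \<in> carrier R" for a x
   using M_mult[OF that] R.m_comm[OF subsetD[OF M_carr that(1)] that(2)] by simp
  show "subgroup M (add_monoid R)"
  proof (rule R.add.subgroupI)
   show "M \<subseteq> carrier R" by (rule M_carr)
   have "f 0 \<in> M" using f_M[of 0] A.zero_closed by (simp add: S)
   then show "M ~= {}" by (intro notI) simp
   show "\<ominus>\<^bsub>R\<^esub> a \<in> M" if a: "a \<in> M" for a
   proof -
    have "\<ominus>\<^bsub>R\<^esub> \<one>\<^bsub>R\<^esub> \<otimes>\<^bsub>R\<^esub> a = \<ominus>\<^bsub>R\<^esub> a" using subsetD[OF M_carr a] by (simp only: R.l_minus R.one_closed R.l_one)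
    then show ?thesis using M_mult[OF a, of "\<ominus>\<^bsub>R\<^esub> \<one>\<^bsub>R\<^esub>"] by simp
   qed
   show "a \<oplus>\<^bsub>R\<^esub> b \<in> M" if aM: "a \<in> M" and bM: "b \<in> M" for a b
   proof -
    obtain p where p: "p \<in> carrier A" "lkp p 0 = 0" "a = f p" using aM by (auto simp: M_def)
    obtain q where q: "q \<in> carrier A" "lkp q 0 = 0" "b = f q" using bM by (auto simp: M_def)
    have "a \<oplus>\<^bsub>R\<^esub> b = f (p + q)" using f_add[OF p(1) q(1)] p q by simp
    then show ?thesis using f_M[OF C(1)[OF p(1) q(1)]] p(2) q(2) by (simp add: lookup_add)
   qed
  qed
 qed
 have one_M: "\<one>\<^bsub>R\<^esub> \<notin> M" using f_M[OF A.one_closed] by (simp add: f_one S lookup_one)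
 have M_max: "maximalideal M R"
 proof (rule maximalidealI[OF M_ideal])
  show "carrier R ~= M" using one_M R.one_closed by blast
  fix J assume J: "ideal J R" "M \<subseteq> J" "J \<subseteq> carrier R"
  interpret J: ideal J R by fact
  show "J = M \<or> J = carrier R"
  proof (cases "J \<subseteq> M")
   case False
   then obtain r where r: "r \<in> J" "r \<notin> M" by blast
   obtain p where p: "p \<in> carrier A" "r = f p" using f_surj r(1) J(3) by blast
   define c where "c = lkp p 0"
   have c: "c ~= 0" using r(2) f_M[OF p(1)] p(2) by (simp add: c_def)
   have sA: "sgl 0 a \<in> carrier A" for a unfolding A_def poly_ring_simps(5) by simp
   have "f (sgl 0 c - p) \<in> J" using f_M[OF C(4)[OF sA p(1)], of c] J(2) by (auto simp: lookup_minus c_def)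
   then have "f (sgl 0 c - p) \<oplus>\<^bsub>R\<^esub> f p \<in> J" using J.a_closed r(1) p(2) by blast
   then have "f (sgl 0 c) \<in> J" using f_add[OF C(4)[OF sA p(1)] p(1), of c] by simp
   then have "f (sgl 0 (1 / c)) \<otimes>\<^bsub>R\<^esub> f (sgl 0 c) \<in> J" by (rule J.I_l_closed[OF _ f_closed[OF sA]])
   then have "\<one>\<^bsub>R\<^esub> \<in> J" using f_mult[OF sA sA, of "1 / c" c] c by (simp add: mult_single f_one)
   then show ?thesis using J.one_imp_carrier by blast
  qed (use J in blast)
 qed
 define L where "L = localization R (carrier R - M)"
 have bl: "buchsbaum_local_ring L" using bb M_max unfolding buchsbaum_def fr buchsbaum_ring_def L_def by blast
 then have crL: "cring L" unfolding buchsbaum_local_ring_def local_noetherian_ring_def by blast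
 have prime: "primeideal M R" by (rule R.maximalideal_prime[OF M_max])
 interpret F: ring_of_fractions R "carrier R - M"
 proof (unfold_locales)
  show "\<one>\<^bsub>R\<^esub> \<in> carrier R - M" using one_M by simp
  show "s \<otimes>\<^bsub>R\<^esub> t \<in> carrier R - M" if "s \<in> carrier R - M" "t \<in> carrier R - M" for s t
   using primeideal.I_prime[OF prime, of s t] that by auto
 qed simp
 note FS = F.cl_mult[folded L_def] F.cl_add[folded L_def] F.cl_carrier[folded L_def] F.cl_one[folded L_def] F.cl_zero[folded L_def]
 have oneS: "\<one>\<^bsub>R\<^esub> \<in> carrier R - M" using one_M by simp
 define r where "r p = poly_restrict V p" for p :: "('v, 'k) mpoly"
 have rA: "r p \<in> carrier A" for p
  unfolding A_def poly_ring_simps(5) r_def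
 proof
  fix m assume "m \<in> kys (poly_restrict V p)"
  then have "lkp (poly_restrict V p) m ~= 0" by (simp only: in_keys_iff not_False_eq_True)
  then show "kys m \<subseteq> V" using lookup_poly_restrict[of V p m] by (cases "kys m \<subseteq> V") auto
 qed
 have r_mult: "r (p * q) = r p * r q" for p q unfolding r_def by (rule poly_restrict_mult)
 have r_add: "r (p + q) = r p + r q" for p q unfolding r_def poly_restrict_def by (rule kext_add)
 have r_id: "r p = p" if "p \<in> carrier A" for p
 proof (rule poly_mapping_eqI)
  fix m show "lkp (r p) m = lkp p m"
   using that unfolding r_def lookup_poly_restrict A_def poly_ring_simps(5) using in_keys_iff[of m p] by auto
 qed
 have r0: "lkp (r p) 0 = lkp p 0" for p by (simp add: r_def lookup_poly_restrict)
 have r_nf: "r p \<in> nonface_ideal \<Delta> \<longleftrightarrow> p \<in> nonface_ideal \<Delta>" for p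
 proof -
  have V: "G \<subseteq> V" if "G \<in> \<Delta>" for G using that cx unfolding V_def vertex_set_def abstract_simplicial_complex_def by blast
  have "(m \<in> kys (r p) --> kys m \<notin> \<Delta>) \<longleftrightarrow> (m \<in> kys p --> kys m \<notin> \<Delta>)" for m
   using V[of "kys m"] unfolding in_keys_iff r_def lookup_poly_restrict by auto
  then show ?thesis unfolding nonface_ideal_def by blast
 qed
 define h where "h p = F.cl (f (r p)) \<one>\<^bsub>R\<^esub>" for p
 have frc: "f (r p) \<in> carrier R" for p by (rule f_closed[OF rA])
 have "face_local_ring L \<Delta> h"
 proof (intro face_local_ring.intro[OF crL] face_local_ring_axioms.intro)
  show "abstract_simplicial_complex \<Delta>" "{} \<in> \<Delta>" by fact+
  show "h p \<in> carrier L" for p unfolding h_def by (rule FS(3)[OF frc oneS])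
  show "h (p + q) = h p \<oplus>\<^bsub>L\<^esub> h q" for p q
   unfolding h_def FS(2)[OF frc oneS frc oneS] using frc by (simp add: r_add f_add rA)
  show "h (p * q) = h p \<otimes>\<^bsub>L\<^esub> h q" for p q
   unfolding h_def FS(1)[OF frc oneS frc oneS] by (simp add: r_mult f_mult rA)
  have "r 1 = 1" using r_id[OF A.one_closed] by (simp add: S)
  then show "h 1 = \<one>\<^bsub>L\<^esub>" unfolding h_def FS(4) by (simp add: f_one)
  show "h p = \<zero>\<^bsub>L\<^esub> \<longleftrightarrow> (\<exists>u. lkp u 0 ~= 0 \<and> u * p \<in> nonface_ideal \<Delta>)" for p
  proof -
   have "h p = \<zero>\<^bsub>L\<^esub> \<longleftrightarrow> (\<exists>s\<in>carrier R - M. s \<otimes>\<^bsub>R\<^esub> f (r p) = \<zero>\<^bsub>R\<^esub>)"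
    unfolding h_def FS(5) F.cl_eq[OF frc oneS R.zero_closed oneS] using frc by (intro bex_cong) auto
   also have "\<dots> \<longleftrightarrow> (\<exists>u. lkp u 0 ~= 0 \<and> u * p \<in> nonface_ideal \<Delta>)"
   proof
    assume "\<exists>s\<in>carrier R - M. s \<otimes>\<^bsub>R\<^esub> f (r p) = \<zero>\<^bsub>R\<^esub>"
    then obtain s where s: "s \<in> carrier R" "s \<notin> M" "s \<otimes>\<^bsub>R\<^esub> f (r p) = \<zero>\<^bsub>R\<^esub>" by blast
    obtain u where u: "u \<in> carrier A" "s = f u" using f_surj[OF s(1)] by blast
    have "f (u * r p) = f 0" using s(3) u f_mult[OF u(1) rA] by (simp add: f_zero)
    then have "r (u * p) \<in> nonface_ideal \<Delta>"
     using f_eq[OF C(2)[OF u(1) rA] A.zero_closed[unfolded S]] by (simp add: r_mult r_id[OF u(1)])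
    then show "\<exists>u. lkp u 0 ~= 0 \<and> u * p \<in> nonface_ideal \<Delta>" using r_nf s(2) u f_M[OF u(1)] by blast
   next
    assume "\<exists>u. lkp u 0 ~= 0 \<and> u * p \<in> nonface_ideal \<Delta>"
    then obtain u where u: "lkp u 0 ~= 0" "u * p \<in> nonface_ideal \<Delta>" by blast
    have "r u * r p - 0 \<in> nonface_ideal \<Delta>" using r_nf[of "u * p"] u(2) by (simp add: r_mult)
    then have "f (r u * r p) = f 0" using f_eq[OF C(2)[OF rA rA] A.zero_closed[unfolded S]] by blast
    then have "f (r u) \<otimes>\<^bsub>R\<^esub> f (r p) = \<zero>\<^bsub>R\<^esub>" by (simp add: f_mult rA f_zero)
    moreover have "f (r u) \<in> carrier R - M" using frc f_M[OF rA, of u] u(1) r0 by simp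
    ultimately show "\<exists>s\<in>carrier R - M. s \<otimes>\<^bsub>R\<^esub> f (r p) = \<zero>\<^bsub>R\<^esub>" by blast
   qed
   finally show ?thesis .
  qed
  show "h u \<in> Units L" if u: "lkp u 0 ~= 0" for u
  proof -
   let ?s = "f (r u)"
   have s: "?s \<in> carrier R - M" using frc f_M[OF rA, of u] u r0 by simp
   have e: "F.cl ?s ?s = \<one>\<^bsub>L\<^esub>" unfolding FS(4) F.cl_eq[OF frc s R.one_closed oneS]
    by (rule bexI[OF _ oneS]) (use frc in simp)
   have "h u \<otimes>\<^bsub>L\<^esub> F.cl \<one>\<^bsub>R\<^esub> ?s = \<one>\<^bsub>L\<^esub>" unfolding h_def FS(1)[OF frc oneS R.one_closed s] using frc e by simp
   moreover have "F.cl \<one>\<^bsub>R\<^esub> ?s \<otimes>\<^bsub>L\<^esub> h u = \<one>\<^bsub>L\<^esub>" unfolding h_def FS(1)[OF R.one_closed s frc oneS] using frc e by simp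
   ultimately show ?thesis unfolding Units_def h_def using FS(3)[OF frc oneS] FS(3)[OF R.one_closed s] by blast
  qed
  show "\<exists>p u. lkp u 0 ~= 0 \<and> y \<otimes>\<^bsub>L\<^esub> h u = h p" if y: "y \<in> carrier L" for y
  proof -
   obtain a s where as: "a \<in> carrier R" "s \<in> carrier R - M" "y = F.cl a s" using F.cl_cases y unfolding L_def by blast
   obtain p where p: "p \<in> carrier A" "a = f p" using f_surj as(1) by blast
   obtain u where u: "u \<in> carrier A" "s = f u" using f_surj as(2) by blast
   have sc: "s \<in> carrier R" using as(2) by simp
   have "y \<otimes>\<^bsub>L\<^esub> h u = F.cl (a \<otimes>\<^bsub>R\<^esub> s) (s \<otimes>\<^bsub>R\<^esub> \<one>\<^bsub>R\<^esub>)"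
    using FS(1)[OF as(1,2) sc oneS] as(3) u by (simp add: h_def r_id)
   also have "\<dots> = F.cl a \<one>\<^bsub>R\<^esub>"
    using F.cl_eq[of "a \<otimes>\<^bsub>R\<^esub> s" "s \<otimes>\<^bsub>R\<^esub> \<one>\<^bsub>R\<^esub>" a "\<one>\<^bsub>R\<^esub>"] as(1,2) sc oneS by auto
   also have "\<dots> = h p" using p by (simp add: h_def r_id)
   finally show ?thesis using f_M[OF u(1)] u(2) as(2) by blast
  qed
 qed
 then show ?thesis using bl by blast
qed

text \<open>The maximal ideal provided by the Buchsbaum condition is unique and hence equals
  \<open>maxid\<close>, so the condition applies to the system of parameters
  \<open>params d\<close>.\<close>

lemma buchsbaum_strongly_connected:
 fixes \<Delta> :: "'v set set"
 assumes cx: "abstract_simplicial_complex \<Delta>" and bb: "buchsbaum (k :: 'k::field itself) \<Delta>"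
  and dim: "!!F. F \<in> \<Delta> ==> card F \<le> d" and F: "F0 \<in> \<Delta>" "card F0 = d" and d: "1 < d"
 shows "F \<in> \<Delta> ==> (!!G. G \<in> \<Delta> ==> F \<subseteq> G ==> G = F) ==> card F = d"
  and "(!!F. F \<in> A ==> F \<in> \<Delta> \<and> card F = d) ==> (!!F. F \<in> \<Delta> ==> card F = d ==> F \<notin> A ==> F \<in> B) ==>
   (!!F. F \<in> B ==> F \<in> \<Delta> \<and> card F = d \<and> F \<notin> A) ==>
   (!!F G. F \<in> A ==> G \<in> B ==> card (F \<inter> G) < d - 1) ==> F \<in> A ==> G \<in> B ==> F \<inter> G = {}"
proof -
 have nonvoid: "{} \<in> \<Delta>" using cx F(1) unfolding abstract_simplicial_complex_def by blast
 obtain L :: "((('v, 'k) mpoly set \<times> ('v, 'k) mpoly set) set) ring" and h :: "('v, 'k) mpoly => _" where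
  L: "face_local_ring L \<Delta> h" "buchsbaum_local_ring L"
  using buchsbaum_face_local_ring[OF cx nonvoid bb] by blast
 interpret face_local_ring L \<Delta> h by (rule L(1))
 obtain M where M: "local_noetherian_ring L M" "\<forall>xs. system_of_parameters L M xs --> weak_sequence L M xs"
  using L(2) unfolding buchsbaum_local_ring_def by blast
 have "M = maxid" using M(1) maximalideal_maxid unfolding local_noetherian_ring_def by blast
 then have weak: "weak_sequence L maxid (params d)" using M(2) params_system[OF dim F] by blast
 show "F \<in> \<Delta> ==> (!!G. G \<in> \<Delta> ==> F \<subseteq> G ==> G = F) ==> card F = d"
 proof -
  assume A: "F \<in> \<Delta>" "!!G. G \<in> \<Delta> ==> F \<subseteq> G ==> G = F"
  have "F ~= {}" using A(2)[OF F(1)] F(2) d by auto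
  then show "card F = d" using d A by (intro maximal_faces_pure[OF weak _ dim]) auto
 qed
 show "(!!F. F \<in> A ==> F \<in> \<Delta> \<and> card F = d) ==> (!!F. F \<in> \<Delta> ==> card F = d ==> F \<notin> A ==> F \<in> B) ==>
   (!!F. F \<in> B ==> F \<in> \<Delta> \<and> card F = d \<and> F \<notin> A) ==>
   (!!F G. F \<in> A ==> G \<in> B ==> card (F \<inter> G) < d - 1) ==> F \<in> A ==> G \<in> B ==> F \<inter> G = {}"
  by (rule facets_not_separated[OF weak d dim])
qed

section \<open>Chains of ordered tuples\<close>

definition cone :: "'a => ('a list \<Rightarrow>\<^sub>0 'k::field) => 'a list \<Rightarrow>\<^sub>0 'k" where
 "cone x = kext (\<lambda>l. sgl (x # l) 1)"

definition map_tuples :: "('a => 'b) => ('a list \<Rightarrow>\<^sub>0 'k::field) => 'b list \<Rightarrow>\<^sub>0 'k" where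
 "map_tuples f = kext (\<lambda>l. sgl (map f l) 1)"

fun tuple_bd :: "'a list => 'a list \<Rightarrow>\<^sub>0 'k::field" where
 "tuple_bd [] = 0"
| "tuple_bd (x # l) = sgl l 1 - cone x (tuple_bd l)"

text \<open>An interior product: each occurrence of \<open>x\<close> is deleted with the sign of its
  position. Iterating it over the entries of a tuple gives \<open>alt\<close>.\<close>

fun tuple_rm :: "'a => 'a list => 'a list \<Rightarrow>\<^sub>0 'k::field" where
 "tuple_rm x [] = 0"
| "tuple_rm x (y # l) = (if x = y then sgl l 1 else 0) - cone y (tuple_rm x l)"

abbreviation "bdry \<equiv> kext tuple_bd"
abbreviation "rmv x \<equiv> kext (tuple_rm x)"

text \<open>The alternating function of a chain: a tuple \<open>l\<close> is sent to the sign of the permutation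
 rearranging \<open>l\<close> into the argument.\<close>
primrec alt :: "'a list => ('a list \<Rightarrow>\<^sub>0 'k::field) => 'k" where
 "alt [] c = lkp c []"
| "alt (x # tp) c = alt tp (rmv x c)"

lemma cone_simps: "cone x 0 = 0" "cone x (a + b) = cone x a + cone x b" "cone x (a - b) = cone x a - cone x b"
 "cone x (sgl l r) = sgl (x # l) r" "cone x (- a) = - cone x a"
 by (simp_all add: cone_def kext_add kext_diff kext_uminus scl_simps)

lemma map_tuples_simps: "map_tuples f 0 = 0" "map_tuples f (a - b) = map_tuples f a - map_tuples f b"
 "map_tuples f (sgl l r) = sgl (map f l) r"
 by (simp_all add: map_tuples_def kext_diff scl_simps)

lemma kext_zero_fun: "(!!x. x \<in> kys c ==> f x = 0) ==> kext f c = 0"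
 unfolding kext_def by (rule sum.neutral) (simp add: scl_simps)

lemma kext_cone: "kext f (cone x c) = kext (\<lambda>l. f (x # l)) c"
 unfolding cone_def kext_kext by (simp add: scl_simps)

lemma rmv_cone: "rmv x (cone y c) = (if x = y then c else 0) - cone y (rmv x c)"
proof -
 have "rmv x (cone y c) = kext (\<lambda>l. if x = y then sgl l 1 else 0) c - kext (\<lambda>l. cone y (tuple_rm x l)) c"
  unfolding kext_cone tuple_rm.simps kext_fun_diff ..
 moreover have "kext (\<lambda>l. cone y (tuple_rm x l)) c = cone y (rmv x c)" unfolding cone_def kext_kext ..
 moreover have "kext (\<lambda>l. if x = y then sgl l 1 else 0) c = (if x = y then c else 0)"
  by (cases "x = y") (simp_all add: kext_ident kext_zero_fun)
 ultimately show ?thesis by simp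
qed

lemma bdry_cone: "bdry (cone x c) = c - cone x (bdry c)"
proof -
 have "bdry (cone x c) = kext (\<lambda>l. sgl l 1) c - kext (\<lambda>l. cone x (tuple_bd l)) c"
  unfolding kext_cone tuple_bd.simps kext_fun_diff ..
 moreover have "kext (\<lambda>l. cone x (tuple_bd l)) c = cone x (bdry c)" unfolding cone_def kext_kext ..
 ultimately show ?thesis by (simp add: kext_ident)
qed

lemma map_tuples_cone: "map_tuples f (cone x c) = cone (f x) (map_tuples f c)"
 unfolding map_tuples_def kext_cone unfolding cone_def kext_kext by (simp add: scl_simps)

text \<open>The operators anticommute. That their squares vanish needs its own induction, because
  anticommutation does not imply it in characteristic 2.\<close>

lemma rmv_tuple_rm: "rmv x (tuple_rm y l) + rmv y (tuple_rm x l) = (0 :: 'a list \<Rightarrow>\<^sub>0 'k::field)"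
 and rmv_tuple_rm_same: "rmv x (tuple_rm x l) = (0 :: 'a list \<Rightarrow>\<^sub>0 'k::field)"
proof -
 show "rmv x (tuple_rm y l) + rmv y (tuple_rm x l) = (0 :: 'a list \<Rightarrow>\<^sub>0 'k::field)"
 proof (induction l)
  case (Cons z l)
  have e: "rmv x (tuple_rm y (z # l) :: 'a list \<Rightarrow>\<^sub>0 'k) = (if y = z then tuple_rm x l else 0) - ((if x = z then tuple_rm y l else 0) - cone z (rmv x (tuple_rm y l)))"
   for x y by (cases "y = z") (simp_all only: tuple_rm.simps kext_diff rmv_cone if_True if_False kext_single scl_simps kext_0 simp_thms)
  have "rmv x (tuple_rm y (z # l)) + rmv y (tuple_rm x (z # l) :: 'a list \<Rightarrow>\<^sub>0 'k) = cone z (rmv x (tuple_rm y l) + rmv y (tuple_rm x l))"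
   unfolding e[of x y] e[of y x] cone_simps by simp
  then show ?case by (simp only: Cons.IH cone_simps(1))
 qed simp
 show "rmv x (tuple_rm x l) = (0 :: 'a list \<Rightarrow>\<^sub>0 'k::field)"
  by (induction l) (simp_all add: kext_diff rmv_cone scl_simps cone_simps)
qed

section \<open>Alternation of chains\<close>

lemma rmv_rmv: "rmv x (rmv y c) + rmv y (rmv x c) = 0"
 unfolding kext_kext kext_fun_add[symmetric] by (rule kext_zero_fun) (rule rmv_tuple_rm)

lemma rmv_rmv_same: "rmv x (rmv x c) = 0"
 unfolding kext_kext by (rule kext_zero_fun) (rule rmv_tuple_rm_same)

text \<open>Every entry of \<open>l\<close> is deleted by exactly one \<open>x\<close> in
  \<open>V\<close>.\<close>

lemma sum_tuple_rm: "finite V ==> set l \<subseteq> V ==> (\<Sum>x\<in>V. tuple_rm x l) = (tuple_bd l :: 'a list \<Rightarrow>\<^sub>0 'k::field)"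
proof (induction l)
 case (Cons y l)
 have "(\<Sum>x\<in>V. tuple_rm x (y # l) :: 'a list \<Rightarrow>\<^sub>0 'k) = (\<Sum>x\<in>V. if x = y then sgl l 1 else 0) - cone y (\<Sum>x\<in>V. tuple_rm x l)"
  by (simp add: sum_subtractf cone_def kext_sum)
 also have "(\<Sum>x\<in>V. if x = y then sgl l (1::'k) else 0) = sgl l 1" using Cons.prems by simp
 also have "(\<Sum>x\<in>V. tuple_rm x l) = (tuple_bd l :: 'a list \<Rightarrow>\<^sub>0 'k)" using Cons by simp
 finally show ?case by (simp only: tuple_bd.simps)
qed simp

lemma alt_linear: "alt tp 0 = 0" "alt tp (a + b) = alt tp a + alt tp b" "alt tp (a - b) = alt tp a - alt tp b" "alt tp (scl r a) = r * alt tp a"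
proof -
 show "alt tp 0 = 0" by (induction tp) simp_all
 show "alt tp (a + b) = alt tp a + alt tp b" by (induction tp arbitrary: a b) (simp_all add: lookup_add kext_add)
 show "alt tp (a - b) = alt tp a - alt tp b" by (induction tp arbitrary: a b) (simp_all add: lookup_minus kext_diff)
 show "alt tp (scl r a) = r * alt tp a" by (induction tp arbitrary: a) (simp_all add: kext_scl)
qed

lemma alt_sum: "alt tp (\<Sum>i\<in>I. f i) = (\<Sum>i\<in>I. alt tp (f i))"
 by (induction I rule: infinite_finite_induct) (simp_all add: alt_linear)

lemma alt_kext: "alt tp (kext f c) = (\<Sum>x\<in>kys c. lkp c x * alt tp (f x))"
 by (simp add: kext_def alt_sum alt_linear)

lemma keys_cone:
 fixes c :: "'a list \<Rightarrow>\<^sub>0 'k::field"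
 assumes "m \<in> kys (cone x c)"
 shows "\<exists>m'\<in>kys c. m = x # m'"
proof -
 have "m \<in> (\<Union>l\<in>kys c. kys (sgl (x # l) (1::'k)))"
  using assms unfolding cone_def by (rule subsetD[OF keys_kext])
 then obtain l where "l \<in> kys c" "m \<in> kys (sgl (x # l) (1::'k))" by (rule UN_E)
 then show ?thesis by (intro bexI[of _ l]) simp_all
qed

lemma keys_diffE:
 assumes "m \<in> kys (a - b)"
 obtains "m \<in> kys a" | "m \<in> kys b"
 using subsetD[OF keys_diff assms] that by (rule UnE)

lemma keys_tuple_rm:
 fixes l :: "'a list"
 shows "m \<in> kys (tuple_rm x l :: 'a list \<Rightarrow>\<^sub>0 'k::field) ==> mset l = add_mset x (mset m)"
proof (induction l arbitrary: m)
 case (Cons y l)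
 from Cons.prems[unfolded tuple_rm.simps] show ?case
 proof (rule keys_diffE)
  assume m: "m \<in> kys (if x = y then sgl l (1::'k) else 0)"
  show ?thesis
  proof (cases "x = y")
   case True
   then have "m = l" using m by simp
   then show ?thesis using True by simp
  next
   case False
   then show ?thesis using m by simp
  qed
 next
  assume m: "m \<in> kys (cone y (tuple_rm x l :: 'a list \<Rightarrow>\<^sub>0 'k))"
  obtain m' where m': "m' \<in> kys (tuple_rm x l :: 'a list \<Rightarrow>\<^sub>0 'k)" "m = y # m'" using keys_cone[OF m] by (rule bexE)
  show ?thesis using Cons.IH[OF m'(1)] unfolding m'(2) by simp
 qed
qed simp

lemma keys_tuple_bd:
 fixes l :: "'a list"
 shows "m \<in> kys (tuple_bd l :: 'a list \<Rightarrow>\<^sub>0 'k::field) ==> Suc (length m) = length l \<and> set m \<subseteq> set l"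
proof (induction l arbitrary: m)
 case (Cons y l)
 from Cons.prems[unfolded tuple_bd.simps] show ?case
 proof (rule keys_diffE)
  assume m: "m \<in> kys (sgl l (1::'k))"
  then have "m = l" by simp
  then show ?thesis by auto
 next
  assume m: "m \<in> kys (cone y (tuple_bd l :: 'a list \<Rightarrow>\<^sub>0 'k))"
  obtain m' where m': "m' \<in> kys (tuple_bd l :: 'a list \<Rightarrow>\<^sub>0 'k)" "m = y # m'" using keys_cone[OF m] by (rule bexE)
  show ?thesis using Cons.IH[OF m'(1)] unfolding m'(2) by auto
 qed
qed simp

lemma alt_nonzero:
 fixes c :: "'a list \<Rightarrow>\<^sub>0 'k::field"
 shows "alt tp c ~= 0 ==> \<exists>m\<in>kys c. mset m = mset tp"
proof (induction tp arbitrary: c)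
 case Nil
 then show ?case by (intro bexI[of _ "[]"]) (simp_all add: in_keys_iff)
next
 case (Cons x tp)
 then obtain m where m: "m \<in> kys (rmv x c)" "mset m = mset tp" by auto
 obtain m' where m': "m' \<in> kys c" "m \<in> kys (tuple_rm x m' :: 'a list \<Rightarrow>\<^sub>0 'k)"
  by (rule keys_kextE[OF m(1)])
 show ?case using keys_tuple_rm[OF m'(2)] m m'(1) by (intro bexI[of _ m']) simp_all
qed

lemma tuple_rm_notin: "x \<notin> set l ==> tuple_rm x l = 0"
 by (induction l) (auto simp: cone_simps)

lemma alt_self: "distinct l ==> alt l (sgl l 1) = 1"
 by (induction l) (simp_all add: scl_simps tuple_rm_notin cone_simps)

lemma alt_swap: "alt (\<alpha> @ x # y # \<rho>) c + alt (\<alpha> @ y # x # \<rho>) c = 0"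
proof (induction \<alpha> arbitrary: c)
 case Nil
 have "alt \<rho> (rmv y (rmv x c)) + alt \<rho> (rmv x (rmv y c)) = 0"
  unfolding alt_linear(2)[symmetric] rmv_rmv alt_linear(1) ..
 then show ?case by simp
qed simp

lemma alt_double: "alt (\<alpha> @ x # x # \<rho>) c = 0"
 by (induction \<alpha> arbitrary: c) (simp_all add: rmv_rmv_same alt_linear)

lemma alt_move: "alt (\<alpha> @ x # \<beta> @ \<rho>) c = (-1) ^ length \<beta> * alt (\<alpha> @ \<beta> @ x # \<rho>) c"
proof (induction \<beta> arbitrary: \<alpha>)
 case (Cons y \<beta>)
 have "alt (\<alpha> @ x # y # (\<beta> @ \<rho>)) c = - alt (\<alpha> @ y # x # (\<beta> @ \<rho>)) c"
  using alt_swap[of \<alpha> x y "\<beta> @ \<rho>" c] by (simp only: add_eq_0_iff2)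
 also have "\<dots> = - ((-1) ^ length \<beta> * alt (\<alpha> @ y # \<beta> @ x # \<rho>) c)" using Cons[of "\<alpha> @ [y]"] by simp
 finally show ?case by simp
qed simp

lemma alt_not_distinct: "\<not> distinct tp ==> alt tp c = 0"
proof -
 assume nd: "\<not> distinct tp"
 obtain \<alpha> x \<beta> \<rho> where "tp = \<alpha> @ [x] @ \<beta> @ [x] @ \<rho>" using not_distinct_decomp[OF nd] by blast
 then have "tp = \<alpha> @ x # \<beta> @ (x # \<rho>)" by simp
 then show ?thesis using alt_move[of \<alpha> x \<beta> "x # \<rho>" c] alt_double[of "\<alpha> @ \<beta>" x \<rho> c] by simp
qed

lemma alt_exchange:
 "alt (\<alpha> @ a # \<beta> @ b # \<rho>) c = - alt (\<alpha> @ b # \<beta> @ a # \<rho>) c"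
proof -
 have "alt (\<alpha> @ \<beta> @ a # b # \<rho>) c = - alt (\<alpha> @ \<beta> @ b # a # \<rho>) c"
  using alt_swap[of "\<alpha> @ \<beta>" a b \<rho> c] by (simp only: add_eq_0_iff2 append.assoc)
 then show ?thesis unfolding alt_move[of \<alpha> a \<beta> "b # \<rho>" c] alt_move[of \<alpha> b \<beta> "a # \<rho>" c] by simp
qed

lemma alternating_alt:
 assumes "!!m. m \<in> kys c ==> length m = d \<and> set m \<subseteq> V"
 shows "alternating d V (\<lambda>tp. alt tp c)"
 unfolding alternating_def
proof (intro conjI allI impI)
 fix tp assume nz: "alt tp c ~= 0"
 obtain m where m: "m \<in> kys c" "mset m = mset tp" using alt_nonzero[OF nz] by blast
 show "length tp = d" "set tp \<subseteq> V" using assms[OF m(1)] mset_eq_length[OF m(2)] mset_eq_setD[OF m(2)] by auto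
 show "distinct tp" by (rule ccontr) (use nz alt_not_distinct[of tp c] in simp)
next
 fix tp and a b :: 'a assume a: "a \<in> set tp" and b: "b \<in> set tp" and ab: "a ~= b"
 have inj: "inj_on (swp a b) (set tp)" by (auto simp: inj_on_def swp_def split: if_splits)
 have ex: "alt (map (swp x y) (\<alpha> @ x # \<beta> @ y # \<rho>)) c = - alt (\<alpha> @ x # \<beta> @ y # \<rho>) c"
  if "distinct (\<alpha> @ x # \<beta> @ y # \<rho>)" for x y \<alpha> \<beta> \<rho>
 proof -
  have "map (swp x y) \<alpha> = \<alpha>" "map (swp x y) \<beta> = \<beta>" "map (swp x y) \<rho> = \<rho>"
   using that by (auto intro!: map_idI simp: swp_def)
  then have "map (swp x y) (\<alpha> @ x # \<beta> @ y # \<rho>) = \<alpha> @ y # \<beta> @ x # \<rho>" using that by (simp add: swp_def)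
  then show ?thesis using alt_exchange[of \<alpha> y \<beta> x \<rho> c] by (simp only:)
 qed
 have sym: "swp a b = swp b a" by (auto simp: swp_def fun_eq_iff)
 show "alt (map (swp a b) tp) c = - alt tp c"
 proof (cases "distinct tp")
  case False
  then have "\<not> distinct (map (swp a b) tp)" using inj by (simp add: distinct_map)
  then show ?thesis using False by (simp add: alt_not_distinct)
 next
  case True
  obtain \<alpha> \<gamma> where s: "tp = \<alpha> @ a # \<gamma>" using split_list[OF a] by blast
  then consider "b \<in> set \<alpha>" | "b \<in> set \<gamma>" using b ab by auto
  then show ?thesis
  proof cases
   case 1
   obtain \<alpha>1 \<alpha>2 where "\<alpha> = \<alpha>1 @ b # \<alpha>2" using split_list[OF 1] by blast
   then have t: "tp = \<alpha>1 @ b # \<alpha>2 @ a # \<gamma>" using s by simp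
   show ?thesis unfolding sym unfolding t by (rule ex) (use True t in simp)
  next
   case 2
   obtain \<alpha>1 \<alpha>2 where "\<gamma> = \<alpha>1 @ b # \<alpha>2" using split_list[OF 2] by blast
   then have t: "tp = \<alpha> @ a # \<alpha>1 @ b # \<alpha>2" using s by simp
   show ?thesis unfolding t by (rule ex) (use True t in simp)
  qed
 qed
qed

text \<open>Translates the boundary of chains into the sum over heads that \<open>cycle_on\<close>
  is about.\<close>

lemma sum_alt:
 assumes "finite V" "!!m. m \<in> kys c ==> set m \<subseteq> V"
 shows "(\<Sum>x\<in>V. alt (x # tp) c) = alt tp (bdry c)"
proof -
 have "(\<Sum>x\<in>V. rmv x c) = (\<Sum>l\<in>kys c. scl (lkp c l) (\<Sum>x\<in>V. tuple_rm x l))"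
  unfolding kext_def scl_sum by (rule sum.swap)
 also have "\<dots> = bdry c" unfolding kext_def by (intro sum.cong refl) (simp only: sum_tuple_rm[OF assms(1) assms(2)])
 finally have "(\<Sum>x\<in>V. rmv x c) = bdry c" .
 then show ?thesis by (simp add: alt_sum[symmetric])
qed

lemma tuple_bd_eq_sum:
 "(tuple_bd l :: 'a list \<Rightarrow>\<^sub>0 'k::field) = (\<Sum>i<length l. sgl (take i l @ drop (Suc i) l) ((-1) ^ i))"
proof (induction l)
 case (Cons x l)
 have "cone x (\<Sum>i<length l. sgl (take i l @ drop (Suc i) l) ((-1) ^ i :: 'k))
   = (\<Sum>i<length l. sgl (x # take i l @ drop (Suc i) l) ((-1) ^ i))"
  unfolding cone_def kext_sum by (simp add: scl_simps)
 then have "(tuple_bd (x # l) :: 'a list \<Rightarrow>\<^sub>0 'k) = sgl l 1 + (\<Sum>i<length l. - sgl (x # take i l @ drop (Suc i) l) ((-1) ^ i))"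
  by (simp add: Cons sum_negf)
 then show ?case by (simp add: sum.lessThan_Suc_shift single_uminus del: sum.lessThan_Suc)
qed simp

lemma tuple_bd_map: "tuple_bd (map f l) = map_tuples f (tuple_bd l)"
 by (induction l) (simp_all add: map_tuples_simps map_tuples_cone)

text \<open>The prism operator; the label \<open>(j, b)\<close> stands for vertex \<open>j\<close> of the bottom or top copy of the simplex.\<close>
fun prism :: "'a list => ('a \<times> bool) list \<Rightarrow>\<^sub>0 'k::field" where
 "prism [] = 0"
| "prism (j # js) = sgl ((j, False) # (j, True) # map (\<lambda>i. (i, True)) js) 1 - cone (j, False) (prism js)"

lemma prism_cone: "kext prism (cone j c) = cone (j, False) (cone (j, True) (map_tuples (\<lambda>i. (i, True)) c)) - cone (j, False) (kext prism c)"
proof -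
 have "kext prism (cone j c) = kext (\<lambda>l. sgl ((j, False) # (j, True) # map (\<lambda>i. (i, True)) l) 1) c - kext (\<lambda>l. cone (j, False) (prism l)) c"
  unfolding kext_cone prism.simps kext_fun_diff ..
 then show ?thesis unfolding cone_def map_tuples_def kext_kext by (simp add: scl_simps)
qed

text \<open>The recursions of \<open>prism\<close> and \<open>tuple_bd\<close> are both built from
  cones, so induction works with \<open>bdry_cone\<close> and \<open>prism_cone\<close> and needs no
  signs of positions.\<close>

lemma bdry_prism: "(bdry (prism l) :: ('a \<times> bool) list \<Rightarrow>\<^sub>0 'k::field) = sgl (map (\<lambda>i. (i, True)) l) 1 - sgl (map (\<lambda>i. (i, False)) l) 1 - kext prism (tuple_bd l)"
proof (induction l)
 case (Cons j js)
 have 1: "(bdry (prism (j # js)) :: ('a \<times> bool) list \<Rightarrow>\<^sub>0 'k) = tuple_bd ((j, False) # (j, True) # map (\<lambda>i. (i, True)) js) - (prism js - cone (j, False) (bdry (prism js)))"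
  by (simp only: prism.simps kext_diff kext_single bdry_cone scl_simps)
 have 2: "(tuple_bd (map (\<lambda>i. (i, True)) js) :: ('a \<times> bool) list \<Rightarrow>\<^sub>0 'k) = map_tuples (\<lambda>i. (i, True)) (tuple_bd js)" by (rule tuple_bd_map)
 show ?case
  unfolding 1 unfolding Cons.IH tuple_bd.simps 2 kext_diff prism_cone kext_single scl_simps cone_simps list.map
  by (simp add: algebra_simps)
qed simp

lemma prism_map: "prism (map f l) = map_tuples (map_prod f id) (prism l)"
 by (induction l) (simp_all add: map_tuples_simps map_tuples_cone comp_def)

lemma keys_prism:
 fixes l :: "'a list"
 shows "m \<in> kys (prism l :: ('a \<times> bool) list \<Rightarrow>\<^sub>0 'k::field) ==> length m = Suc (length l) \<and> fst ` set m \<subseteq> set l"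
proof (induction l arbitrary: m)
 case (Cons y l)
 from Cons.prems[unfolded prism.simps] show ?case
 proof (rule keys_diffE)
  assume "m \<in> kys (sgl ((y, False) # (y, True) # map (\<lambda>i. (i, True)) l) (1::'k))"
  then have "m = (y, False) # (y, True) # map (\<lambda>i. (i, True)) l" by simp
  then show ?thesis by auto
 next
  assume m: "m \<in> kys (cone (y, False) (prism l :: ('a \<times> bool) list \<Rightarrow>\<^sub>0 'k))"
  obtain m' where m': "m' \<in> kys (prism l :: ('a \<times> bool) list \<Rightarrow>\<^sub>0 'k)" "m = (y, False) # m'" using keys_cone[OF m] by (rule bexE)
  show ?thesis using Cons.IH[OF m'(1)] unfolding m'(2) by auto
 qed
qed simp

section \<open>Singular chains with field coefficients\<close>

text \<open>An operator on integral singular chains is applied to generators and extended linearly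
  over the field; identities between such operators need to be checked on generators only.\<close>

definition transfer :: "(('a \<Rightarrow>\<^sub>0 int) => 'b \<Rightarrow>\<^sub>0 int) => ('a \<Rightarrow>\<^sub>0 'k::field) => 'b \<Rightarrow>\<^sub>0 'k" where
 "transfer T = kext (\<lambda>f. emb (T (frag_of f)))"

lemma transfer_transfer:
 assumes "!!a b. T (a - b) = T a - (T b :: 'c \<Rightarrow>\<^sub>0 int)"
 shows "transfer T (transfer U c) = kext (\<lambda>f. emb (T (U (frag_of f)))) c"
 unfolding transfer_def[of U] transfer_def[of T] kext_kext
 by (simp add: kext_emb[of T, OF assms])

lemma field_boundary_eq:
 fixes c :: "('a, 'k::field) field_chain"
 shows "field_boundary p c = transfer (chain_boundary p) c"
proof -
 have "(emb (chain_boundary p (frag_of f)) :: ('a, 'k) field_chain) = (if p = 0 then 0 else \<Sum>i\<le>p. sgl (singular_face p i f) ((-1) ^ i))" for f :: "(nat => real) => 'a"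
  by (simp add: chain_boundary_def emb_simps emb_sum scl_simps)
 then show ?thesis
  unfolding field_boundary_def transfer_def kext_def by (simp add: scl_sum scl_simps mult.commute)
qed

lemma field_boundary_kext: "field_boundary p c = kext (\<lambda>f. field_boundary p (sgl f 1)) c"
 unfolding field_boundary_eq transfer_def by (simp add: scl_simps)

lemma field_boundary_linear: "field_boundary p 0 = 0" "field_boundary p (a + b) = field_boundary p a + field_boundary p b"
 "field_boundary p (a - b) = field_boundary p a - field_boundary p b" "field_boundary p (scl r a) = scl r (field_boundary p a)"
 unfolding field_boundary_eq transfer_def by (simp_all add: kext_add kext_diff kext_scl)

lemma field_boundary_single:
 "p ~= 0 ==> field_boundary p (sgl f 1) = (\<Sum>i\<le>p. sgl (singular_face p i f) ((-1) ^ i))"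
 unfolding field_boundary_eq transfer_def by (simp add: chain_boundary_def emb_simps emb_sum scl_simps)

lemma field_chains_iff: "c \<in> field_chains p T \<longleftrightarrow> (\<forall>f\<in>kys c. singular_simplex p T f)"
 by (auto simp: field_chains_def)

lemma field_chains_linear: "0 \<in> field_chains p T" "a \<in> field_chains p T ==> b \<in> field_chains p T ==> a + b \<in> field_chains p T"
 "a \<in> field_chains p T ==> b \<in> field_chains p T ==> a - b \<in> field_chains p T" "a \<in> field_chains p T ==> scl r a \<in> field_chains p T"
proof -
 show "0 \<in> field_chains p T" by (simp add: field_chains_def)
 show "a \<in> field_chains p T ==> b \<in> field_chains p T ==> a + b \<in> field_chains p T" using keys_add[of a b] unfolding field_chains_def by blast
 show "a \<in> field_chains p T ==> b \<in> field_chains p T ==> a - b \<in> field_chains p T" using keys_diff[of a b] unfolding field_chains_def by blast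
 have "kys (scl r a) \<subseteq> kys a" by (auto simp: in_keys_iff)
 then show "a \<in> field_chains p T ==> scl r a \<in> field_chains p T" unfolding field_chains_def by blast
qed

lemma kext_field_chains:
 assumes "!!x. x \<in> kys c ==> f x \<in> field_chains p T"
 shows "kext f c \<in> field_chains p T"
 using keys_kext[of f c] assms unfolding field_chains_def by blast

lemma transfer_field_chains:
 assumes c: "c \<in> field_chains p T" and D: "!!b. singular_chain p T b ==> singular_chain q T' (D b)"
 shows "transfer D c \<in> field_chains q T'"
 unfolding transfer_def
proof (rule kext_field_chains)
 fix f assume "f \<in> kys c"
 then have "singular_chain p T (frag_of f)" using c by (auto simp: field_chains_iff singular_chain_of)
 then have "singular_chain q T' (D (frag_of f))" by (rule D)
 then show "emb (D (frag_of f)) \<in> field_chains q T'"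
  using keys_emb[of "D (frag_of f)"] unfolding field_chains_def singular_chain_def by blast
qed

lemma field_boundary_boundary:
 assumes "c \<in> field_chains (Suc p) T"
 shows "field_boundary p (field_boundary (Suc p) c) = 0"
 unfolding field_boundary_eq transfer_transfer[of "chain_boundary p", OF chain_boundary_diff]
proof (rule kext_zero_fun)
 fix f assume "f \<in> kys c"
 then have "singular_chain (Suc p) T (frag_of f)" using assms by (auto simp: field_chains_iff singular_chain_of)
 then have "chain_boundary p (chain_boundary (Suc p) (frag_of f)) = 0" using chain_boundary_boundary[of "Suc p" T] by simp
 then show "emb (chain_boundary p (chain_boundary (Suc p) (frag_of f))) = 0" by (simp add: emb_simps)
qed

abbreviation subdiv :: "nat => nat => ('a, 'k::field) field_chain => ('a, 'k) field_chain" where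
 "subdiv n p \<equiv> transfer (singular_subdivision p ^^ n)"

lemma iterated_subdivision:
 "(singular_subdivision p ^^ n) (a - b) = (singular_subdivision p ^^ n) a - (singular_subdivision p ^^ n) b"
 "singular_chain p T c ==> singular_chain p T ((singular_subdivision p ^^ n) c)"
 "singular_chain p T c ==> chain_boundary p ((singular_subdivision p ^^ n) c) = (singular_subdivision (p - 1) ^^ n) (chain_boundary p c)"
 "singular_chain 0 T c ==> (singular_subdivision 0 ^^ n) c = c"
proof -
 show "(singular_subdivision p ^^ n) (a - b) = (singular_subdivision p ^^ n) a - (singular_subdivision p ^^ n) b"
  by (induction n) (simp_all add: singular_subdivision_diff)
 show s: "singular_chain p T ((singular_subdivision p ^^ n) c)" if "singular_chain p T c" for p n
  using that by (induction n) (simp_all add: singular_chain_singular_subdivision)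
 show "chain_boundary p ((singular_subdivision p ^^ n) c) = (singular_subdivision (p - 1) ^^ n) (chain_boundary p c)" if c: "singular_chain p T c"
  by (induction n) (simp_all add: chain_boundary_singular_subdivision[OF s[OF c]])
 show "(singular_subdivision 0 ^^ n) c = c" if c: "singular_chain 0 T c"
  by (induction n) (simp_all add: singular_subdivision_zero[OF c])
qed

lemma subdiv_chains: "c \<in> field_chains p T ==> subdiv n p c \<in> field_chains p T"
 by (rule transfer_field_chains) (auto intro: iterated_subdivision)

lemma boundary_subdiv:
 assumes "c \<in> field_chains (Suc p) T"
 shows "field_boundary (Suc p) (subdiv n (Suc p) c) = subdiv n p (field_boundary (Suc p) c)"
proof -
 have "transfer (chain_boundary (Suc p)) (transfer (singular_subdivision (Suc p) ^^ n) c)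
   = kext (\<lambda>f. emb (chain_boundary (Suc p) ((singular_subdivision (Suc p) ^^ n) (frag_of f)))) c"
  by (rule transfer_transfer) (rule chain_boundary_diff)
 also have "\<dots> = kext (\<lambda>f. emb ((singular_subdivision p ^^ n) (chain_boundary (Suc p) (frag_of f)))) c"
 proof (rule kext_cong)
  fix f assume "f \<in> kys c"
  then have "singular_chain (Suc p) T (frag_of f)" using assms by (auto simp: field_chains_iff singular_chain_of)
  from iterated_subdivision(3)[OF this, of n]
  show "emb (chain_boundary (Suc p) ((singular_subdivision (Suc p) ^^ n) (frag_of f))) = emb ((singular_subdivision p ^^ n) (chain_boundary (Suc p) (frag_of f)))"
   by simp
 qed
 also have "\<dots> = transfer (singular_subdivision p ^^ n) (transfer (chain_boundary (Suc p)) c)"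
  by (rule transfer_transfer[symmetric]) (rule iterated_subdivision(1))
 finally show ?thesis by (simp only: field_boundary_eq)
qed

lemma subdiv_homologous:
 assumes c: "c \<in> field_chains p T" and z: "field_boundary p c = 0"
 shows "\<exists>b\<in>field_chains (Suc p) T. subdiv n p c - c = field_boundary (Suc p) b"
proof -
 obtain h :: "nat => 'a chain => 'a chain" where h: "!!p. h p 0 = 0" "!!p c1 c2. h p (c1 - c2) = h p c1 - h p c2"
  "!!p T c. singular_chain p T c ==> singular_chain (Suc p) T (h p c)"
  "!!p T c. singular_chain p T c ==> chain_boundary (Suc p) (h p c) + h (p - Suc 0) (chain_boundary p c) = (singular_subdivision p ^^ n) c - c"
  by (rule chain_homotopic_iterated_singular_subdivision[where n = n], rule that; assumption)
 have "kext (\<lambda>f. emb (chain_boundary (Suc p) (h p (frag_of f)))) c + kext (\<lambda>f. emb (h (p - Suc 0) (chain_boundary p (frag_of f)))) c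
   = kext (\<lambda>f. emb ((singular_subdivision p ^^ n) (frag_of f))) c - kext (\<lambda>f. sgl f 1) c"
  unfolding kext_fun_add[symmetric] kext_fun_diff[symmetric]
 proof (rule kext_cong)
  fix f assume "f \<in> kys c"
  then have "singular_chain p T (frag_of f)" using c by (auto simp: field_chains_iff singular_chain_of)
  from arg_cong[OF h(4)[OF this], of emb]
  show "emb (chain_boundary (Suc p) (h p (frag_of f))) + emb (h (p - Suc 0) (chain_boundary p (frag_of f)))
    = emb ((singular_subdivision p ^^ n) (frag_of f)) - sgl f 1"
   by (simp only: emb_simps)
 qed
 also have "kext (\<lambda>f. emb (chain_boundary (Suc p) (h p (frag_of f)))) c = field_boundary (Suc p) (transfer (h p) c)"
  unfolding field_boundary_eq by (rule transfer_transfer[symmetric]) (rule chain_boundary_diff)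
 also have "kext (\<lambda>f. emb (h (p - Suc 0) (chain_boundary p (frag_of f)))) c = transfer (h (p - Suc 0)) (field_boundary p c)"
  unfolding field_boundary_eq by (rule transfer_transfer[symmetric]) (rule h(2))
 also have "\<dots> = 0" unfolding z by (simp add: transfer_def)
 finally have "subdiv n p c - c = field_boundary (Suc p) (transfer (h p) c)" by (simp add: transfer_def kext_ident)
 moreover have "transfer (h p) c \<in> field_chains (Suc p) T" by (rule transfer_field_chains[OF c h(3)])
 ultimately show ?thesis by blast
qed

text \<open>Smallness of one subdivided simplex persists under further subdivision, so a common
  exponent serves the finitely many simplices of \<open>c\<close>.\<close>

lemma subdiv_small:
 fixes c :: "('a, 'k::field) field_chain"
 assumes "!!U. U \<in> \<C> ==> openin T U" "topspace T \<subseteq> \<Union>\<C>" and c: "c \<in> field_chains p T"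
 shows "\<exists>n. \<forall>f\<in>kys (subdiv n p c). \<exists>V\<in>\<C>. f \<in> standard_simplex p \<rightarrow> V"
proof -
 have "\<exists>n. \<forall>m\<ge>n. \<forall>f\<in>kys ((singular_subdivision p ^^ m) (frag_of g)). \<exists>V\<in>\<C>. f \<in> standard_simplex p \<rightarrow> V"
  if "g \<in> kys c" for g
 proof -
  have g: "singular_chain p T (frag_of g)" using c that by (auto simp: field_chains_iff singular_chain_of)
  obtain n where n: "!!m f. n \<le> m ==> f \<in> kys ((singular_subdivision p ^^ m) (frag_of g)) ==> \<exists>V\<in>\<C>. f \<in> standard_simplex p \<rightarrow> V"
   by (rule sufficient_iterated_singular_subdivision_exists[OF assms(1,2) g], assumption, rule that; assumption)
  show ?thesis by (intro exI[of _ n] allI impI ballI) (rule n)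
 qed
 then have "\<forall>g\<in>kys c. \<exists>n. \<forall>m\<ge>n. \<forall>f\<in>kys ((singular_subdivision p ^^ m) (frag_of g)). \<exists>V\<in>\<C>. f \<in> standard_simplex p \<rightarrow> V"
  by (rule ballI)
 from bchoice[OF this] obtain N where N: "\<forall>g\<in>kys c. \<forall>m\<ge>N g. \<forall>f\<in>kys ((singular_subdivision p ^^ m) (frag_of g)).
   \<exists>V\<in>\<C>. f \<in> standard_simplex p \<rightarrow> V" by (rule exE)
 define n where "n = (\<Sum>g\<in>kys c. N g)"
 have Nn: "N g \<le> n" if "g \<in> kys c" for g
  unfolding n_def by (rule member_le_sum[OF that]) auto
 have "\<exists>V\<in>\<C>. f \<in> standard_simplex p \<rightarrow> V" if f: "f \<in> kys (subdiv n p c)" for f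
 proof -
  obtain g where g: "g \<in> kys c" "f \<in> kys (emb ((singular_subdivision p ^^ n) (frag_of g)) :: ('a, 'k) field_chain)"
   by (rule keys_kextE[OF f[unfolded transfer_def]])
  have "f \<in> kys ((singular_subdivision p ^^ n) (frag_of g))" by (rule subsetD[OF keys_emb g(2)])
  then show ?thesis using bspec[OF N g(1)] Nn[OF g(1)] by blast
 qed
 then show ?thesis by blast
qed

text \<open>Stated for any assignment \<open>\<rho>\<close> of singular simplices to tuples that
  respects faces: it serves both the affine simplices and the simplices of a prism.\<close>

lemma real_boundary:
 assumes len: "!!m. m \<in> kys c ==> length m = Suc (Suc p)"
  and face: "!!m i. m \<in> kys c ==> i \<le> Suc p ==> singular_face (Suc p) i (\<rho> m) = \<rho> (take i m @ drop (Suc i) m)"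
 shows "field_boundary (Suc p) (kext (\<lambda>m. sgl (\<rho> m) 1) c) = kext (\<lambda>m. sgl (\<rho> m) 1) (bdry c)"
proof -
 have "field_boundary (Suc p) (kext (\<lambda>m. sgl (\<rho> m) 1) c) = kext (\<lambda>m. field_boundary (Suc p) (sgl (\<rho> m) 1)) c"
  by (subst field_boundary_kext, subst kext_kext) (simp add: scl_simps)
 also have "\<dots> = kext (\<lambda>m. kext (\<lambda>m. sgl (\<rho> m) 1) (tuple_bd m)) c"
 proof (rule kext_cong)
  fix m assume m: "m \<in> kys c"
  have "field_boundary (Suc p) (sgl (\<rho> m) 1) = (\<Sum>i\<le>Suc p. sgl (singular_face (Suc p) i (\<rho> m)) ((-1) ^ i))"
   by (rule field_boundary_single) simp
  also have "\<dots> = (\<Sum>i\<le>Suc p. sgl (\<rho> (take i m @ drop (Suc i) m)) ((-1) ^ i))"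
   by (intro sum.cong refl) (simp only: face[OF m] atMost_iff)
  also have "\<dots> = kext (\<lambda>m. sgl (\<rho> m) 1) (tuple_bd m)"
   unfolding tuple_bd_eq_sum kext_sum len[OF m] lessThan_Suc_atMost by (simp add: scl_simps del: sum.atMost_Suc)
  finally show "field_boundary (Suc p) (sgl (\<rho> m) 1) = kext (\<lambda>m. sgl (\<rho> m) 1) (tuple_bd m)" .
 qed
 finally show ?thesis by (simp only: kext_kext)
qed

subsection \<open>Comparing quotient dimensions\<close>

definition subspace_pm :: "('b \<Rightarrow>\<^sub>0 'k::field) set => bool" where
 "subspace_pm Z \<longleftrightarrow> 0 \<in> Z \<and> (\<forall>a\<in>Z. \<forall>b\<in>Z. a + b \<in> Z) \<and> (\<forall>a\<in>Z. \<forall>r. scl r a \<in> Z)"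

lemma subspace_pmD:
 assumes "subspace_pm Z"
 shows "0 \<in> Z" "a \<in> Z ==> b \<in> Z ==> a + b \<in> Z" "a \<in> Z ==> scl r a \<in> Z" "a \<in> Z ==> b \<in> Z ==> a - b \<in> Z"
  "(!!i. i \<in> I ==> f i \<in> Z) ==> (\<Sum>i\<in>I. f i) \<in> Z"
proof -
 show 1: "0 \<in> Z" and 2: "!!a b. a \<in> Z ==> b \<in> Z ==> a + b \<in> Z" and 3: "!!a r. a \<in> Z ==> scl r a \<in> Z"
  using assms by (auto simp: subspace_pm_def)
 show "a \<in> Z ==> b \<in> Z ==> a - b \<in> Z" using 2[of a "scl (-1) b"] 3[of b "-1"] by (simp add: scl_simps)
 show "(!!i. i \<in> I ==> f i \<in> Z) ==> (\<Sum>i\<in>I. f i) \<in> Z"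
  by (induction I rule: infinite_finite_induct) (simp_all add: 1 2)
qed

definition indep_mod :: "('b \<Rightarrow>\<^sub>0 'k::field) set => ('b \<Rightarrow>\<^sub>0 'k) set => bool" where
 "indep_mod B S \<longleftrightarrow> (\<forall>a. (\<Sum>z\<in>S. scl (a z) z) \<in> B --> (\<forall>z\<in>S. a z = 0))"

lemma quotient_dim_eq: "quotient_dim Z B = Sup {enat (card S) | S. finite S \<and> S \<subseteq> Z \<and> indep_mod B S}"
 unfolding quotient_dim_def indep_mod_def scl_def ..

text \<open>Representatives supported in the finite set \<open>T\<close> bound the dimension modulo
  \<open>BX\<close>. Lift a maximal independent family of \<open>ZX\<close> to \<open>ZY\<close>; if
  \<open>w\<close> were outside \<open>BY\<close>, adding it would keep the lifted family
  independent modulo \<open>BY\<close> and make that dimension larger.\<close>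

lemma equal_quotient_dims_injective:
 fixes ZX BX ZY BY :: "('b \<Rightarrow>\<^sub>0 'k::field) set"
 assumes sBX: "subspace_pm BX" and sBY: "subspace_pm BY" and sub: "BY \<subseteq> BX"
  and fin: "finite T" and rep: "!!z. z \<in> ZX ==> \<exists>z'\<in>ZY. kys z' \<subseteq> T \<and> z - z' \<in> BX"
  and eq: "quotient_dim ZY BY = quotient_dim ZX BX"
  and w: "w \<in> ZY" "w \<in> BX"
 shows "w \<in> BY"
proof (rule ccontr)
 assume wB: "w \<notin> BY"
 have "\<forall>z\<in>ZX. \<exists>z'. z' \<in> ZY \<and> kys z' \<subseteq> T \<and> z - z' \<in> BX" using rep by blast
 from bchoice[OF this] obtain g where g0: "\<forall>z\<in>ZX. g z \<in> ZY \<and> kys (g z) \<subseteq> T \<and> z - g z \<in> BX" by (rule exE)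
 have g: "g z \<in> ZY \<and> kys (g z) \<subseteq> T \<and> z - g z \<in> BX" if "z \<in> ZX" for z by (rule bspec[OF g0 that])
 have swap: "(\<Sum>z\<in>S. scl (a z) z) \<in> BX" if S: "S \<subseteq> ZX" and m: "(\<Sum>z\<in>S. scl (a z) (g z)) \<in> BX" for S a
 proof -
  have "(\<Sum>z\<in>S. scl (a z) (z - g z)) \<in> BX" using S g subspace_pmD(3)[OF sBX] by (intro subspace_pmD(5)[OF sBX]) auto
  from subspace_pmD(2)[OF sBX this m] show ?thesis by (simp add: scl_simps sum_subtractf)
 qed
 \<comment> \<open>Finiteness is indispensable here, since equality of two infinite dimensions would
   give no contradiction.\<close>
 have bound: "card S \<le> card T" if S: "finite S" "S \<subseteq> ZX" "indep_mod BX S" for S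
 proof (rule ccontr)
  assume "\<not> card S \<le> card T"
  then obtain a where a: "\<exists>s\<in>S. a s ~= 0" "\<forall>l\<in>T. (\<Sum>s\<in>S. a s * lkp (g s) l) = 0"
   using exists_nontrivial_solution[OF fin S(1), of "\<lambda>s l. lkp (g s) l"] by auto
  have "(\<Sum>z\<in>S. scl (a z) (g z)) = 0"
  proof (rule poly_mapping_eqI)
   fix l
   show "lkp (\<Sum>z\<in>S. scl (a z) (g z)) l = lkp 0 l"
   proof (cases "l \<in> T")
    case True then show ?thesis using a(2) by (simp add: lookup_sum)
   next
    case False
    then have "lkp (g z) l = 0" if "z \<in> S" for z using g[of z] that S(2) by (auto simp: not_in_keys_iff_lookup_eq_zero[symmetric])
    then show ?thesis by (simp add: lookup_sum)
   qed
  qed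
  then have "(\<Sum>z\<in>S. scl (a z) (g z)) \<in> BX" using subspace_pmD(1)[OF sBX] by simp
  then have "(\<Sum>z\<in>S. scl (a z) z) \<in> BX" by (rule swap[OF S(2)])
  then show False using S(3) a(1) unfolding indep_mod_def by blast
 qed
 define C where "C = {card S | S. finite S \<and> S \<subseteq> ZX \<and> indep_mod BX S}"
 have finC: "finite C" unfolding C_def by (rule finite_subset[of _ "{..card T}"]) (auto simp: bound)
 have "card {} \<in> C" unfolding C_def by (auto simp: indep_mod_def intro!: exI[of _ "{}"])
 then have "Max C \<in> C" using finC by (intro Max_in) auto
 then obtain S where S: "finite S" "S \<subseteq> ZX" "indep_mod BX S" "card S = Max C" unfolding C_def by auto
 have qX: "quotient_dim ZX BX \<le> enat (card S)"
  unfolding quotient_dim_eq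
 proof (rule Sup_least)
  fix x assume "x \<in> {enat (card S) |S. finite S \<and> S \<subseteq> ZX \<and> indep_mod BX S}"
  then obtain n where "x = enat n" "n \<in> C" unfolding C_def by blast
  then show "x \<le> enat (card S)" using Max_ge[OF finC] S(4) by simp
 qed
 have comb: "a z = 0" if "(\<Sum>z\<in>S. scl (a z) (g z)) \<in> BX" "z \<in> S" for a z
  using swap[OF S(2) that(1)] S(3) that(2) unfolding indep_mod_def by blast
 have inj: "inj_on g S"
 proof (rule inj_onI, rule ccontr)
  fix x y assume xy: "x \<in> S" "y \<in> S" "g x = g y" "x ~= y"
  define a where "a z = (if z = x then 1 else if z = y then -1 else 0 :: 'k)" for z
  have "(\<Sum>z\<in>S. scl (a z) (g z)) = (\<Sum>z\<in>{x, y}. scl (a z) (g z))"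
   by (rule sum.mono_neutral_right) (use S xy in \<open>auto simp: a_def scl_simps\<close>)
  also have "\<dots> = 0" using xy by (simp add: a_def scl_simps)
  finally have "a x = 0" using comb[of a x] subspace_pmD(1)[OF sBX] xy by simp
  then show False by (simp add: a_def)
 qed
 have wg: "w \<notin> g ` S"
 proof
  assume "w \<in> g ` S"
  then obtain x where x: "x \<in> S" "w = g x" by blast
  define a where "a z = (if z = x then 1 else 0 :: 'k)" for z
  have "(\<Sum>z\<in>S. scl (a z) (g z)) = (\<Sum>z\<in>{x}. scl (a z) (g z))"
   by (rule sum.mono_neutral_right) (use S x in \<open>auto simp: a_def scl_simps\<close>)
  also have "\<dots> = w" using x by (simp add: a_def scl_simps)
  finally have "a x = 0" using comb[of a x] w(2) x by simp
  then show False by (simp add: a_def)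
 qed
 have "indep_mod BY (insert w (g ` S))"
  unfolding indep_mod_def
 proof (intro allI impI)
  fix a assume m: "(\<Sum>z\<in>insert w (g ` S). scl (a z) z) \<in> BY"
  have e: "(\<Sum>z\<in>insert w (g ` S). scl (a z) z) = scl (a w) w + (\<Sum>z\<in>S. scl (a (g z)) (g z))"
   using S(1) wg by (simp add: sum.reindex[OF inj])
  have mX: "scl (a w) w + (\<Sum>z\<in>S. scl (a (g z)) (g z)) \<in> BX" using m sub unfolding e by blast
  from subspace_pmD(4)[OF sBX mX subspace_pmD(3)[OF sBX w(2), of "a w"]]
  have "(\<Sum>z\<in>S. scl (a (g z)) (g z)) \<in> BX" by simp
  then have z: "a (g z) = 0" if "z \<in> S" for z using comb[of "\<lambda>z. a (g z)"] that by blast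
  then have "(\<Sum>z\<in>S. scl (a (g z)) (g z)) = 0" by (intro sum.neutral) (simp add: scl_simps)
  then have aw: "scl (a w) w \<in> BY" using m unfolding e by simp
  have "a w = 0"
  proof (rule ccontr)
   assume "a w ~= 0"
   then have "scl (1 / a w) (scl (a w) w) = w" by (simp add: scl_simps)
   then show False using subspace_pmD(3)[OF sBY aw, of "1 / a w"] wB by simp
  qed
  then show "\<forall>z\<in>insert w (g ` S). a z = 0" using z by auto
 qed
 moreover have "insert w (g ` S) \<subseteq> ZY" using w(1) g S(2) by blast
 moreover have "finite (insert w (g ` S))" using S(1) by simp
 ultimately have le: "enat (card (insert w (g ` S))) \<le> quotient_dim ZX BX"
  unfolding eq[symmetric] unfolding quotient_dim_eq by (intro Sup_upper) blast
 have "card (insert w (g ` S)) = Suc (card S)" using S(1) wg by (simp add: card_image[OF inj])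
 then show False using order_trans[OF le qX] by simp
qed

section \<open>Singular simplices in a geometric realization\<close>

lemma continuous_on_coord: "continuous_on S (\<lambda>t :: 'i => real. t i)"
 by (rule continuous_on_subset[OF continuous_on_product_coordinates]) simp

lemma singular_simplex_top_of_set:
 "singular_simplex p (top_of_set A) f \<longleftrightarrow> continuous_on (standard_simplex p) f \<and> f \<in> standard_simplex p \<rightarrow> A \<and> f \<in> extensional (standard_simplex p)"
 unfolding singular_simplex_def euclidean_product_topology continuous_map_in_subtopology by auto

definition basis_pt :: "nat => nat => real" where
 "basis_pt j = (\<lambda>i. if i = j then 1 else 0)"

definition del :: "nat => 'a list => 'a list" where
 "del i l = take i l @ drop (Suc i) l"

text \<open>The increasing injection that misses \<open>i\<close>: the coface map on vertex
  numbers.\<close>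

definition skip :: "nat => nat => nat" where
 "skip i n = (if n < i then n else Suc n)"

definition list_comb :: "('a => real) => 'a list => (nat => real) => real" where
 "list_comb f m t = (\<Sum>k<length m. f (m ! k) * t k)"

lemma length_del: "i < length m ==> length (del i m) = length m - Suc 0"
 by (simp add: del_def)

lemma nth_del: "i < length m ==> k < length m - Suc 0 ==> del i m ! k = m ! skip i k"
 by (auto simp: del_def skip_def nth_append min_def)

lemma sum_simplical_face:
 assumes "i \<le> q"
 shows "(\<Sum>k\<le>q. g k * simplical_face i t k) = (\<Sum>k<q. g (skip i k) * (t k :: real))"
proof -
 have "(\<Sum>k\<le>q. g k * simplical_face i t k) = (\<Sum>k\<in>{0..<Suc q}. g k * simplical_face i t k)"
  by (simp only: lessThan_Suc_atMost[symmetric] lessThan_atLeast0)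
 also have "\<dots> = (\<Sum>k\<in>{0..<i}. g k * simplical_face i t k) + (\<Sum>k\<in>{i..<Suc q}. g k * simplical_face i t k)"
  by (rule sum.atLeastLessThan_concat[symmetric]) (use assms in auto)
 also have "(\<Sum>k\<in>{i..<Suc q}. g k * simplical_face i t k) = g i * simplical_face i t i + (\<Sum>k\<in>{Suc i..<Suc q}. g k * simplical_face i t k)"
  by (rule sum.atLeast_Suc_lessThan) (use assms in auto)
 also have "(\<Sum>k\<in>{Suc i..<Suc q}. g k * simplical_face i t k) = (\<Sum>k\<in>{i..<q}. g (Suc k) * simplical_face i t (Suc k))"
  by (rule sum.shift_bounds_Suc_ivl)
 also have "(\<Sum>k\<in>{i..<q}. g (Suc k) * simplical_face i t (Suc k)) = (\<Sum>k\<in>{i..<q}. g (skip i k) * t k)"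
  by (rule sum.cong) (auto simp: simplical_face_def skip_def)
 also have "(\<Sum>k\<in>{0..<i}. g k * simplical_face i t k) = (\<Sum>k\<in>{0..<i}. g (skip i k) * t k)"
  by (rule sum.cong) (auto simp: simplical_face_def skip_def)
 also have "g i * simplical_face i t i = 0" by (simp add: simplical_face_def)
 finally have "(\<Sum>k\<le>q. g k * simplical_face i t k) = (\<Sum>k\<in>{0..<i}. g (skip i k) * t k) + (\<Sum>k\<in>{i..<q}. g (skip i k) * t k)" by simp
 also have "\<dots> = (\<Sum>k\<in>{0..<q}. g (skip i k) * t k)" by (rule sum.atLeastLessThan_concat) (use assms in auto)
 finally show ?thesis by (simp only: lessThan_atLeast0)
qed

lemma list_comb_face:
 assumes "i < length m"
 shows "list_comb f m (simplical_face i t) = list_comb f (del i m) t"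
proof -
 obtain q where q: "length m = Suc q" using assms by (cases "length m") auto
 have "list_comb f m (simplical_face i t) = (\<Sum>k<q. f (m ! skip i k) * t k)"
  unfolding list_comb_def q lessThan_Suc_atMost by (rule sum_simplical_face) (use assms q in simp)
 also have "\<dots> = list_comb f (del i m) t"
  unfolding list_comb_def length_del[OF assms] using q nth_del[OF assms] by (intro sum.cong) auto
 finally show ?thesis .
qed

lemma standard_simplexI:
 assumes "!!i. 0 \<le> x i" "!!i. p < i ==> x i = 0" "(\<Sum>i\<le>p. x i) = 1"
 shows "x \<in> standard_simplex p"
proof -
 have "x i \<le> 1" for i
 proof (cases "i \<le> p")
  case True
  then have "x i \<le> (\<Sum>i\<le>p. x i)" using assms(1) by (intro member_le_sum) auto
  then show ?thesis using assms(3) by simp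
 qed (use assms(2) in auto)
 then show ?thesis using assms by (simp add: standard_simplex_def)
qed

lemma list_comb_one:
 assumes "t \<in> standard_simplex (length m - Suc 0)" "m ~= []"
 shows "list_comb (\<lambda>_. 1) m t = 1"
proof -
 have "{..<length m} = {..length m - Suc 0}" using assms(2) by (cases m) (auto simp: less_Suc_eq_le)
 then show ?thesis using assms(1) by (simp add: list_comb_def standard_simplex_def)
qed

lemma list_comb_nonneg: "(!!x. 0 \<le> f x) ==> t \<in> standard_simplex q ==> 0 \<le> list_comb f m t"
 unfolding list_comb_def by (intro sum_nonneg mult_nonneg_nonneg) (auto simp: standard_simplex_def)

lemma list_comb_zero: "(!!x. x \<in> set m ==> f x = 0) ==> list_comb f m t = 0"
 unfolding list_comb_def by (intro sum.neutral) auto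

lemma sum_list_comb: "(\<Sum>w\<in>G. list_comb (f w) m t) = list_comb (\<lambda>x. \<Sum>w\<in>G. f w x) m t"
 unfolding list_comb_def sum_distrib_right by (rule sum.swap)

lemma list_comb_cong: "(!!x. x \<in> set m ==> f x = g x) ==> list_comb f m t = list_comb g m t"
 unfolding list_comb_def by (intro sum.cong) auto

lemma continuous_on_list_comb: "continuous_on S (list_comb f m)"
 unfolding list_comb_def[abs_def] by (intro continuous_intros continuous_on_coord)

lemma complex_down: "abstract_simplicial_complex \<Gamma> ==> F \<in> \<Gamma> ==> G \<subseteq> F ==> G \<in> \<Gamma>"
 by (simp add: abstract_simplicial_complex_def)

lemma in_realization:
 assumes cx: "abstract_simplicial_complex \<Gamma>" and G: "G \<in> \<Gamma>" and nn: "!!w. 0 \<le> x w"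
  and supp: "!!w. w \<notin> G ==> x w = 0" and one: "(\<Sum>w\<in>G. x w) = 1"
 shows "x \<in> geometric_realization \<Gamma>"
proof -
 have sub: "{w. x w ~= 0} \<subseteq> G" using supp by blast
 have "finite G" using cx G by (auto simp: abstract_simplicial_complex_def)
 then have "(\<Sum>w | x w ~= 0. x w) = (\<Sum>w\<in>G. x w)" using sub by (intro sum.mono_neutral_left) auto
 moreover have "{w. x w ~= 0} \<in> \<Gamma>" by (rule complex_down[OF cx G sub])
 ultimately show ?thesis using nn one by (simp add: geometric_realization_def)
qed

lemma realizationD:
 assumes "x \<in> geometric_realization \<Gamma>"
 shows "0 \<le> x w" "{w. x w ~= 0} \<in> \<Gamma>" "(\<Sum>w | x w ~= 0. x w) = 1"
 using assms by (auto simp: geometric_realization_def)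

subsection \<open>Simplices spanned by vertices\<close>

text \<open>The affine simplex with the listed vertices; repetitions are allowed, so degenerate
  tuples need no special treatment.\<close>

definition span_simplex :: "'v list => (nat => real) => 'v => real" where
 "span_simplex l = restrict (\<lambda>t w. list_comb (\<lambda>x. of_bool (x = w)) l t) (standard_simplex (length l - Suc 0))"

lemma span_simplex_realization:
 assumes cx: "abstract_simplicial_complex \<Gamma>" and l: "set l \<in> \<Gamma>" "l ~= []" and t: "t \<in> standard_simplex (length l - Suc 0)"
 shows "span_simplex l t \<in> geometric_realization \<Gamma>"
proof (rule in_realization[OF cx l(1)])
 have e: "span_simplex l t w = list_comb (\<lambda>x. of_bool (x = w)) l t" for w using t by (simp add: span_simplex_def)
 show "0 \<le> span_simplex l t w" for w unfolding e by (rule list_comb_nonneg[OF _ t]) simp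
 show "span_simplex l t w = 0" if "w \<notin> set l" for w unfolding e by (rule list_comb_zero) (use that in auto)
 have "(\<Sum>w\<in>set l. span_simplex l t w) = list_comb (\<lambda>x. \<Sum>w\<in>set l. of_bool (x = w)) l t"
  unfolding e by (rule sum_list_comb)
 also have "\<dots> = list_comb (\<lambda>_. 1) l t" by (rule list_comb_cong) (simp add: of_bool_def)
 also have "\<dots> = 1" by (rule list_comb_one[OF t l(2)])
 finally show "(\<Sum>w\<in>set l. span_simplex l t w) = 1" .
qed

lemma span_simplex_supp: "t \<in> standard_simplex (length l - Suc 0) ==> span_simplex l t w ~= 0 ==> w \<in> set l"
 unfolding span_simplex_def using list_comb_zero[of l "\<lambda>x. of_bool (x = w)" t] by (cases "w \<in> set l") auto

lemma singular_span_simplex: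
 assumes cx: "abstract_simplicial_complex \<Gamma>" and l: "set l \<in> \<Gamma>" "length l = Suc p"
 shows "singular_simplex p (top_of_set (geometric_realization \<Gamma>)) (span_simplex l)"
proof -
 have ne: "l ~= []" and p: "length l - Suc 0 = p" using l by auto
 have "continuous_on (standard_simplex p) (\<lambda>t w. list_comb (\<lambda>x. of_bool (x = w)) l t)"
  by (rule continuous_on_coordinatewise_then_product) (rule continuous_on_list_comb)
 then have "continuous_on (standard_simplex p) (span_simplex l)"
  by (rule continuous_on_eq) (simp add: span_simplex_def p)
 then show ?thesis unfolding singular_simplex_top_of_set
  using span_simplex_realization[OF cx l(1) ne] p by (auto simp: span_simplex_def)
qed

lemma face_span_simplex:
 assumes "length l = Suc (Suc p)" "i \<le> Suc p"
 shows "singular_face (Suc p) i (span_simplex l) = span_simplex (del i l)"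
proof
 fix t
 have i: "i < length l" using assms by simp
 have d: "length (del i l) - Suc 0 = p" using length_del[OF i] assms by simp
 show "singular_face (Suc p) i (span_simplex l) t = span_simplex (del i l) t"
 proof (cases "t \<in> standard_simplex p")
  case True
  then have "simplical_face i t \<in> standard_simplex (Suc p)" using simplical_face_in_standard_simplex[of "Suc p" i t] assms by simp
  then show ?thesis using True assms d by (simp add: singular_face_def span_simplex_def list_comb_face[OF i])
 next
  case False
  then show ?thesis by (simp add: singular_face_def span_simplex_def d)
 qed
qed

subsection \<open>Vertex tuples of small simplices\<close>

definition vtuple :: "(('v => real) => 'v) => nat => ((nat => real) => 'v => real) => 'v list" where
 "vtuple f p sg = map (\<lambda>j. f (sg (basis_pt j))) [0..<Suc p]"

lemma basis_pt_in: "j \<le> p ==> basis_pt j \<in> standard_simplex p"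
 unfolding basis_pt_def by simp

lemma simplical_face_basis: "simplical_face i (basis_pt j) = basis_pt (skip i j)"
 by (rule ext) (auto simp: simplical_face_def basis_pt_def skip_def)

lemma face_basis: "j \<le> p ==> singular_face (Suc p) i sg (basis_pt j) = sg (basis_pt (skip i j))"
 by (simp add: singular_face_def basis_pt_in simplical_face_basis)

lemma vtuple_face: "i \<le> Suc p ==> vtuple f p (singular_face (Suc p) i sg) = del i (vtuple f (Suc p) sg)"
proof (rule nth_equalityI)
 assume i: "i \<le> Suc p"
 have l: "length (vtuple f (Suc p) sg) = Suc (Suc p)" by (simp add: vtuple_def)
 show "length (vtuple f p (singular_face (Suc p) i sg)) = length (del i (vtuple f (Suc p) sg))"
  using i by (simp add: length_del l, simp add: vtuple_def)
 fix k assume "k < length (vtuple f p (singular_face (Suc p) i sg))"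
 then have k: "k \<le> p" by (simp add: vtuple_def)
 have "skip i k < Suc (Suc p)" using k by (simp add: skip_def)
 then have "vtuple f (Suc p) sg ! skip i k = f (sg (basis_pt (skip i k)))" unfolding vtuple_def by (simp del: upt_Suc)
 moreover have "vtuple f p (singular_face (Suc p) i sg) ! k = f (singular_face (Suc p) i sg (basis_pt k))"
  unfolding vtuple_def using k by (simp del: upt_Suc)
 ultimately show "vtuple f p (singular_face (Suc p) i sg) ! k = del i (vtuple f (Suc p) sg) ! k"
  using nth_del[of i "vtuple f (Suc p) sg" k] i k l face_basis[OF k, of i sg] by simp
qed

abbreviation vchain :: "(('v => real) => 'v) => nat => ('v => real, 'k::field) field_chain => 'v list \<Rightarrow>\<^sub>0 'k" where
 "vchain f p \<equiv> kext (\<lambda>sg. sgl (vtuple f p sg) 1)"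

lemma bdry_vchain:
 fixes c :: "('v => real, 'k::field) field_chain"
 shows "bdry (vchain f (Suc p) c) = vchain f p (field_boundary (Suc p) c)"
proof -
 have "(tuple_bd (vtuple f (Suc p) sg) :: 'v list \<Rightarrow>\<^sub>0 'k) = vchain f p (field_boundary (Suc p) (sgl sg 1))" for sg :: "(nat => real) => 'v => real"
 proof -
  have "length (vtuple f (Suc p) sg) = Suc (Suc p)" by (simp add: vtuple_def)
  then have "(tuple_bd (vtuple f (Suc p) sg) :: 'v list \<Rightarrow>\<^sub>0 'k) = (\<Sum>i\<le>Suc p. sgl (del i (vtuple f (Suc p) sg)) ((-1) ^ i))"
   unfolding tuple_bd_eq_sum del_def by (simp only: lessThan_Suc_atMost)
  also have "\<dots> = (\<Sum>i\<le>Suc p. sgl (vtuple f p (singular_face (Suc p) i sg)) ((-1) ^ i))"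
   by (intro sum.cong refl) (simp only: vtuple_face atMost_iff)
  also have "\<dots> = vchain f p (field_boundary (Suc p) (sgl sg 1))"
   unfolding field_boundary_single[OF Suc_not_Zero] kext_sum by (simp add: scl_simps del: sum.atMost_Suc)
  finally show ?thesis .
 qed
 then show ?thesis by (subst field_boundary_kext) (simp add: kext_kext scl_simps)
qed

text \<open>The vertex chosen at any point must lie in the support of every other point of the
  simplex. The straight-line homotopy to the simplex on the chosen vertices then stays inside the
  supporting faces.\<close>

definition tight :: "(('v => real) => 'v) => nat => ((nat => real) => 'v => real) => bool" where
 "tight f p sg \<longleftrightarrow> (\<forall>s\<in>standard_simplex p. \<forall>t\<in>standard_simplex p. sg t (f (sg s)) ~= 0)"

lemma tight_vtuple:
 assumes "tight f p sg" "t \<in> standard_simplex p"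
 shows "set (vtuple f p sg) \<subseteq> {w. sg t w ~= 0}"
proof
 fix v assume "v \<in> set (vtuple f p sg)"
 then obtain j where "j < Suc p" "v = f (sg (basis_pt j))" unfolding vtuple_def set_map set_upt by auto
 then show "v \<in> {w. sg t w ~= 0}" using assms basis_pt_in[of j p] unfolding tight_def by auto
qed

subsection \<open>The prism between a small simplex and the simplex of its vertex tuple\<close>

text \<open>A list of labels describes an affine simplex in the prism over the standard simplex;
  \<open>bx\<close> and \<open>bs\<close> give the horizontal position and the height of its
  points.\<close>

definition bx :: "(nat \<times> bool) list => (nat => real) => nat => real" where
 "bx m t = (\<lambda>n. list_comb (\<lambda>x. of_bool (fst x = n)) m t)"

definition bs :: "(nat \<times> bool) list => (nat => real) => real" where
 "bs m t = list_comb (\<lambda>x. of_bool (snd x)) m t"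

definition slant :: "(('v => real) => 'v) => nat => ((nat => real) => 'v => real) => real => (nat => real) => 'v => real" where
 "slant f p sg s x = (\<lambda>w. (1 - s) * sg x w + s * (\<Sum>j\<le>p. of_bool (f (sg (basis_pt j)) = w) * x j))"

definition pz :: "(('v => real) => 'v) => nat => ((nat => real) => 'v => real) => (nat \<times> bool) list => (nat => real) => 'v => real" where
 "pz f p sg m = restrict (\<lambda>t. slant f p sg (bs m t) (bx m t)) (standard_simplex (length m - Suc 0))"

lemma bx_in:
 assumes t: "t \<in> standard_simplex (length m - Suc 0)" and m: "m ~= []" "fst ` set m \<subseteq> {..p}"
 shows "bx m t \<in> standard_simplex p"
proof (rule standard_simplexI)
 show "0 \<le> bx m t i" for i unfolding bx_def by (rule list_comb_nonneg[OF _ t]) simp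
 show "bx m t i = 0" if "p < i" for i unfolding bx_def by (rule list_comb_zero) (use that m(2) in auto)
 have "(\<Sum>i\<le>p. bx m t i) = list_comb (\<lambda>x. \<Sum>i\<le>p. of_bool (fst x = i)) m t" unfolding bx_def by (rule sum_list_comb)
 also have "\<dots> = list_comb (\<lambda>_. 1) m t" by (rule list_comb_cong) (use m(2) in \<open>auto simp: of_bool_def\<close>)
 also have "\<dots> = 1" by (rule list_comb_one[OF t m(1)])
 finally show "(\<Sum>i\<le>p. bx m t i) = 1" .
qed

lemma face_pz:
 assumes "length m = Suc (Suc q)" "i \<le> Suc q"
 shows "singular_face (Suc q) i (pz f p sg m) = pz f p sg (del i m)"
proof
 fix t
 have i: "i < length m" using assms by simp
 have d: "length (del i m) - Suc 0 = q" using length_del[OF i] assms by simp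
 show "singular_face (Suc q) i (pz f p sg m) t = pz f p sg (del i m) t"
 proof (cases "t \<in> standard_simplex q")
  case True
  then have "simplical_face i t \<in> standard_simplex (Suc q)" using simplical_face_in_standard_simplex[of "Suc q" i t] assms by simp
  then show ?thesis using True assms d by (simp add: singular_face_def pz_def bx_def bs_def list_comb_face[OF i])
 next
  case False
  then show ?thesis by (simp add: singular_face_def pz_def d)
 qed
qed

text \<open>By tightness, the segment from \<open>sg x\<close> to the corresponding point of the
  vertex simplex is supported in the face that carries \<open>sg x\<close>.\<close>

lemma singular_pz:
 assumes cx: "abstract_simplicial_complex \<Gamma>" and sg: "singular_simplex p (top_of_set (geometric_realization \<Gamma>)) sg"
  and tight: "tight f p sg" and m: "length m = Suc q" "fst ` set m \<subseteq> {..p}"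
 shows "singular_simplex q (top_of_set (geometric_realization \<Gamma>)) (pz f p sg m)"
 unfolding singular_simplex_top_of_set
proof (intro conjI)
 have q: "length m - Suc 0 = q" and ne: "m ~= []" using m by auto
 have sgc: "continuous_on (standard_simplex p) sg" and sgm: "sg \<in> standard_simplex p \<rightarrow> geometric_realization \<Gamma>"
  using sg by (auto simp: singular_simplex_top_of_set)
 have bxc: "continuous_on (standard_simplex q) (bx m)"
  by (rule continuous_on_coordinatewise_then_product) (simp add: bx_def continuous_on_list_comb)
 have bsc: "continuous_on (standard_simplex q) (bs m)"
  unfolding bs_def[abs_def] by (rule continuous_on_list_comb)
 have bxi: "bx m t \<in> standard_simplex p" if "t \<in> standard_simplex q" for t using bx_in[of t m p] that q ne m(2) by simp
 have comp: "continuous_on (standard_simplex q) (\<lambda>t. sg (bx m t))"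
  by (rule continuous_on_compose2[OF sgc bxc]) (use bxi in auto)
 have "continuous_on (standard_simplex q) (\<lambda>t. slant f p sg (bs m t) (bx m t))"
 proof (rule continuous_on_coordinatewise_then_product)
  fix w
  have 1: "continuous_on (standard_simplex q) (\<lambda>t. sg (bx m t) w)" by (rule continuous_on_product_then_coordinatewise[OF comp])
  have 2: "continuous_on (standard_simplex q) (\<lambda>t. bx m t j)" for j by (rule continuous_on_product_then_coordinatewise[OF bxc])
  show "continuous_on (standard_simplex q) (\<lambda>t. slant f p sg (bs m t) (bx m t) w)"
   unfolding slant_def by (intro continuous_intros 1 2 bsc)
 qed
 then show "continuous_on (standard_simplex q) (pz f p sg m)"
  by (rule continuous_on_eq) (simp add: pz_def q)
 show "pz f p sg m \<in> extensional (standard_simplex q)" by (simp add: pz_def q)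
 show "pz f p sg m \<in> standard_simplex q \<rightarrow> geometric_realization \<Gamma>"
 proof
  fix t assume t: "t \<in> standard_simplex q"
  define x where "x = bx m t"
  define s where "s = bs m t"
  define G where "G = {w. sg x w ~= 0}"
  have x: "x \<in> standard_simplex p" unfolding x_def by (rule bxi[OF t])
  have y: "sg x \<in> geometric_realization \<Gamma>" using sgm x by auto
  note yD = realizationD[OF y, folded G_def]
  have fin: "finite G" using cx yD(2) by (auto simp: abstract_simplicial_complex_def)
  have s0: "0 \<le> s" unfolding s_def bs_def by (rule list_comb_nonneg[OF _ t]) simp
  have "s \<le> list_comb (\<lambda>_. 1) m t" unfolding s_def bs_def list_comb_def
   using t by (intro sum_mono mult_right_mono) (auto simp: standard_simplex_def)
  then have s1: "s \<le> 1" using list_comb_one[of t m] t q ne by simp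
  have inG: "f (sg (basis_pt j)) \<in> G" if "j \<le> p" for j
   using tight basis_pt_in[OF that] x unfolding tight_def G_def by blast
  have e: "pz f p sg m t = slant f p sg s x" using t q by (simp add: pz_def s_def x_def)
  show "pz f p sg m t \<in> geometric_realization \<Gamma>"
   unfolding e
  proof (rule in_realization[OF cx yD(2)])
   show "0 \<le> slant f p sg s x w" for w
    unfolding slant_def using s0 s1 yD(1) x by (intro add_nonneg_nonneg mult_nonneg_nonneg sum_nonneg) (auto simp: standard_simplex_def)
   show "slant f p sg s x w = 0" if "w \<notin> G" for w
   proof -
    have "(\<Sum>j\<le>p. of_bool (f (sg (basis_pt j)) = w) * x j) = 0" using that inG by (intro sum.neutral) auto
    moreover have "sg x w = 0" using that by (simp add: G_def)
    ultimately show ?thesis by (simp add: slant_def)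
   qed
   have "(\<Sum>w\<in>G. \<Sum>j\<le>p. of_bool (f (sg (basis_pt j)) = w) * x j) = (\<Sum>j\<le>p. (\<Sum>w\<in>G. of_bool (f (sg (basis_pt j)) = w)) * x j)"
    unfolding sum_distrib_right by (rule sum.swap)
   also have "\<dots> = (\<Sum>j\<le>p. x j)" using inG fin by (intro sum.cong refl) (auto simp: of_bool_def)
   also have "\<dots> = 1" using x by (simp add: standard_simplex_def)
   finally have "(\<Sum>w\<in>G. \<Sum>j\<le>p. of_bool (f (sg (basis_pt j)) = w) * x j) = 1" .
   then show "(\<Sum>w\<in>G. slant f p sg s x w) = 1"
    unfolding slant_def sum.distrib sum_distrib_left[symmetric] using yD(3) by simp
  qed
 qed
qed

lemma pz_face:
 assumes i: "i \<le> Suc p" and m: "m ~= []" "fst ` set m \<subseteq> {..p}"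
 shows "pz f (Suc p) sg (map (map_prod (skip i) id) m) = pz f p (singular_face (Suc p) i sg) m"
proof
 fix t
 let ?m = "map (map_prod (skip i) id) m"
 show "pz f (Suc p) sg ?m t = pz f p (singular_face (Suc p) i sg) m t"
 proof (cases "t \<in> standard_simplex (length m - Suc 0)")
  case True
  have bs: "bs ?m t = bs m t" unfolding bs_def list_comb_def by (simp add: snd_map_prod)
  have bx: "bx ?m t = simplical_face i (bx m t)"
  proof
   fix n
   have "bx ?m t n = list_comb (\<lambda>x. of_bool (skip i (fst x) = n)) m t"
    unfolding bx_def list_comb_def by (simp add: fst_map_prod)
   also have "\<dots> = simplical_face i (bx m t) n"
   proof -
    consider "n < i" | "n = i" | "i < n" by linarith
    then show ?thesis
    proof cases
     case 1
     then have "skip i a = n \<longleftrightarrow> a = n" for a by (auto simp: skip_def)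
     then show ?thesis using 1 by (simp add: simplical_face_def bx_def)
    next
     case 2
     then have "skip i a = n \<longleftrightarrow> False" for a by (auto simp: skip_def)
     then show ?thesis using 2 by (simp add: simplical_face_def list_comb_def)
    next
     case 3
     then have "skip i a = n \<longleftrightarrow> a = n - 1" for a by (auto simp: skip_def)
     then show ?thesis using 3 by (simp add: simplical_face_def bx_def)
    qed
   qed
   finally show "bx ?m t n = simplical_face i (bx m t) n" .
  qed
  have x: "bx m t \<in> standard_simplex p" by (rule bx_in[OF True m])
  have sgx: "singular_face (Suc p) i sg (bx m t) = sg (simplical_face i (bx m t))" using x by (simp add: singular_face_def)
  have "(\<Sum>j\<le>Suc p. of_bool (f (sg (basis_pt j)) = w) * simplical_face i (bx m t) j)
    = (\<Sum>j\<le>p. of_bool (f (singular_face (Suc p) i sg (basis_pt j)) = w) * bx m t j)" for w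
  proof -
   have "(\<Sum>j\<le>Suc p. of_bool (f (sg (basis_pt j)) = w) * simplical_face i (bx m t) j)
     = (\<Sum>j<Suc p. of_bool (f (sg (basis_pt (skip i j))) = w) * bx m t j)"
    by (rule sum_simplical_face[OF i])
   also have "\<dots> = (\<Sum>j<Suc p. of_bool (f (singular_face (Suc p) i sg (basis_pt j)) = w) * bx m t j)"
    by (intro sum.cong refl) (simp add: face_basis)
   finally show ?thesis by (simp only: lessThan_Suc_atMost)
  qed
  then have "slant f (Suc p) sg (bs m t) (simplical_face i (bx m t)) = slant f p (singular_face (Suc p) i sg) (bs m t) (bx m t)"
   unfolding slant_def sgx by simp
  then show ?thesis using True by (simp add: pz_def bs bx)
 next
  case False
  then show ?thesis by (simp add: pz_def)
 qed
qed

lemma pz_top_bottom: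
 assumes "sg \<in> extensional (standard_simplex p)"
 shows "pz f p sg (map (\<lambda>i. (i, True)) [0..<Suc p]) = span_simplex (vtuple f p sg)"
  and "pz f p sg (map (\<lambda>i. (i, False)) [0..<Suc p]) = sg"
proof -
 have bx: "bx (map (\<lambda>i. (i, b)) [0..<Suc p]) t = t" if t: "t \<in> standard_simplex p" for b t
 proof
  fix n
  have "bx (map (\<lambda>i. (i, b)) [0..<Suc p]) t n = (\<Sum>k<Suc p. of_bool (k = n) * t k)"
   unfolding bx_def list_comb_def by (intro sum.cong) (auto simp del: upt_Suc)
  also have "\<dots> = (\<Sum>k<Suc p. if k = n then t k else 0)" by (intro sum.cong) auto
  also have "\<dots> = t n" using t by (auto simp: standard_simplex_def simp del: sum.lessThan_Suc)
  finally show "bx (map (\<lambda>i. (i, b)) [0..<Suc p]) t n = t n" .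
 qed
 have bs: "bs (map (\<lambda>i. (i, b)) [0..<Suc p]) t = of_bool b" if t: "t \<in> standard_simplex p" for b t
 proof -
  have "bs (map (\<lambda>i. (i, b)) [0..<Suc p]) t = (\<Sum>k<Suc p. of_bool b * t k)"
   unfolding bs_def list_comb_def by (intro sum.cong) (auto simp del: upt_Suc)
  also have "\<dots> = of_bool b * (\<Sum>k\<le>p. t k)" by (simp only: sum_distrib_left lessThan_Suc_atMost)
  also have "\<dots> = of_bool b" using t by (simp add: standard_simplex_def)
  finally show ?thesis .
 qed
 have len: "length (map (\<lambda>i. (i, b)) [0..<Suc p]) - Suc 0 = p" for b :: bool by simp
 have lv: "length (vtuple f p sg) = Suc p" by (simp add: vtuple_def)
 show "pz f p sg (map (\<lambda>i. (i, True)) [0..<Suc p]) = span_simplex (vtuple f p sg)"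
 proof
  fix t show "pz f p sg (map (\<lambda>i. (i, True)) [0..<Suc p]) t = span_simplex (vtuple f p sg) t"
  proof (cases "t \<in> standard_simplex p")
   case True
   have "pz f p sg (map (\<lambda>i. (i, True)) [0..<Suc p]) t = slant f p sg 1 t"
    unfolding pz_def len using True by (simp only: restrict_apply' bx[OF True] bs[OF True] of_bool_eq)
   also have "\<dots> = span_simplex (vtuple f p sg) t"
   proof
    fix w
    have "(\<Sum>j\<le>p. of_bool (f (sg (basis_pt j)) = w) * t j) = list_comb (\<lambda>x. of_bool (x = w)) (vtuple f p sg) t"
     unfolding list_comb_def lv lessThan_Suc_atMost vtuple_def by (intro sum.cong) (auto simp del: upt_Suc)
    then show "slant f p sg 1 t w = span_simplex (vtuple f p sg) t w"
     using True by (simp add: slant_def span_simplex_def lv)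
   qed
   finally show ?thesis .
  next
   case False
   then show ?thesis unfolding pz_def len span_simplex_def lv by simp
  qed
 qed
 show "pz f p sg (map (\<lambda>i. (i, False)) [0..<Suc p]) = sg"
 proof
  fix t show "pz f p sg (map (\<lambda>i. (i, False)) [0..<Suc p]) t = sg t"
  proof (cases "t \<in> standard_simplex p")
   case True
   have "pz f p sg (map (\<lambda>i. (i, False)) [0..<Suc p]) t = slant f p sg 0 t"
    unfolding pz_def len using True by (simp only: restrict_apply' bx[OF True] bs[OF True] of_bool_eq)
   then show ?thesis by (simp add: slant_def)
  next
   case False
   then show ?thesis using assms unfolding pz_def len by (simp add: extensional_def)
  qed
 qed
qed

definition prism_op :: "(('v => real) => 'v) => nat => ((nat => real) => 'v => real) => ('v => real, 'k::field) field_chain" where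
 "prism_op f p sg = kext (\<lambda>m. sgl (pz f p sg m) 1) (prism [0..<Suc p])"

abbreviation span_chain :: "('v list \<Rightarrow>\<^sub>0 'k::field) => ('v => real, 'k) field_chain" where
 "span_chain \<equiv> kext (\<lambda>l. sgl (span_simplex l) 1)"

lemma del_upt: "i \<le> Suc p ==> del i [0..<Suc (Suc p)] = map (skip i) [0..<Suc p]"
 by (rule nth_equalityI) (simp_all add: length_del nth_del skip_def del: upt_Suc)

text \<open>The homotopy formula \<open>bdry_prism\<close> is transported along \<open>pz\<close>;
  by \<open>pz_face\<close> its last term consists of the prisms over the faces of
  \<open>sg\<close>.\<close>

lemma boundary_prism_op:
 fixes sg :: "(nat => real) => 'v => real"
 assumes "sg \<in> extensional (standard_simplex (Suc p))"
 shows "field_boundary (Suc (Suc p)) (prism_op f (Suc p) sg :: ('v => real, 'k::field) field_chain) =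
  sgl (span_simplex (vtuple f (Suc p) sg)) 1 - sgl sg 1
   - kext (prism_op f p) (field_boundary (Suc p) (sgl sg 1))"
proof -
 let ?l = "[0..<Suc (Suc p)]"
 let ?r = "\<lambda>m. sgl (pz f (Suc p) sg m) (1 :: 'k)"
 have len: "length m = Suc (Suc (Suc p)) \<and> fst ` set m \<subseteq> set ?l" if "m \<in> kys (prism ?l :: (nat \<times> bool) list \<Rightarrow>\<^sub>0 'k)" for m
  using keys_prism[OF that] by (simp del: upt_Suc)
 have "field_boundary (Suc (Suc p)) (prism_op f (Suc p) sg :: ('v => real, 'k) field_chain) = kext ?r (bdry (prism ?l))"
  unfolding prism_op_def
 proof (rule real_boundary)
  fix m i assume m: "m \<in> kys (prism ?l :: (nat \<times> bool) list \<Rightarrow>\<^sub>0 'k)"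
  show "length m = Suc (Suc (Suc p))" using len[OF m] by blast
  show "i \<le> Suc (Suc p) ==> singular_face (Suc (Suc p)) i (pz f (Suc p) sg m) = pz f (Suc p) sg (take i m @ drop (Suc i) m)"
   using face_pz[of m "Suc p" i f "Suc p" sg] len[OF m] unfolding del_def by blast
 qed
 also have "\<dots> = kext ?r (sgl (map (\<lambda>i. (i, True)) ?l) 1) - kext ?r (sgl (map (\<lambda>i. (i, False)) ?l) 1)
   - kext ?r (kext prism (tuple_bd ?l))"
  unfolding bdry_prism kext_diff ..
 also have "kext ?r (sgl (map (\<lambda>i. (i, True)) ?l) 1) = sgl (span_simplex (vtuple f (Suc p) sg)) 1"
  unfolding kext_single scl_simps pz_top_bottom(1)[OF assms] by simp
 also have "kext ?r (sgl (map (\<lambda>i. (i, False)) ?l) 1) = sgl sg 1"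
  unfolding kext_single scl_simps pz_top_bottom(2)[OF assms] by simp
 also have "kext ?r (kext prism (tuple_bd ?l)) = kext (prism_op f p) (field_boundary (Suc p) (sgl sg 1))"
 proof -
  have face: "kext ?r (prism (del i ?l)) = prism_op f p (singular_face (Suc p) i sg)" if i: "i \<le> Suc p" for i
  proof -
   have "kext ?r (prism (del i ?l)) = kext (\<lambda>m. ?r (map (map_prod (skip i) id) m)) (prism [0..<Suc p])"
    unfolding del_upt[OF i] prism_map map_tuples_def kext_kext by (simp only: kext_single scl_simps mult_1_right)
   also have "\<dots> = prism_op f p (singular_face (Suc p) i sg)"
    unfolding prism_op_def
   proof (rule kext_cong)
    fix m assume "m \<in> kys (prism [0..<Suc p] :: (nat \<times> bool) list \<Rightarrow>\<^sub>0 'k)"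
    from keys_prism[OF this] have "m ~= []" "fst ` set m \<subseteq> {..p}" by (auto simp: less_Suc_eq_le)
    from pz_face[OF i this, of f sg] show "?r (map (map_prod (skip i) id) m) = sgl (pz f p (singular_face (Suc p) i sg) m) 1"
     by simp
   qed
   finally show ?thesis .
  qed
  have "tuple_bd ?l = (\<Sum>i\<le>Suc p. sgl (del i ?l) ((-1) ^ i) :: nat list \<Rightarrow>\<^sub>0 'k)"
   unfolding tuple_bd_eq_sum del_def by (simp only: length_upt diff_zero lessThan_Suc_atMost)
  then have "kext ?r (kext prism (tuple_bd ?l)) = (\<Sum>i\<le>Suc p. scl ((-1) ^ i) (kext ?r (prism (del i ?l))))"
   by (simp only: kext_sum kext_single kext_scl)
  also have "\<dots> = (\<Sum>i\<le>Suc p. scl ((-1) ^ i) (prism_op f p (singular_face (Suc p) i sg)))"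
   by (intro sum.cong refl) (simp only: face atMost_iff)
  also have "\<dots> = kext (prism_op f p) (field_boundary (Suc p) (sgl sg 1))"
   unfolding field_boundary_single[OF Suc_not_Zero] kext_sum kext_single ..
  finally show ?thesis .
 qed
 finally show ?thesis .
qed

lemma small_cycle_homologous:
 fixes c :: "('v => real, 'k::field) field_chain"
 assumes cx: "abstract_simplicial_complex \<Gamma>" and c: "c \<in> field_chains (Suc p) (top_of_set (geometric_realization \<Gamma>))"
  and z: "field_boundary (Suc p) c = 0" and tight: "!!sg. sg \<in> kys c ==> tight f (Suc p) sg"
 shows "span_chain (vchain f (Suc p) c) - c \<in> boundaries (Suc p) (top_of_set (geometric_realization \<Gamma>))"
proof -
 let ?T = "top_of_set (geometric_realization \<Gamma>)"
 have s: "singular_simplex (Suc p) ?T sg" if "sg \<in> kys c" for sg using c that by (auto simp: field_chains_iff)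
 have "field_boundary (Suc (Suc p)) (kext (prism_op f (Suc p)) c) = kext (\<lambda>sg. field_boundary (Suc (Suc p)) (prism_op f (Suc p) sg)) c"
  by (simp add: field_boundary_eq transfer_def kext_kext)
 also have "\<dots> = kext (\<lambda>sg. sgl (span_simplex (vtuple f (Suc p) sg)) 1 - sgl sg 1
   - kext (prism_op f p) (field_boundary (Suc p) (sgl sg 1))) c"
  by (rule kext_cong, rule boundary_prism_op) (use s in \<open>auto simp: singular_simplex_def\<close>)
 also have "\<dots> = span_chain (vchain f (Suc p) c) - c - kext (prism_op f p) (field_boundary (Suc p) c)"
  unfolding kext_fun_diff field_boundary_kext[of "Suc p" c] kext_kext by (simp add: kext_ident scl_simps)
 finally have e: "span_chain (vchain f (Suc p) c) - c = field_boundary (Suc (Suc p)) (kext (prism_op f (Suc p)) c)"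
  by (simp add: z)
 have "kext (prism_op f (Suc p)) c \<in> field_chains (Suc (Suc p)) ?T"
 proof (rule kext_field_chains)
  fix sg assume sg: "sg \<in> kys c"
  show "(prism_op f (Suc p) sg :: ('v => real, 'k) field_chain) \<in> field_chains (Suc (Suc p)) ?T"
   unfolding prism_op_def
  proof (rule kext_field_chains)
   fix m :: "(nat \<times> bool) list" assume "m \<in> kys (prism [0..<Suc (Suc p)] :: (nat \<times> bool) list \<Rightarrow>\<^sub>0 'k)"
   from keys_prism[OF this] have "length m = Suc (Suc (Suc p))" "fst ` set m \<subseteq> {..Suc p}" by (auto simp: less_Suc_eq_le)
   then show "sgl (pz f (Suc p) sg m) (1::'k) \<in> field_chains (Suc (Suc p)) ?T"
    using singular_pz[OF cx s[OF sg] tight[OF sg]] by (simp add: field_chains_iff)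
  qed
 qed
 then show ?thesis unfolding boundaries_def e by blast
qed

section \<open>From homology to alternating cycles\<close>

text \<open>Selects a coordinate that is at least the average \<open>1 / card V\<close>.\<close>

definition vx :: "'v set => ('v => real) => 'v" where
 "vx V x = (SOME v. v \<in> V \<and> 1 \<le> real (card V) * x v)"

lemma sum_realization:
 assumes "x \<in> geometric_realization \<Gamma>" "finite V" "!!G. G \<in> \<Gamma> ==> G \<subseteq> V"
 shows "(\<Sum>v\<in>V. x v) = 1"
proof -
 have "{w. x w ~= 0} \<subseteq> V" using realizationD(2)[OF assms(1)] assms(3) by blast
 then have "(\<Sum>w | x w ~= 0. x w) = (\<Sum>v\<in>V. x v)" using assms(2) by (intro sum.mono_neutral_left) auto
 then show ?thesis using realizationD(3)[OF assms(1)] by simp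
qed

lemma vx:
 assumes x: "x \<in> geometric_realization \<Gamma>" and V: "finite V" "!!G. G \<in> \<Gamma> ==> G \<subseteq> V"
 shows "vx V x \<in> V" "1 \<le> real (card V) * x (vx V x)" "x (vx V x) ~= 0"
proof -
 have "\<exists>v. v \<in> V \<and> 1 \<le> real (card V) * x v"
 proof (rule ccontr)
  assume "\<nexists>v. v \<in> V \<and> 1 \<le> real (card V) * x v"
  then have lt: "real (card V) * x v < 1" if "v \<in> V" for v using that by auto
  have ne: "V ~= {}" using sum_realization[OF x V] by auto
  have "(\<Sum>v\<in>V. real (card V) * x v) < (\<Sum>v\<in>V. 1)" by (rule sum_strict_mono[OF V(1) ne]) (rule lt)
  then show False using sum_realization[OF x V] by (simp add: sum_distrib_left[symmetric])
 qed
 then have "vx V x \<in> V \<and> 1 \<le> real (card V) * x (vx V x)" unfolding vx_def by (rule someI_ex)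
 then show "vx V x \<in> V" "1 \<le> real (card V) * x (vx V x)" by auto
 then show "x (vx V x) ~= 0" by auto
qed

lemma tight_subdivision:
 assumes V: "finite V" "!!G. G \<in> \<Gamma> ==> G \<subseteq> V" and c: "c \<in> field_chains p (top_of_set (geometric_realization \<Gamma>))"
 shows "\<exists>n. \<forall>sg\<in>kys (subdiv n p c). tight (vx V) p sg"
proof -
 \<comment> \<open>Two points of one set \<open>U z\<close> differ by less than
   \<open>2 * e\<close>, that is \<open>1 / card V\<close>, in each coordinate from
   \<open>V\<close>; so the coordinate selected at one of them is positive at the other.\<close>
 define e where "e = 1 / (2 * real (card V))"
 define U where "U z = {y \<in> geometric_realization \<Gamma>. \<forall>v\<in>V. \<bar>y v - z v\<bar> < e}" for z
 let ?C = "U ` geometric_realization \<Gamma>"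
 have pos: "0 < card V" if "x \<in> geometric_realization \<Gamma>" for x
  using vx(1)[OF that V] V(1) card_gt_0_iff by blast
 have op: "openin (top_of_set (geometric_realization \<Gamma>)) (U z)" for z
 proof -
  have "open (\<Inter>v\<in>V. {y. \<bar>y v - z v\<bar> < e})"
  proof (rule open_INT[OF V(1)], rule ballI)
   fix v show "open {y :: 'a => real. \<bar>y v - z v\<bar> < e}"
    by (rule open_Collect_less) (intro continuous_intros continuous_on_coord)+
  qed
  moreover have "U z = geometric_realization \<Gamma> \<inter> (\<Inter>v\<in>V. {y. \<bar>y v - z v\<bar> < e})" by (auto simp: U_def)
  ultimately show ?thesis unfolding openin_open by blast
 qed
 have cover: "topspace (top_of_set (geometric_realization \<Gamma>)) \<subseteq> \<Union>?C"
 proof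
  fix z assume "z \<in> topspace (top_of_set (geometric_realization \<Gamma>))"
  then have z: "z \<in> geometric_realization \<Gamma>" by simp
  then have "z \<in> U z" using pos by (simp add: U_def e_def)
  then show "z \<in> \<Union>?C" using z by blast
 qed
 have "\<exists>n. \<forall>sg\<in>kys (subdiv n p c). \<exists>W\<in>?C. sg \<in> standard_simplex p \<rightarrow> W"
  by (rule subdiv_small[OF _ cover c]) (elim imageE, simp only: op)
 then obtain n where n: "\<forall>sg\<in>kys (subdiv n p c). \<exists>W\<in>?C. sg \<in> standard_simplex p \<rightarrow> W" by (rule exE)
 have "tight (vx V) p sg" if sg: "sg \<in> kys (subdiv n p c)" for sg
  unfolding tight_def
 proof (intro ballI)
  obtain z where z: "z \<in> geometric_realization \<Gamma>" "sg \<in> standard_simplex p \<rightarrow> U z" using n sg by blast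
  fix s t assume s: "s \<in> standard_simplex p" and t: "t \<in> standard_simplex p"
  have sU: "sg s \<in> U z" "sg t \<in> U z" using z(2) s t by auto
  then have sG: "sg s \<in> geometric_realization \<Gamma>" by (simp add: U_def)
  define w where "w = vx V (sg s)"
  have w: "w \<in> V" "1 \<le> real (card V) * sg s w" unfolding w_def using vx(1)[OF sG V] vx(2)[OF sG V] by simp_all
  have "1 / real (card V) \<le> sg s w" using w(2) pos[OF sG] by (simp add: field_simps)
  moreover have "2 * e = 1 / real (card V)" by (simp add: e_def)
  moreover have "\<bar>sg s w - z w\<bar> < e" "\<bar>sg t w - z w\<bar> < e" using sU w(1) by (auto simp: U_def)
  ultimately have "0 < sg t w" by linarith
  then show "sg t (vx V (sg s)) ~= 0" by (simp add: w_def)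
 qed
 then show ?thesis by blast
qed

lemma keys_vchain:
 fixes c :: "('v => real, 'k::field) field_chain"
 assumes "m \<in> kys (vchain f p c)"
 obtains sg where "sg \<in> kys c" "m = vtuple f p sg"
proof -
 obtain sg where s: "sg \<in> kys c" "m \<in> kys (sgl (vtuple f p sg) (1::'k))"
  by (rule keys_kextE[OF assms])
 have "m = vtuple f p sg" using s(2) by simp
 then show ?thesis by (rule that[OF s(1)])
qed

lemma length_vtuple: "length (vtuple f p sg) = Suc p"
 by (simp add: vtuple_def)

lemma subdiv_linear: "subdiv n p 0 = 0" "subdiv n p (kext g c) = kext (\<lambda>x. subdiv n p (g x)) c"
 by (simp_all add: transfer_def kext_kext)

lemma vtuple_face_tight:
 assumes cx: "abstract_simplicial_complex \<Gamma>" and sg: "singular_simplex p (top_of_set (geometric_realization \<Gamma>)) sg" and t: "tight f p sg"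
 shows "set (vtuple f p sg) \<in> \<Gamma>"
proof -
 have b: "basis_pt 0 \<in> standard_simplex p" by (rule basis_pt_in) simp
 then have "sg (basis_pt 0) \<in> geometric_realization \<Gamma>" using sg by (auto simp: singular_simplex_top_of_set)
 from complex_down[OF cx realizationD(2)[OF this] tight_vtuple[OF t b]] show ?thesis .
qed

text \<open>A tuple in the support enumerates all of \<open>A\<close>, so a head sum has at most one
  nonzero term.\<close>

lemma alternating_top_zero:
 assumes A: "finite A" "card A \<le> d" "0 < d" and g: "alternating d A g" and z: "!!tp. (\<Sum>x\<in>A. g (x # tp)) = 0"
 shows "g tp = 0"
proof (rule ccontr)
 assume nz: "g tp ~= 0"
 obtain x \<rho> where t: "tp = x # \<rho>" using alternatingD(1)[OF g nz] A(3) by (cases tp) auto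
 have sub: "set tp = A" if "g tp ~= 0" for tp
  using alternatingD(1-3)[OF g that] A(1,2) distinct_card[of tp] card_seteq[OF A(1), of "set tp"] by simp
 have "(\<Sum>y\<in>A. g (y # \<rho>)) = (\<Sum>y\<in>{x}. g (y # \<rho>))"
 proof (rule sum.mono_neutral_right[OF A(1)])
  show "{x} \<subseteq> A" using sub[OF nz] t by auto
  show "\<forall>y\<in>A - {x}. g (y # \<rho>) = 0"
  proof (intro ballI, rule ccontr)
   fix y assume y: "y \<in> A - {x}" and ny: "g (y # \<rho>) ~= 0"
   have "y \<notin> set \<rho>" using alternatingD(3)[OF g ny] by simp
   moreover have "set tp = A" by (rule sub[OF nz])
   ultimately show False using y t by auto
  qed
 qed
 then show False using z[of \<rho>] nz t by simp
qed

text \<open>An algebraic Sperner lemma: subdividing a simplex and selecting vertices reproduces it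
  after alternation. The difference \<open>D\<close> lives on the vertices of \<open>l\<close>, its
  boundary alternates to 0 by induction, and a top-dimensional alternating cycle on these vertices
  vanishes.\<close>

lemma alt_subdivided_simplex:
 assumes V: "finite V"
 shows "set l \<subseteq> V ==> length l = Suc p ==>
  alt tp (vchain (vx V) p (subdiv n p (sgl (span_simplex l) 1))) = alt tp (sgl l (1 :: 'k::field))"
proof (induction p arbitrary: l tp)
 case (0 l tp)
 then obtain v where l: "l = [v]" by (cases l) auto
 let ?G = "Pow (set l)"
 have cxl: "abstract_simplicial_complex ?G" by (auto simp: abstract_simplicial_complex_def finite_subset)
 have s: "singular_simplex 0 (top_of_set (geometric_realization ?G)) (span_simplex l)"
  by (rule singular_span_simplex[OF cxl]) (use 0 in auto)
 have "singular_chain 0 (top_of_set (geometric_realization ?G)) (frag_of (span_simplex l))" using s by (simp add: singular_chain_of)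
 from iterated_subdivision(4)[OF this]
 have sd: "subdiv n 0 (sgl (span_simplex l) (1::'k)) = sgl (span_simplex l) 1"
  by (simp add: transfer_def emb_simps scl_simps)
 have x: "span_simplex l (basis_pt 0) \<in> geometric_realization ?G"
  using s basis_pt_in[of 0 0] by (auto simp: singular_simplex_top_of_set)
 have sub: "G \<subseteq> V" if "G \<in> ?G" for G using that 0 by auto
 have "span_simplex l (basis_pt 0) (vx V (span_simplex l (basis_pt 0))) ~= 0" by (rule vx(3)[OF x V sub])
 then have "vx V (span_simplex l (basis_pt 0)) \<in> set l" using span_simplex_supp[of "basis_pt 0" l] basis_pt_in[of 0 0] l by simp
 then have "vtuple (vx V) 0 (span_simplex l) = l" using l by (simp add: vtuple_def)
 then show ?case unfolding sd by (simp add: scl_simps)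
next
 case (Suc q l tp)
 let ?f = "vx V"
 \<comment> \<open>Working in the full simplex on \<open>l\<close> forces all selected vertices into
   \<open>set l\<close>.\<close>
 let ?G = "Pow (set l)"
 have cxl: "abstract_simplicial_complex ?G" by (auto simp: abstract_simplicial_complex_def finite_subset)
 have sub: "G \<subseteq> V" if "G \<in> ?G" for G using that Suc.prems by auto
 let ?s = "sgl (span_simplex l) 1 :: ('a => real, 'k) field_chain"
 have sc: "?s \<in> field_chains (Suc q) (top_of_set (geometric_realization ?G))"
  using singular_span_simplex[OF cxl _ Suc.prems(2)] by (simp add: field_chains_iff)
 define D where "D = vchain ?f (Suc q) (subdiv n (Suc q) ?s) - sgl l 1"
 have kD: "length m = Suc (Suc q) \<and> set m \<subseteq> set l" if m: "m \<in> kys D" for m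
 proof -
  have "m \<in> kys (vchain ?f (Suc q) (subdiv n (Suc q) ?s)) \<or> m = l"
   using m keys_diff[of "vchain ?f (Suc q) (subdiv n (Suc q) ?s)" "sgl l 1"] unfolding D_def by auto
  then show ?thesis
  proof
   assume "m \<in> kys (vchain ?f (Suc q) (subdiv n (Suc q) ?s))"
   then obtain sg where sg: "sg \<in> kys (subdiv n (Suc q) ?s)" "m = vtuple ?f (Suc q) sg" by (rule keys_vchain)
   have "singular_simplex (Suc q) (top_of_set (geometric_realization ?G)) sg"
    using subdiv_chains[OF sc, of n] sg(1) by (simp add: field_chains_iff)
   then have "sg (basis_pt j) \<in> geometric_realization ?G" if "j \<le> Suc q" for j
    using basis_pt_in[OF that] by (auto simp: singular_simplex_top_of_set)
   then have "?f (sg (basis_pt j)) \<in> set l" if "j \<le> Suc q" for j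
    using vx(3)[OF _ V sub, of "sg (basis_pt j)"] realizationD(2)[of "sg (basis_pt j)" ?G] that by blast
   then show ?thesis using sg(2) by (auto simp: length_vtuple vtuple_def less_Suc_eq_le simp del: upt_Suc)
  qed (use Suc.prems in auto)
 qed
 have fb: "field_boundary (Suc q) ?s = span_chain (tuple_bd l)"
 proof -
  have "field_boundary (Suc q) (span_chain (sgl l 1)) = span_chain (bdry (sgl l (1::'k)))"
   by (rule real_boundary) (use face_span_simplex[of l q] Suc.prems in \<open>auto simp: del_def split: if_splits\<close>)
  then show ?thesis by (simp add: scl_simps)
 qed
 have "bdry D = vchain ?f q (subdiv n q (span_chain (tuple_bd l))) - tuple_bd l"
  unfolding D_def kext_diff bdry_vchain boundary_subdiv[OF sc] fb by (simp add: scl_simps)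
 then have bD: "bdry D = kext (\<lambda>m. vchain ?f q (subdiv n q (sgl (span_simplex m) 1)) - sgl m 1) (tuple_bd l)"
  unfolding kext_fun_diff subdiv_linear(2) kext_ident by (simp only: kext_kext)
 have zero: "alt \<rho> (bdry D) = 0" for \<rho>
  unfolding bD alt_kext
 proof (rule sum.neutral, rule ballI)
  fix m assume "m \<in> kys (tuple_bd l :: 'a list \<Rightarrow>\<^sub>0 'k)"
  from keys_tuple_bd[OF this] have "set m \<subseteq> V" "length m = Suc q" using Suc.prems by auto
  from Suc.IH[OF this, of \<rho>] show "lkp (tuple_bd l) m * alt \<rho> (vchain ?f q (subdiv n q (sgl (span_simplex m) (1::'k))) - sgl m 1) = 0"
   by (simp add: alt_linear)
 qed
 have "alt tp D = 0"
 proof (rule alternating_top_zero[of "set l" "Suc (Suc q)"])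
  show "card (set l) \<le> Suc (Suc q)" using card_length[of l] Suc.prems(2) by simp
  show "alternating (Suc (Suc q)) (set l) (\<lambda>tp. alt tp D)" by (rule alternating_alt) (rule kD)
  show "(\<Sum>x\<in>set l. alt (x # \<rho>) D) = 0" for \<rho>
   using sum_alt[of "set l" D \<rho>] kD zero[of \<rho>] by simp
 qed simp_all
 then show ?case by (simp add: D_def alt_linear)
qed

subsection \<open>Pushing away from the barycentre of a face\<close>

definition barycentre :: "'v set => 'v => real" where
 "barycentre S = (\<lambda>v. if v \<in> S then 1 / real (card S) else 0)"

text \<open>Projection from the barycentre of \<open>S\<close>: the least coordinate on
  \<open>S\<close> is subtracted from all coordinates in \<open>S\<close>, and rescaling restores
  the sum 1. On the realization the denominator vanishes at the barycentre only.\<close>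

definition pushed :: "'v set => ('v => real) => 'v => real" where
 "pushed S x = (\<lambda>v. (x v - (if v \<in> S then Min (x ` S) else 0)) / (1 - real (card S) * Min (x ` S)))"

lemma continuous_on_Min_coord:
 "finite S ==> S ~= {} ==> continuous_on A (\<lambda>x :: 'v => real. Min (x ` S))"
proof (induction S rule: finite_ne_induct)
 case (singleton v)
 then show ?case by (simp add: continuous_on_coord)
next
 case (insert v S)
 have e: "(\<lambda>x :: 'v => real. Min (x ` insert v S)) = (\<lambda>x. min (x v) (Min (x ` S)))"
  using insert.hyps by (intro ext) simp
 show ?case unfolding e by (intro continuous_on_min continuous_on_coord insert.IH)
qed

text \<open>A coordinate at which the minimum on \<open>S\<close> is attained becomes 0, so the
  support of the image does not contain \<open>S\<close>.\<close>

lemma pushed_props: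
 assumes cx: "abstract_simplicial_complex \<Delta>" and V: "finite V" "!!G. G \<in> \<Delta> ==> G \<subseteq> V" and S: "S \<in> \<Delta>" "S ~= {}"
  and x: "x \<in> geometric_realization \<Delta>" "x ~= barycentre S"
 shows "real (card S) * Min (x ` S) < 1" and "pushed S x \<in> geometric_realization {G \<in> \<Delta>. \<not> S \<subseteq> G}"
proof -
 define mm where "mm = Min (x ` S)"
 have pu: "pushed S x = (\<lambda>v. (x v - (if v \<in> S then mm else 0)) / (1 - real (card S) * mm))"
  unfolding pushed_def mm_def ..
 have fS: "finite S" using cx S by (auto simp: abstract_simplicial_complex_def)
 have SV: "S \<subseteq> V" using V S by blast
 have nn: "0 \<le> x v" for v by (rule realizationD(1)[OF x(1)])
 have mle: "mm \<le> x v" if "v \<in> S" for v unfolding mm_def using fS that by (intro Min_le) auto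
 have "mm \<in> x ` S" unfolding mm_def using fS S(2) by (intro Min_in) auto
 then obtain a where a: "a \<in> S" "x a = mm" by (elim imageE) simp
 have m0: "0 \<le> mm" using nn[of a] a by simp
 have sV: "(\<Sum>v\<in>V. x v) = 1" by (rule sum_realization[OF x(1) V])
 have split: "(\<Sum>v\<in>V. x v) = (\<Sum>v\<in>V - S. x v) + (\<Sum>v\<in>S. x v)" by (rule sum.subset_diff[OF SV V(1)])
 have off: "x v = 0" if "v \<notin> V" for v using realizationD(2)[OF x(1)] V(2) that by blast
 have sd: "(\<Sum>v\<in>S. x v - mm) = (\<Sum>v\<in>S. x v) - real (card S) * mm" by (simp add: sum_subtractf)
 have D: "real (card S) * mm < 1"
 proof (rule ccontr)
  assume n: "\<not> real (card S) * mm < 1"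
  have 1: "0 \<le> (\<Sum>v\<in>V - S. x v)" by (rule sum_nonneg) (rule nn)
  have 2: "0 \<le> (\<Sum>v\<in>S. x v - mm)" by (rule sum_nonneg) (use mle in auto)
  have e1: "(\<Sum>v\<in>V - S. x v) = 0" and e2: "(\<Sum>v\<in>S. x v - mm) = 0" and e3: "real (card S) * mm = 1"
   using 1 2 n split sV sd by linarith+
  have z1: "x v = 0" if "v \<in> V - S" for v using e1 sum_nonneg_eq_0_iff[of "V - S" x] nn V(1) that by auto
  have "\<forall>v\<in>S. x v - mm = 0" using e2 sum_nonneg_eq_0_iff[of S "\<lambda>v. x v - mm"] mle fS by auto
  then have z2: "x v = mm" if "v \<in> S" for v using that by auto
  have "real (card S) ~= 0" using fS S(2) by simp
  then have "mm = 1 / real (card S)" using e3 by (simp add: eq_divide_eq mult.commute)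
  then have "x = barycentre S" using z1 z2 off by (intro ext) (auto simp: barycentre_def)
  then show False using x(2) by simp
 qed
 show "real (card S) * Min (x ` S) < 1" using D unfolding mm_def .
 define G where "G = {v. pushed S x v ~= 0}"
 have cxK: "abstract_simplicial_complex {G \<in> \<Delta>. \<not> S \<subseteq> G}" using cx unfolding abstract_simplicial_complex_def by auto
 have Gsub: "G \<subseteq> {v. x v ~= 0}"
 proof
  fix v assume "v \<in> G"
  then have p: "pushed S x v ~= 0" by (simp add: G_def)
  have "x v ~= 0"
  proof
   assume x0: "x v = 0"
   have "(if v \<in> S then mm else 0) = 0" using mle[of v] m0 x0 by (cases "v \<in> S") simp_all
   then have "pushed S x v = 0" unfolding pu x0 by (simp only: diff_self div_0)
   then show False using p by simp
  qed
  then show "v \<in> {v. x v ~= 0}" by simp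
 qed
 have GD: "G \<in> \<Delta>" by (rule complex_down[OF cx realizationD(2)[OF x(1)] Gsub])
 have "a \<notin> G" using a by (simp add: G_def pu)
 then have GK: "G \<in> {G \<in> \<Delta>. \<not> S \<subseteq> G}" using GD a(1) by blast
 show "pushed S x \<in> geometric_realization {G \<in> \<Delta>. \<not> S \<subseteq> G}"
 proof (rule in_realization[OF cxK GK])
  show "0 \<le> pushed S x w" for w unfolding pu using D mle[of w] nn[of w] by (intro divide_nonneg_nonneg) auto
  show "pushed S x w = 0" if "w \<notin> G" for w using that by (simp add: G_def)
  have "(\<Sum>w\<in>G. pushed S x w) = (\<Sum>w\<in>V. pushed S x w)"
   using V GD by (intro sum.mono_neutral_left) (auto simp: G_def)
  also have "\<dots> = ((\<Sum>w\<in>V. x w) - (\<Sum>w\<in>V. if w \<in> S then mm else 0)) / (1 - real (card S) * mm)"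
   unfolding pu sum_divide_distrib[symmetric] sum_subtractf ..
  also have "(\<Sum>w\<in>V. if w \<in> S then mm else 0) = real (card S) * mm"
  proof -
   have "(\<Sum>w\<in>V. if w \<in> S then mm else 0) = (\<Sum>w\<in>V \<inter> S. mm)" by (rule sum.inter_restrict[OF V(1), symmetric])
   also have "V \<inter> S = S" using SV by blast
   finally show ?thesis by simp
  qed
  finally show "(\<Sum>w\<in>G. pushed S x w) = 1" using sV D by simp
 qed
qed

lemma continuous_map_pushed:
 assumes cx: "abstract_simplicial_complex \<Delta>" and V: "finite V" "!!G. G \<in> \<Delta> ==> G \<subseteq> V" and S: "S \<in> \<Delta>" "S ~= {}"
 shows "continuous_map (top_of_set (geometric_realization \<Delta> - {barycentre S})) (top_of_set (geometric_realization {G \<in> \<Delta>. \<not> S \<subseteq> G})) (pushed S)"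
proof -
 have fS: "finite S" using cx S by (auto simp: abstract_simplicial_complex_def)
 have P: "real (card S) * Min (x ` S) < 1" "pushed S x \<in> geometric_realization {G \<in> \<Delta>. \<not> S \<subseteq> G}"
  if "x \<in> geometric_realization \<Delta> - {barycentre S}" for x
  using pushed_props[OF cx V S, of x] that by auto
 have "continuous_on (geometric_realization \<Delta> - {barycentre S}) (pushed S)"
 proof (rule continuous_on_coordinatewise_then_product)
  fix v
  have "continuous_on (geometric_realization \<Delta> - {barycentre S}) (\<lambda>x. if v \<in> S then Min (x ` S) else 0)"
   by (cases "v \<in> S") (simp_all add: continuous_on_Min_coord[OF fS S(2)])
  then show "continuous_on (geometric_realization \<Delta> - {barycentre S}) (\<lambda>x. pushed S x v)"
   unfolding pushed_def using P(1)
   by (intro continuous_on_divide continuous_on_diff continuous_on_mult continuous_on_const continuous_on_coord continuous_on_Min_coord[OF fS S(2)])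
    fastforce+
 qed
 then show ?thesis using P(2) by (auto simp: continuous_map_in_subtopology)
qed

text \<open>If some element of \<open>S\<close> is not a vertex of the simplex, the minimum on
  \<open>S\<close> is 0 and nothing is subtracted.\<close>

lemma pushed_span_simplex:
 assumes fS: "finite S" and n: "\<not> S \<subseteq> set m" and t: "t \<in> standard_simplex (length m - Suc 0)"
 shows "pushed S (span_simplex m t) = span_simplex m t"
proof -
 let ?x = "span_simplex m t"
 have nn: "0 \<le> ?x v" for v using list_comb_nonneg[OF _ t, of "\<lambda>y. of_bool (y = v)" m] t by (simp add: span_simplex_def)
 obtain v where v: "v \<in> S" "v \<notin> set m" using n by blast
 have "?x v = 0" using span_simplex_supp[OF t, of v] v by blast
 then have "Min (?x ` S) \<le> 0" using fS v(1) by (metis Min_le finite_imageI imageI)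
 moreover have "0 \<le> Min (?x ` S)" using fS v(1) nn by (subst Min_ge_iff) auto
 ultimately have "Min (?x ` S) = 0" by simp
 then show ?thesis by (intro ext) (simp add: pushed_def)
qed

abbreviation push_chain :: "'v set => nat => ('v => real, 'k::field) field_chain => ('v => real, 'k) field_chain" where
 "push_chain S p \<equiv> kext (\<lambda>sg. sgl (simplex_map p (pushed S) sg) 1)"

lemma boundary_push_chain: "field_boundary (Suc p) (push_chain S (Suc p) c) = push_chain S p (field_boundary (Suc p) c)"
proof -
 have face: "singular_face (Suc p) i (simplex_map (Suc p) (pushed S) sg) = simplex_map p (pushed S) (singular_face (Suc p) i sg)"
  if "i \<le> Suc p" for i and sg :: "(nat => real) => 'a => real"
 proof -
  have "singular_face (Suc p) i (simplex_map (Suc p) (pushed S) sg) = simplex_map (Suc p - Suc 0) (pushed S) (sg \<circ> simplical_face i)"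
   by (rule singular_face_simplex_map) (use that in auto)
  also have "\<dots> = simplex_map p (pushed S) (singular_face (Suc p) i sg)"
   by (auto simp: simplex_map_def singular_face_def restrict_def fun_eq_iff)
  finally show ?thesis .
 qed
 have one: "field_boundary (Suc p) (sgl (simplex_map (Suc p) (pushed S) sg) 1)
   = push_chain S p (field_boundary (Suc p) (sgl sg (1::'b)))" for sg :: "(nat => real) => 'a => real"
  unfolding field_boundary_single[OF Suc_not_Zero] kext_sum kext_single scl_simps mult_1_right
  by (intro sum.cong refl) (simp only: face atMost_iff)
 have "field_boundary (Suc p) (push_chain S (Suc p) c) = kext (\<lambda>sg. field_boundary (Suc p) (sgl (simplex_map (Suc p) (pushed S) sg) 1)) c"
  by (subst field_boundary_kext, subst kext_kext) (simp add: scl_simps)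
 also have "\<dots> = push_chain S p (field_boundary (Suc p) c)"
  unfolding one by (subst (2) field_boundary_kext) (simp only: kext_kext)
 finally show ?thesis .
qed

lemma field_chains_mono:
 assumes sub: "A \<subseteq> B"
 shows "field_chains p (top_of_set A) \<subseteq> field_chains p (top_of_set B)"
proof
 fix c assume c: "c \<in> field_chains p (top_of_set A)"
 have "singular_simplex p (top_of_set B) f" if f: "f \<in> kys c" for f
 proof -
  have "singular_simplex p (top_of_set A) f" using c f by (simp add: field_chains_iff)
  then show ?thesis using sub unfolding singular_simplex_top_of_set Pi_iff by blast
 qed
 then show "c \<in> field_chains p (top_of_set B)" by (simp add: field_chains_iff)
qed

lemma subspace_boundaries: "subspace_pm (boundaries p T :: ('a, 'k::field) field_chain set)"
 unfolding subspace_pm_def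
proof (intro conjI ballI allI)
 show "(0 :: ('a, 'k) field_chain) \<in> boundaries p T" unfolding boundaries_def
  by (rule image_eqI[of _ _ 0]) (simp_all add: field_boundary_linear field_chains_linear)
 fix a :: "('a, 'k) field_chain" and r assume "a \<in> boundaries p T"
 then obtain a' where a: "a' \<in> field_chains (Suc p) T" "a = field_boundary (Suc p) a'" by (auto simp: boundaries_def)
 then show "scl r a \<in> boundaries p T" unfolding boundaries_def
  by (intro image_eqI[of _ _ "scl r a'"]) (simp_all add: field_boundary_linear field_chains_linear)
next
 fix a b :: "('a, 'k) field_chain" assume "a \<in> boundaries p T" "b \<in> boundaries p T"
 then obtain a' b' where a: "a' \<in> field_chains (Suc p) T" "a = field_boundary (Suc p) a'"
  and b: "b' \<in> field_chains (Suc p) T" "b = field_boundary (Suc p) b'" by (auto simp: boundaries_def)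
 then show "a + b \<in> boundaries p T" unfolding boundaries_def
  by (intro image_eqI[of _ _ "a' + b'"]) (simp_all add: field_boundary_linear field_chains_linear)
qed

lemma boundary_of_boundaries: "b \<in> boundaries (Suc r) T ==> field_boundary (Suc r) b = 0"
 unfolding boundaries_def using field_boundary_boundary by auto

text \<open>The cycle is the alternation of \<open>C - y\<close>, where \<open>y\<close> is a
  simplicial chain with the same alternated boundary as \<open>C\<close> and no simplex through
  \<open>S\<close>. The face \<open>F\<close> supplies a vertex by which a simplex on
  \<open>S\<close> is moved off its barycentre.\<close>

lemma cycle_through_face:
 fixes C :: "'v list \<Rightarrow>\<^sub>0 'k::field"
 assumes cx: "abstract_simplicial_complex \<Delta>" and V: "finite V" "!!G. G \<in> \<Delta> ==> G \<subseteq> V"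
  and S: "S \<in> \<Delta>" "S ~= {}" "Suc (Suc r) \<le> card S" and F: "F \<in> \<Delta>" "S \<subseteq> F" "card F = Suc (Suc (Suc r))"
  and C: "!!m. m \<in> kys C ==> length m = Suc (Suc (Suc r)) \<and> set m \<in> \<Delta>"
  and bC: "!!m. m \<in> kys (bdry C) ==> \<not> S \<subseteq> set m"
  and dims: "quotient_dim (reduced_cycles (Suc r) (top_of_set (geometric_realization \<Delta> - {barycentre S})) :: ('v => real, 'k) field_chain set)
    (boundaries (Suc r) (top_of_set (geometric_realization \<Delta> - {barycentre S})))
   = quotient_dim (reduced_cycles (Suc r) (top_of_set (geometric_realization \<Delta>)) :: ('v => real, 'k) field_chain set)
    (boundaries (Suc r) (top_of_set (geometric_realization \<Delta>)))"
 shows "\<exists>z\<in>cycles (Suc (Suc (Suc r))) V. (\<forall>tp\<in>supp z. set tp \<in> \<Delta>) \<and> (\<forall>tp. S \<subseteq> set tp --> z tp = alt tp C)"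
proof -
 let ?P = "top_of_set (geometric_realization \<Delta>)"
 let ?Q = "top_of_set (geometric_realization \<Delta> - {barycentre S})"
 let ?f = "vx V"
 define BX where "BX = (boundaries (Suc r) ?P :: ('v => real, 'k) field_chain set)"
 define BY where "BY = (boundaries (Suc r) ?Q :: ('v => real, 'k) field_chain set)"
 define ZX where "ZX = (reduced_cycles (Suc r) ?P :: ('v => real, 'k) field_chain set)"
 define ZY where "ZY = (reduced_cycles (Suc r) ?Q :: ('v => real, 'k) field_chain set)"
 have fS: "finite S" using cx S by (auto simp: abstract_simplicial_complex_def)
 have down: "H \<in> \<Delta>" if "G \<in> \<Delta>" "H \<subseteq> G" for G H by (rule complex_down[OF cx that])
 have chQP: "field_chains p ?Q \<subseteq> field_chains p ?P" for p by (rule field_chains_mono) blast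
 have sBX: "subspace_pm BX" and sBY: "subspace_pm BY" unfolding BX_def BY_def by (rule subspace_boundaries)+
 have BB: "BY \<subseteq> BX" unfolding BX_def BY_def boundaries_def using chQP by blast
 have ZXi: "z \<in> ZX \<longleftrightarrow> z \<in> field_chains (Suc r) ?P \<and> field_boundary (Suc r) z = 0" for z
  by (simp add: ZX_def reduced_cycles_def)
 have ZYi: "z \<in> ZY \<longleftrightarrow> z \<in> field_chains (Suc r) ?Q \<and> field_boundary (Suc r) z = 0" for z
  by (simp add: ZY_def reduced_cycles_def)
 have spanQ: "singular_simplex j ?Q (span_simplex m)" if m: "set m \<in> \<Delta>" "\<not> S \<subseteq> set m" "length m = Suc j" for m j
 proof -
  have s: "singular_simplex j ?P (span_simplex m)" by (rule singular_span_simplex[OF cx m(1,3)])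
  have "span_simplex m t ~= barycentre S" if t: "t \<in> standard_simplex j" for t
  proof
   assume e: "span_simplex m t = barycentre S"
   have "S \<subseteq> set m"
   proof
    fix v assume v: "v \<in> S"
    then have "barycentre S v ~= 0" using fS S(2) by (auto simp: barycentre_def)
    then show "v \<in> set m" using span_simplex_supp[of t m v] t m(3) e by simp
   qed
   then show False using m(2) by simp
  qed
  then show ?thesis using s by (auto simp: singular_simplex_top_of_set)
 qed
 have fb_span: "field_boundary (Suc j) (span_chain c) = span_chain (bdry c)"
  if "!!m. m \<in> kys c ==> length m = Suc (Suc j)" for j and c :: "'v list \<Rightarrow>\<^sub>0 'k"
  by (rule real_boundary) (use that face_span_simplex in \<open>auto simp: del_def\<close>)
 have span_ch: "span_chain c \<in> field_chains j ?P" if "!!m. m \<in> kys c ==> length m = Suc j \<and> set m \<in> \<Delta>"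
  for j and c :: "'v list \<Rightarrow>\<^sub>0 'k"
  by (rule kext_field_chains) (use that singular_span_simplex[OF cx] in \<open>auto simp: field_chains_iff\<close>)
 have span_chQ: "span_chain c \<in> field_chains j ?Q" if "!!m. m \<in> kys c ==> length m = Suc j \<and> set m \<in> \<Delta> \<and> \<not> S \<subseteq> set m"
  for j and c :: "'v list \<Rightarrow>\<^sub>0 'k"
  by (rule kext_field_chains) (use that spanQ in \<open>auto simp: field_chains_iff\<close>)
 define T where "T = (span_simplex :: 'v list => _) ` {l. set l \<subseteq> V \<and> length l = Suc (Suc r)}"
 have finT: "finite T" unfolding T_def by (intro finite_imageI finite_lists_length_eq V(1))
 have rep: "\<exists>z'\<in>ZY. kys z' \<subseteq> T \<and> z - z' \<in> BX" if z: "z \<in> ZX" for z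
 proof -
  have zc: "z \<in> field_chains (Suc r) ?P" "field_boundary (Suc r) z = 0" using z ZXi by auto
  obtain n where n: "\<forall>sg\<in>kys (subdiv n (Suc r) z). tight ?f (Suc r) sg"
   using tight_subdivision[OF V zc(1)] by blast
  define c where "c = subdiv n (Suc r) z"
  have c: "c \<in> field_chains (Suc r) ?P" unfolding c_def by (rule subdiv_chains[OF zc(1)])
  have cz: "field_boundary (Suc r) c = 0" unfolding c_def boundary_subdiv[OF zc(1)] zc(2) by (rule subdiv_linear)
  have "c - z \<in> BX" using subdiv_homologous[OF zc, of n] unfolding c_def BX_def boundaries_def by auto
  define y where "y = vchain ?f (Suc r) c"
  have yc: "span_chain y - c \<in> BX" unfolding y_def BX_def
   by (rule small_cycle_homologous[OF cx c cz]) (use n in \<open>auto simp: c_def\<close>)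
  have ky: "length m = Suc (Suc r) \<and> set m \<in> \<Delta>" if my: "m \<in> kys y" for m
  proof -
   obtain sg where sg: "sg \<in> kys c" "m = vtuple ?f (Suc r) sg" by (rule keys_vchain[OF my[unfolded y_def]])
   have "singular_simplex (Suc r) ?P sg" using c sg(1) by (simp add: field_chains_iff)
   moreover have "tight ?f (Suc r) sg" using n sg(1) by (simp add: c_def)
   ultimately have "set (vtuple ?f (Suc r) sg) \<in> \<Delta>" by (rule vtuple_face_tight[OF cx])
   then show ?thesis using sg(2) by (simp add: length_vtuple)
  qed
  \<comment> \<open>A simplex of \<open>y\<close> contains \<open>S\<close> only if \<open>S\<close>
    has \<open>r + 2\<close> elements and is its whole vertex set; then \<open>F\<close> has one
    vertex more. In the other case nothing is required of \<open>u\<close>.\<close>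
  obtain u where u: "card S = Suc (Suc r) ==> u \<in> F - S"
  proof (cases "card S = Suc (Suc r)")
   case True
   then have "S ~= F" using F(3) by auto
   then show ?thesis using F(2) that by blast
  qed (use that in blast)
  have hit: "set m = S" "card S = Suc (Suc r)" "insert u S \<in> \<Delta>" "u \<notin> S" if m: "m \<in> kys y" "S \<subseteq> set m" for m
  proof -
   have c1: "card (set m) \<le> Suc (Suc r)" using card_length[of m] ky[OF m(1)] by simp
   have "card S \<le> card (set m)" using m(2) by (intro card_mono) auto
   then show cS: "card S = Suc (Suc r)" using c1 S(3) by simp
   show "set m = S" using card_seteq[of "set m" S] m(2) c1 cS by auto
   have "u \<in> F - S" by (rule u[OF cS])
   then show "insert u S \<in> \<Delta>" "u \<notin> S" using down[OF F(1), of "insert u S"] F(2) by auto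
  qed
  \<comment> \<open>Each simplex on \<open>S\<close> is replaced by the cone from \<open>u\<close>
    over its boundary, which has no simplex through \<open>S\<close>; \<open>w\<close> fills in
    between the two.\<close>
  define y' where "y' = kext (\<lambda>m. if S \<subseteq> set m then cone u (tuple_bd m) else sgl m 1) y"
  define w where "w = kext (\<lambda>m. if S \<subseteq> set m then sgl (u # m) 1 else 0) y"
  have "bdry w = kext (\<lambda>m. sgl m 1 - (if S \<subseteq> set m then cone u (tuple_bd m) else sgl m 1)) y"
   unfolding w_def kext_kext by (rule kext_cong) (simp add: scl_simps)
  then have bw: "bdry w = y - y'" unfolding kext_fun_diff y'_def kext_ident .
  have kw: "length m = Suc (Suc (Suc r)) \<and> set m \<in> \<Delta>" if mw: "m \<in> kys w" for m
  proof -
   obtain m' where m': "m' \<in> kys y" "m \<in> kys (if S \<subseteq> set m' then sgl (u # m') (1::'k) else 0)"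
    by (rule keys_kextE[OF mw[unfolded w_def]])
   then have s: "S \<subseteq> set m'" "m = u # m'" by (auto split: if_splits)
   show ?thesis using hit[OF m'(1) s(1)] ky[OF m'(1)] s(2) by simp
  qed
  have "span_chain y - span_chain y' = field_boundary (Suc (Suc r)) (span_chain w)"
   unfolding kext_diff[symmetric] bw[symmetric] by (rule fb_span[symmetric]) (use kw in blast)
  moreover have "span_chain w \<in> field_chains (Suc (Suc r)) ?P" by (rule span_ch) (rule kw)
  ultimately have yy: "span_chain y - span_chain y' \<in> BX" unfolding BX_def boundaries_def by blast
  have ky': "length m = Suc (Suc r) \<and> set m \<in> \<Delta> \<and> \<not> S \<subseteq> set m" if my: "m \<in> kys y'" for m
  proof -
   obtain m' where m': "m' \<in> kys y"
    "m \<in> kys (if S \<subseteq> set m' then cone u (tuple_bd m') else sgl m' (1::'k))"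
    by (rule keys_kextE[OF my[unfolded y'_def]])
   show ?thesis
   proof (cases "S \<subseteq> set m'")
    case False
    then show ?thesis using m' ky by auto
   next
    case True
    note h = hit[OF m'(1) True]
    obtain m2 where m2: "m2 \<in> kys (tuple_bd m' :: 'v list \<Rightarrow>\<^sub>0 'k)" "m = u # m2"
     using m'(2) True keys_cone[of m u "tuple_bd m' :: 'v list \<Rightarrow>\<^sub>0 'k"] by auto
    have l: "Suc (length m2) = length m'" "set m2 \<subseteq> S" using keys_tuple_bd[OF m2(1)] h(1) by auto
    have "\<not> S \<subseteq> set m"
    proof
     assume "S \<subseteq> set m"
     then have "S \<subseteq> set m2" using m2(2) h(4) by auto
     then have "card S \<le> length m2" using card_mono[of "set m2" S] card_length[of m2] by simp
     then show False using l(1) ky[OF m'(1)] h(2) by simp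
    qed
    moreover have "set m \<in> \<Delta>" using down[OF h(3), of "set m"] m2(2) l(2) by auto
    ultimately show ?thesis using m2(2) l(1) ky[OF m'(1)] by simp
   qed
  qed
  define z' where "z' = span_chain y'"
  have zz: "z - z' \<in> BX"
  proof -
   have 1: "(span_chain y - c) + (c - z) \<in> BX" by (rule subspace_pmD(2)[OF sBX yc \<open>c - z \<in> BX\<close>])
   have "(span_chain y - span_chain y') - ((span_chain y - c) + (c - z)) \<in> BX" by (rule subspace_pmD(4)[OF sBX yy 1])
   moreover have "(span_chain y - span_chain y') - ((span_chain y - c) + (c - z)) = z - z'" by (simp add: z'_def)
   ultimately show ?thesis by simp
  qed
  have "field_boundary (Suc r) (z - z') = 0" using boundary_of_boundaries zz unfolding BX_def by blast
  then have "field_boundary (Suc r) z' = 0" using zc(2) by (simp add: field_boundary_linear)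
  moreover have "z' \<in> field_chains (Suc r) ?Q" unfolding z'_def by (rule span_chQ) (rule ky')
  ultimately have "z' \<in> ZY" using ZYi by blast
  moreover have "kys z' \<subseteq> T"
  proof
   fix s assume sz: "s \<in> kys z'"
   obtain m where "m \<in> kys y'" "s \<in> kys (sgl (span_simplex m) (1::'k))"
    by (rule keys_kextE[OF sz[unfolded z'_def]])
   then show "s \<in> T" using ky'[of m] V(2) unfolding T_def by auto
  qed
  ultimately show ?thesis using zz by blast
 qed
 have kb: "length m = Suc (Suc r) \<and> set m \<in> \<Delta> \<and> \<not> S \<subseteq> set m" if m: "m \<in> kys (bdry C)" for m
 proof -
  obtain m' where m': "m' \<in> kys C" "m \<in> kys (tuple_bd m' :: 'v list \<Rightarrow>\<^sub>0 'k)"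
   by (rule keys_kextE[OF m])
  show ?thesis using keys_tuple_bd[OF m'(2)] C[OF m'(1)] down[of "set m'" "set m"] bC[OF m] by simp
 qed
 define W where "W = span_chain (bdry C)"
 have Wb: "W = field_boundary (Suc (Suc r)) (span_chain C)" unfolding W_def by (rule fb_span[symmetric]) (use C in blast)
 have "span_chain C \<in> field_chains (Suc (Suc r)) ?P" by (rule span_ch) (rule C)
 then have WX: "W \<in> BX" unfolding Wb BX_def boundaries_def by blast
 have "W \<in> field_chains (Suc r) ?Q" unfolding W_def by (rule span_chQ) (rule kb)
 moreover have "field_boundary (Suc r) W = 0" using boundary_of_boundaries WX unfolding BX_def by blast
 ultimately have WZ: "W \<in> ZY" using ZYi by blast
 \<comment> \<open>The comparison of dimensions enters here: \<open>W\<close> bounds in the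
   realization and therefore also away from the barycentre.\<close>
 have "W \<in> BY"
  by (rule equal_quotient_dims_injective[OF sBX sBY BB finT rep _ WZ WX])
   (use dims in \<open>simp_all add: BX_def BY_def ZX_def ZY_def\<close>)
 then obtain e where e: "e \<in> field_chains (Suc (Suc r)) ?Q" "W = field_boundary (Suc (Suc r)) e"
  unfolding BY_def boundaries_def by blast
 define K where "K = {G \<in> \<Delta>. \<not> S \<subseteq> G}"
 have cxK: "abstract_simplicial_complex K" using cx unfolding K_def abstract_simplicial_complex_def by auto
 have VK: "G \<subseteq> V" if "G \<in> K" for G using that V(2) by (auto simp: K_def)
 \<comment> \<open>The bounding chain is pushed into the complex \<open>K\<close> of faces not
   containing \<open>S\<close>, so that its approximation has no simplex through \<open>S\<close>;
   the boundary \<open>W\<close> is left unchanged.\<close>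
 define e' where "e' = push_chain S (Suc (Suc r)) e"
 have e'c: "e' \<in> field_chains (Suc (Suc r)) (top_of_set (geometric_realization K))"
  unfolding e'_def
 proof (rule kext_field_chains)
  fix sg assume "sg \<in> kys e"
  then have "singular_simplex (Suc (Suc r)) ?Q sg" using e(1) by (simp add: field_chains_iff)
  from singular_simplex_simplex_map[OF this continuous_map_pushed[OF cx V S(1,2)]]
  show "sgl (simplex_map (Suc (Suc r)) (pushed S) sg) 1 \<in> field_chains (Suc (Suc r)) (top_of_set (geometric_realization K))"
   by (simp add: field_chains_iff K_def)
 qed
 have fe': "field_boundary (Suc (Suc r)) e' = W"
 proof -
  have "field_boundary (Suc (Suc r)) e' = push_chain S (Suc r) W" unfolding e'_def boundary_push_chain e(2) ..
  also have "\<dots> = kext (\<lambda>m. sgl (simplex_map (Suc r) (pushed S) (span_simplex m)) 1) (bdry C)"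
   unfolding W_def kext_kext by (simp add: scl_simps)
  also have "\<dots> = W" unfolding W_def
  proof (rule kext_cong)
   fix m assume "m \<in> kys (bdry C)"
   then have m: "length m - Suc 0 = Suc r" "\<not> S \<subseteq> set m" using kb by auto
   have "simplex_map (Suc r) (pushed S) (span_simplex m) t = span_simplex m t" for t
   proof (cases "t \<in> standard_simplex (Suc r)")
    case True
    then show ?thesis using pushed_span_simplex[OF fS m(2), of t] m(1) by (simp add: simplex_map_def)
   next
    case False
    then show ?thesis by (simp add: simplex_map_def span_simplex_def m(1))
   qed
   then have "simplex_map (Suc r) (pushed S) (span_simplex m) = span_simplex m" by blast
   then show "sgl (simplex_map (Suc r) (pushed S) (span_simplex m)) 1 = sgl (span_simplex m) (1::'k)"
    by simp
  qed
  finally show ?thesis .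
 qed
 obtain n where n: "\<forall>sg\<in>kys (subdiv n (Suc (Suc r)) e'). tight ?f (Suc (Suc r)) sg"
  using tight_subdivision[OF V(1) VK e'c] by blast
 define y where "y = vchain ?f (Suc (Suc r)) (subdiv n (Suc (Suc r)) e')"
 have ky: "length m = Suc (Suc (Suc r)) \<and> set m \<in> K" if my: "m \<in> kys y" for m
 proof -
  obtain sg where sg: "sg \<in> kys (subdiv n (Suc (Suc r)) e')" "m = vtuple ?f (Suc (Suc r)) sg"
   by (rule keys_vchain[OF my[unfolded y_def]])
  have "singular_simplex (Suc (Suc r)) (top_of_set (geometric_realization K)) sg"
   using subdiv_chains[OF e'c, of n] sg(1) by (simp add: field_chains_iff)
  moreover have "tight ?f (Suc (Suc r)) sg" using n sg(1) by blast
  ultimately have "set (vtuple ?f (Suc (Suc r)) sg) \<in> K" by (rule vtuple_face_tight[OF cxK])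
  then show ?thesis using sg(2) by (simp add: length_vtuple)
 qed
 \<comment> \<open>Approximation may change the boundary itself, but not its alternation, by
   \<open>alt_subdivided_simplex\<close> for each simplex of \<open>bdry C\<close>.\<close>
 have by_alt: "alt tp (bdry y) = alt tp (bdry C)" for tp
 proof -
  have "bdry y = vchain ?f (Suc r) (subdiv n (Suc r) W)"
   unfolding y_def bdry_vchain boundary_subdiv[OF e'c] fe' ..
  also have "\<dots> = kext (\<lambda>m. vchain ?f (Suc r) (subdiv n (Suc r) (sgl (span_simplex m) 1))) (bdry C)"
   unfolding W_def subdiv_linear(2) kext_kext ..
  finally have "alt tp (bdry y) = (\<Sum>m\<in>kys (bdry C). lkp (bdry C) m * alt tp (vchain ?f (Suc r) (subdiv n (Suc r) (sgl (span_simplex m) 1))))"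
   by (simp only: alt_kext)
  also have "\<dots> = (\<Sum>m\<in>kys (bdry C). lkp (bdry C) m * alt tp (sgl m 1))"
  proof (rule sum.cong[OF refl])
   fix m assume "m \<in> kys (bdry C)"
   then have m: "set m \<subseteq> V" "length m = Suc (Suc r)" using kb V(2) by auto
   show "lkp (bdry C) m * alt tp (vchain ?f (Suc r) (subdiv n (Suc r) (sgl (span_simplex m) 1))) = lkp (bdry C) m * alt tp (sgl m 1)"
    by (rule arg_cong[of _ _ "\<lambda>x. lkp (bdry C) m * x"]) (rule alt_subdivided_simplex[OF V(1) m])
  qed
  also have "\<dots> = alt tp (kext (\<lambda>m. sgl m 1) (bdry C))" by (simp only: alt_kext)
  finally show ?thesis by (simp only: kext_ident)
 qed
 define z where "z = (\<lambda>tp. alt tp (C - y))"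
 have kz: "length m = Suc (Suc (Suc r)) \<and> set m \<in> \<Delta>" if "m \<in> kys (C - y)" for m
  using that keys_diff[of C y] C[of m] ky[of m] by (auto simp: K_def)
 have alt_z: "alternating (Suc (Suc (Suc r))) V z" unfolding z_def
  by (rule alternating_alt) (use kz V(2) in blast)
 have cyc_z: "cycle_on V z" unfolding cycle_on_def z_def
 proof
  fix tp
  have "(\<Sum>x\<in>V. alt (x # tp) (C - y)) = alt tp (bdry (C - y))"
   by (rule sum_alt[OF V(1)]) (use kz V(2) in blast)
  then show "(\<Sum>x\<in>V. alt (x # tp) (C - y)) = 0" by (simp only: kext_diff alt_linear by_alt diff_self)
 qed
 have "z \<in> cycles (Suc (Suc (Suc r))) V" unfolding cycles_def using alt_z cyc_z by blast
 moreover have "set tp \<in> \<Delta>" if "tp \<in> supp z" for tp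
 proof -
  have "alt tp (C - y) ~= 0" using that by (simp add: supp_def z_def)
  then obtain m where m: "m \<in> kys (C - y)" "mset m = mset tp" using alt_nonzero[of tp] by blast
  show ?thesis using kz[OF m(1)] mset_eq_setD[OF m(2)] by simp
 qed
 moreover have "z tp = alt tp C" if "S \<subseteq> set tp" for tp
 proof -
  have "alt tp y = 0"
  proof (rule ccontr)
   assume "alt tp y ~= 0"
   then obtain m where m: "m \<in> kys y" "mset m = mset tp" using alt_nonzero[of tp] by blast
   show False using ky[OF m(1)] mset_eq_setD[OF m(2)] that by (simp add: K_def)
  qed
  then show ?thesis by (simp add: z_def alt_linear)
 qed
 ultimately show ?thesis by blast
qed

section \<open>Rigidity of Buchsbaum* complexes\<close>

lemma subset_maximal_face:
 assumes "abstract_simplicial_complex \<Delta>" "G \<in> \<Delta>"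
 shows "\<exists>F\<in>\<Delta>. G \<subseteq> F \<and> (\<forall>H\<in>\<Delta>. F \<subseteq> H --> H = F)"
proof -
 have "finite \<Delta>" using assms(1) by (simp add: abstract_simplicial_complex_def)
 from finite_has_maximal2[OF this assms(2)] obtain F where F: "F \<in> \<Delta>" "G \<subseteq> F" "\<forall>H\<in>\<Delta>. F \<subseteq> H --> F = H"
  by (elim bexE conjE)
 have "H = F" if "H \<in> \<Delta>" "F \<subseteq> H" for H using bspec[OF F(3) that(1)] that(2) by simp
 then show ?thesis by (intro bexI[OF _ F(1)] conjI F(2) ballI impI)
qed

text \<open>The points with a nonzero coordinate in \<open>A\<close> and those with one in
  \<open>B\<close> would be two open sets separating the realization.\<close>

lemma realization_disconnected:
 assumes cx: "abstract_simplicial_complex \<Delta>" and conn: "connected (geometric_realization \<Delta>)"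
  and cover: "!!G. G \<in> \<Delta> ==> G \<subseteq> A \<or> G \<subseteq> B" and disj: "A \<inter> B = {}"
  and a: "a \<in> A" "{a} \<in> \<Delta>" and b: "b \<in> B" "{b} \<in> \<Delta>"
 shows False
proof -
 define hits where "hits W = (\<Union>v\<in>W. {x :: 'a => real. x v ~= 0})" for W
 have op: "open (hits W)" for W unfolding hits_def
  by (intro open_UN ballI open_Collect_neq continuous_on_coord continuous_on_const)
 have ne: "\<exists>x. x \<in> hits W \<inter> geometric_realization \<Delta>" if "v \<in> W" "{v} \<in> \<Delta>" for v W
 proof (intro exI IntI)
  let ?x = "\<lambda>w. if w = v then 1 else 0 :: real"
  show "?x \<in> hits W" using that(1) by (auto simp: hits_def)
  show "?x \<in> geometric_realization \<Delta>" by (rule in_realization[OF cx that(2)]) auto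
 qed
 have "geometric_realization \<Delta> \<subseteq> hits A \<union> hits B"
 proof
  fix x assume x: "x \<in> geometric_realization \<Delta>"
  have "{w. x w ~= 0} ~= {}"
  proof
   assume e: "{w. x w ~= 0} = {}"
   show False using realizationD(3)[OF x] unfolding e by simp
  qed
  then show "x \<in> hits A \<union> hits B" using cover[OF realizationD(2)[OF x]] by (auto simp: hits_def)
 qed
 moreover have "hits A \<inter> hits B \<inter> geometric_realization \<Delta> = {}"
 proof (rule ccontr)
  assume "hits A \<inter> hits B \<inter> geometric_realization \<Delta> ~= {}"
  then obtain x v w where x: "x \<in> geometric_realization \<Delta>" "v \<in> A" "x v ~= 0" "w \<in> B" "x w ~= 0" by (auto simp: hits_def)
  then show False using cover[OF realizationD(2)[OF x(1)]] disj by blast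
 qed
 ultimately have "hits A \<inter> geometric_realization \<Delta> = {} \<or> hits B \<inter> geometric_realization \<Delta> = {}"
  using connectedD[OF conn op op] by blast
 then show False using ne[OF a] ne[OF b] by blast
qed

lemma minimal_cycle_through:
 fixes z :: "'v list => 'k::field"
 assumes V: "finite V" and z: "z \<in> cycles d V" and t: "z tp ~= 0"
 obtains w :: "'v list => 'k" where "minimal_in (cycles d V) w" "supp w \<subseteq> supp z" "w tp ~= 0"
proof -
 have fin: "finite (supp f)" if "f \<in> cycles d V" for f :: "'v list => 'k"
  using that finite_supp[OF V] unfolding cycles_def by blast
 have "\<exists>U. finite U \<and> (\<forall>w\<in>U. minimal_in (cycles d V) w \<and> supp w \<subseteq> supp z) \<and> (\<forall>tp. z tp = (\<Sum>w\<in>U. w tp))"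
  by (rule exists_minimal_decomposition[OF subspace_cycles _ z]) (rule fin)
 then obtain U where U: "finite U" "\<forall>w\<in>U. minimal_in (cycles d V) w \<and> supp w \<subseteq> supp z" "\<forall>tp. z tp = (\<Sum>w\<in>U. w tp)"
  by (elim exE conjE)
 have "(\<Sum>w\<in>U. w tp) ~= 0" using spec[OF U(3), of tp] t by simp
 from sum.not_neutral_contains_not_neutral[OF this] obtain w where w: "w \<in> U" "w tp ~= 0" .
 show ?thesis by (rule that[of w]) (use bspec[OF U(2) w(1)] w(2) in simp_all)
qed

text \<open>With \<open>d = r + 3\<close> the homological degree \<open>d - 2\<close> is the
  positive number \<open>Suc r\<close>, so the augmentation never enters.\<close>

locale buchsbaum_star_complex =
 fixes \<Delta> :: "'v set set" and k :: "'k::field itself" and r :: nat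
 assumes cx: "abstract_simplicial_complex \<Delta>" and dim: "complex_dim \<Delta> = int (Suc (Suc (Suc r))) - 1"
  and conn: "connected (geometric_realization \<Delta>)" and star: "buchsbaum_star k \<Delta>"
begin

abbreviation "d \<equiv> Suc (Suc (Suc r))"
abbreviation "V \<equiv> vertex_set \<Delta>"
abbreviation "E \<equiv> {e \<in> \<Delta>. card e = 2}"

lemma fin: "finite \<Delta>" "F \<in> \<Delta> ==> finite F" and down: "F \<in> \<Delta> ==> G \<subseteq> F ==> G \<in> \<Delta>"
 using cx by (auto simp: abstract_simplicial_complex_def)

lemma finV: "finite V" and face_V: "G \<in> \<Delta> ==> G \<subseteq> V"
proof -
 have "inj_on (\<lambda>v. {v}) V" "(\<lambda>v. {v}) ` V \<subseteq> \<Delta>" by (auto simp: vertex_set_def inj_on_def)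
 then show "finite V" using inj_on_finite fin(1) by blast
 show "G \<in> \<Delta> ==> G \<subseteq> V" using down[of G "{_}"] by (auto simp: vertex_set_def)
qed

lemma card_le: "F \<in> \<Delta> ==> card F \<le> d" and ex_facet: "\<exists>F\<in>\<Delta>. card F = d"
proof -
 let ?I = "insert (-1) ((\<lambda>F. int (card F) - 1) ` \<Delta>)"
 have fI: "finite ?I" using fin(1) by simp
 have M: "Max ?I = int d - 1" using dim by (simp add: complex_dim_def)
 show "card F \<le> d" if "F \<in> \<Delta>"
 proof -
  have "int (card F) - 1 \<in> ?I" using that by blast
  then have "int (card F) - 1 \<le> int d - 1" using Max_ge[OF fI] M by metis
  then show ?thesis by simp
 qed
 have "Max ?I \<in> ?I" by (rule Max_in[OF fI]) simp
 then have "int d - 1 \<in> (\<lambda>F. int (card F) - 1) ` \<Delta>" unfolding M by auto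
 then obtain F where "F \<in> \<Delta>" "int d - 1 = int (card F) - 1" by blast
 then show "\<exists>F\<in>\<Delta>. card F = d" by (intro bexI[of _ F]) auto
qed

lemma barycentre_in:
 assumes S: "S \<in> \<Delta>" "S ~= {}"
 shows "barycentre S \<in> geometric_realization \<Delta>"
proof (rule in_realization[OF cx S(1)])
 have c: "real (card S) ~= 0" using fin(2)[OF S(1)] S(2) by simp
 have "(\<Sum>w\<in>S. barycentre S w) = (\<Sum>w\<in>S. 1 / real (card S))"
  unfolding barycentre_def by (intro sum.cong) auto
 then show "(\<Sum>w\<in>S. barycentre S w) = 1" using c by simp
qed (simp_all add: barycentre_def)

lemma dims:
 assumes "S \<in> \<Delta>" "S ~= {}"
 shows "quotient_dim (reduced_cycles (Suc r) (top_of_set (geometric_realization \<Delta> - {barycentre S})) :: ('v => real, 'k) field_chain set)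
    (boundaries (Suc r) (top_of_set (geometric_realization \<Delta> - {barycentre S})))
   = quotient_dim (reduced_cycles (Suc r) (top_of_set (geometric_realization \<Delta>)) :: ('v => real, 'k) field_chain set)
    (boundaries (Suc r) (top_of_set (geometric_realization \<Delta>)))"
proof -
 have n: "complex_dim \<Delta> - 1 = int (Suc r)" using dim by simp
 have "reduced_homology_dim k (complex_dim \<Delta> - 1) (top_of_set (geometric_realization \<Delta> - {barycentre S})) =
    reduced_homology_dim k (complex_dim \<Delta> - 1) (top_of_set (geometric_realization \<Delta>))"
  using star barycentre_in[OF assms] unfolding buchsbaum_star_def by blast
 then show ?thesis unfolding n reduced_homology_dim_def by (simp del: of_nat_Suc)
qed

lemma rigid_cycle:
 assumes n: "CARD('n::finite) = d" and z: "(z :: 'v list => 'k) \<in> cycles d V" "\<forall>tp\<in>supp z. set tp \<in> \<Delta>"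
  and w: "minimal_in (cycles d V) w" "supp w \<subseteq> supp z"
 shows "generically V (inf_rigid E (chain_verts w) :: ('v => real^'n) => bool)" and "chain_verts w \<subseteq> V"
proof -
 have g: "generically V (inf_rigid (chain_edges w) (chain_verts w) :: ('v => real^'n) => bool)"
  by (rule minimal_cycle_rigid[OF finV n _ w(1)]) simp
 have face: "set tp \<in> \<Delta>" if "tp \<in> supp w" for tp using that w(2) z(2) by blast
 have "{x, y} \<in> E" if e: "{x, y} \<in> chain_edges w" for x y
 proof -
  obtain tp where t: "tp \<in> supp w" "x \<in> set tp" "y \<in> set tp" "x ~= y" using chain_edgesE[OF e] .
  have "{x, y} \<in> \<Delta>" using down[OF face[OF t(1)], of "{x, y}"] t by blast
  then show ?thesis using t(4) by simp
 qed
 then have m: "inf_rigid E (chain_verts w) f" if "inf_rigid (chain_edges w) (chain_verts w) f" for f :: "'v => real^'n"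
  using inf_rigid_mono[OF that] by blast
 show "generically V (inf_rigid E (chain_verts w) :: ('v => real^'n) => bool)" by (rule generically_mono[OF g m])
 show "chain_verts w \<subseteq> V" unfolding chain_verts_def using face face_V by blast
qed

text \<open>Here the face and the chain are the facet itself: the tuples in its boundary are too
  short to contain it.\<close>

lemma facet_rigid:
 assumes n: "CARD('n::finite) = d" and F: "F \<in> \<Delta>" "card F = d"
 shows "\<exists>W. F \<subseteq> W \<and> W \<subseteq> V \<and> generically V (inf_rigid E W :: ('v => real^'n) => bool)"
proof -
 obtain l where l: "set l = F" "distinct l" using finite_distinct_list[OF fin(2)[OF F(1)]] by blast
 have len: "length l = d" using distinct_card[OF l(2)] l(1) F(2) by simp
 define C where "C = sgl l (1::'k)"
 have ne: "F ~= {}" using F(2) by auto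
 have "\<exists>z\<in>cycles d V. (\<forall>tp\<in>supp z. set tp \<in> \<Delta>) \<and> (\<forall>tp. F \<subseteq> set tp --> z tp = alt tp C)"
 proof (rule cycle_through_face[OF cx finV face_V F(1) ne _ F(1) _ F(2) _ _ dims[OF F(1) ne]])
  show "length m = d \<and> set m \<in> \<Delta>" if "m \<in> kys C" for m using that len l F by (simp add: C_def)
  show "\<not> F \<subseteq> set m" if m: "m \<in> kys (bdry C)" for m
  proof
   assume "F \<subseteq> set m"
   have "m \<in> kys (tuple_bd l :: 'v list \<Rightarrow>\<^sub>0 'k)" using m by (simp add: C_def scl_simps)
   then have "length m < d" using keys_tuple_bd len by fastforce
   moreover have "card F \<le> length m" using card_mono[OF _ \<open>F \<subseteq> set m\<close>] card_length[of m] by simp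
   ultimately show False using F(2) by simp
  qed
 qed (use F in simp_all)
 then obtain z where z: "z \<in> cycles d V" "\<forall>tp\<in>supp z. set tp \<in> \<Delta>" "z l = alt l C" using l(1) by auto
 have "z l ~= 0" unfolding z(3) C_def alt_self[OF l(2)] by simp
 from minimal_cycle_through[OF finV z(1) this]
 obtain w :: "'v list => 'k" where w: "minimal_in (cycles d V) w" "supp w \<subseteq> supp z" "w l ~= 0" .
 have "l \<in> supp w" using w(3) by (simp add: supp_def)
 from UN_upper[OF this, of set] have "F \<subseteq> chain_verts w" unfolding chain_verts_def l(1) .
 then show ?thesis by (intro exI[of _ "chain_verts w"] conjI rigid_cycle[OF n z(1,2) w(1,2)])
qed

text \<open>\<open>C\<close> is the difference of the two facets, both written with the same
  ordering of their common ridge, so that the ridge cancels in the boundary.\<close>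

lemma adjacent_facets_rigid:
 assumes n: "CARD('n::finite) = d" and F: "F \<in> \<Delta>" "card F = d" "G \<in> \<Delta>" "card G = d" "card (F \<inter> G) = d - 1"
 shows "\<exists>W. F \<union> G \<subseteq> W \<and> W \<subseteq> V \<and> generically V (inf_rigid E W :: ('v => real^'n) => bool)"
proof -
 define R where "R = F \<inter> G"
 have fF: "finite F" "finite G" using fin(2) F by auto
 have RD: "R \<in> \<Delta>" using down[OF F(1)] by (simp add: R_def)
 have cR: "card R = Suc (Suc r)" using F(5) by (simp add: R_def)
 have ne: "R ~= {}" using cR by auto
 have "card (F - R) = 1" "card (G - R) = 1"
  using card_Diff_subset[of R F] card_Diff_subset[of R G] fF cR F(2,4) by (auto simp: R_def)
 then obtain a b where ab: "F - R = {a}" "G - R = {b}" by (auto simp: card_1_singleton_iff)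
 then have FG: "F = insert a R" "G = insert b R" "a \<notin> R" "b \<notin> R" by (auto simp: R_def)
 have "a ~= b" using ab by (auto simp: R_def)
 obtain \<rho> where p: "set \<rho> = R" "distinct \<rho>" using finite_distinct_list[of R] fF by (auto simp: R_def)
 have lr: "length \<rho> = Suc (Suc r)" using distinct_card[OF p(2)] p(1) cR by simp
 define C where "C = sgl (a # \<rho>) (1::'k) - sgl (b # \<rho>) 1"
 have kC: "m = a # \<rho> \<or> m = b # \<rho>" if "m \<in> kys C" for m
  using that keys_diff[of "sgl (a # \<rho>) (1::'k)" "sgl (b # \<rho>) 1"] by (auto simp: C_def)
 have bC: "bdry C = cone b (tuple_bd \<rho>) - cone a (tuple_bd \<rho>)" unfolding C_def kext_diff kext_single tuple_bd.simps scl_simps by simp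
 have "\<exists>z\<in>cycles d V. (\<forall>tp\<in>supp z. set tp \<in> \<Delta>) \<and> (\<forall>tp. R \<subseteq> set tp --> z tp = alt tp C)"
 proof (rule cycle_through_face[OF cx finV face_V RD ne _ F(1) _ F(2) _ _ dims[OF RD ne]])
  show "Suc (Suc r) \<le> card R" using cR by simp
  show "R \<subseteq> F" by (simp add: R_def)
  show "length m = d \<and> set m \<in> \<Delta>" if "m \<in> kys C" for m using kC[OF that] lr p(1) FG F by auto
  show "\<not> R \<subseteq> set m" if m: "m \<in> kys (bdry C)" for m
  proof
   assume "R \<subseteq> set m"
   have "m \<in> kys (cone b (tuple_bd \<rho>) :: 'v list \<Rightarrow>\<^sub>0 'k) \<union> kys (cone a (tuple_bd \<rho>) :: 'v list \<Rightarrow>\<^sub>0 'k)"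
    by (rule subsetD[OF keys_diff m[unfolded bC]])
   then obtain x m' where x: "x = a \<or> x = b" "m = x # m'" "m' \<in> kys (tuple_bd \<rho> :: 'v list \<Rightarrow>\<^sub>0 'k)"
    using keys_cone[of m a "tuple_bd \<rho> :: 'v list \<Rightarrow>\<^sub>0 'k"] keys_cone[of m b "tuple_bd \<rho> :: 'v list \<Rightarrow>\<^sub>0 'k"] by auto
   have "R \<subseteq> set m'" using \<open>R \<subseteq> set m\<close> x(1,2) FG(3,4) by auto
   then have "card R \<le> length m'" using card_mono[of "set m'" R] card_length[of m'] by simp
   then show False using keys_tuple_bd[OF x(3)] lr cR by simp
  qed
 qed
 then obtain z where z: "z \<in> cycles d V" "\<forall>tp\<in>supp z. set tp \<in> \<Delta>" "!!tp. R \<subseteq> set tp ==> z tp = alt tp C" by blast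
 have other: "x = a \<or> x = b" if "z (x # \<rho>) ~= 0" for x
 proof -
  have "z (x # \<rho>) = alt (x # \<rho>) C" by (rule z(3)) (auto simp: p(1)[symmetric])
  then have "alt (x # \<rho>) C ~= 0" using that by (simp only: not_False_eq_True)
  from alt_nonzero[OF this] obtain m where m: "m \<in> kys C" "mset m = mset (x # \<rho>)" by (rule bexE)
  show ?thesis using kC[OF m(1)] m(2) by auto
 qed
 have "alt (a # \<rho>) (sgl (b # \<rho>) (1::'k)) = 0"
 proof (rule ccontr)
  assume "alt (a # \<rho>) (sgl (b # \<rho>) (1::'k)) ~= 0"
  then obtain m where m: "m \<in> kys (sgl (b # \<rho>) (1::'k))" "mset m = mset (a # \<rho>)" using alt_nonzero[of "_ # \<rho>"] by blast
  then show False using \<open>a ~= b\<close> by simp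
 qed
 moreover have "alt (a # \<rho>) (sgl (a # \<rho>) (1::'k)) = 1" by (rule alt_self) (use p FG in simp)
 moreover have "z (a # \<rho>) = alt (a # \<rho>) C" by (rule z(3)) (auto simp: p(1)[symmetric])
 ultimately have "z (a # \<rho>) = 1" unfolding C_def alt_linear(3) by simp
 then have "z (a # \<rho>) ~= 0" by simp
 from minimal_cycle_through[OF finV z(1) this]
 obtain w :: "'v list => 'k" where w: "minimal_in (cycles d V) w" "supp w \<subseteq> supp z" "w (a # \<rho>) ~= 0" .
 \<comment> \<open>A minimal cycle through the first facet also contains the second: at the common
   ridge no other facet of \<open>z\<close> is available to satisfy the cycle condition.\<close>
 have "w \<in> cycles d V" using w(1) by (rule minimal_inD(1))
 then have s0: "(\<Sum>x\<in>V. w (x # \<rho>)) = 0" by (simp add: cycles_def cycle_on_def)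
 have s1: "(\<Sum>x\<in>V. w (x # \<rho>)) = (\<Sum>x\<in>{a, b}. w (x # \<rho>))"
 proof (rule sum.mono_neutral_right[OF finV])
  show "{a, b} \<subseteq> V" using face_V[OF F(1)] face_V[OF F(3)] FG by auto
  show "\<forall>x\<in>V - {a, b}. w (x # \<rho>) = 0"
  proof (intro ballI, rule ccontr)
   fix x assume x: "x \<in> V - {a, b}" and nz: "w (x # \<rho>) ~= 0"
   then have "z (x # \<rho>) ~= 0" using w(2) by (auto simp: supp_def)
   from other[OF this] show False using x by simp
  qed
 qed
 have "(\<Sum>x\<in>{a, b}. w (x # \<rho>)) = w (a # \<rho>) + w (b # \<rho>)" using \<open>a ~= b\<close> by simp
 from trans[OF this[symmetric] trans[OF s1[symmetric] s0]] have s: "w (a # \<rho>) + w (b # \<rho>) = 0" .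
 have "w (b # \<rho>) ~= 0"
 proof
  assume "w (b # \<rho>) = 0"
  then show False using s w(3) by simp
 qed
 then have wb: "b # \<rho> \<in> supp w" by (simp add: supp_def)
 have wa: "a # \<rho> \<in> supp w" using w(3) by (simp add: supp_def)
 have "F = set (a # \<rho>)" "G = set (b # \<rho>)" unfolding FG p(1)[symmetric] by simp_all
 then have "F \<subseteq> chain_verts w" "G \<subseteq> chain_verts w"
  unfolding chain_verts_def using UN_upper[OF wa, of set] UN_upper[OF wb, of set] by simp_all
 then show ?thesis by (intro exI[of _ "chain_verts w"] conjI Un_least rigid_cycle[OF n z(1,2) w(1,2)])
qed

text \<open>A maximal generically rigid vertex set \<open>W\<close> containing a facet is taken. By
  maximality facets inside \<open>W\<close> share no ridge with the others, so the two classes are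
  disjoint and connectedness leaves none outside. By purity every vertex lies in a facet.\<close>

lemma rigid:
 assumes n: "CARD('n::finite) = d"
 shows "generically V (inf_rigid E V :: ('v => real^'n) => bool)"
proof -
 let ?gr = "\<lambda>W. generically V (inf_rigid E W :: ('v => real^'n) => bool)"
 obtain F0 where F0: "F0 \<in> \<Delta>" "card F0 = d" using ex_facet by blast
 define Ws where "Ws = {W. F0 \<subseteq> W \<and> W \<subseteq> V \<and> ?gr W}"
 have finW: "finite Ws" by (rule finite_subset[of _ "Pow V"]) (auto simp: Ws_def finV)
 from facet_rigid[OF n F0] obtain W0 where "F0 \<subseteq> W0 \<and> W0 \<subseteq> V \<and> ?gr W0" by (rule exE)
 then have W0: "W0 \<in> Ws" by (simp only: Ws_def mem_Collect_eq)
 from finite_has_maximal2[OF finW W0] obtain W where W1: "W \<in> Ws" "\<forall>U\<in>Ws. W \<subseteq> U --> W = U"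
  by (elim bexE conjE)
 have Wmax: "W = U" if "U \<in> Ws" "W \<subseteq> U" for U by (rule mp[OF bspec[OF W1(2) that(1)] that(2)])
 have WV: "F0 \<subseteq> W" "W \<subseteq> V" "?gr W" using W1(1) by (simp_all only: Ws_def mem_Collect_eq)
 define A where "A = {F \<in> \<Delta>. card F = d \<and> F \<subseteq> W}"
 define B where "B = {F \<in> \<Delta>. card F = d \<and> \<not> F \<subseteq> W}"
 have bb: "buchsbaum k \<Delta>" using star by (simp add: buchsbaum_star_def)
 have d1: "1 < d" by simp
 have cross: "card (F \<inter> G) < d - 1" if FA: "F \<in> A" and GB: "G \<in> B" for F G
 proof (rule ccontr)
  assume nlt: "\<not> card (F \<inter> G) < d - 1"
  have F: "F \<in> \<Delta>" "card F = d" "F \<subseteq> W" and G: "G \<in> \<Delta>" "card G = d" "\<not> G \<subseteq> W" using FA GB by (auto simp: A_def B_def)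
  have fG: "finite F" "finite G" using fin(2) F G by auto
  have "F \<inter> G ~= G" using F(3) G(3) by blast
  then have "F \<inter> G \<subset> G" by blast
  then have "card (F \<inter> G) < card G" by (rule psubset_card_mono[OF fG(2)])
  then have "card (F \<inter> G) = d - 1" using nlt G(2) by simp
  from adjacent_facets_rigid[OF n F(1,2) G(1,2) this]
  obtain U where U: "F \<union> G \<subseteq> U" "U \<subseteq> V" "?gr U" by (elim exE conjE)
  have "card F \<le> card (W \<inter> U)" using F(3) U(1) WV(2) finite_subset[OF _ finV] by (intro card_mono) auto
  then have "CARD('n) \<le> card (W \<inter> U)" using n F(2) by simp
  from generically_inf_rigid_Un[OF finV WV(2) U(2) this WV(3) U(3)] have gr: "?gr (W \<union> U)" .
  have "W \<union> U \<in> Ws" unfolding Ws_def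
   by (intro CollectI conjI le_supI1[OF WV(1)] Un_least[OF WV(2) U(2)] gr)
  from Wmax[OF this Un_upper1] have eq: "W = W \<union> U" .
  have "U \<subseteq> W \<union> U" by (rule Un_upper2)
  then have "U \<subseteq> W" unfolding eq[symmetric] .
  then show False using U(1) G(3) by blast
 qed
 have sep: "F \<inter> G = {}" if "F \<in> A" "G \<in> B" for F G
  by (rule buchsbaum_strongly_connected(2)[OF cx bb card_le F0 d1, of A B])
   (use cross that in \<open>auto simp: A_def B_def\<close>)
 have facet: "\<exists>F\<in>A \<union> B. H \<subseteq> F" if H: "H \<in> \<Delta>" for H
 proof -
  obtain F where F: "F \<in> \<Delta>" "H \<subseteq> F" "\<forall>G\<in>\<Delta>. F \<subseteq> G --> G = F" using subset_maximal_face[OF cx H] by blast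
  have "card F = d" by (rule buchsbaum_strongly_connected(1)[OF cx bb card_le F0 d1 F(1)]) (use F(3) in auto)
  then show ?thesis using F by (auto simp: A_def B_def)
 qed
 have F0A: "F0 \<in> A" using F0 WV(1) by (simp add: A_def)
 have "B = {}"
 proof (rule ccontr)
  assume "B ~= {}"
  then obtain G0 where G0: "G0 \<in> B" by blast
  have "F0 ~= {}" "G0 ~= {}" using F0 G0 by (auto simp: B_def)
  then obtain a b where a: "a \<in> F0" and b: "b \<in> G0" by blast
  have "G0 \<in> \<Delta>" using G0 by (simp add: B_def)
  show False
  proof (rule realization_disconnected[OF cx conn, of "\<Union>A" "\<Union>B" a b])
   show "H \<subseteq> \<Union>A \<or> H \<subseteq> \<Union>B" if "H \<in> \<Delta>" for H using facet[OF that] by blast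
   show "\<Union>A \<inter> \<Union>B = {}" using sep by blast
   show "a \<in> \<Union>A" "b \<in> \<Union>B" using a b F0A G0 by blast+
   show "{a} \<in> \<Delta>" "{b} \<in> \<Delta>" using down[OF F0(1), of "{a}"] down[OF \<open>G0 \<in> \<Delta>\<close>, of "{b}"] a b by auto
  qed
 qed
 have "V \<subseteq> W"
 proof
  fix v assume "v \<in> V"
  then have "{v} \<in> \<Delta>" by (simp add: vertex_set_def)
  from facet[OF this] show "v \<in> W" using \<open>B = {}\<close> by (auto simp: A_def)
 qed
 then have "W = V" using WV(2) by blast
 then show ?thesis using WV(3) by simp
qed

end

theorem theorem4p1:
  fixes \<Delta> :: "'v set set" and k :: "'k::field itself" and d :: nat
  assumes "abstract_simplicial_complex \<Delta>"
    and "complex_dim \<Delta> = int d - 1"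
    and "connected (geometric_realization \<Delta>)"
    and "buchsbaum_star k \<Delta>"
    and "d \<ge> 3"
    and "CARD('n::finite) = d"
  shows "generically_rigid TYPE('n) (complex_graph \<Delta>)"
proof -
  define r where "r = d - 3"
  have d: "d = Suc (Suc (Suc r))" using assms(5) by (simp add: r_def)
  interpret buchsbaum_star_complex \<Delta> k r
    by (rule buchsbaum_star_complex.intro) (use assms(1-4) d in simp_all)
  show ?thesis unfolding complex_graph_def
    by (rule generically_rigidI[OF finV rigid]) (use assms(6) d in simp)
qed

end
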